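(* The group $\mathbb{T}^H_2=\{(z_n)\in\mathbb{T}^{\infty}:\ \sum_{n=1}^\infty|1-z_n|^2<\infty\}$ (with coordinatewise multiplication and the metric $d_2((z_n),(w_n))=(\sum_{n}|z_n-w_n|^2)^{1/2}$) is topologically isomorphic to the quotient group of the real Hilbert space $\ell^2$ modulo its discrete subgroup $\mathbb{Z}_0^\infty$ of finitely supported integer sequences; it is a Polish, monothetic, pathwise connected QI-group which is not locally quasi-convex (and hence not reflexive); and its bidual group $(\mathbb{T}^H_2)^{\wedge\wedge}$ is not a QI-group.
   Context: $\mathbb{T}=\{z\in\mathbb{C}:|z|=1\}$ and $\mathbb{T}^\infty$ is the countable product of copies of $\mathbb{T}$. A topological group is monothetic if it has a dense cyclic subgroup. QI-groups: for a Borel probability measure $\mu$ on a Polish group $X$ and $g\in X$, $\mu_g(E):=\mu(g^{-1}E)$ for Borel $E$; $\sim$ denotes equivalence of measures and $\perp$ mutual singularity; $E(\mu):=\{g\in X:\mu_g\sim\mu\}$. A Polish group $G$ is a QI-group (group of quasi-invariance) if there exist a locally compact Polish group $X$ and a Borel probability measure $\mu$ on $X$ such that $G$ is continuously embedded in $X$ (there is a continuous injective homomorphism $G\to X$, by which $G$ is identified, as an abstract group, with a subgroup of $X$), $E(\mu)=G$, and $\mu_g\perp\mu$ for all $g\in X\setminus E(\mu)$. Duality: for an abelian topological group $G$, $G^\wedge$ is the group of continuous homomorphisms (characters) $G\to\mathbb{T}$ with the compact-open topology; $G^{\wedge\wedge}=(G^\wedge)^\wedge$ is the bidual; $(\chi,g)$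 denotes the value of $\chi$ at $g$. $G$ is (Pontryagin) reflexive if the canonical homomorphism $\alpha_G:G\to G^{\wedge\wedge}$, $g\mapsto(\chi\mapsto(\chi,g))$, is a topological isomorphism. A subset $A\subset G$ is quasi-convex if for every $g\in G\setminus A$ there is $\chi\in A^{\triangleright}:=\{\chi\in G^\wedge:\ \mathrm{Re}(\chi,h)\ge 0\ \forall h\in A\}$ with $\mathrm{Re}(\chi,g)<0$. $G$ is locally quasi-convex if it has a neighborhood basis of the neutral element consisting of quasi-convex sets. *)

theory Defs
  imports
    "HOL-Algebra.Generated_Groups"
    "HOL-Probability.Probability_Measure"
begin

section \<open>Topological groups with an explicit carrier\<close>

record 'a topgroup = "'a monoid" +
  gtop :: "'a topology"

definition topological_group :: "'a topgroup \<Rightarrow> bool" where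
  "topological_group G \<longleftrightarrow>
     group G \<and> topspace (gtop G) = carrier G \<and>
     continuous_map (prod_topology (gtop G) (gtop G)) (gtop G) (\<lambda>(x, y). x \<otimes>\<^bsub>G\<^esub> y) \<and>
     continuous_map (gtop G) (gtop G) (\<lambda>x. inv\<^bsub>G\<^esub> x)"

definition separable_space :: "'a topology \<Rightarrow> bool" where
  "separable_space T \<longleftrightarrow>
     (\<exists>D. countable D \<and> D \<subseteq> topspace T \<and> T closure_of D = topspace T)"

definition polish_group :: "'a topgroup \<Rightarrow> bool" where
  "polish_group G \<longleftrightarrow>
     topological_group G \<and> completely_metrizable_space (gtop G) \<and> separable_space (gtop G)"

definition monothetic :: "'a topgroup \<Rightarrow> bool" where
  "monothetic G \<longleftrightarrow>
     (\<exists>g\<in>carrier G. gtop G closure_of (generate G {g}) = carrier G)"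

definition top_group_iso :: "'a topgroup \<Rightarrow> 'b topgroup \<Rightarrow> ('a \<Rightarrow> 'b) \<Rightarrow> bool" where
  "top_group_iso G H f \<longleftrightarrow> f \<in> iso G H \<and> homeomorphic_map (gtop G) (gtop H) f"

definition topologically_isomorphic :: "'a topgroup \<Rightarrow> 'b topgroup \<Rightarrow> bool" where
  "topologically_isomorphic G H \<longleftrightarrow> (\<exists>f. top_group_iso G H f)"

definition discrete_subgroup :: "'a set \<Rightarrow> 'a topgroup \<Rightarrow> bool" where
  "discrete_subgroup H G \<longleftrightarrow>
     subgroup H G \<and> subtopology (gtop G) H = discrete_topology H"

text \<open>The quotient carries the finest topology making the coset projection continuous;
  see \<open>quotient_map_quotient_group\<close> below.\<close>

definition quotient_group :: "'a topgroup \<Rightarrow> 'a set \<Rightarrow> 'a set topgroup" where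
  "quotient_group G H =
     \<lparr>carrier = carrier (G Mod H), monoid.mult = monoid.mult (G Mod H), one = one (G Mod H),
      gtop = topology (\<lambda>U. U \<subseteq> carrier (G Mod H) \<and>
                          openin (gtop G) {x \<in> topspace (gtop G). H #>\<^bsub>G\<^esub> x \<in> U})\<rparr>"

lemma quotient_map_quotient_group:
  assumes "topspace (gtop G) = carrier G"
  shows "quotient_map (gtop G) (gtop (quotient_group G H)) (\<lambda>x. H #>\<^bsub>G\<^esub> x)"
proof -
  let ?T = "gtop G" and ?C = "carrier (G Mod H)" and ?p = "\<lambda>x. H #>\<^bsub>G\<^esub> x"
  let ?P = "\<lambda>U. U \<subseteq> ?C \<and> openin ?T {x \<in> topspace ?T. ?p x \<in> U}"
  have "istopology ?P"
    unfolding istopology_def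
  proof safe
    fix S T assume "openin ?T {x \<in> topspace ?T. ?p x \<in> S}" "openin ?T {x \<in> topspace ?T. ?p x \<in> T}"
    then have "openin ?T ({x \<in> topspace ?T. ?p x \<in> S} \<inter> {x \<in> topspace ?T. ?p x \<in> T})" by blast
    moreover have "{x \<in> topspace ?T. ?p x \<in> S} \<inter> {x \<in> topspace ?T. ?p x \<in> T} =
        {x \<in> topspace ?T. ?p x \<in> S \<inter> T}" by auto
    ultimately show "openin ?T {x \<in> topspace ?T. ?p x \<in> S \<inter> T}" by simp
  next
    fix K assume "\<forall>U\<in>K. ?P U"
    then have "openin ?T (\<Union>U\<in>K. {x \<in> topspace ?T. ?p x \<in> U})" by blast
    moreover have "(\<Union>U\<in>K. {x \<in> topspace ?T. ?p x \<in> U}) = {x \<in> topspace ?T. ?p x \<in> \<Union>K}" by auto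
    ultimately show "openin ?T {x \<in> topspace ?T. ?p x \<in> \<Union>K}" by simp
  qed auto
  then have op: "openin (gtop (quotient_group G H)) = ?P"
    unfolding quotient_group_def by (simp add: topology_inverse')
  have im: "?p ` topspace ?T = ?C"
    by (simp add: assms carrier_FactGroup)
  have "{x \<in> topspace ?T. ?p x \<in> ?C} = topspace ?T" using im by blast
  then have "openin (gtop (quotient_group G H)) ?C" by (simp add: op)
  then have "topspace (gtop (quotient_group G H)) = ?C"
    unfolding topspace_def op by auto
  then show ?thesis unfolding quotient_map_def op using im by auto
qed


section \<open>Groups of quasi-invariance\<close>

definition borel_prob :: "'a topgroup \<Rightarrow> 'a measure \<Rightarrow> bool" where
  "borel_prob X M \<longleftrightarrow>
     prob_space M \<and> space M = topspace (gtop X) \<and>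
     sets M = sigma_sets (topspace (gtop X)) {U. openin (gtop X) U}"

text \<open>The translate \<open>E \<mapsto> M (g\<inverse> E)\<close>, written as an image measure;
  see \<open>emeasure_translate\<close> below.\<close>

definition translate :: "'a topgroup \<Rightarrow> 'a measure \<Rightarrow> 'a \<Rightarrow> 'a measure" where
  "translate X M g = distr M M (\<lambda>x. g \<otimes>\<^bsub>X\<^esub> x)"

definition equivalent_measures :: "'a measure \<Rightarrow> 'a measure \<Rightarrow> bool" where
  "equivalent_measures M N \<longleftrightarrow> absolutely_continuous M N \<and> absolutely_continuous N M"

definition mutually_singular :: "'a measure \<Rightarrow> 'a measure \<Rightarrow> bool" where
  "mutually_singular M N \<longleftrightarrow>
     (\<exists>A\<in>sets M. emeasure M A = 0 \<and> emeasure N (space M - A) = 0)"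

definition quasi_invariance :: "'a topgroup \<Rightarrow> 'a measure \<Rightarrow> 'a set" where
  "quasi_invariance X M = {g \<in> carrier X. equivalent_measures (translate X M g) M}"

definition QI_witness ::
    "'a topgroup \<Rightarrow> 'x topgroup \<Rightarrow> 'x measure \<Rightarrow> ('a \<Rightarrow> 'x) \<Rightarrow> bool" where
  "QI_witness G X M f \<longleftrightarrow>
     polish_group X \<and> locally_compact_space (gtop X) \<and> borel_prob X M \<and>
     f \<in> hom G X \<and> inj_on f (carrier G) \<and> continuous_map (gtop G) (gtop X) f \<and>
     quasi_invariance X M = f ` carrier G \<and>
     (\<forall>g \<in> carrier X - quasi_invariance X M. mutually_singular (translate X M g) M)"

text \<open>HOL cannot quantify over the type underlying \<open>X\<close>. A Polish space has at most continuum
  many points, so \<open>X\<close> can be taken to live on the type \<open>nat \<Rightarrow> complex\<close> without loss of generality: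
  \<open>QI_groupI\<close> below shows that a witness on any type yields one on this type.\<close>

definition QI_group :: "'a topgroup \<Rightarrow> bool" where
  "QI_group G \<longleftrightarrow>
     polish_group G \<and> (\<exists>(X :: (nat \<Rightarrow> complex) topgroup) M f. QI_witness G X M f)"

lemma translate_continuous:
  assumes "topological_group X" "g \<in> carrier X"
  shows "continuous_map (gtop X) (gtop X) (\<lambda>x. g \<otimes>\<^bsub>X\<^esub> x)"
proof -
  have "continuous_map (gtop X) (prod_topology (gtop X) (gtop X)) (\<lambda>x. (g, x))"
    using assms by (simp add: continuous_map_pairwise o_def topological_group_def)
  then have "continuous_map (gtop X) (gtop X) ((\<lambda>(x, y). x \<otimes>\<^bsub>X\<^esub> y) \<circ> (\<lambda>x. (g, x)))"
    using assms unfolding topological_group_def by (blast intro: continuous_map_compose)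
  then show ?thesis by (simp add: o_def)
qed

lemma continuous_map_borel_measurable:
  assumes "continuous_map T S f"
    and "space M = topspace T" "sets M = sigma_sets (topspace T) {U. openin T U}"
    and "space N = topspace S" "sets N = sigma_sets (topspace S) {U. openin S U}"
  shows "f \<in> measurable M N"
proof (rule measurable_sigma_sets[OF assms(5)])
  show "{U. openin S U} \<subseteq> Pow (topspace S)" by (auto dest: openin_subset)
  show "f \<in> space M \<rightarrow> topspace S" using assms by (auto simp: continuous_map_def)
  fix U assume "U \<in> {U. openin S U}"
  then have "openin T {x \<in> topspace T. f x \<in> U}"
    using assms(1) by (simp add: openin_continuous_map_preimage)
  moreover have "{x \<in> topspace T. f x \<in> U} = f -` U \<inter> space M" using assms by auto
  ultimately show "f -` U \<inter> space M \<in> sets M" by (simp add: assms(3) sigma_sets.Basic)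
qed

lemma translate_measurable:
  assumes "topological_group X" "borel_prob X M" "g \<in> carrier X"
  shows "(\<lambda>x. g \<otimes>\<^bsub>X\<^esub> x) \<in> measurable M M"
  using translate_continuous[OF assms(1,3)] assms(2)
  by (auto simp: borel_prob_def intro: continuous_map_borel_measurable)

lemma emeasure_translate:
  assumes X: "topological_group X" and M: "borel_prob X M" and g: "g \<in> carrier X"
    and E: "E \<in> sets M"
  shows "emeasure (translate X M g) E = emeasure M (inv\<^bsub>X\<^esub> g <#\<^bsub>X\<^esub> E)"
proof -
  interpret group X using X by (simp add: topological_group_def)
  have sp: "space M = carrier X" using X M by (simp add: topological_group_def borel_prob_def)
  have "E \<subseteq> carrier X" using sets.sets_into_space[OF E] sp by simp
  have "(\<lambda>x. g \<otimes>\<^bsub>X\<^esub> x) -` E \<inter> space M = inv\<^bsub>X\<^esub> g <#\<^bsub>X\<^esub> E"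
  proof (intro equalityI subsetI)
    fix x assume "x \<in> (\<lambda>x. g \<otimes>\<^bsub>X\<^esub> x) -` E \<inter> space M"
    then have x: "g \<otimes>\<^bsub>X\<^esub> x \<in> E" "x \<in> space M" by auto
    then have "x = inv\<^bsub>X\<^esub> g \<otimes>\<^bsub>X\<^esub> (g \<otimes>\<^bsub>X\<^esub> x)" using g sp by (simp add: m_assoc[symmetric])
    then show "x \<in> inv\<^bsub>X\<^esub> g <#\<^bsub>X\<^esub> E" using x unfolding l_coset_def by blast
  next
    fix x assume "x \<in> inv\<^bsub>X\<^esub> g <#\<^bsub>X\<^esub> E"
    then obtain e where e: "e \<in> E" "x = inv\<^bsub>X\<^esub> g \<otimes>\<^bsub>X\<^esub> e" unfolding l_coset_def by blast
    then have ec: "e \<in> carrier X" using \<open>E \<subseteq> carrier X\<close> by blast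
    then have "g \<otimes>\<^bsub>X\<^esub> x \<in> E" using e g by (simp add: m_assoc[symmetric])
    then show "x \<in> (\<lambda>x. g \<otimes>\<^bsub>X\<^esub> x) -` E \<inter> space M" using e ec g sp by simp
  qed
  then show ?thesis
    unfolding translate_def
    by (simp add: emeasure_distr[OF translate_measurable[OF X M g] E])
qed


lemma absolutely_continuous_distr:
  assumes ac: "absolutely_continuous A B" and h: "h \<in> measurable A N" "h \<in> measurable B N"
    and s: "space A = space B"
  shows "absolutely_continuous (distr A N h) (distr B N h)"
  using ac unfolding absolutely_continuous_def
  by (auto simp: null_sets_distr_iff[OF h(1)] null_sets_distr_iff[OF h(2)] s)

lemma mutually_singular_distr:
  assumes ms: "mutually_singular A B" and s: "sets A = sets B"
    and h: "h \<in> measurable A N" and k: "k \<in> measurable N A"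
    and kh: "\<And>x. x \<in> space A \<Longrightarrow> k (h x) = x"
  shows "mutually_singular (distr A N h) (distr B N h)"
proof -
  have sp: "space A = space B" using s by (rule sets_eq_imp_space_eq)
  have h': "h \<in> measurable B N" using h s by (simp cong: measurable_cong_sets)
  obtain E where E: "E \<in> sets A" "emeasure A E = 0" "emeasure B (space A - E) = 0"
    using ms unfolding mutually_singular_def by blast
  have F: "k -` E \<inter> space N \<in> sets N" using measurable_sets[OF k E(1)] .
  have ES: "E \<subseteq> space A" using sets.sets_into_space[OF E(1)] .
  have hs: "h x \<in> space N" if "x \<in> space A" for x using measurable_space[OF h that] .
  have "h -` (k -` E \<inter> space N) \<inter> space A = E" using ES hs kh by auto
  moreover have "h -` (space N - (k -` E \<inter> space N)) \<inter> space B = space A - E"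
    using hs kh sp by auto
  ultimately have "emeasure (distr A N h) (k -` E \<inter> space N) = 0"
    "emeasure (distr B N h) (space N - (k -` E \<inter> space N)) = 0"
    using E F by (simp_all add: emeasure_distr[OF h] emeasure_distr[OF h'])
  then show ?thesis
    unfolding mutually_singular_def by (intro bexI[of _ "k -` E \<inter> space N"]) (simp_all add: F)
qed

lemma polish_embeds_sequences:
  fixes X :: "'x topgroup"
  assumes "polish_group X"
  shows "\<exists>h :: 'x \<Rightarrow> nat \<Rightarrow> complex. inj_on h (carrier X)"
proof -
  have C: "topspace (gtop X) = carrier X" "carrier X \<noteq> {}"
    using assms monoid.one_closed[OF group.is_monoid] by (force simp: polish_group_def topological_group_def)+
  obtain Q d where m: "Metric_space Q d" and T: "gtop X = Metric_space.mtopology Q d"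
    using assms unfolding polish_group_def completely_metrizable_space_def by blast
  interpret Metric_space Q d by fact
  have Q: "Q = carrier X" using C(1) T by simp
  obtain D where D: "countable D" "D \<subseteq> Q" "mtopology closure_of D = Q"
    using assms T unfolding polish_group_def separable_space_def by auto
  have "D \<noteq> {}" using D C Q by auto
  define e where "e = from_nat_into D"
  have e: "range e = D" unfolding e_def using \<open>D \<noteq> {}\<close> D(1) by (rule range_from_nat_into)
  have "inj_on (\<lambda>x n. complex_of_real (d x (e n))) Q"
  proof (rule inj_onI, rule ccontr)
    fix x y assume xy: "x \<in> Q" "y \<in> Q" "x \<noteq> y"
      and eq: "(\<lambda>n. complex_of_real (d x (e n))) = (\<lambda>n. complex_of_real (d y (e n)))"
    have "d x y > 0" using xy by simp
    moreover have "x \<in> mtopology closure_of D" using D xy by simp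
    ultimately obtain z where z: "z \<in> D" "d x z < d x y / 2"
      unfolding metric_closure_of by (auto dest: spec[of _ "d x y / 2"])
    then obtain n where "z = e n" using e by blast
    then have "d x z = d y z" using eq by (metis of_real_eq_iff)
    moreover have "d x y \<le> d x z + d z y" using z D xy by (intro triangle) auto
    ultimately show False using z commute[of z y] by simp
  qed
  then show ?thesis using Q by blast
qed

lemma QI_witness_transfer:
  fixes h :: "'x \<Rightarrow> 'y"
  assumes W: "QI_witness G X M f" and inj: "inj_on h (carrier X)"
  shows "\<exists>(Y :: 'y topgroup) M' f'. QI_witness G Y M' f'"
proof -
  define k where "k = inv_into (carrier X) h"
  define C where "C = h ` carrier X"
  define Y where "Y = \<lparr>carrier = C, monoid.mult = (\<lambda>a b. h (k a \<otimes>\<^bsub>X\<^esub> k b)), one = h \<one>\<^bsub>X\<^esub>,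
    gtop = pullback_topology C k (gtop X)\<rparr>"
  have pX: "polish_group X" and lc: "locally_compact_space (gtop X)" and bM: "borel_prob X M"
    using W by (auto simp: QI_witness_def)
  have tX: "topological_group X" using pX by (simp add: polish_group_def)
  interpret X: group X using tX by (simp add: topological_group_def)
  interpret M: prob_space M using bM by (simp add: borel_prob_def)
  have tsX: "topspace (gtop X) = carrier X" using tX by (simp add: topological_group_def)
  have kh: "k (h x) = x" if "x \<in> carrier X" for x using that inj by (simp add: k_def)
  have kC: "k y \<in> carrier X" "h (k y) = y" if "y \<in> C" for y
    using that kh by (auto simp: C_def)
  have hC: "h x \<in> C" if "x \<in> carrier X" for x using that by (simp add: C_def)
  have cY: "carrier Y = C" and mY: "a \<otimes>\<^bsub>Y\<^esub> b = h (k a \<otimes>\<^bsub>X\<^esub> k b)" and oY: "\<one>\<^bsub>Y\<^esub> = h \<one>\<^bsub>X\<^esub>"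
    and gY: "gtop Y = pullback_topology C k (gtop X)" for a b by (simp_all add: Y_def)
  have tsY: "topspace (gtop Y) = C"
    using kC by (auto simp: gY topspace_pullback_topology tsX)
  have grpY: "group Y"
  proof (rule groupI)
    fix x assume x: "x \<in> carrier Y"
    show "\<exists>y\<in>carrier Y. y \<otimes>\<^bsub>Y\<^esub> x = \<one>\<^bsub>Y\<^esub>"
      using x kC kh hC by (intro bexI[of _ "h (inv\<^bsub>X\<^esub> k x)"]) (auto simp: cY mY oY)
  qed (auto simp: cY mY oY kC kh hC X.m_assoc)
  interpret Y: group Y by fact
  have invY: "inv\<^bsub>Y\<^esub> y = h (inv\<^bsub>X\<^esub> k y)" if "y \<in> C" for y
    using that by (intro Y.inv_equality) (auto simp: cY mY oY kC kh hC)
  have ck: "continuous_map (gtop Y) (gtop X) k"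
    unfolding continuous_map_def openin_pullback_topology gY
    using kC tsX tsY gY by (auto simp: openin_pullback_topology)
  have ch: "continuous_map (gtop X) (gtop Y) h"
    unfolding continuous_map_def
  proof (intro conjI allI impI)
    show "h \<in> topspace (gtop X) \<rightarrow> topspace (gtop Y)" using hC by (simp add: tsX tsY)
    fix U assume "openin (gtop Y) U"
    then obtain V where V: "openin (gtop X) V" "U = k -` V \<inter> C"
      by (auto simp: gY openin_pullback_topology)
    have "{x \<in> topspace (gtop X). h x \<in> U} = V"
      using openin_subset[OF V(1)] V(2) kh hC tsX by auto
    then show "openin (gtop X) {x \<in> topspace (gtop X). h x \<in> U}" using V by simp
  qed
  have hom: "homeomorphic_maps (gtop X) (gtop Y) h k"
    using ck ch kh kC by (simp add: homeomorphic_maps_def tsX tsY)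
  then have hm: "homeomorphic_map (gtop X) (gtop Y) h" by (rule homeomorphic_maps_map[THEN iffD1, THEN conjunct1])
  have hs: "gtop X homeomorphic_space gtop Y" using hom by (auto simp: homeomorphic_space_def)
  have tY: "topological_group Y"
    unfolding topological_group_def
  proof (intro conjI)
    have "continuous_map (prod_topology (gtop Y) (gtop Y)) (prod_topology (gtop X) (gtop X))
        (\<lambda>(a, b). (k a, k b))"
      using ck by (simp add: continuous_map_prod_top)
    moreover have "continuous_map (prod_topology (gtop X) (gtop X)) (gtop X) (\<lambda>(x, y). x \<otimes>\<^bsub>X\<^esub> y)"
      using tX by (simp add: topological_group_def)
    ultimately have "continuous_map (prod_topology (gtop Y) (gtop Y)) (gtop Y)
        (h \<circ> ((\<lambda>(x, y). x \<otimes>\<^bsub>X\<^esub> y) \<circ> (\<lambda>(a, b). (k a, k b))))"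
      by (rule continuous_map_compose[OF continuous_map_compose ch])
    then show "continuous_map (prod_topology (gtop Y) (gtop Y)) (gtop Y) (\<lambda>(x, y). x \<otimes>\<^bsub>Y\<^esub> y)"
      by (simp add: o_def case_prod_unfold mY)
    have "continuous_map (gtop X) (gtop X) (\<lambda>x. inv\<^bsub>X\<^esub> x)"
      using tX by (simp add: topological_group_def)
    then have "continuous_map (gtop Y) (gtop Y) (h \<circ> ((\<lambda>x. inv\<^bsub>X\<^esub> x) \<circ> k))"
      by (rule continuous_map_compose[OF continuous_map_compose[OF ck] ch])
    then show "continuous_map (gtop Y) (gtop Y) (\<lambda>x. inv\<^bsub>Y\<^esub> x)"
      by (rule continuous_map_eq) (simp add: tsY invY)
  qed (use grpY tsY cY in auto)
  have sepY: "separable_space (gtop Y)"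
  proof -
    obtain D where D: "countable D" "D \<subseteq> topspace (gtop X)" "gtop X closure_of D = topspace (gtop X)"
      using pX by (auto simp: polish_group_def separable_space_def)
    have "gtop Y closure_of (h ` D) = topspace (gtop Y)"
      using homeomorphic_map_closure_of[OF hm D(2)] D(3) by (simp add: tsX tsY C_def)
    moreover have "h ` D \<subseteq> topspace (gtop Y)" using D(2) hC by (auto simp: tsX tsY)
    ultimately show ?thesis using D(1) unfolding separable_space_def by blast
  qed
  have pY: "polish_group Y"
    using tY sepY pX homeomorphic_completely_metrizable_space[OF hs] by (simp add: polish_group_def)
  have lcY: "locally_compact_space (gtop Y)"
    using lc homeomorphic_locally_compact_space[OF hs] by simp
  define N where "N = sigma (topspace (gtop Y)) {U. openin (gtop Y) U}"
  have opY: "{U. openin (gtop Y) U} \<subseteq> Pow (topspace (gtop Y))" by (auto dest: openin_subset)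
  have spN: "space N = topspace (gtop Y)"
    and seN: "sets N = sigma_sets (topspace (gtop Y)) {U. openin (gtop Y) U}"
    using opY by (simp_all add: N_def)
  have spM: "space M = topspace (gtop X)"
    and seM: "sets M = sigma_sets (topspace (gtop X)) {U. openin (gtop X) U}"
    using bM by (simp_all add: borel_prob_def)
  have mh: "h \<in> measurable M N"
    by (rule continuous_map_borel_measurable[OF ch spM seM spN seN])
  have mk: "k \<in> measurable N M"
    by (rule continuous_map_borel_measurable[OF ck spN seN spM seM])
  define M' where "M' = distr M N h"
  have bM': "borel_prob Y M'"
    using M.prob_space_distr[OF mh] spN seN by (simp add: borel_prob_def M'_def)
  have tr: "translate Y M' (h g) = distr (translate X M g) N h" if g: "g \<in> carrier X" for g
  proof -
    have mg: "(\<lambda>x. g \<otimes>\<^bsub>X\<^esub> x) \<in> measurable M M" by (rule translate_measurable[OF tX bM g])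
    have mg': "(\<lambda>x. h g \<otimes>\<^bsub>Y\<^esub> x) \<in> measurable N N"
      using translate_measurable[OF tY bM', of "h g"] hC[OF g] cY by (simp add: M'_def)
    have "translate Y M' (h g) = distr M' N (\<lambda>x. h g \<otimes>\<^bsub>Y\<^esub> x)"
      unfolding translate_def by (rule distr_cong) (simp_all add: M'_def)
    also have "\<dots> = distr M N ((\<lambda>x. h g \<otimes>\<^bsub>Y\<^esub> x) \<circ> h)"
      unfolding M'_def by (rule distr_distr[OF mg' mh])
    also have "\<dots> = distr M N (h \<circ> (\<lambda>x. g \<otimes>\<^bsub>X\<^esub> x))"
      by (rule distr_cong) (auto simp: mY kh g spM tsX)
    also have "\<dots> = distr (translate X M g) N h"
      unfolding translate_def by (rule distr_distr[OF mh mg, symmetric])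
    finally show ?thesis .
  qed
  have st: "sets (translate X M g) = sets M" "space (translate X M g) = space M" for g
    by (simp_all add: translate_def)
  have mht: "h \<in> measurable (translate X M g) N" for g
    using mh by (simp add: translate_def)
  have roundtrip: "distr (distr A N h) M k = A" if A: "sets A = sets M" for A
  proof -
    have mA: "h \<in> measurable A N" using mh A by (simp cong: measurable_cong_sets)
    have spA: "space A = space M" using A by (rule sets_eq_imp_space_eq)
    have "distr (distr A N h) M k = distr A M (k \<circ> h)" by (rule distr_distr[OF mk mA])
    also have "\<dots> = distr A M (\<lambda>x. x)"
      by (rule distr_cong) (auto simp: spA spM tsX kh)
    also have "\<dots> = A" using A by (simp add: distr_id2)
    finally show ?thesis .
  qed
  have ac: "absolutely_continuous (distr A N h) (distr B N h) \<longleftrightarrow> absolutely_continuous A B"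
    if A: "sets A = sets M" and B: "sets B = sets M" for A B
  proof
    have s: "space A = space B" using A B sets_eq_imp_space_eq by metis
    have m: "h \<in> measurable A N" "h \<in> measurable B N"
      using mh A B by (simp_all cong: measurable_cong_sets)
    show "absolutely_continuous (distr A N h) (distr B N h)" if "absolutely_continuous A B"
      using absolutely_continuous_distr[OF that m s] .
    assume "absolutely_continuous (distr A N h) (distr B N h)"
    then have "absolutely_continuous (distr (distr A N h) M k) (distr (distr B N h) M k)"
      by (rule absolutely_continuous_distr) (use mk in simp_all)
    then show "absolutely_continuous A B" by (simp add: roundtrip A B)
  qed
  have QI: "h g \<in> quasi_invariance Y M' \<longleftrightarrow> g \<in> quasi_invariance X M" if "g \<in> carrier X" for g
    using that hC ac[OF st(1) refl] ac[OF refl st(1)]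
    by (simp add: quasi_invariance_def equivalent_measures_def cY tr[unfolded M'_def] M'_def)
  have QIc: "quasi_invariance Y M' \<subseteq> C" by (auto simp: quasi_invariance_def cY)
  have QIX: "quasi_invariance X M \<subseteq> carrier X" by (auto simp: quasi_invariance_def)
  have QIY: "quasi_invariance Y M' = h ` quasi_invariance X M"
  proof (intro equalityI subsetI)
    fix y assume y: "y \<in> quasi_invariance Y M'"
    then have "y \<in> C" using QIc by blast
    then have "k y \<in> quasi_invariance X M" using QI[of "k y"] kC y by simp
    then show "y \<in> h ` quasi_invariance X M" using kC(2)[OF \<open>y \<in> C\<close>] by force
  next
    fix y assume "y \<in> h ` quasi_invariance X M"
    then show "y \<in> quasi_invariance Y M'" using QI QIX by auto
  qed
  have fh: "f \<in> hom G X" "inj_on f (carrier G)" "continuous_map (gtop G) (gtop X) f"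
    "quasi_invariance X M = f ` carrier G"
    using W by (auto simp: QI_witness_def)
  have fc: "f x \<in> carrier X" if "x \<in> carrier G" for x using fh(1) that by (auto simp: hom_def)
  have "QI_witness G Y M' (h \<circ> f)"
    unfolding QI_witness_def
  proof (intro conjI ballI)
    show "h \<circ> f \<in> hom G Y"
      using fh(1) fc by (auto simp: hom_def cY mY hC kh)
    show "inj_on (h \<circ> f) (carrier G)"
      using fh(2) by (rule comp_inj_on) (use fc in \<open>auto intro: inj_on_subset[OF inj]\<close>)
    show "continuous_map (gtop G) (gtop Y) (h \<circ> f)"
      using fh(3) ch by (rule continuous_map_compose)
    show "quasi_invariance Y M' = (h \<circ> f) ` carrier G"
      using QIY fh(4) by (simp add: image_comp)
  next
    fix y assume y: "y \<in> carrier Y - quasi_invariance Y M'"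
    then have "k y \<in> carrier X - quasi_invariance X M"
      using kC QI[of "k y"] cY by auto
    then have g: "k y \<in> carrier X" "mutually_singular (translate X M (k y)) M"
      using W by (auto simp: QI_witness_def)
    have "mutually_singular (distr (translate X M (k y)) N h) (distr M N h)"
      by (rule mutually_singular_distr[OF g(2) st(1) mht])
        (use mk in \<open>auto simp: translate_def spM tsX kh\<close>)
    moreover have "h (k y) = y" using kC y cY by simp
    ultimately show "mutually_singular (translate Y M' y) M'"
      using tr[OF g(1), unfolded M'_def] by (simp add: M'_def)
  qed (use pY lcY bM' in auto)
  then show ?thesis by blast
qed

lemma QI_groupI:
  assumes "polish_group G" "QI_witness G X M f"
  shows "QI_group G"
  using assms polish_embeds_sequences[of X] QI_witness_transfer[of G X M f]
  unfolding QI_group_def QI_witness_def by metis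


section \<open>Pontryagin duality\<close>

definition circle_group :: "complex topgroup" where
  "circle_group =
     \<lparr>carrier = {z. cmod z = 1}, monoid.mult = (*), one = 1, gtop = top_of_set {z. cmod z = 1}\<rparr>"

text \<open>Characters are normalised to be \<open>undefined\<close> off the carrier, so that equality of characters
  is equality on the group.\<close>

definition characters :: "'a topgroup \<Rightarrow> ('a \<Rightarrow> complex) set" where
  "characters G =
     {\<phi> \<in> hom G circle_group. \<phi> \<in> extensional (carrier G) \<and>
        continuous_map (gtop G) (gtop circle_group) \<phi>}"

definition compact_open_topology :: "'a topgroup \<Rightarrow> ('a \<Rightarrow> complex) topology" where
  "compact_open_topology G = topology_generated_by
     {{\<phi> \<in> characters G. \<phi> ` K \<subseteq> U} | K U. compactin (gtop G) K \<and> openin (gtop circle_group) U}"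

definition dual :: "'a topgroup \<Rightarrow> ('a \<Rightarrow> complex) topgroup" where
  "dual G =
     \<lparr>carrier = characters G,
      monoid.mult = (\<lambda>\<phi> \<psi>. \<lambda>g\<in>carrier G. \<phi> g * \<psi> g),
      one = (\<lambda>g\<in>carrier G. 1),
      gtop = compact_open_topology G\<rparr>"

abbreviation bidual :: "'a topgroup \<Rightarrow> (('a \<Rightarrow> complex) \<Rightarrow> complex) topgroup" where
  "bidual G \<equiv> dual (dual G)"

definition canonical_hom :: "'a topgroup \<Rightarrow> 'a \<Rightarrow> ('a \<Rightarrow> complex) \<Rightarrow> complex" where
  "canonical_hom G g = (\<lambda>\<phi>\<in>carrier (dual G). \<phi> g)"

definition reflexive :: "'a topgroup \<Rightarrow> bool" where
  "reflexive G \<longleftrightarrow> top_group_iso G (bidual G) (canonical_hom G)"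

definition polar :: "'a topgroup \<Rightarrow> 'a set \<Rightarrow> ('a \<Rightarrow> complex) set" where
  "polar G A = {\<phi> \<in> carrier (dual G). \<forall>h\<in>A. Re (\<phi> h) \<ge> 0}"

definition quasi_convex :: "'a topgroup \<Rightarrow> 'a set \<Rightarrow> bool" where
  "quasi_convex G A \<longleftrightarrow>
     A \<subseteq> carrier G \<and> (\<forall>g\<in>carrier G - A. \<exists>\<phi>\<in>polar G A. Re (\<phi> g) < 0)"

definition locally_quasi_convex :: "'a topgroup \<Rightarrow> bool" where
  "locally_quasi_convex G \<longleftrightarrow>
     (\<forall>U. openin (gtop G) U \<and> \<one>\<^bsub>G\<^esub> \<in> U \<longrightarrow>
        (\<exists>A V. quasi_convex G A \<and> openin (gtop G) V \<and> \<one>\<^bsub>G\<^esub> \<in> V \<and> V \<subseteq> A \<and> A \<subseteq> U))"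

lemma topspace_dual: "topspace (gtop (dual G)) = carrier (dual G)"
proof -
  have "characters G \<in> {{\<phi> \<in> characters G. \<phi> ` K \<subseteq> U} | K U.
      compactin (gtop G) K \<and> openin (gtop circle_group) U}"
    by (rule CollectI, rule exI[of _ "{}"], rule exI[of _ "{}"]) auto
  then show ?thesis
    unfolding dual_def compact_open_topology_def by (auto simp: topology_generated_by_topspace)
qed


section \<open>The groups of the theorem\<close>

text \<open>The unordered sum \<open>infsum\<close> is \<open>0\<close> for a non-summable family, which makes this
  distance non-negative everywhere, as \<open>Metric_space\<close> requires even off the carrier.\<close>

definition l2_dist :: "(nat \<Rightarrow> 'a::real_normed_vector) \<Rightarrow> (nat \<Rightarrow> 'a) \<Rightarrow> real" where
  "l2_dist x y = sqrt (\<Sum>\<^sub>\<infinity>n. (norm (x n - y n))\<^sup>2)"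

definition T2H_set :: "(nat \<Rightarrow> complex) set" where
  "T2H_set = {z. (\<forall>n. cmod (z n) = 1) \<and> summable (\<lambda>n. (cmod (1 - z n))\<^sup>2)}"

definition T2H :: "(nat \<Rightarrow> complex) topgroup" where
  "T2H =
     \<lparr>carrier = T2H_set, monoid.mult = (\<lambda>z w n. z n * w n), one = (\<lambda>n. 1),
      gtop = Metric_space.mtopology T2H_set l2_dist\<rparr>"

definition ell2_set :: "(nat \<Rightarrow> real) set" where
  "ell2_set = {x. summable (\<lambda>n. (x n)\<^sup>2)}"

definition ell2 :: "(nat \<Rightarrow> real) topgroup" where
  "ell2 =
     \<lparr>carrier = ell2_set, monoid.mult = (\<lambda>x y n. x n + y n), one = (\<lambda>n. 0),
      gtop = Metric_space.mtopology ell2_set l2_dist\<rparr>"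

definition Z0 :: "(nat \<Rightarrow> real) set" where
  "Z0 = {x. (\<forall>n. x n \<in> \<int>) \<and> finite {n. x n \<noteq> 0}}"

lemma square_summable_add:
  fixes x y :: "nat \<Rightarrow> 'a::real_normed_vector"
  assumes "summable (\<lambda>n. (norm (x n))\<^sup>2)" "summable (\<lambda>n. (norm (y n))\<^sup>2)"
  shows "summable (\<lambda>n. (norm (x n + y n))\<^sup>2)"
proof (rule summable_comparison_test')
  show "summable (\<lambda>n. 2 * (norm (x n))\<^sup>2 + 2 * (norm (y n))\<^sup>2)"
    using assms by (intro summable_add summable_mult)
  fix n
  have "(norm (x n + y n))\<^sup>2 \<le> (norm (x n) + norm (y n))\<^sup>2"
    by (intro power_mono norm_triangle_ineq) auto
  also have "\<dots> \<le> 2 * (norm (x n))\<^sup>2 + 2 * (norm (y n))\<^sup>2"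
    using sum_squares_bound[of "norm (x n)" "norm (y n)"] by (simp add: power2_sum)
  finally show "norm ((norm (x n + y n))\<^sup>2) \<le> 2 * (norm (x n))\<^sup>2 + 2 * (norm (y n))\<^sup>2" by simp
qed

lemma Metric_space_l2_dist:
  fixes S :: "(nat \<Rightarrow> 'a::real_normed_vector) set"
  assumes "\<And>x y. x \<in> S \<Longrightarrow> y \<in> S \<Longrightarrow> summable (\<lambda>n. (norm (x n - y n))\<^sup>2)"
  shows "Metric_space S l2_dist"
proof
  have so: "(\<lambda>n. (norm (x n - y n))\<^sup>2) summable_on UNIV" if "x \<in> S" "y \<in> S" for x y
    using assms[OF that] by (simp add: summable_on_UNIV_nonneg_real_iff)
  fix x y z :: "nat \<Rightarrow> 'a"
  show nn: "0 \<le> l2_dist x y" by (simp add: l2_dist_def infsum_nonneg)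
  show "l2_dist x y = l2_dist y x" by (simp add: l2_dist_def norm_minus_commute)
  show "l2_dist x y = 0 \<longleftrightarrow> x = y" if xy: "x \<in> S" "y \<in> S"
  proof
    assume "l2_dist x y = 0"
    then have "(norm (x n - y n))\<^sup>2 = 0" for n
      by (intro nonneg_infsum_le_0D[OF _ so[OF xy]]) (auto simp: l2_dist_def)
    then show "x = y" by auto
  qed (simp add: l2_dist_def)
  show "l2_dist x z \<le> l2_dist x y + l2_dist y z" if S: "x \<in> S" "y \<in> S" "z \<in> S"
  proof -
    have nn: "0 \<le> l2_dist x y" for x y :: "nat \<Rightarrow> 'a" by (simp add: l2_dist_def infsum_nonneg)
    have fin: "L2_set (\<lambda>n. norm (x n - y n)) F \<le> l2_dist x y" if "finite F" "x \<in> S" "y \<in> S" for F x y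
      unfolding L2_set_def l2_dist_def
      by (rule real_sqrt_le_mono, rule finite_sum_le_infsum) (use that so in auto)
    have "(\<Sum>\<^sub>\<infinity>n. (norm (x n - z n))\<^sup>2) \<le> (l2_dist x y + l2_dist y z)\<^sup>2"
    proof (rule infsum_le_finite_sums[OF so[OF S(1,3)]])
      fix F :: "nat set" assume F: "finite F"
      have "L2_set (\<lambda>n. norm (x n - z n)) F \<le> L2_set (\<lambda>n. norm (x n - y n) + norm (y n - z n)) F"
        by (rule L2_set_mono) (use norm_triangle_ineq[of "x i - y i" "y i - z i" for i] in auto)
      also have "\<dots> \<le> L2_set (\<lambda>n. norm (x n - y n)) F + L2_set (\<lambda>n. norm (y n - z n)) F"
        by (rule L2_set_triangle_ineq)
      also have "\<dots> \<le> l2_dist x y + l2_dist y z" using fin[OF F] S by (simp add: add_mono)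
      finally show "(\<Sum>n\<in>F. (norm (x n - z n))\<^sup>2) \<le> (l2_dist x y + l2_dist y z)\<^sup>2"
        unfolding L2_set_def by (rule sqrt_le_D)
    qed
    then show ?thesis
      using nn[of x y] nn[of y z] by (simp add: l2_dist_def[of x z] real_le_lsqrt infsum_nonneg)
  qed
qed

lemma Metric_space_T2H: "Metric_space T2H_set l2_dist"
proof (rule Metric_space_l2_dist)
  fix x y assume "x \<in> T2H_set" "y \<in> T2H_set"
  then have "summable (\<lambda>n. (norm ((x n - 1) + (1 - y n)))\<^sup>2)"
    by (intro square_summable_add) (auto simp: T2H_set_def norm_minus_commute)
  then show "summable (\<lambda>n. (norm (x n - y n))\<^sup>2)" by simp
qed

lemma Metric_space_ell2: "Metric_space ell2_set l2_dist"
proof (rule Metric_space_l2_dist)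
  fix x y assume "x \<in> ell2_set" "y \<in> ell2_set"
  then have "summable (\<lambda>n. (norm (x n + - y n))\<^sup>2)"
    by (intro square_summable_add) (auto simp: ell2_set_def)
  then show "summable (\<lambda>n. (norm (x n - y n))\<^sup>2)" by simp
qed

end

theory Submission
  imports Defs "HOL-Probability.Infinite_Product_Measure"
begin

text \<open>The map \<open>x \<mapsto> (exp (2\<pi>i x\<^sub>n))\<close> is an open homomorphism from \<open>\<ell>\<^sup>2\<close> onto \<open>T2H\<close> with kernel \<open>Z0\<close>,
  and an infinite product of smooth densities on the circle is quasi-invariant exactly under the
  rotations in \<open>T2H\<close> (a form of Kakutani's theorem).

  A character of \<open>T2H\<close> has finitely many nonzero integer coefficients. Characters that are bounded
  away from \<open>-1\<close> on a fixed neighbourhood of the identity have coefficients bounded in \<open>\<ell>\<^sup>2\<close>, hence,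
  being integral, in \<open>\<ell>\<^sup>1\<close>; so they cannot separate sequences of long \<open>\<ell>\<^sup>2\<close> norm and small sup norm
  from the identity, which excludes quasi-convex bases and reflexivity. Consequently every
  neighbourhood of the identity in the bidual contains all products of distinct members of a
  sequence \<open>h\<^sub>i\<close> with \<open>h\<^sub>i\<^sup>p\<close> the involution in coordinate \<open>i\<close>. In a group of quasi-invariance such
  products would move the measure little in total variation, and averaging the orbit of a unit vector
  over them forces the involutions to be small infinitely often; by local compactness a subsequence
  of distinct involutions converges. But the bidual has only countably many involutions, and
  these are complete for the distance that adds total variation to the metric of the locally
  compact group, hence discrete by Baire, a contradiction.\<close>

section \<open>Translates and total variation\<close>

text \<open>Nothing is known about a group and a measure that might witness quasi-invariance of the
  bidual, and the small roots found in a neighbourhood of the identity change with the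
  neighbourhood, whereas a contradiction needs one fixed sequence. Hence the \<open>p\<close>-th
  powers: they are the same involutions whatever roots were taken, and a root that almost fixes a
  vector has a \<open>p\<close>-th power that does so too, up to a factor depending on
  \<open>p\<close> alone. Averaging beats any such factor because it may run over arbitrarily many
  roots: products over a set \<open>S\<close> of coordinates have a sup norm that does not grow with
  \<open>S\<close>, so they never leave the neighbourhood. The bidual is never identified; its
  involutions are counted through their signs on the coordinate characters, and only images of
  points of \<open>T2H\<close> serve as roots. On the positive side no infinite product density is
  constructed: both alternatives are read off from finite likelihood ratios on sets depending on
  finitely many coordinates, a second moment bound giving absolute continuity and a decaying
  Hellinger affinity giving singularity.\<close>

lemma borel_outer_regular:
  assumes T: "metrizable_space T" and fin: "finite_measure N"
    and sp: "space N = topspace T" and st: "sets N = sigma_sets (topspace T) {U. openin T U}"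
    and E: "E \<in> sets N" and "\<epsilon> > 0"
  shows "\<exists>U. openin T U \<and> E \<subseteq> U \<and> measure N U \<le> measure N E + \<epsilon>"
proof -
  interpret finite_measure N by fact
  have op: "U \<in> sets N" if "openin T U" for U using that st by (simp add: sigma_sets.Basic)
  have cl: "C \<in> sets N" if "closedin T C" for C
  proof -
    have "topspace T - (topspace T - C) \<in> sets N"
      using op[of "topspace T - C"] that sp sets.compl_sets[of "topspace T - C" N] by auto
    then show ?thesis using closedin_subset[OF that] by (simp add: double_diff)
  qed
  have "E \<in> sigma_sets (topspace T) {U. openin T U}" using E st by simp
  \<comment> \<open>Sandwiching between a closed and an open set is what survives the induction:
    complementation exchanges the two, so the outer bound alone would not be an invariant.\<close>
  then have "\<forall>\<epsilon>>0. \<exists>C U. closedin T C \<and> openin T U \<and> C \<subseteq> E \<and> E \<subseteq> U \<and> measure N (U - C) \<le> \<epsilon>"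
  proof (induction rule: sigma_sets.induct)
    case (Basic U)
    then have U: "openin T U" by simp
    have "fsigma_in T U" by (rule open_imp_fsigma_in[OF T U])
    then obtain C :: "nat \<Rightarrow> _" where C: "\<And>n. closedin T (C n)" "\<And>n. C n \<subseteq> C (Suc n)" "\<Union>(range C) = U"
      unfolding fsigma_in_ascending by blast
    have "incseq C" using C(2) by (rule incseq_SucI)
    have "(\<lambda>n. measure N (C n)) \<longlonglongrightarrow> measure N (\<Union>n. C n)"
      by (rule finite_Lim_measure_incseq) (use cl C(1) \<open>incseq C\<close> in auto)
    then have lim: "(\<lambda>n. measure N (C n)) \<longlonglongrightarrow> measure N U" using C(3) by simp
    show ?case
    proof (intro allI impI)
      fix e :: real assume "e > 0"
      then obtain n where "dist (measure N (C n)) (measure N U) < e"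
        using metric_LIMSEQ_D[OF lim] by blast
      moreover have "measure N (U - C n) = measure N U - measure N (C n)"
        by (rule finite_measure_Diff) (use op[OF U] cl C(1,3) in auto)
      ultimately show "\<exists>C U'. closedin T C \<and> openin T U' \<and> C \<subseteq> U \<and> U \<subseteq> U' \<and> measure N (U' - C) \<le> e"
        using C(1,3) U by (intro exI[of _ "C n"] exI[of _ U] conjI) (auto simp: dist_real_def)
    qed
  next
    case Empty
    have "closedin T {} \<and> openin T {} \<and> {} \<subseteq> ({}::'a set) \<and> ({}::'a set) \<subseteq> {}" by simp
    then show ?case by (metis Diff_empty less_imp_le measure_empty)
  next
    case (Compl a)
    have aT: "a \<subseteq> topspace T" using sigma_sets_into_sp[OF _ Compl(1)] openin_subset by blast
    show ?case
    proof (intro allI impI)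
      fix e :: real assume "e > 0"
      from Compl.IH[rule_format, OF this]
      obtain C U where CU: "closedin T C" "openin T U" "C \<subseteq> a" "a \<subseteq> U" "measure N (U - C) \<le> e"
        by metis
      have "(topspace T - C) - (topspace T - U) = U - C" using CU(2) openin_subset by blast
      then show "\<exists>C U. closedin T C \<and> openin T U \<and> C \<subseteq> topspace T - a \<and> topspace T - a \<subseteq> U \<and> measure N (U - C) \<le> e"
        using CU by (intro exI[of _ "topspace T - U"] exI[of _ "topspace T - C"] conjI) auto
    qed
  next
    case (Union a)
    show ?case
    proof (intro allI impI)
      fix e :: real assume e: "e > 0"
      \<comment> \<open>Half of \<open>e\<close> is spread over the sets \<open>U i - C i\<close>;
        the other half pays for replacing the union of all \<open>C i\<close>, which need not be
        closed, by a finite one.\<close>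
      define r where "r i = e / 2 * (1/2)^Suc i" for i
      have r: "r i > 0" for i using e by (simp add: r_def)
      have "\<forall>i. \<exists>C U. closedin T C \<and> openin T U \<and> C \<subseteq> a i \<and> a i \<subseteq> U \<and> measure N (U - C) \<le> r i"
        using Union.IH[rule_format, OF r] by (rule allI)
      then obtain C U where CU: "\<And>i. closedin T (C i)" "\<And>i. openin T (U i)" "\<And>i. C i \<subseteq> a i"
        "\<And>i. a i \<subseteq> U i" "\<And>i. measure N (U i - C i) \<le> r i"
        by metis
      have "r sums (e/2 * 1)" unfolding r_def by (rule sums_mult[OF power_half_series])
      then have rs: "r sums (e/2)" by simp
      have s: "summable (\<lambda>i. measure N (U i - C i))"
        by (rule summable_comparison_test[OF _ sums_summable[OF rs]]) (use CU(5) in auto)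
      define D where "D n = (\<Union>i\<le>n. C i)" for n
      let ?U = "\<Union>i. U i"
      have mU: "?U \<in> sets N" using op CU(2) by blast
      have Dm: "D n \<in> sets N" for n unfolding D_def using cl CU(1) by blast
      have "measure N (\<Union>i. U i - C i) \<le> (\<Sum>i. measure N (U i - C i))"
        by (rule finite_measure_subadditive_countably[OF _ s]) (use op cl CU in auto)
      also have "\<dots> \<le> e/2"
        using suminf_le[OF CU(5) s sums_summable[OF rs]] sums_unique[OF rs] by simp
      finally have 1: "measure N (\<Union>i. U i - C i) \<le> e/2" .
      have "measure N (?U - (\<Union>i. C i)) \<le> measure N (\<Union>i. U i - C i)"
        by (rule finite_measure_mono) (use op cl CU in auto)
      then have 2: "measure N (?U - (\<Union>i. C i)) \<le> e/2" using 1 by simp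
      have "incseq D" unfolding D_def by (rule incseq_SucI) (rule UN_mono, auto)
      moreover have "(\<Union>n. D n) = (\<Union>i. C i)" unfolding D_def by blast
      ultimately have "(\<lambda>n. measure N (D n)) \<longlonglongrightarrow> measure N (\<Union>i. C i)"
        using finite_Lim_measure_incseq[of D] Dm by auto
      from metric_LIMSEQ_D[OF this half_gt_zero[OF e]]
      obtain n where n: "dist (measure N (D n)) (measure N (\<Union>i. C i)) < e/2" by blast
      have sub: "(\<Union>i. C i) \<subseteq> ?U" "D n \<subseteq> ?U" using CU(3,4) unfolding D_def by blast+
      have mC: "(\<Union>i. C i) \<in> sets N" using cl CU(1) by blast
      have "measure N (?U - D n) = measure N ?U - measure N (D n)"
        "measure N (?U - (\<Union>i. C i)) = measure N ?U - measure N (\<Union>i. C i)"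
        using finite_measure_Diff[OF mU Dm sub(2)] finite_measure_Diff[OF mU mC sub(1)] by auto
      then have "measure N (?U - D n) \<le> e" using n 2 unfolding dist_real_def by linarith
      moreover have "closedin T (D n)" unfolding D_def using CU(1) by (intro closedin_Union) auto
      moreover have "openin T ?U" using CU(2) by blast
      moreover have "D n \<subseteq> \<Union> (range a)" "\<Union> (range a) \<subseteq> ?U" using CU(3,4) unfolding D_def by blast+
      ultimately show "\<exists>C U. closedin T C \<and> openin T U \<and> C \<subseteq> \<Union> (range a) \<and> \<Union> (range a) \<subseteq> U \<and> measure N (U - C) \<le> e"
        using \<open>measure N (?U - D n) \<le> e\<close> by (intro exI[of _ "D n"] exI[of _ ?U] conjI)
    qed
  qed
  from this[rule_format, OF \<open>\<epsilon> > 0\<close>]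
  obtain C U where CU: "closedin T C" "openin T U" "C \<subseteq> E" "E \<subseteq> U" "measure N (U - C) \<le> \<epsilon>"
    by metis
  have m: "U - C \<in> sets N" using op[OF CU(2)] cl[OF CU(1)] by (rule sets.Diff)
  have "measure N U \<le> measure N (E \<union> (U - C))"
    using CU(3) sets.Un[OF E m] by (intro finite_measure_mono) auto
  also have "\<dots> \<le> measure N E + measure N (U - C)"
    using E m by (rule measure_Un_le)
  finally have "measure N U \<le> measure N E + \<epsilon>" using CU(5) by simp
  then show ?thesis using CU(2,4) by blast
qed

lemma metrizable_separable_countable_base:
  assumes "metrizable_space T" "separable_space T"
  obtains B where "countable B" "\<And>V. V \<in> B \<Longrightarrow> openin T V"
    "\<And>U x. openin T U \<Longrightarrow> x \<in> U \<Longrightarrow> \<exists>V\<in>B. x \<in> V \<and> V \<subseteq> U"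
proof -
  obtain Q d where m: "Metric_space Q d" and T: "T = Metric_space.mtopology Q d"
    using assms(1) unfolding metrizable_space_def by blast
  interpret Metric_space Q d by fact
  obtain D where D: "countable D" "D \<subseteq> Q" "mtopology closure_of D = Q"
    using assms T unfolding separable_space_def by auto
  define B where "B = (\<lambda>(x, n). mball x (1 / real (Suc n))) ` (D \<times> (UNIV :: nat set))"
  show thesis
  proof
    show "countable B" unfolding B_def using D by auto
    show "openin T V" if "V \<in> B" for V using that unfolding B_def T by auto
    fix U x assume U: "openin T U" "x \<in> U"
    then obtain r where r: "r > 0" "mball x r \<subseteq> U" "x \<in> Q"
      unfolding T openin_mtopology by blast
    obtain n where n: "1 / real (Suc n) < r / 2" using r(1) nat_approx_posE half_gt_zero by blast
    have "x \<in> mtopology closure_of D" using D r by simp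
    then obtain z where z: "z \<in> D" "d x z < 1 / real (Suc n)"
      unfolding metric_closure_of by (auto dest: spec[of _ "1 / real (Suc n)"])
    have zQ: "z \<in> Q" using z D by auto
    have "mball z (1 / real (Suc n)) \<subseteq> mball x r"
    proof
      fix y assume y: "y \<in> mball z (1 / real (Suc n))"
      then have "d x y \<le> d x z + d z y" using zQ r by (intro triangle) auto
      then show "y \<in> mball x r" using y z n r(3) by auto
    qed
    moreover have "x \<in> mball z (1 / real (Suc n))" using z zQ r commute[of x z] by simp
    ultimately show "\<exists>V\<in>B. x \<in> V \<and> V \<subseteq> U" using r z unfolding B_def by blast
  qed
qed

text \<open>Polishness of \<open>G\<close> is assumed separately because
  \<open>tv_continuous\<close> applies Baire category in \<open>G\<close>; all that is known about
  \<open>X\<close> comes from the witness.\<close>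

locale qi_witness =
  fixes G :: "'g topgroup" and X :: "'x topgroup" and M :: "'x measure" and f :: "'g \<Rightarrow> 'x"
  assumes polish_G: "polish_group G" and witness: "QI_witness G X M f"
begin

lemma polish_X: "polish_group X" and lc_X: "locally_compact_space (gtop X)" and bM: "borel_prob X M"
  and f_hom: "f \<in> hom G X" and f_inj: "inj_on f (carrier G)"
  and f_cont: "continuous_map (gtop G) (gtop X) f"
  and QI_eq: "quasi_invariance X M = f ` carrier G"
  using witness by (auto simp: QI_witness_def)

lemma tg_X: "topological_group X" and tg_G: "topological_group G"
  using polish_X polish_G by (auto simp: polish_group_def)

lemma group_X: "group X" and group_G: "group G"
  using tg_X tg_G by (auto simp: topological_group_def)

sublocale X: group X by (rule group_X)
sublocale G: group G by (rule group_G)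
sublocale M: prob_space M using bM by (simp add: borel_prob_def)

lemma ts_X: "topspace (gtop X) = carrier X" and ts_G: "topspace (gtop G) = carrier G"
  using tg_X tg_G by (auto simp: topological_group_def)

lemma space_M: "space M = carrier X" and sets_M: "sets M = sigma_sets (carrier X) {U. openin (gtop X) U}"
  using bM ts_X by (auto simp: borel_prob_def)

lemma metrizable_X: "metrizable_space (gtop X)"
  using polish_X by (simp add: polish_group_def completely_metrizable_imp_metrizable_space)

lemma f_carrier: "g \<in> carrier G \<Longrightarrow> f g \<in> carrier X" using f_hom by (auto simp: hom_def)
lemma f_mult: "g \<in> carrier G \<Longrightarrow> h \<in> carrier G \<Longrightarrow> f (g \<otimes>\<^bsub>G\<^esub> h) = f g \<otimes>\<^bsub>X\<^esub> f h"
  using f_hom by (auto simp: hom_def)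
lemma f_one: "f \<one>\<^bsub>G\<^esub> = \<one>\<^bsub>X\<^esub>" using f_hom hom_one[OF _ group_G group_X] by blast

abbreviation tr :: "'x \<Rightarrow> 'x measure" where "tr g \<equiv> translate X M g"

lemma open_sets: "openin (gtop X) U \<Longrightarrow> U \<in> sets M"
  by (simp add: sets_M sigma_sets.Basic)

lemma mt[measurable]: "g \<in> carrier X \<Longrightarrow> (\<lambda>x. g \<otimes>\<^bsub>X\<^esub> x) \<in> measurable M M"
  using translate_measurable[OF tg_X bM] .

lemma sets_tr[simp]: "sets (tr g) = sets M" and space_tr[simp]: "space (tr g) = space M"
  by (simp_all add: translate_def)

lemma prob_tr: "g \<in> carrier X \<Longrightarrow> prob_space (tr g)"
  unfolding translate_def by (rule M.prob_space_distr[OF mt])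

lemma tr_mult:
  assumes "g \<in> carrier X" "h \<in> carrier X"
  shows "tr (g \<otimes>\<^bsub>X\<^esub> h) = distr (tr h) M (\<lambda>x. g \<otimes>\<^bsub>X\<^esub> x)"
proof -
  have "distr (tr h) M (\<lambda>x. g \<otimes>\<^bsub>X\<^esub> x) = distr M M ((\<lambda>x. g \<otimes>\<^bsub>X\<^esub> x) \<circ> (\<lambda>x. h \<otimes>\<^bsub>X\<^esub> x))"
    unfolding translate_def by (rule distr_distr) (use assms mt in auto)
  also have "\<dots> = tr (g \<otimes>\<^bsub>X\<^esub> h)"
    unfolding translate_def by (rule distr_cong) (use assms in \<open>auto simp: space_M X.m_assoc\<close>)
  finally show ?thesis ..
qed

lemma tr_one: "tr \<one>\<^bsub>X\<^esub> = M"
proof -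
  have "tr \<one>\<^bsub>X\<^esub> = distr M M (\<lambda>x. x)"
    unfolding translate_def by (rule distr_cong) (auto simp: space_M)
  then show ?thesis by (simp add: distr_id2)
qed

lemma mult_limit:
  assumes "limitin (gtop X) x l F" "\<And>n. x n \<in> carrier X" "y \<in> carrier X"
  shows "limitin (gtop X) (\<lambda>n. x n \<otimes>\<^bsub>X\<^esub> y) (l \<otimes>\<^bsub>X\<^esub> y) F"
proof -
  have "continuous_map (gtop X) (prod_topology (gtop X) (gtop X)) (\<lambda>x. (x, y))"
    using assms ts_X by (simp add: continuous_map_pairwise o_def)
  then have "continuous_map (gtop X) (gtop X) ((\<lambda>(x, y). x \<otimes>\<^bsub>X\<^esub> y) \<circ> (\<lambda>x. (x, y)))"
    using tg_X unfolding topological_group_def by (blast intro: continuous_map_compose)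
  from continuous_map_limit[OF this assms(1)] show ?thesis by (simp add: o_def)
qed

text \<open>Fatou's lemma: for each \<open>y\<close> the products of \<open>x n\<close> with
  \<open>y\<close> converge to that of \<open>l\<close> with \<open>y\<close>, and if the limit lies
  in the open set \<open>U\<close>, so do the terms from some index on.\<close>

lemma tr_lsc:
  assumes x: "limitin (gtop X) x l sequentially" "\<And>n. x n \<in> carrier X" and U: "openin (gtop X) U"
    and c: "\<And>n. measure (tr (x n)) U \<le> c"
  shows "measure (tr l) U \<le> c"
proof -
  have l: "l \<in> carrier X" using x(1) ts_X by (simp add: limitin_def)
  have [measurable]: "U \<in> sets M" using U by (rule open_sets)
  have em: "emeasure (tr g) U = (\<integral>\<^sup>+y. indicator U (g \<otimes>\<^bsub>X\<^esub> y) \<partial>M)" if "g \<in> carrier X" for g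
  proof -
    have "emeasure (tr g) U = (\<integral>\<^sup>+y. indicator U y \<partial>tr g)" by simp
    also have "\<dots> = (\<integral>\<^sup>+y. indicator U (g \<otimes>\<^bsub>X\<^esub> y) \<partial>M)"
      unfolding translate_def by (rule nn_integral_distr) (use that in auto)
    finally show ?thesis .
  qed
  have c0: "c \<ge> 0" using c[of 0] measure_nonneg order_trans by blast
  have "(\<integral>\<^sup>+y. indicator U (l \<otimes>\<^bsub>X\<^esub> y) \<partial>M) \<le> (\<integral>\<^sup>+y. liminf (\<lambda>n. indicator U (x n \<otimes>\<^bsub>X\<^esub> y)) \<partial>M)"
  proof (rule nn_integral_mono)
    fix y assume "y \<in> space M"
    then have y: "y \<in> carrier X" by (simp add: space_M)
    show "indicator U (l \<otimes>\<^bsub>X\<^esub> y) \<le> liminf (\<lambda>n. indicator U (x n \<otimes>\<^bsub>X\<^esub> y) :: ennreal)"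
    proof (cases "l \<otimes>\<^bsub>X\<^esub> y \<in> U")
      case True
      then have "eventually (\<lambda>n. x n \<otimes>\<^bsub>X\<^esub> y \<in> U) sequentially"
        using mult_limit[OF x y] U unfolding limitin_def by blast
      then have "eventually (\<lambda>n. (1::ennreal) \<le> indicator U (x n \<otimes>\<^bsub>X\<^esub> y)) sequentially"
        by eventually_elim simp
      then show ?thesis using True by (simp add: Liminf_bounded)
    qed simp
  qed
  also have "\<dots> \<le> liminf (\<lambda>n. \<integral>\<^sup>+y. indicator U (x n \<otimes>\<^bsub>X\<^esub> y) \<partial>M)"
  proof (rule nn_integral_liminf)
    fix n
    show "(\<lambda>y. indicator U (x n \<otimes>\<^bsub>X\<^esub> y)) \<in> borel_measurable M"
      using mt[OF x(2)[of n]] by measurable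
  qed
  also have "\<dots> \<le> liminf (\<lambda>n. ennreal c)"
  proof (rule Liminf_mono, rule always_eventually, rule allI)
    fix n
    interpret T: prob_space "tr (x n)" using prob_tr x(2) .
    show "(\<integral>\<^sup>+y. indicator U (x n \<otimes>\<^bsub>X\<^esub> y) \<partial>M) \<le> ennreal c"
      unfolding em[OF x(2), symmetric] T.emeasure_eq_measure using c by (simp add: ennreal_leI)
  qed
  finally have le: "emeasure (tr l) U \<le> ennreal c" using em[OF l] by (simp add: Liminf_const)
  interpret T: prob_space "tr l" using prob_tr l .
  show ?thesis using le c0 by (simp add: T.emeasure_eq_measure)
qed

text \<open>Total variation as a relation with an explicit bound: triangle inequality and limits
  then need no supremum. \<open>tv_dist\<close> supplies the supremum where an actual metric is
  required.\<close>

definition tv_le :: "'x \<Rightarrow> 'x \<Rightarrow> real \<Rightarrow> bool" where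
  "tv_le g h \<epsilon> \<longleftrightarrow> (\<forall>E\<in>sets M. \<bar>measure (tr g) E - measure (tr h) E\<bar> \<le> \<epsilon>)"

lemma tv_le_sym: "tv_le g h \<epsilon> \<Longrightarrow> tv_le h g \<epsilon>" by (simp add: tv_le_def abs_minus_commute)

lemma tv_le_trans: "tv_le g h a \<Longrightarrow> tv_le h k b \<Longrightarrow> tv_le g k (a + b)"
  unfolding tv_le_def by (smt (verit))

lemma tv_le_mono: "tv_le g h a \<Longrightarrow> a \<le> b \<Longrightarrow> tv_le g h b"
  unfolding tv_le_def by (meson order_trans)

text \<open>Outer regularity of \<open>tr h\<close> extends the bound from open sets to Borel sets,
  and complements give the reverse inequality since both measures are probabilities. One-sided
  bounds on open sets are exactly what \<open>tr_lsc\<close> preserves in the limit, so total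
  variation is lower semicontinuous.\<close>

lemma tv_le_open:
  assumes g: "g \<in> carrier X" "h \<in> carrier X"
    and U: "\<And>U. openin (gtop X) U \<Longrightarrow> measure (tr g) U \<le> measure (tr h) U + \<epsilon>"
  shows "tv_le g h \<epsilon>"
proof -
  interpret g: prob_space "tr g" using prob_tr g(1) .
  interpret h: prob_space "tr h" using prob_tr g(2) .
  have le: "measure (tr g) E \<le> measure (tr h) E + \<epsilon>" if E: "E \<in> sets M" for E
  proof (rule field_le_epsilon)
    fix e :: real assume "e > 0"
    moreover have "space (tr h) = topspace (gtop X)"
      "sets (tr h) = sigma_sets (topspace (gtop X)) {U. openin (gtop X) U}" "E \<in> sets (tr h)"
      using E by (simp_all add: sets_M[symmetric] space_M ts_X)
    ultimately obtain U where V: "openin (gtop X) U" "E \<subseteq> U" "measure (tr h) U \<le> measure (tr h) E + e"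
      using borel_outer_regular[OF metrizable_X h.finite_measure_axioms, of E e] by blast
    have "measure (tr g) E \<le> measure (tr g) U"
      by (rule g.finite_measure_mono) (use V open_sets in auto)
    then show "measure (tr g) E \<le> measure (tr h) E + \<epsilon> + e" using U[OF V(1)] V(3) by simp
  qed
  show ?thesis unfolding tv_le_def
  proof
    fix E assume E: "E \<in> sets M"
    have "measure (tr g) (space M - E) = 1 - measure (tr g) E" "measure (tr h) (space M - E) = 1 - measure (tr h) E"
      using g.prob_compl[of E] h.prob_compl[of E] E by auto
    then show "\<bar>measure (tr g) E - measure (tr h) E\<bar> \<le> \<epsilon>"
      using le[OF E] le[of "space M - E"] E by auto
  qed
qed

lemma tv_le_left:
  assumes "tv_le g h \<epsilon>" "k \<in> carrier X" "g \<in> carrier X" "h \<in> carrier X"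
  shows "tv_le (k \<otimes>\<^bsub>X\<^esub> g) (k \<otimes>\<^bsub>X\<^esub> h) \<epsilon>"
  unfolding tv_le_def
proof
  fix E assume E: "E \<in> sets M"
  have *: "(\<lambda>x. k \<otimes>\<^bsub>X\<^esub> x) -` E \<inter> space M \<in> sets M" using mt[OF assms(2)] E by (rule measurable_sets)
  have "(\<lambda>x. k \<otimes>\<^bsub>X\<^esub> x) \<in> measurable (tr g) M" for g
    using mt[OF assms(2)] by (simp cong: measurable_cong_sets)
  then have "measure (tr (k \<otimes>\<^bsub>X\<^esub> g)) E = measure (tr g) ((\<lambda>x. k \<otimes>\<^bsub>X\<^esub> x) -` E \<inter> space M)" if "g \<in> carrier X" for g
    using assms(2) that E by (simp add: tr_mult measure_distr)
  then show "\<bar>measure (tr (k \<otimes>\<^bsub>X\<^esub> g)) E - measure (tr (k \<otimes>\<^bsub>X\<^esub> h)) E\<bar> \<le> \<epsilon>"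
    using assms * unfolding tv_le_def by simp
qed

lemma tv_le_limit:
  assumes x: "limitin (gtop X) x l sequentially" "\<And>n. x n \<in> carrier X"
    and "\<And>n. tv_le (x n) h \<epsilon>" and h: "h \<in> carrier X"
  shows "tv_le l h \<epsilon>"
proof (rule tv_le_open)
  show "l \<in> carrier X" using x(1) ts_X by (simp add: limitin_def)
  fix U assume U: "openin (gtop X) U"
  show "measure (tr l) U \<le> measure (tr h) U + \<epsilon>"
    proof (rule tr_lsc[OF x U])
    fix n
    have "\<bar>measure (tr (x n)) U - measure (tr h) U\<bar> \<le> \<epsilon>"
      using assms(3)[of n] open_sets[OF U] by (simp add: tv_le_def)
    then show "measure (tr (x n)) U \<le> measure (tr h) U + \<epsilon>" by simp
  qed
qed (rule h)

end

section \<open>Continuity of translation in total variation\<close>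

text \<open>Rational combinations of indicators from \<open>\<A>\<close> suffice. For one indicator
  the coefficient and the set are approximated separately, for sums the errors add up, and limits
  are handled by dominated convergence.\<close>

lemma L1_countable_dense:
  fixes \<A> :: "'a set set"
  assumes "finite_measure M" and ct: "countable \<A>" and As: "\<A> \<subseteq> sets M"
    and approx: "\<And>E \<epsilon>. E \<in> sets M \<Longrightarrow> \<epsilon> > 0 \<Longrightarrow> \<exists>A\<in>\<A>. measure M ((E - A) \<union> (A - E)) < \<epsilon>"
  shows "\<exists>S. countable S \<and> (\<forall>s\<in>S. integrable M s) \<and>
    (\<forall>h :: 'a \<Rightarrow> real. integrable M h \<longrightarrow> (\<forall>\<epsilon>>0. \<exists>s\<in>S. (\<integral>x. \<bar>h x - s x\<bar> \<partial>M) < \<epsilon>))"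
proof -
  interpret finite_measure M by fact
  \<comment> \<open>Lists instead of finite sets of pairs: there are countably many over a countable
    alphabet, and appending lists adds the functions, repetitions included.\<close>
  define \<phi> where "\<phi> l x = (\<Sum>(q, A)\<leftarrow>l. real_of_rat q * indicat_real A x)" for l :: "(rat \<times> 'a set) list" and x
  define S where "S = \<phi> ` lists (UNIV \<times> \<A>)"
  have cS: "countable S" unfolding S_def using ct by (intro countable_image countable_lists) auto
  have nil: "\<phi> [] = (\<lambda>x. 0)" and cons: "\<phi> ((q, A) # l) = (\<lambda>x. real_of_rat q * indicat_real A x + \<phi> l x)"
    and app: "\<phi> (k @ l) = (\<lambda>x. \<phi> k x + \<phi> l x)" for q A l k
    by (auto simp: \<phi>_def fun_eq_iff)
  have "integrable M (\<phi> l)" if "l \<in> lists (UNIV \<times> \<A>)" for l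
    using that
  proof (induction l)
    case (Cons a l)
    then obtain q A where a: "a = (q, A)" "A \<in> sets M" using As by (cases a) auto
    have "integrable M (\<lambda>x. real_of_rat q * indicat_real A x)"
      using a(2) by (intro integrable_mult_right integrable_real_indicator) (auto simp: emeasure_eq_measure)
    then show ?case using Cons a by (simp add: cons)
  qed (simp add: nil)
  then have iS: "integrable M s" if "s \<in> S" for s using that by (auto simp: S_def)
  have "\<forall>\<epsilon>>0. \<exists>s\<in>S. (\<integral>x. \<bar>h x - s x\<bar> \<partial>M) < \<epsilon>" if "integrable M h" for h :: "'a \<Rightarrow> real"
    using that
  proof (induction rule: integrable_induct)
    case (base E c)
    show ?case
    proof (intro allI impI)
      fix \<epsilon> :: real assume e: "\<epsilon> > 0"
      define m where "m = measure M (space M)"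
      have m0: "m \<ge> 0" by (simp add: m_def)
      have "\<epsilon> / (2 * (m + 1)) > 0" using e m0 by simp
      then obtain q where q: "q \<in> \<rat>" "c < q" "q < c + \<epsilon> / (2 * (m + 1))"
        using Rats_dense_in_real[of c "c + \<epsilon> / (2 * (m + 1))"] by auto
      obtain p where "q = of_rat p" using q(1) by (rule Rats_cases)
      with q have p: "\<bar>c - of_rat p\<bar> < \<epsilon> / (2 * (m + 1))" by linarith
      have "\<epsilon> / (2 * (\<bar>c\<bar> + 1)) > 0" using e by simp
      then obtain A where A: "A \<in> \<A>" "measure M ((E - A) \<union> (A - E)) < \<epsilon> / (2 * (\<bar>c\<bar> + 1))"
        using approx[OF base(1)] by blast
      have As': "A \<in> sets M" using A As by blast
      let ?D = "(E - A) \<union> (A - E)"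
      have D: "?D \<in> sets M" using base(1) As' by blast
      have s: "\<phi> [(p, A)] \<in> S" unfolding S_def using A by auto
      have ii: "integrable M (indicat_real B)" if "B \<in> sets M" for B
        using that by (intro integrable_real_indicator) (auto simp: emeasure_eq_measure)
      have "(\<integral>x. \<bar>indicator E x *\<^sub>R c - \<phi> [(p, A)] x\<bar> \<partial>M) \<le> (\<integral>x. \<bar>c\<bar> * indicat_real ?D x + \<bar>c - of_rat p\<bar> \<partial>M)"
      proof (rule integral_mono)
        show "integrable M (\<lambda>x. \<bar>indicator E x *\<^sub>R c - \<phi> [(p, A)] x\<bar>)"
          using ii[OF base(1)] iS[OF s] by (intro integrable_abs Bochner_Integration.integrable_diff) auto
        show "integrable M (\<lambda>x. \<bar>c\<bar> * indicat_real ?D x + \<bar>c - of_rat p\<bar>)"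
          using ii[OF D] by simp
        fix x
        show "\<bar>indicator E x *\<^sub>R c - \<phi> [(p, A)] x\<bar> \<le> \<bar>c\<bar> * indicat_real ?D x + \<bar>c - of_rat p\<bar>"
          using abs_triangle_ineq4[of c "c - of_rat p"] by (auto simp: cons nil indicator_def)
      qed
      also have "\<dots> = \<bar>c\<bar> * measure M ?D + \<bar>c - of_rat p\<bar> * m"
        using ii[OF D] D by (simp add: m_def)
      also have "\<dots> \<le> (\<bar>c\<bar> + 1) * measure M ?D + \<bar>c - of_rat p\<bar> * (m + 1)"
        by (intro add_mono mult_right_mono mult_left_mono) auto
      also have "\<dots> < \<epsilon> / 2 + \<epsilon> / 2"
        using A(2) p m0 by (intro add_strict_mono) (auto simp: field_simps)
      finally show "\<exists>s\<in>S. (\<integral>x. \<bar>indicator E x *\<^sub>R c - s x\<bar> \<partial>M) < \<epsilon>"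
        by (simp only: field_sum_of_halves) (rule bexI[where x = "\<phi> [(p, A)]"], assumption, rule s)
    qed
  next
    case (add f g)
    show ?case
    proof (intro allI impI)
      fix \<epsilon> :: real assume e: "\<epsilon> > 0"
      then obtain s t where st: "s \<in> S" "t \<in> S" "(\<integral>x. \<bar>f x - s x\<bar> \<partial>M) < \<epsilon>/2" "(\<integral>x. \<bar>g x - t x\<bar> \<partial>M) < \<epsilon>/2"
        using add.IH by (meson half_gt_zero)
      from st(1) obtain k where k: "s = \<phi> k" "k \<in> lists (UNIV \<times> \<A>)" unfolding S_def by (rule imageE)
      from st(2) obtain l where l: "t = \<phi> l" "l \<in> lists (UNIV \<times> \<A>)" unfolding S_def by (rule imageE)
      have kl: "s = \<phi> k" "t = \<phi> l" "k @ l \<in> lists (UNIV \<times> \<A>)"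
        using k l by (simp_all only: append_in_lists_conv)
      have stS: "(\<lambda>x. s x + t x) \<in> S"
        unfolding S_def kl(1,2) app[symmetric] using kl(3) by (rule imageI)
      have i: "integrable M (\<lambda>x. \<bar>f x - s x\<bar>)" "integrable M (\<lambda>x. \<bar>g x - t x\<bar>)"
        using add.hyps iS st by auto
      have "(\<integral>x. \<bar>f x + g x - (s x + t x)\<bar> \<partial>M) \<le> (\<integral>x. \<bar>f x - s x\<bar> + \<bar>g x - t x\<bar> \<partial>M)"
        by (rule integral_mono) (use add.hyps iS[OF st(1)] iS[OF st(2)] i in auto)
      also have "\<dots> < \<epsilon>" using i st(3,4) by simp
      finally show "\<exists>s\<in>S. (\<integral>x. \<bar>f x + g x - s x\<bar> \<partial>M) < \<epsilon>"
        by (rule bexI[where x = "\<lambda>x. s x + t x"]) (rule stS)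
    qed
  next
    case (lim f u)
    show ?case
    proof (intro allI impI)
      fix \<epsilon> :: real assume e: "\<epsilon> > 0"
      have "(\<lambda>i. \<integral>x. \<bar>f x - u i x\<bar> \<partial>M) \<longlonglongrightarrow> (\<integral>x. 0 \<partial>M)"
      proof (rule integral_dominated_convergence)
        \<comment> \<open>The approximants satisfy
          \<open>\<bar>u i x\<bar> \<le> 2 * \<bar>f x\<bar>\<close>, whence the factor
          \<open>3\<close> for the difference.\<close>
        show "integrable M (\<lambda>x. 3 * \<bar>f x\<bar>)" using lim.hyps by simp
        show "(\<lambda>x. \<bar>f x - u i x\<bar>) \<in> borel_measurable M" for i
          using lim.hyps by (auto intro!: borel_measurable_integrable)
        show "AE x in M. (\<lambda>i. \<bar>f x - u i x\<bar>) \<longlonglongrightarrow> 0"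
        proof (rule AE_I2)
          fix x assume "x \<in> space M"
          then have "(\<lambda>i. f x - u i x) \<longlonglongrightarrow> f x - f x" by (intro tendsto_diff tendsto_const lim.hyps(2))
          then show "(\<lambda>i. \<bar>f x - u i x\<bar>) \<longlonglongrightarrow> 0" by (simp add: tendsto_rabs_zero)
        qed
        show "AE x in M. norm \<bar>f x - u i x\<bar> \<le> 3 * \<bar>f x\<bar>" for i
        proof (rule AE_I2)
          fix x assume "x \<in> space M"
          from lim.hyps(3)[OF this, of i] show "norm \<bar>f x - u i x\<bar> \<le> 3 * \<bar>f x\<bar>" by simp
        qed
      qed simp
      then have "(\<lambda>i. \<integral>x. \<bar>f x - u i x\<bar> \<partial>M) \<longlonglongrightarrow> 0" by simp
      from metric_LIMSEQ_D[OF this half_gt_zero[OF e]]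
      obtain i where i: "(\<integral>x. \<bar>f x - u i x\<bar> \<partial>M) < \<epsilon>/2" by (auto simp: dist_real_def)
      from lim.IH[rule_format, OF half_gt_zero[OF e], of i]
      obtain s where s: "s \<in> S" "(\<integral>x. \<bar>u i x - s x\<bar> \<partial>M) < \<epsilon>/2" by metis
      have "(\<integral>x. \<bar>f x - s x\<bar> \<partial>M) \<le> (\<integral>x. \<bar>f x - u i x\<bar> + \<bar>u i x - s x\<bar> \<partial>M)"
        by (rule integral_mono) (use lim.hyps iS[OF s(1)] in auto)
      also have "\<dots> = (\<integral>x. \<bar>f x - u i x\<bar> \<partial>M) + (\<integral>x. \<bar>u i x - s x\<bar> \<partial>M)"
        by (rule Bochner_Integration.integral_add) (use lim.hyps iS[OF s(1)] in auto)
      also have "\<dots> < \<epsilon>" using i s(2) by simp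
      finally show "\<exists>s\<in>S. (\<integral>x. \<bar>f x - s x\<bar> \<partial>M) < \<epsilon>" using s(1) by blast
    qed
  qed
  then show ?thesis using cS iS by blast
qed

context qi_witness
begin

text \<open>Finite unions of members of a countable base work: they exhaust an open set that
  contains \<open>E\<close> with little excess measure. With \<open>L1_countable_dense\<close> this
  makes the space of integrable functions separable.\<close>

lemma countable_approx:
  "\<exists>\<A>. countable \<A> \<and> \<A> \<subseteq> sets M \<and>
    (\<forall>E\<in>sets M. \<forall>\<epsilon>>0. \<exists>A\<in>\<A>. measure M ((E - A) \<union> (A - E)) < \<epsilon>)"
proof -
  obtain B where B: "countable B" "\<And>V. V \<in> B \<Longrightarrow> openin (gtop X) V"
    "\<And>U x. openin (gtop X) U \<Longrightarrow> x \<in> U \<Longrightarrow> \<exists>V\<in>B. x \<in> V \<and> V \<subseteq> U"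
    using metrizable_separable_countable_base[OF metrizable_X] polish_X
    unfolding polish_group_def by metis
  define \<A> where "\<A> = Union ` {F. finite F \<and> F \<subseteq> B}"
  have c: "countable \<A>" unfolding \<A>_def using B(1) by (intro countable_image countable_Collect_finite_subset)
  have BM: "V \<in> sets M" if "V \<in> B" for V using open_sets[OF B(2)[OF that]] .
  have s: "\<A> \<subseteq> sets M" unfolding \<A>_def using BM by (auto intro!: sets.finite_Union)
  have "\<exists>A\<in>\<A>. measure M ((E - A) \<union> (A - E)) < \<epsilon>" if E: "E \<in> sets M" and e: "\<epsilon> > 0" for E and \<epsilon> :: real
  proof -
    obtain U where U: "openin (gtop X) U" "E \<subseteq> U" "measure M U \<le> measure M E + \<epsilon>/3"
      using borel_outer_regular[OF metrizable_X M.finite_measure_axioms, of E "\<epsilon>/3"] E sets_M space_M ts_X e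
      by auto
    have Um: "U \<in> sets M" using U(1) by (rule open_sets)
    \<comment> \<open>The empty set is added so that the family is nonempty and
      \<open>from_nat_into\<close> enumerates it.\<close>
    define BU where "BU = insert {} {V\<in>B. V \<subseteq> U}"
    have BU: "countable BU" "BU \<noteq> {}" "\<Union>BU = U" unfolding BU_def using B(1) B(3)[OF U(1)] by auto
    define b where "b = from_nat_into BU"
    have b: "range b = BU" unfolding b_def using BU by (simp add: range_from_nat_into)
    have bB: "b i \<in> insert {} B" "b i \<in> sets M" for i
    proof -
      have "b i \<in> BU" using b by blast
      then show "b i \<in> insert {} B" "b i \<in> sets M" using BM by (auto simp: BU_def)
    qed
    define D where "D n = (\<Union>i\<le>n. b i)" for n
    have Dm: "D n \<in> sets M" for n unfolding D_def using bB by blast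
    have "incseq D" unfolding D_def by (rule incseq_SucI) (rule UN_mono, auto)
    moreover have "(\<Union>n. D n) = U" using b BU(3) unfolding D_def by blast
    ultimately have "(\<lambda>n. measure M (D n)) \<longlonglongrightarrow> measure M U"
      using M.finite_Lim_measure_incseq[of D] Dm by auto
    moreover have "\<epsilon>/3 > 0" using e by simp
    ultimately obtain n where n: "dist (measure M (D n)) (measure M U) < \<epsilon>/3"
      using metric_LIMSEQ_D by blast
    have DU: "D n \<subseteq> U" unfolding D_def using b BU(3) by blast
    have "D n = \<Union>((b ` {..n}) \<inter> B)" unfolding D_def using bB(1) by blast
    then have DA: "D n \<in> \<A>" unfolding \<A>_def by (intro image_eqI[where x="(b ` {..n}) \<inter> B"]) auto
    have "measure M ((E - D n) \<union> (D n - E)) \<le> measure M ((U - D n) \<union> (U - E))"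
      by (rule M.finite_measure_mono) (use DU U(2) Um Dm E in auto)
    also have "\<dots> \<le> measure M (U - D n) + measure M (U - E)"
      by (rule measure_Un_le) (use Um Dm E in auto)
    also have "\<dots> = (measure M U - measure M (D n)) + (measure M U - measure M E)"
      using M.finite_measure_Diff[OF Um Dm DU] M.finite_measure_Diff[OF Um E U(2)] by simp
    also have "\<dots> < \<epsilon>" using n U(3) e unfolding dist_real_def by linarith
    finally show ?thesis using DA by blast
  qed
  then show ?thesis using c s by blast
qed

section \<open>Densities of the translates by elements of the group\<close>

definition rho :: "'x \<Rightarrow> 'x \<Rightarrow> real" where "rho g x = enn2real (RN_deriv M (tr g) x)"

lemma rho_measurable[measurable]: "rho g \<in> borel_measurable M"
  unfolding rho_def by measurable

lemma rho_nonneg[simp]: "rho g x \<ge> 0" by (simp add: rho_def)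

lemma ac: "g \<in> carrier G \<Longrightarrow> absolutely_continuous M (tr (f g))"
  using QI_eq unfolding quasi_invariance_def equivalent_measures_def by blast

lemma rho_density:
  assumes "g \<in> carrier G"
  shows "density M (\<lambda>x. ennreal (rho (f g) x)) = tr (f g)"
proof -
  interpret T: prob_space "tr (f g)" using prob_tr f_carrier assms by blast
  have a: "absolutely_continuous M (tr (f g))" "sets (tr (f g)) = sets M" using ac[OF assms] by auto
  \<comment> \<open>\<open>enn2real\<close> sends \<infinity> to \<open>0\<close>, so
    \<open>rho\<close> is a version of the density only because the derivative is finite almost
    everywhere.\<close>
  have "AE x in M. RN_deriv M (tr (f g)) x \<noteq> \<infinity>"
    by (rule M.RN_deriv_finite[OF _ a]) (rule T.sigma_finite_measure_axioms)
  then have "AE x in M. ennreal (rho (f g) x) = RN_deriv M (tr (f g)) x"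
    by eventually_elim (simp add: rho_def ennreal_enn2real_if)
  then have "density M (\<lambda>x. ennreal (rho (f g) x)) = density M (RN_deriv M (tr (f g)))"
    by (intro density_cong) auto
  then show ?thesis using M.density_RN_deriv[OF a] by simp
qed

lemma rho_integrable: "g \<in> carrier G \<Longrightarrow> integrable M (rho (f g))"
  and rho_integral: "g \<in> carrier G \<Longrightarrow> E \<in> sets M \<Longrightarrow>
    measure (tr (f g)) E = (\<integral>x. rho (f g) x * indicator E x \<partial>M)"
proof -
  assume g: "g \<in> carrier G"
  interpret T: prob_space "tr (f g)" using prob_tr f_carrier g by blast
  have em: "emeasure (tr (f g)) E = (\<integral>\<^sup>+x. ennreal (rho (f g) x * indicator E x) \<partial>M)" if "E \<in> sets M" for E
  proof -
    have "emeasure (tr (f g)) E = emeasure (density M (\<lambda>x. ennreal (rho (f g) x))) E"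
      by (simp add: rho_density[OF g])
    also have "\<dots> = (\<integral>\<^sup>+x. ennreal (rho (f g) x) * indicator E x \<partial>M)"
      by (rule emeasure_density) (use that in auto)
    also have "\<dots> = (\<integral>\<^sup>+x. ennreal (rho (f g) x * indicator E x) \<partial>M)"
      by (rule nn_integral_cong) (auto simp: indicator_def)
    finally show ?thesis .
  qed
  have "(\<integral>\<^sup>+x. ennreal (rho (f g) x) \<partial>M) = (\<integral>\<^sup>+x. ennreal (rho (f g) x * indicator (space M) x) \<partial>M)"
    by (rule nn_integral_cong) auto
  also have "\<dots> = 1" using em[of "space M"] T.emeasure_space_1 by simp
  finally show i: "integrable M (rho (f g))"
    by (intro integrableI_nonneg) auto
  fix E assume E: "E \<in> sets M"
  have "integrable M (\<lambda>x. rho (f g) x * indicator E x)"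
    using integrable_mult_indicator[OF E i] by (simp add: mult.commute)
  then have "(\<integral>\<^sup>+x. ennreal (rho (f g) x * indicator E x) \<partial>M) = ennreal (\<integral>x. rho (f g) x * indicator E x \<partial>M)"
    by (intro nn_integral_eq_integral) auto
  then have "ennreal (measure (tr (f g)) E) = ennreal (\<integral>x. rho (f g) x * indicator E x \<partial>M)"
    using em[OF E] by (simp add: T.emeasure_eq_measure)
  moreover have "(\<integral>x. rho (f g) x * indicator E x \<partial>M) \<ge> 0" by (rule Bochner_Integration.integral_nonneg) auto
  ultimately show "measure (tr (f g)) E = (\<integral>x. rho (f g) x * indicator E x \<partial>M)" by simp
qed

lemma tv_le_L1:
  assumes g: "g \<in> carrier G" "h \<in> carrier G"
  shows "tv_le (f g) (f h) (\<integral>x. \<bar>rho (f g) x - rho (f h) x\<bar> \<partial>M)"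
  unfolding tv_le_def
proof
  fix E assume E: "E \<in> sets M"
  have i: "integrable M (\<lambda>x. rho (f g) x * indicator E x)" if "g \<in> carrier G" for g
    using integrable_mult_indicator[OF E rho_integrable[OF that]] by (simp add: mult.commute)
  have "\<bar>measure (tr (f g)) E - measure (tr (f h)) E\<bar>
      = \<bar>\<integral>x. rho (f g) x * indicator E x - rho (f h) x * indicator E x \<partial>M\<bar>"
    using i g by (simp add: rho_integral E)
  also have "\<dots> \<le> (\<integral>x. \<bar>rho (f g) x * indicator E x - rho (f h) x * indicator E x\<bar> \<partial>M)"
    by (rule integral_abs_bound)
  also have "\<dots> \<le> (\<integral>x. \<bar>rho (f g) x - rho (f h) x\<bar> \<partial>M)"
    by (rule integral_mono)
      (use i g rho_integrable in \<open>auto simp: indicator_def\<close>)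
  finally show "\<bar>measure (tr (f g)) E - measure (tr (f h)) E\<bar> \<le> (\<integral>x. \<bar>rho (f g) x - rho (f h) x\<bar> \<partial>M)" .
qed

lemma limit_f:
  assumes "limitin (gtop G) x l sequentially" shows "limitin (gtop X) (\<lambda>n. f (x n)) (f l) sequentially"
  using continuous_map_limit[OF f_cont assms] by (simp add: o_def)

text \<open>The total variation distance is lower semicontinuous and \<open>L\<^sup>1\<close> is separable, so by Baire
  category \<open>g \<mapsto> tr (f g)\<close> is continuous for it, although only continuity of \<open>f\<close> was assumed.\<close>

lemma tv_continuous:
  assumes e: "\<epsilon> > 0"
  shows "\<exists>W. openin (gtop G) W \<and> \<one>\<^bsub>G\<^esub> \<in> W \<and> (\<forall>g\<in>W. tv_le (f g) \<one>\<^bsub>X\<^esub> \<epsilon>)"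
proof -
  define e' where "e' = \<epsilon> / 4"
  have e': "e' > 0" "e'/2 > 0" using e by (auto simp: e'_def)
  obtain \<A> where \<A>: "countable \<A>" "\<A> \<subseteq> sets M"
    "\<And>E \<epsilon>. E \<in> sets M \<Longrightarrow> \<epsilon> > 0 \<Longrightarrow> \<exists>A\<in>\<A>. measure M ((E - A) \<union> (A - E)) < \<epsilon>"
    using countable_approx by metis
  obtain S where S: "countable S" "\<And>s. s \<in> S \<Longrightarrow> integrable M s"
    "\<And>h \<epsilon>. integrable M h \<Longrightarrow> \<epsilon> > 0 \<Longrightarrow> \<exists>s\<in>S. (\<integral>x. \<bar>h x - s x\<bar> \<partial>M) < (\<epsilon> :: real)"
    using L1_countable_dense[OF M.finite_measure_axioms \<A>] by metis
  define near where "near s g \<longleftrightarrow> g \<in> carrier G \<and> (\<integral>x. \<bar>rho (f g) x - s x\<bar> \<partial>M) < e'/2" for s g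
  \<comment> \<open>One representative per function of the countable dense set \<open>S\<close>,
    where one exists. The countably many sets \<open>F (c s)\<close> cover \<open>G\<close>, since
    two densities near the same \<open>s\<close> are close to each other.\<close>
  define c where "c s = (SOME g. near s g)" for s
  \<comment> \<open>Stated as a one-sided bound on open sets so that \<open>tr_lsc\<close> makes the
    set closed; by \<open>tv_le_open\<close> it is still a ball for total variation.\<close>
  define F where "F k = {g \<in> carrier G. \<forall>U. openin (gtop X) U \<longrightarrow> measure (tr (f g)) U \<le> measure (tr (f k)) U + e'}" for k
  define \<G> where "\<G> = F ` c ` {s\<in>S. \<exists>g. near s g}"
  obtain Q d where m: "Metric_space Q d" and T: "gtop G = Metric_space.mtopology Q d"
    using polish_G completely_metrizable_imp_metrizable_space unfolding polish_group_def metrizable_space_def by blast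
  interpret Metric_space Q d by fact
  have Q: "Q = carrier G" using ts_G T by simp
  have closed: "closedin (gtop G) (F k)" for k
    unfolding T metric_closedin_iff_sequentially_closed
  proof (intro conjI allI impI)
    show "F k \<subseteq> Q" unfolding F_def Q by blast
    fix \<sigma> l assume *: "range \<sigma> \<subseteq> F k \<and> limitin mtopology \<sigma> l sequentially"
    then have "l \<in> topspace (gtop G)" unfolding T limitin_def by blast
    then have l: "l \<in> carrier G" by (simp add: ts_G)
    have sc: "\<sigma> n \<in> carrier G" for n using * unfolding F_def by blast
    have lim: "limitin (gtop X) (\<lambda>n. f (\<sigma> n)) (f l) sequentially" using limit_f * T by simp
    have "measure (tr (f l)) U \<le> measure (tr (f k)) U + e'" if U: "openin (gtop X) U" for U
    proof (rule tr_lsc[OF lim _ U])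
      fix n
      have "\<sigma> n \<in> F k" using * by blast
      then show "f (\<sigma> n) \<in> carrier X" "measure (tr (f (\<sigma> n))) U \<le> measure (tr (f k)) U + e'"
        using sc f_carrier U by (auto simp: F_def)
    qed
    then show "l \<in> F k" using l by (simp add: F_def)
  qed
  have cov: "\<Union>\<G> = carrier G"
  proof
    show "\<Union>\<G> \<subseteq> carrier G" unfolding \<G>_def F_def by blast
    show "carrier G \<subseteq> \<Union>\<G>"
    proof
      fix g assume g: "g \<in> carrier G"
      obtain s where s: "s \<in> S" "near s g" using S(3)[OF rho_integrable[OF g] e'(2)] g by (auto simp: near_def)
      then have n: "near s (c s)" unfolding c_def by (metis someI)
      then have cs: "c s \<in> carrier G" by (simp add: near_def)
      have i: "integrable M (\<lambda>x. \<bar>rho (f k) x - s x\<bar>)" if "k \<in> carrier G" for k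
        using rho_integrable[OF that] S(2)[OF s(1)] by auto
      have "(\<integral>x. \<bar>rho (f g) x - rho (f (c s)) x\<bar> \<partial>M) \<le> (\<integral>x. \<bar>rho (f g) x - s x\<bar> + \<bar>rho (f (c s)) x - s x\<bar> \<partial>M)"
        by (rule integral_mono) (use i g cs rho_integrable in auto)
      also have "\<dots> \<le> e'" using i g cs n s(2) by (simp add: near_def)
      finally have "tv_le (f g) (f (c s)) e'" using tv_le_L1[OF g cs] tv_le_mono by blast
      then have "measure (tr (f g)) U \<le> measure (tr (f (c s))) U + e'" if "openin (gtop X) U" for U
        unfolding tv_le_def using open_sets[OF that] by (smt (verit))
      then have "g \<in> F (c s)" using g by (simp add: F_def)
      then show "g \<in> \<Union>\<G>" unfolding \<G>_def using s by blast
    qed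
  qed
  have "\<exists>k\<in>c ` {s\<in>S. \<exists>g. near s g}. gtop G interior_of F k \<noteq> {}"
  proof (rule ccontr)
    assume "\<not> ?thesis"
    then have "gtop G interior_of \<Union>\<G> = {}"
      using S(1) closed polish_G by (intro Baire_category_alt) (auto simp: \<G>_def polish_group_def)
    moreover have "gtop G interior_of \<Union>\<G> = carrier G" using cov ts_G interior_of_topspace by metis
    ultimately show False using G.one_closed by simp
  qed
  then obtain s w where s: "\<exists>g. near s g" "w \<in> gtop G interior_of F (c s)" by blast
  define k where "k = c s"
  have "near s (c s)" unfolding c_def by (rule someI_ex[OF s(1)])
  then have k: "k \<in> carrier G" "w \<in> gtop G interior_of F k" using s(2) by (auto simp: near_def k_def)
  define W0 where "W0 = gtop G interior_of F k"
  have W0: "openin (gtop G) W0" "W0 \<subseteq> F k" by (auto simp: W0_def interior_of_subset)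
  have w: "w \<in> W0" "w \<in> carrier G" using k W0 unfolding W0_def F_def by blast+
  \<comment> \<open>The interior point \<open>w\<close> is moved to the identity. Left translation
    preserves total variation, so all of \<open>W\<close> stays within \<open>e' + e'\<close> of the
    identity.\<close>
  define W where "W = {h \<in> topspace (gtop G). w \<otimes>\<^bsub>G\<^esub> h \<in> W0}"
  have "openin (gtop G) W" unfolding W_def
    by (rule openin_continuous_map_preimage[OF translate_continuous[OF tg_G w(2)] W0(1)])
  moreover have "\<one>\<^bsub>G\<^esub> \<in> W" using w by (simp add: W_def ts_G)
  moreover have "tv_le (f h) \<one>\<^bsub>X\<^esub> \<epsilon>" if "h \<in> W" for h
  proof -
    have h: "h \<in> carrier G" "w \<otimes>\<^bsub>G\<^esub> h \<in> F k" "w \<in> F k" using that W0 w by (auto simp: W_def ts_G)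
    have t: "tv_le (f g) (f k) e'" if "g \<in> F k" for g
      using that k f_carrier by (intro tv_le_open) (auto simp: F_def)
    have "tv_le (f (w \<otimes>\<^bsub>G\<^esub> h)) (f w) (e' + e')" by (rule tv_le_trans[OF t tv_le_sym[OF t]]) (use h in auto)
    then have "tv_le (inv\<^bsub>X\<^esub> (f w) \<otimes>\<^bsub>X\<^esub> f (w \<otimes>\<^bsub>G\<^esub> h)) (inv\<^bsub>X\<^esub> (f w) \<otimes>\<^bsub>X\<^esub> f w) (e' + e')"
      by (rule tv_le_left) (use w h f_carrier in auto)
    then have "tv_le (f h) \<one>\<^bsub>X\<^esub> (e' + e')"
      using w h f_carrier by (simp add: f_mult X.m_assoc[symmetric])
    then show ?thesis using e by (elim tv_le_mono) (simp add: e'_def)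
  qed
  ultimately show ?thesis by blast
qed

end

section \<open>The square-root densities and the Koopman operators\<close>

context qi_witness
begin

text \<open>The quasi-regular representation of \<open>G\<close> on real square-integrable
  functions: the factor \<open>sqrt (rho (f g) x)\<close> compensates the change of measure and
  makes each operator isometric. The constant \<open>1\<close> is sent to the square root of the
  density.\<close>

definition koopman :: "'g \<Rightarrow> ('x \<Rightarrow> real) \<Rightarrow> 'x \<Rightarrow> real" where
  "koopman g v x = v (inv\<^bsub>X\<^esub> (f g) \<otimes>\<^bsub>X\<^esub> x) * sqrt (rho (f g) x)"

text \<open>Squared norm with values in \<open>ennreal\<close>, so that the identities below need
  measurability only and no integrability.\<close>

definition sq_norm :: "('x \<Rightarrow> real) \<Rightarrow> ennreal" where "sq_norm v = (\<integral>\<^sup>+x. ennreal ((v x)\<^sup>2) \<partial>M)"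

lemma koopman_measurable[measurable]:
  assumes g: "g \<in> carrier G" and v[measurable]: "v \<in> borel_measurable M"
  shows "koopman g v \<in> borel_measurable M"
proof -
  have [measurable]: "(\<lambda>x. inv\<^bsub>X\<^esub> (f g) \<otimes>\<^bsub>X\<^esub> x) \<in> measurable M M" by (rule mt) (use g f_carrier in auto)
  show ?thesis unfolding koopman_def by measurable
qed

lemma inv_cancel: "g \<in> carrier G \<Longrightarrow> x \<in> carrier X \<Longrightarrow> inv\<^bsub>X\<^esub> (f g) \<otimes>\<^bsub>X\<^esub> (f g \<otimes>\<^bsub>X\<^esub> x) = x"
  by (simp add: f_carrier X.m_assoc[symmetric])

lemma sq_norm_koopman:
  assumes g: "g \<in> carrier G" and v[measurable]: "v \<in> borel_measurable M"
  shows "sq_norm (koopman g v) = sq_norm v"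
proof -
  have [measurable]: "(\<lambda>x. inv\<^bsub>X\<^esub> (f g) \<otimes>\<^bsub>X\<^esub> x) \<in> measurable M M" by (rule mt) (use g f_carrier in auto)
  have [measurable]: "(\<lambda>x. f g \<otimes>\<^bsub>X\<^esub> x) \<in> measurable M M" by (rule mt) (use g f_carrier in auto)
  have "sq_norm (koopman g v) = (\<integral>\<^sup>+x. ennreal (rho (f g) x) * ennreal ((v (inv\<^bsub>X\<^esub> (f g) \<otimes>\<^bsub>X\<^esub> x))\<^sup>2) \<partial>M)"
    unfolding sq_norm_def koopman_def
    by (rule nn_integral_cong) (simp add: power_mult_distrib ennreal_mult mult.commute)
  also have "\<dots> = (\<integral>\<^sup>+x. ennreal ((v (inv\<^bsub>X\<^esub> (f g) \<otimes>\<^bsub>X\<^esub> x))\<^sup>2) \<partial>density M (\<lambda>x. ennreal (rho (f g) x)))"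
    by (rule nn_integral_density[symmetric]) measurable
  also have "\<dots> = (\<integral>\<^sup>+x. ennreal ((v (inv\<^bsub>X\<^esub> (f g) \<otimes>\<^bsub>X\<^esub> x))\<^sup>2) \<partial>distr M M (\<lambda>x. f g \<otimes>\<^bsub>X\<^esub> x))"
    by (simp add: rho_density[OF g] translate_def)
  also have "\<dots> = (\<integral>\<^sup>+x. ennreal ((v (inv\<^bsub>X\<^esub> (f g) \<otimes>\<^bsub>X\<^esub> (f g \<otimes>\<^bsub>X\<^esub> x)))\<^sup>2) \<partial>M)"
    by (rule nn_integral_distr) measurable
  also have "\<dots> = sq_norm v"
    unfolding sq_norm_def by (rule nn_integral_cong) (simp add: inv_cancel[OF g] space_M)
  finally show ?thesis .
qed

text \<open>The cocycle identity: both sides are densities of the translate by the product, computed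
  once directly and once as the image of \<open>tr (f h)\<close> under translation by
  \<open>f g\<close>. Densities are unique only up to null sets, so the operators compose only
  almost everywhere.\<close>

lemma rho_mult:
  assumes g: "g \<in> carrier G" "h \<in> carrier G"
  shows "AE x in M. rho (f (g \<otimes>\<^bsub>G\<^esub> h)) x = rho (f g) x * rho (f h) (inv\<^bsub>X\<^esub> (f g) \<otimes>\<^bsub>X\<^esub> x)"
proof -
  have [measurable]: "(\<lambda>x. inv\<^bsub>X\<^esub> (f g) \<otimes>\<^bsub>X\<^esub> x) \<in> measurable M M" by (rule mt) (use g f_carrier in auto)
  have [measurable]: "(\<lambda>x. f g \<otimes>\<^bsub>X\<^esub> x) \<in> measurable M M" by (rule mt) (use g f_carrier in auto)
  let ?r = "\<lambda>x. ennreal (rho (f h) (inv\<^bsub>X\<^esub> (f g) \<otimes>\<^bsub>X\<^esub> x))"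
  have "density M (\<lambda>x. ennreal (rho (f g) x) * ?r x) = density (density M (\<lambda>x. ennreal (rho (f g) x))) ?r"
    by (rule density_density_eq[symmetric]) measurable
  also have "\<dots> = density (distr M M (\<lambda>x. f g \<otimes>\<^bsub>X\<^esub> x)) ?r" by (simp add: rho_density[OF g(1)] translate_def)
  also have "\<dots> = distr (density M (\<lambda>x. ?r (f g \<otimes>\<^bsub>X\<^esub> x))) M (\<lambda>x. f g \<otimes>\<^bsub>X\<^esub> x)"
    by (rule density_distr) measurable
  also have "density M (\<lambda>x. ?r (f g \<otimes>\<^bsub>X\<^esub> x)) = density M (\<lambda>x. ennreal (rho (f h) x))"
    by (rule density_cong) (auto simp: inv_cancel[OF g(1)] space_M)
  also have "\<dots> = tr (f h)" by (rule rho_density[OF g(2)])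
  also have "distr (tr (f h)) M (\<lambda>x. f g \<otimes>\<^bsub>X\<^esub> x) = tr (f (g \<otimes>\<^bsub>G\<^esub> h))"
    using g f_carrier by (simp add: f_mult tr_mult)
  also have "\<dots> = density M (\<lambda>x. ennreal (rho (f (g \<otimes>\<^bsub>G\<^esub> h)) x))"
    by (rule rho_density[symmetric]) (use g in auto)
  finally have "AE x in M. ennreal (rho (f g) x) * ?r x = ennreal (rho (f (g \<otimes>\<^bsub>G\<^esub> h)) x)"
    by (subst (asm) M.density_unique_iff) measurable
  then show ?thesis by eventually_elim (simp add: ennreal_mult[symmetric])
qed

lemma rho_one: "AE x in M. rho (f \<one>\<^bsub>G\<^esub>) x = 1"
proof -
  have "density M (\<lambda>x. ennreal (rho (f \<one>\<^bsub>G\<^esub>) x)) = density M (\<lambda>x. 1)"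
    using rho_density[OF G.one_closed] by (simp add: f_one tr_one density_1)
  then have "AE x in M. ennreal (rho (f \<one>\<^bsub>G\<^esub>) x) = 1"
    by (subst (asm) M.density_unique_iff) auto
  then show ?thesis by eventually_elim simp
qed

lemma koopman_mult:
  assumes g: "g \<in> carrier G" "h \<in> carrier G"
  shows "AE x in M. koopman g (koopman h v) x = koopman (g \<otimes>\<^bsub>G\<^esub> h) v x"
  using rho_mult[OF g] AE_space
proof eventually_elim
  case (elim x)
  then have x: "x \<in> carrier X" by (simp add: space_M)
  have "inv\<^bsub>X\<^esub> (f h) \<otimes>\<^bsub>X\<^esub> (inv\<^bsub>X\<^esub> (f g) \<otimes>\<^bsub>X\<^esub> x) = inv\<^bsub>X\<^esub> (f (g \<otimes>\<^bsub>G\<^esub> h)) \<otimes>\<^bsub>X\<^esub> x"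
    using g x f_carrier by (simp add: f_mult X.inv_mult_group X.m_assoc)
  then show ?case unfolding koopman_def elim(1) by (simp add: real_sqrt_mult ac_simps)
qed

lemma koopman_one: "AE x in M. koopman \<one>\<^bsub>G\<^esub> v x = v x"
  using rho_one AE_space by eventually_elim (simp add: koopman_def f_one space_M)

lemma sq_norm_cong_AE: "AE x in M. u x = v x \<Longrightarrow> sq_norm u = sq_norm v"
  unfolding sq_norm_def by (rule nn_integral_cong_AE) auto

lemma sq_norm_parallelogram:
  assumes [measurable]: "u \<in> borel_measurable M" "v \<in> borel_measurable M"
  shows "sq_norm (\<lambda>x. u x + v x) + sq_norm (\<lambda>x. u x - v x) = 2 * sq_norm u + 2 * sq_norm v"
proof -
  have "sq_norm (\<lambda>x. u x + v x) + sq_norm (\<lambda>x. u x - v x) = (\<integral>\<^sup>+x. ennreal ((u x + v x)\<^sup>2) + ennreal ((u x - v x)\<^sup>2) \<partial>M)"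
    unfolding sq_norm_def by (rule nn_integral_add[symmetric]) measurable
  also have "\<dots> = (\<integral>\<^sup>+x. 2 * ennreal ((u x)\<^sup>2) + 2 * ennreal ((v x)\<^sup>2) \<partial>M)"
  proof (rule nn_integral_cong)
    fix x
    have "ennreal ((u x + v x)\<^sup>2) + ennreal ((u x - v x)\<^sup>2) = ennreal (2 * (u x)\<^sup>2 + 2 * (v x)\<^sup>2)"
    proof -
      have "ennreal ((u x + v x)\<^sup>2) + ennreal ((u x - v x)\<^sup>2) = ennreal ((u x + v x)\<^sup>2 + (u x - v x)\<^sup>2)"
        by (rule ennreal_plus[symmetric]) auto
      also have "(u x + v x)\<^sup>2 + (u x - v x)\<^sup>2 = 2 * (u x)\<^sup>2 + 2 * (v x)\<^sup>2"
        by (simp add: power2_eq_square algebra_simps)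
      finally show ?thesis .
    qed
    then show "ennreal ((u x + v x)\<^sup>2) + ennreal ((u x - v x)\<^sup>2) = 2 * ennreal ((u x)\<^sup>2) + 2 * ennreal ((v x)\<^sup>2)"
      by (simp add: ennreal_plus ennreal_mult)
  qed
  also have "\<dots> = 2 * sq_norm u + 2 * sq_norm v"
    unfolding sq_norm_def by (simp add: nn_integral_add nn_integral_cmult)
  finally show ?thesis .
qed

lemma sq_norm_add_le:
  assumes [measurable]: "u \<in> borel_measurable M" "v \<in> borel_measurable M"
  shows "sq_norm (\<lambda>x. u x + v x) \<le> 2 * sq_norm u + 2 * sq_norm v"
  using sq_norm_parallelogram[OF assms] by (metis le_iff_add)

lemma sq_norm_scale:
  assumes [measurable]: "u \<in> borel_measurable M"
  shows "sq_norm (\<lambda>x. c * u x) = ennreal (c\<^sup>2) * sq_norm u"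
  unfolding sq_norm_def power_mult_distrib by (simp add: ennreal_mult nn_integral_cmult)

text \<open>Total variation controls Hellinger distance, by
  \<open>(1 - s)\<^sup>2 \<le> \<bar>s\<^sup>2 - 1\<bar>\<close> for \<open>s \<ge> 0\<close>. The
  factor \<open>2\<close> arises because the integral of \<open>\<bar>rho (f g) x - 1\<bar>\<close>
  splits over the set where the density is at least \<open>1\<close> and its complement.\<close>

lemma tv_imp_sq_norm:
  assumes g: "g \<in> carrier G" and t: "tv_le (f g) \<one>\<^bsub>X\<^esub> \<epsilon>"
  shows "sq_norm (\<lambda>x. 1 - sqrt (rho (f g) x)) \<le> ennreal (2 * \<epsilon>)"
proof -
  let ?r = "rho (f g)"
  have i: "integrable M ?r" by (rule rho_integrable[OF g])
  define E where "E = {x \<in> space M. ?r x \<ge> 1}"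
  have E: "E \<in> sets M" "space M - E \<in> sets M" unfolding E_def by measurable
  have d: "\<bar>measure (tr (f g)) A - measure M A\<bar> \<le> \<epsilon>" if "A \<in> sets M" for A
    using t that by (simp add: tv_le_def tr_one)
  have ii: "integrable M (\<lambda>x. ?r x * indicator A x)" "integrable M (indicat_real A)" if "A \<in> sets M" for A
    using integrable_mult_indicator[OF that i] that
    by (auto simp: mult.commute M.emeasure_eq_measure)
  have di: "measure (tr (f g)) A - measure M A = (\<integral>x. ?r x * indicator A x - indicator A x \<partial>M)" if "A \<in> sets M" for A
    using that ii[OF that] by (simp add: rho_integral[OF g])
  have "(\<integral>x. \<bar>?r x - 1\<bar> \<partial>M) = (\<integral>x. (?r x * indicator E x - indicator E x)
      - (?r x * indicator (space M - E) x - indicator (space M - E) x) \<partial>M)"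
    by (rule Bochner_Integration.integral_cong) (auto simp: E_def indicator_def)
  also have "\<dots> = (measure (tr (f g)) E - measure M E) - (measure (tr (f g)) (space M - E) - measure M (space M - E))"
    using ii[OF E(1)] ii[OF E(2)] by (simp add: di[OF E(1)] di[OF E(2)])
  also have "\<dots> \<le> 2 * \<epsilon>" using d[OF E(1)] d[OF E(2)] by linarith
  finally have le: "(\<integral>x. \<bar>?r x - 1\<bar> \<partial>M) \<le> 2 * \<epsilon>" .
  have "sq_norm (\<lambda>x. 1 - sqrt (?r x)) \<le> (\<integral>\<^sup>+x. ennreal \<bar>?r x - 1\<bar> \<partial>M)"
    unfolding sq_norm_def
  proof (intro nn_integral_mono ennreal_leI)
    fix x
    define s where "s = sqrt (?r x)"
    have s: "s \<ge> 0" "?r x = s\<^sup>2" by (auto simp: s_def)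
    have "\<bar>1 - s\<bar> * \<bar>1 - s\<bar> \<le> \<bar>1 - s\<bar> * \<bar>1 + s\<bar>" by (rule mult_left_mono) (use s in auto)
    also have "\<dots> = \<bar>s\<^sup>2 - 1\<bar>" by (simp add: abs_mult[symmetric] power2_eq_square algebra_simps abs_minus_commute)
    finally have "(1 - s)\<^sup>2 \<le> \<bar>s\<^sup>2 - 1\<bar>" by (simp add: power2_eq_square)
    then show "(1 - sqrt (?r x))\<^sup>2 \<le> \<bar>?r x - 1\<bar>" by (metis s(2) s_def)
  qed
  also have "\<dots> = ennreal (\<integral>x. \<bar>?r x - 1\<bar> \<partial>M)"
    by (rule nn_integral_eq_integral) (use i in auto)
  also have "\<dots> \<le> ennreal (2 * \<epsilon>)" using le by (rule ennreal_leI)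
  finally show ?thesis .
qed

text \<open>The converse comparison. Cauchy-Schwarz for \<open>\<bar>1 - t\<bar> * (1 + t)\<close>
  is replaced by a pointwise inequality between means with weight \<open>\<delta>\<close>, chosen so
  that each of the two resulting terms integrates to at most \<open>\<delta>\<close>.\<close>

lemma sq_norm_imp_tv:
  assumes g: "g \<in> carrier G" and s: "sq_norm (\<lambda>x. 1 - sqrt (rho (f g) x)) \<le> ennreal (\<delta>\<^sup>2)" and d: "\<delta> > 0"
  shows "tv_le (f g) \<one>\<^bsub>X\<^esub> (2 * \<delta>)"
proof -
  let ?r = "rho (f g)" and ?s = "\<lambda>x. (1 - sqrt (rho (f g) x))\<^sup>2"
  have i: "integrable M ?r" by (rule rho_integrable[OF g])
  have i1: "(\<integral>x. ?r x \<partial>M) = 1"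
  proof -
    interpret T: prob_space "tr (f g)" using prob_tr f_carrier g by blast
    have "(\<integral>x. ?r x \<partial>M) = (\<integral>x. ?r x * indicator (space M) x \<partial>M)"
      by (rule Bochner_Integration.integral_cong) auto
    also have "\<dots> = 1" using rho_integral[OF g, of "space M"] T.prob_space by simp
    finally show ?thesis .
  qed
  have fin: "(\<integral>\<^sup>+x. ennreal (?s x) \<partial>M) < \<infinity>" using s unfolding sq_norm_def by (rule le_less_trans) simp
  have isq: "integrable M ?s" by (rule integrableI_nonneg) (use fin in auto)
  have "ennreal (\<integral>x. ?s x \<partial>M) \<le> ennreal (\<delta>\<^sup>2)"
    using s nn_integral_eq_integral[OF isq] unfolding sq_norm_def by simp
  then have sle: "(\<integral>x. ?s x \<partial>M) \<le> \<delta>\<^sup>2" by (simp add: ennreal_le_iff)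
  have "(\<integral>x. \<bar>?r x - 1\<bar> \<partial>M) \<le> (\<integral>x. ?s x / \<delta> + \<delta> / 2 * (1 + ?r x) \<partial>M)"
  proof (rule integral_mono)
    fix x
    define t where "t = sqrt (?r x)"
    have t: "t \<ge> 0" "?r x = t\<^sup>2" by (auto simp: t_def)
    have "2 * (\<bar>1 - t\<bar> / sqrt \<delta>) * (sqrt \<delta> * (1 + t) / 2) \<le> (\<bar>1 - t\<bar> / sqrt \<delta>)\<^sup>2 + (sqrt \<delta> * (1 + t) / 2)\<^sup>2"
      by (rule sum_squares_bound)
    also have "2 * (\<bar>1 - t\<bar> / sqrt \<delta>) * (sqrt \<delta> * (1 + t) / 2) = \<bar>t\<^sup>2 - 1\<bar>"
    proof -
      have "\<bar>t\<^sup>2 - 1\<bar> = \<bar>1 - t\<bar> * \<bar>1 + t\<bar>"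
        by (simp add: abs_mult[symmetric] power2_eq_square algebra_simps abs_minus_commute)
      then show ?thesis using d t by simp
    qed
    also have "(\<bar>1 - t\<bar> / sqrt \<delta>)\<^sup>2 + (sqrt \<delta> * (1 + t) / 2)\<^sup>2 = (1 - t)\<^sup>2 / \<delta> + \<delta> / 4 * (1 + t)\<^sup>2"
      using d by (simp add: power_divide power_mult_distrib)
    also have "\<dots> \<le> (1 - t)\<^sup>2 / \<delta> + \<delta> / 4 * (2 * (1 + t\<^sup>2))"
      using d sum_squares_bound[of 1 t] by (intro add_left_mono mult_left_mono) (auto simp: power2_sum)
    also have "\<delta> / 4 * (2 * (1 + t\<^sup>2)) = \<delta> / 2 * (1 + t\<^sup>2)" by (simp add: field_simps)
    finally have "\<bar>t\<^sup>2 - 1\<bar> \<le> (1 - t)\<^sup>2 / \<delta> + \<delta> / 2 * (1 + t\<^sup>2)" .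
    then show "\<bar>?r x - 1\<bar> \<le> ?s x / \<delta> + \<delta> / 2 * (1 + ?r x)" by (metis t(2) t_def)
  qed (use i isq in auto)
  also have "\<dots> = (\<integral>x. ?s x \<partial>M) / \<delta> + \<delta>"
    using i isq i1 M.prob_space by simp
  also have "\<dots> \<le> \<delta> + \<delta>"
    using sle d by (intro add_right_mono) (simp add: field_simps power2_eq_square)
  finally have le: "(\<integral>x. \<bar>?r x - 1\<bar> \<partial>M) \<le> 2 * \<delta>" by simp
  have "(\<integral>x. \<bar>?r x - rho (f \<one>\<^bsub>G\<^esub>) x\<bar> \<partial>M) = (\<integral>x. \<bar>?r x - 1\<bar> \<partial>M)"
    by (rule Bochner_Integration.integral_cong_AE) (use rho_one in \<open>auto elim: eventually_mono\<close>)
  then show ?thesis using tv_le_L1[OF g G.one_closed] le f_one tv_le_mono by metis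
qed

text \<open>The operators \<open>(1 + koopman (h i)) / 2\<close> for \<open>i < m\<close>, applied
  in turn to the constant \<open>1\<close>. Expanded, up to null sets, this is the mean of its
  images under all products of subsets of the first \<open>m\<close> generators.\<close>

fun avg :: "(nat \<Rightarrow> 'g) \<Rightarrow> nat \<Rightarrow> 'x \<Rightarrow> real" where
  "avg h 0 = (\<lambda>x. 1)"
| "avg h (Suc m) = (\<lambda>x. (avg h m x + koopman (h m) (avg h m) x) / 2)"

lemma avg_measurable[measurable]:
  assumes "\<And>i. h i \<in> carrier G" shows "avg h m \<in> borel_measurable M"
proof (induction m)
  case (Suc m)
  have [measurable]: "avg h m \<in> borel_measurable M" by fact
  have [measurable]: "koopman (h m) (avg h m) \<in> borel_measurable M" using assms by measurable
  show ?case by simp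
qed simp

text \<open>The parallelogram identity for \<open>avg h m\<close> and its image, which have equal
  norm: what averaging loses in norm is accounted for by the defect.\<close>

lemma sq_norm_avg_Suc:
  assumes h: "\<And>i. h i \<in> carrier G"
  shows "4 * sq_norm (avg h (Suc m)) + sq_norm (\<lambda>x. avg h m x - koopman (h m) (avg h m) x) = 4 * sq_norm (avg h m)"
proof -
  have [measurable]: "avg h m \<in> borel_measurable M" using h by measurable
  have [measurable]: "koopman (h m) (avg h m) \<in> borel_measurable M" using h by measurable
  have "sq_norm (avg h (Suc m)) = sq_norm (\<lambda>x. (1/2) * (avg h m x + koopman (h m) (avg h m) x))"
    by simp
  also have "\<dots> = ennreal ((1/2)\<^sup>2) * sq_norm (\<lambda>x. avg h m x + koopman (h m) (avg h m) x)"
    by (rule sq_norm_scale) measurable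
  finally have "4 * sq_norm (avg h (Suc m)) = (4 * ennreal ((1/2)\<^sup>2)) * sq_norm (\<lambda>x. avg h m x + koopman (h m) (avg h m) x)"
    by (simp add: mult.assoc)
  also have "4 * ennreal ((1/2)\<^sup>2) = 1"
  proof -
    have "4 * ennreal ((1/2)\<^sup>2) = ennreal 4 * ennreal ((1/2)\<^sup>2)" by simp
    also have "\<dots> = ennreal (4 * (1/2)\<^sup>2)" by (rule ennreal_mult[symmetric]) auto
    finally show ?thesis by (simp add: power2_eq_square)
  qed
  finally have "4 * sq_norm (avg h (Suc m)) + sq_norm (\<lambda>x. avg h m x - koopman (h m) (avg h m) x)
      = 2 * sq_norm (avg h m) + 2 * sq_norm (koopman (h m) (avg h m))"
    using sq_norm_parallelogram[of "avg h m" "koopman (h m) (avg h m)"] by simp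
  also have "\<dots> = 4 * sq_norm (avg h m)"
    by (subst sq_norm_koopman[OF h]) (auto simp: distrib_right[symmetric])
  finally show ?thesis .
qed

text \<open>The defects telescope against four times the squared norms of the averages, which start
  at \<open>4\<close>. A numerator larger than \<open>4\<close> therefore rules out that the first
  \<open>n\<close> defects all reach \<open>5 / real n\<close>.\<close>

lemma sq_norm_avg_small_step:
  assumes h: "\<And>i. h i \<in> carrier G" and n: "n > 0"
  shows "\<exists>m<n. sq_norm (\<lambda>x. avg h m x - koopman (h m) (avg h m) x) \<le> ennreal (5 / real n)"
proof (rule ccontr)
  define d where "d m = sq_norm (\<lambda>x. avg h m x - koopman (h m) (avg h m) x)" for m
  assume "\<not> ?thesis"
  then have gt: "ennreal (5 / real n) \<le> d m" if "m < n" for m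
    using that unfolding d_def by (meson linear)
  have "4 * sq_norm (avg h k) + (\<Sum>m<k. d m) = 4" for k
  proof (induction k)
    case 0
    show ?case by (simp add: sq_norm_def M.emeasure_space_1)
  next
    case (Suc k)
    have "4 * sq_norm (avg h (Suc k)) + (\<Sum>m<Suc k. d m) = (4 * sq_norm (avg h (Suc k)) + d k) + (\<Sum>m<k. d m)"
      by (simp only: sum.lessThan_Suc ac_simps)
    also have "4 * sq_norm (avg h (Suc k)) + d k = 4 * sq_norm (avg h k)"
      unfolding d_def by (rule sq_norm_avg_Suc[of h k, OF h])
    finally show ?case using Suc.IH by (simp only:)
  qed
  then have le: "(\<Sum>m<n. d m) \<le> 4" by (metis le_iff_add add.commute)
  have "(\<Sum>m<n. ennreal (5 / real n)) = ennreal (\<Sum>m<n. 5 / real n)" by (rule sum_ennreal) simp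
  also have "(\<Sum>m<n. 5 / real n) = 5" using n by simp
  finally have "ennreal 5 \<le> (\<Sum>m<n. d m)" using sum_mono[of "{..<n}" "\<lambda>m. ennreal (5 / real n)" d] gt by simp
  also note le
  finally have "ennreal 5 \<le> ennreal 4" by (simp only: ennreal_numeral)
  then show False by (subst (asm) ennreal_le_iff) auto
qed

end

section \<open>Almost fixed averages and a large compact set\<close>

context qi_witness
begin

lemma koopman_diff: "koopman g (\<lambda>x. u x - v x) = (\<lambda>x. koopman g u x - koopman g v x)"
  and koopman_avg: "koopman g (\<lambda>x. (u x + v x) / 2) = (\<lambda>x. (koopman g u x + koopman g v x) / 2)"
  by (auto simp: koopman_def fun_eq_iff algebra_simps add_divide_distrib)

text \<open>Telescoping with isometric steps: passing from \<open>p\<close> to \<open>Suc p\<close>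
  adds the image of \<open>v - koopman h v\<close> under the operator of the \<open>p\<close>-th
  power. The crude factor \<open>4 ^ p\<close> is harmless, because \<open>p\<close> is fixed before
  the number of averaging steps is chosen.\<close>

lemma sq_norm_le_pow:
  assumes h: "h \<in> carrier G" and v[measurable]: "v \<in> borel_measurable M"
  shows "sq_norm (\<lambda>x. v x - koopman (h [^]\<^bsub>G\<^esub> p) v x) \<le> 4 ^ p * sq_norm (\<lambda>x. v x - koopman h v x)"
proof (induction p)
  case 0
  have "sq_norm (\<lambda>x. v x - koopman (h [^]\<^bsub>G\<^esub> (0::nat)) v x) = sq_norm (\<lambda>x. 0)"
    by (rule sq_norm_cong_AE) (use koopman_one[of v] in \<open>auto elim: eventually_mono\<close>)
  then show ?case by (simp add: sq_norm_def)
next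
  case (Suc p)
  let ?d = "sq_norm (\<lambda>x. v x - koopman h v x)"
  have hp: "h [^]\<^bsub>G\<^esub> p \<in> carrier G" "h [^]\<^bsub>G\<^esub> Suc p \<in> carrier G" using h by auto
  have [measurable]: "koopman h v \<in> borel_measurable M" "koopman (h [^]\<^bsub>G\<^esub> p) v \<in> borel_measurable M"
    "koopman (h [^]\<^bsub>G\<^esub> Suc p) v \<in> borel_measurable M"
    using h hp by measurable
  have "AE x in M. koopman (h [^]\<^bsub>G\<^esub> p) (koopman h v) x = koopman (h [^]\<^bsub>G\<^esub> Suc p) v x"
    using koopman_mult[OF hp(1) h] by simp
  then have "AE x in M. koopman (h [^]\<^bsub>G\<^esub> p) v x - koopman (h [^]\<^bsub>G\<^esub> Suc p) v x
      = koopman (h [^]\<^bsub>G\<^esub> p) (\<lambda>x. v x - koopman h v x) x"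
    by eventually_elim (simp add: koopman_diff)
  then have step: "sq_norm (\<lambda>x. koopman (h [^]\<^bsub>G\<^esub> p) v x - koopman (h [^]\<^bsub>G\<^esub> Suc p) v x) = ?d"
    using sq_norm_koopman[OF hp(1), of "\<lambda>x. v x - koopman h v x"] sq_norm_cong_AE by (simp add: sq_norm_cong_AE)
  have "sq_norm (\<lambda>x. v x - koopman (h [^]\<^bsub>G\<^esub> Suc p) v x)
      = sq_norm (\<lambda>x. (v x - koopman (h [^]\<^bsub>G\<^esub> p) v x) + (koopman (h [^]\<^bsub>G\<^esub> p) v x - koopman (h [^]\<^bsub>G\<^esub> Suc p) v x))"
    by simp
  also have "\<dots> \<le> 2 * sq_norm (\<lambda>x. v x - koopman (h [^]\<^bsub>G\<^esub> p) v x) + 2 * ?d"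
    unfolding step[symmetric] by (rule sq_norm_add_le) measurable
  also have "\<dots> \<le> 2 * (4 ^ p * ?d) + 2 * (4 ^ p * ?d)"
  proof (intro add_mono mult_left_mono Suc)
    have "1 * ?d \<le> 4 ^ p * ?d" by (intro mult_right_mono) (auto intro: one_le_power)
    then show "?d \<le> 4 ^ p * ?d" by simp
  qed auto
  also have "\<dots> = 4 ^ Suc p * ?d" by (simp add: distrib_right[symmetric] mult.assoc[symmetric])
  finally show ?case .
qed

lemma sq_norm_convex:
  assumes [measurable]: "u \<in> borel_measurable M" "v \<in> borel_measurable M"
    and le: "sq_norm (\<lambda>x. 1 - u x) \<le> c" "sq_norm (\<lambda>x. 1 - v x) \<le> c"
  shows "sq_norm (\<lambda>x. 1 - (u x + v x) / 2) \<le> c"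
proof -
  have "sq_norm (\<lambda>x. 1 - (u x + v x) / 2) = sq_norm (\<lambda>x. (1/2) * ((1 - u x) + (1 - v x)))"
    by (rule arg_cong[of _ _ sq_norm]) (auto simp: fun_eq_iff field_simps)
  also have "\<dots> = ennreal ((1/2)\<^sup>2) * sq_norm (\<lambda>x. (1 - u x) + (1 - v x))" by (rule sq_norm_scale) measurable
  also have "\<dots> \<le> ennreal ((1/2)\<^sup>2) * (2 * sq_norm (\<lambda>x. 1 - u x) + 2 * sq_norm (\<lambda>x. 1 - v x))"
    by (intro mult_left_mono sq_norm_add_le) auto
  also have "\<dots> \<le> ennreal ((1/2)\<^sup>2) * (2 * c + 2 * c)"
    by (intro mult_left_mono add_mono le) auto
  also have "\<dots> = (ennreal ((1/2)\<^sup>2) * 4) * c"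
    by (simp add: distrib_right[symmetric] mult.assoc)
  also have "ennreal ((1/2)\<^sup>2) * 4 = ennreal ((1/2)\<^sup>2 * 4)" by (subst ennreal_mult) auto
  also have "\<dots> = 1" by (simp add: power2_eq_square)
  finally show ?thesis by simp
qed

text \<open>If all products over finite subsets of a family \<open>F {i}\<close> move the measure only a little, then
  some member of the family, and hence its \<open>p\<close>-th power, almost fixes an average of the orbit of
  the constant function \<open>1\<close>: averaging over one more generator \<open>h\<close> decreases the squared norm of
  the average \<open>v\<close> by a quarter of that of \<open>v - koopman h v\<close>, so these defects are summable.\<close>

lemma uniformly_small_powers:
  fixes F :: "nat set \<Rightarrow> 'g"
  assumes F: "\<And>S. finite S \<Longrightarrow> F S \<in> carrier G" "F {} = \<one>\<^bsub>G\<^esub>"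
    "\<And>i S. finite S \<Longrightarrow> i \<notin> S \<Longrightarrow> F (insert i S) = F S \<otimes>\<^bsub>G\<^esub> F {i}"
    and t: "\<And>S. finite S \<Longrightarrow> tv_le (f (F S)) \<one>\<^bsub>X\<^esub> \<epsilon>" and e: "\<epsilon> > 0"
  shows "\<exists>j\<ge>J. sq_norm (\<lambda>x. 1 - sqrt (rho (f (F {j} [^]\<^bsub>G\<^esub> (p::nat))) x)) \<le> ennreal (24 * \<epsilon>)"
proof -
  define h where "h i = F {J + i}" for i
  have h: "h i \<in> carrier G" for i using F(1) by (simp add: h_def)
  let ?\<eta> = "avg h"
  have m[measurable]: "?\<eta> m \<in> borel_measurable M" for m using h by (rule avg_measurable)
  have k1: "koopman g (\<lambda>x. 1) = (\<lambda>x. sqrt (rho (f g) x))" for g by (simp add: koopman_def fun_eq_iff)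
  \<comment> \<open>The bound has to hold for every \<open>S\<close> beyond the generators already
    used: expanding the last average replaces \<open>S\<close> by \<open>S\<close> and
    \<open>insert (J + m) S\<close>, both covered by the induction hypothesis.\<close>
  have C: "sq_norm (\<lambda>x. 1 - koopman (F S) (?\<eta> m) x) \<le> ennreal (2 * \<epsilon>)" if "finite S" "S \<subseteq> {J + m..}" for S m
    using that
  proof (induction m arbitrary: S)
    case 0
    then show ?case using tv_imp_sq_norm[OF F(1) t] by (simp add: k1)
  next
    case (Suc m)
    have S: "J + m \<notin> S" using Suc.prems by auto
    let ?g = "F (insert (J + m) S)"
    have FS: "F S \<in> carrier G" "?g \<in> carrier G" using Suc.prems F(1) by auto
    have [measurable]: "koopman (F S) (?\<eta> m) \<in> borel_measurable M" "koopman ?g (?\<eta> m) \<in> borel_measurable M"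
      using FS by measurable
    have "AE x in M. koopman (F S) (koopman (h m) (?\<eta> m)) x = koopman ?g (?\<eta> m) x"
      using koopman_mult[OF FS(1) h, of m "?\<eta> m"] F(3)[OF Suc.prems(1) S] by (simp add: h_def)
    then have "AE x in M. 1 - koopman (F S) (?\<eta> (Suc m)) x = 1 - (koopman (F S) (?\<eta> m) x + koopman ?g (?\<eta> m) x) / 2"
      by eventually_elim (simp add: koopman_avg)
    then have "sq_norm (\<lambda>x. 1 - koopman (F S) (?\<eta> (Suc m)) x) = sq_norm (\<lambda>x. 1 - (koopman (F S) (?\<eta> m) x + koopman ?g (?\<eta> m) x) / 2)"
      by (rule sq_norm_cong_AE)
    also have "\<dots> \<le> ennreal (2 * \<epsilon>)"
    proof (rule sq_norm_convex)
      show "sq_norm (\<lambda>x. 1 - koopman (F S) (?\<eta> m) x) \<le> ennreal (2 * \<epsilon>)"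
        by (rule Suc.IH) (use Suc.prems in auto)
      show "sq_norm (\<lambda>x. 1 - koopman ?g (?\<eta> m) x) \<le> ennreal (2 * \<epsilon>)"
        by (rule Suc.IH) (use Suc.prems in auto)
    qed measurable
    finally show ?case .
  qed
  have C0: "sq_norm (\<lambda>x. 1 - ?\<eta> m x) \<le> ennreal (2 * \<epsilon>)" for m
  proof -
    have "sq_norm (\<lambda>x. 1 - ?\<eta> m x) = sq_norm (\<lambda>x. 1 - koopman (F {}) (?\<eta> m) x)"
      by (rule sq_norm_cong_AE) (use koopman_one[of "?\<eta> m"] F(2) in \<open>auto elim: eventually_mono\<close>)
    then show ?thesis using C[of "{}" m] by simp
  qed
  \<comment> \<open>Enough averaging steps to absorb the factor \<open>4 ^ p\<close> into
    \<open>\<epsilon>\<close>.\<close>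
  obtain n :: nat where n: "n > 0" "4 ^ p * 5 / \<epsilon> < real n"
    using reals_Archimedean2[of "max 0 (4 ^ p * 5 / \<epsilon>)"] by auto
  obtain m where md: "sq_norm (\<lambda>x. ?\<eta> m x - koopman (h m) (?\<eta> m) x) \<le> ennreal (5 / real n)"
    using sq_norm_avg_small_step[of h, OF h n(1)] by blast
  define g where "g = h m [^]\<^bsub>G\<^esub> p"
  have g: "g \<in> carrier G" unfolding g_def using h by simp
  have [measurable]: "koopman g (?\<eta> m) \<in> borel_measurable M" "koopman g (\<lambda>x. 1) \<in> borel_measurable M"
    using g by measurable
  have "sq_norm (\<lambda>x. ?\<eta> m x - koopman g (?\<eta> m) x) \<le> 4 ^ p * sq_norm (\<lambda>x. ?\<eta> m x - koopman (h m) (?\<eta> m) x)"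
    unfolding g_def by (rule sq_norm_le_pow[OF h]) measurable
  also have "\<dots> \<le> ennreal (4 ^ p) * ennreal (5 / real n)"
    using md by (simp add: ennreal_power[symmetric] mult_left_mono)
  also have "\<dots> = ennreal (4 ^ p * (5 / real n))" by (rule ennreal_mult[symmetric]) auto
  also have "\<dots> \<le> ennreal \<epsilon>"
    using n e by (intro ennreal_leI) (simp add: field_simps)
  finally have b: "sq_norm (\<lambda>x. ?\<eta> m x - koopman g (?\<eta> m) x) \<le> ennreal \<epsilon>" .
  have "sq_norm (\<lambda>x. koopman g (?\<eta> m) x - koopman g (\<lambda>x. 1) x) = sq_norm (koopman g (\<lambda>x. ?\<eta> m x - 1))"
    by (simp add: koopman_diff)
  also have "\<dots> = sq_norm (\<lambda>x. ?\<eta> m x - 1)" by (rule sq_norm_koopman[OF g]) measurable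
  also have "\<dots> = sq_norm (\<lambda>x. 1 - ?\<eta> m x)" unfolding sq_norm_def by (simp add: power2_commute)
  finally have c: "sq_norm (\<lambda>x. koopman g (?\<eta> m) x - koopman g (\<lambda>x. 1) x) \<le> ennreal (2 * \<epsilon>)" using C0 by simp
  \<comment> \<open>Three steps from \<open>1\<close> to its image under \<open>g\<close>: to the
    average, to the image of the average, and back by isometry. The bounds
    \<open>2 * \<epsilon>\<close>, \<open>\<epsilon>\<close>, \<open>2 * \<epsilon>\<close> and two
    uses of \<open>sq_norm_add_le\<close> give \<open>16 * \<epsilon>\<close>.\<close>
  have "sq_norm (\<lambda>x. 1 - sqrt (rho (f g) x))
      = sq_norm (\<lambda>x. (1 - ?\<eta> m x) + ((?\<eta> m x - koopman g (?\<eta> m) x) + (koopman g (?\<eta> m) x - koopman g (\<lambda>x. 1) x)))"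
    by (simp add: k1)
  also have "\<dots> \<le> 2 * sq_norm (\<lambda>x. 1 - ?\<eta> m x)
      + 2 * sq_norm (\<lambda>x. (?\<eta> m x - koopman g (?\<eta> m) x) + (koopman g (?\<eta> m) x - koopman g (\<lambda>x. 1) x))"
    by (rule sq_norm_add_le) measurable
  also have "\<dots> \<le> 2 * sq_norm (\<lambda>x. 1 - ?\<eta> m x)
      + 2 * (2 * sq_norm (\<lambda>x. ?\<eta> m x - koopman g (?\<eta> m) x) + 2 * sq_norm (\<lambda>x. koopman g (?\<eta> m) x - koopman g (\<lambda>x. 1) x))"
    by (intro add_left_mono mult_left_mono sq_norm_add_le) auto
  also have "\<dots> \<le> 2 * ennreal (2 * \<epsilon>) + 2 * (2 * ennreal \<epsilon> + 2 * ennreal (2 * \<epsilon>))"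
    by (intro add_mono mult_left_mono C0 b c) auto
  also have "\<dots> = ennreal (16 * \<epsilon>)"
  proof -
    have "ennreal (16 * \<epsilon>) = ennreal (2 * (2 * \<epsilon>) + 2 * (2 * \<epsilon> + 2 * (2 * \<epsilon>)))" by simp
    also have "\<dots> = 2 * ennreal (2 * \<epsilon>) + 2 * (2 * ennreal \<epsilon> + 2 * ennreal (2 * \<epsilon>))"
      using e by (simp only: ennreal_plus ennreal_mult zero_le_numeral mult_nonneg_nonneg less_imp_le add_nonneg_nonneg ennreal_numeral)
    finally show ?thesis ..
  qed
  also have "\<dots> \<le> ennreal (24 * \<epsilon>)" using e by (intro ennreal_leI) simp
  finally show ?thesis unfolding g_def h_def by (intro exI[of _ "J + m"]) simp
qed

text \<open>Otherwise \<open>K\<close> and its preimage under translation by \<open>g\<close> would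
  be disjoint with measures above \<open>3/4\<close> and \<open>1/2\<close>. So a small change in
  total variation confines \<open>g\<close> to the quotients of elements of
  \<open>K\<close>.\<close>

lemma translates_meet:
  assumes g: "g \<in> carrier X" and K: "K \<in> sets M" "measure M K > 3/4" and t: "tv_le g \<one>\<^bsub>X\<^esub> (1/4)"
  shows "\<exists>x\<in>K. g \<otimes>\<^bsub>X\<^esub> x \<in> K"
proof (rule ccontr)
  assume no: "\<not> ?thesis"
  let ?P = "(\<lambda>x. g \<otimes>\<^bsub>X\<^esub> x) -` K \<inter> space M"
  have P: "?P \<in> sets M" using mt[OF g] K(1) by (rule measurable_sets)
  have "measure (tr g) K = measure M ?P" unfolding translate_def by (rule measure_distr[OF mt[OF g] K(1)])
  moreover have "\<bar>measure (tr g) K - measure M K\<bar> \<le> 1/4" using t K(1) unfolding tv_le_def tr_one by blast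
  ultimately have "measure M ?P > 1/2" using K(2) by linarith
  moreover have "?P \<inter> K = {}" using no by auto
  then have "measure M (?P \<union> K) = measure M ?P + measure M K"
    using P K(1) by (intro M.finite_measure_Union) auto
  moreover have "measure M (?P \<union> K) \<le> 1" by (rule M.prob_le_1)
  ultimately show False using K(2) by linarith
qed

text \<open>Local compactness and a countable base make \<open>X\<close> a countable union of
  compact sets.\<close>

lemma compact_large: "\<exists>K. compactin (gtop X) K \<and> K \<in> sets M \<and> measure M K > 3/4"
proof -
  let ?T = "gtop X"
  obtain B where B: "countable B" "\<And>V. V \<in> B \<Longrightarrow> openin ?T V"
    "\<And>U x. openin ?T U \<Longrightarrow> x \<in> U \<Longrightarrow> \<exists>V\<in>B. x \<in> V \<and> V \<subseteq> U"
    using metrizable_separable_countable_base[OF metrizable_X] polish_X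
    unfolding polish_group_def by metis
  have haus: "Hausdorff_space ?T" using metrizable_X by (rule metrizable_imp_Hausdorff_space)
  have Ks: "K \<in> sets M" if "compactin ?T K" for K
  proof -
    have "closedin ?T K" using compactin_imp_closedin[OF haus that] .
    then have "openin ?T (topspace ?T - K)" "K \<subseteq> topspace ?T" by (auto simp: closedin_def)
    then have "space M - (topspace ?T - K) \<in> sets M" using open_sets by blast
    then show ?thesis using \<open>K \<subseteq> topspace ?T\<close> by (simp add: space_M ts_X double_diff)
  qed
  define BK where "BK = insert {} {V\<in>B. \<exists>K. compactin ?T K \<and> V \<subseteq> K}"
  have BK: "countable BK" "BK \<noteq> {}" using B(1) by (auto simp: BK_def)
  define b where "b = from_nat_into BK"
  have b: "range b = BK" unfolding b_def using BK by (simp add: range_from_nat_into)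
  have "\<exists>K. compactin ?T K \<and> b i \<subseteq> K" for i
    using b rangeI[of b i] unfolding BK_def by auto
  then obtain C where C: "\<And>i. compactin ?T (C i)" "\<And>i. b i \<subseteq> C i" by metis
  define D where "D n = (\<Union>i\<le>n. C i)" for n
  have Dc: "compactin ?T (D n)" for n unfolding D_def by (rule compactin_Union) (use C in auto)
  have "(\<Union>n. D n) = space M"
  proof
    show "(\<Union>n. D n) \<subseteq> space M" using Dc compactin_subset_topspace by (fastforce simp: space_M ts_X)
    show "space M \<subseteq> (\<Union>n. D n)"
    proof
      fix x assume "x \<in> space M"
      then have "x \<in> topspace ?T" by (simp add: space_M ts_X)
      then obtain U K where UK: "openin ?T U" "compactin ?T K" "x \<in> U" "U \<subseteq> K"
        using lc_X unfolding locally_compact_space_def by blast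
      obtain V where V: "V \<in> B" "x \<in> V" "V \<subseteq> U" using B(3)[OF UK(1,3)] by blast
      then have "V \<in> BK" using UK unfolding BK_def by blast
      then obtain i where "V = b i" using b by blast
      then have "x \<in> D i" unfolding D_def using V(2) C(2) by blast
      then show "x \<in> (\<Union>n. D n)" by blast
    qed
  qed
  moreover have "incseq D" unfolding D_def by (rule incseq_SucI) (rule UN_mono, auto)
  ultimately have "(\<lambda>n. measure M (D n)) \<longlonglongrightarrow> measure M (space M)"
    using M.finite_Lim_measure_incseq[of D] Ks[OF Dc] by auto
  from metric_LIMSEQ_D[OF this, of "1/4"]
  obtain n where "dist (measure M (D n)) (measure M (space M)) < 1/4" by auto
  then have "measure M (D n) > 3/4" using M.prob_space unfolding dist_real_def by linarith
  then show ?thesis using Dc Ks[OF Dc] by blast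
qed

end

section \<open>A criterion for not being a group of quasi-invariance\<close>

context qi_witness
begin

definition tv_dist :: "'x \<Rightarrow> 'x \<Rightarrow> real" where
  "tv_dist g h = (SUP E\<in>sets M. \<bar>measure (tr g) E - measure (tr h) E\<bar>)"

lemma tv_le_iff_tv_dist:
  assumes "g \<in> carrier X" "h \<in> carrier X"
  shows "tv_le g h \<epsilon> \<longleftrightarrow> tv_dist g h \<le> \<epsilon>"
proof -
  interpret g: prob_space "tr g" using prob_tr assms(1) .
  interpret h: prob_space "tr h" using prob_tr assms(2) .
  have "\<bar>measure (tr g) E - measure (tr h) E\<bar> \<le> 1" for E
    using g.prob_le_1[of E] h.prob_le_1[of E] measure_nonneg[of "tr g" E] measure_nonneg[of "tr h" E]
    by linarith
  then have "bdd_above ((\<lambda>E. \<bar>measure (tr g) E - measure (tr h) E\<bar>) ` sets M)" by (intro bdd_aboveI[of _ 1]) auto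
  then show ?thesis unfolding tv_le_def tv_dist_def by (subst cSUP_le_iff) auto
qed

lemma tv_dist_nonneg: "g \<in> carrier X \<Longrightarrow> h \<in> carrier X \<Longrightarrow> tv_dist g h \<ge> 0"
proof -
  assume "g \<in> carrier X" "h \<in> carrier X"
  then have "tv_le g h (tv_dist g h)" by (simp add: tv_le_iff_tv_dist)
  then have "\<bar>measure (tr g) {} - measure (tr h) {}\<bar> \<le> tv_dist g h" unfolding tv_le_def by blast
  then show "tv_dist g h \<ge> 0" by simp
qed

lemma singular_off_range:
  assumes "g \<in> carrier X - f ` carrier G"
  shows "mutually_singular (tr g) M"
proof -
  have "\<forall>g\<in>carrier X - quasi_invariance X M. mutually_singular (tr g) M"
    using witness unfolding QI_witness_def by (elim conjE)
  from bspec[OF this[unfolded QI_eq] assms] show ?thesis .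
qed

text \<open>Here the alternative of mutual singularity enters: a set null for \<open>tr l\<close>
  with \<open>M\<close>-null complement has a complement null for every \<open>tr (x n)\<close>, so
  \<open>tr l\<close> would stay at distance one from all of them.\<close>

lemma tv_limit_in_range:
  assumes lim: "limitin (gtop X) x l sequentially" and x: "\<And>n. x n \<in> f ` carrier G"
    and c: "\<And>\<epsilon>. \<epsilon> > 0 \<Longrightarrow> \<exists>n. tv_le l (x n) \<epsilon>"
  shows "l \<in> f ` carrier G"
proof (rule ccontr)
  assume no: "l \<notin> f ` carrier G"
  have l: "l \<in> carrier X" using lim ts_X by (simp add: limitin_def)
  interpret T: prob_space "tr l" using prob_tr l .
  have "mutually_singular (tr l) M" by (rule singular_off_range) (use l no in blast)
  then obtain A where A: "A \<in> sets M" "emeasure (tr l) A = 0" "emeasure M (space M - A) = 0"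
    unfolding mutually_singular_def space_tr sets_tr by metis
  have nul: "measure (tr (x n)) (space M - A) = 0" for n
  proof -
    obtain g where g: "g \<in> carrier G" "x n = f g" using x[of n] by blast
    have "space M - A \<in> null_sets M" using A(1,3) by (intro null_setsI sets.compl_sets)
    then have "space M - A \<in> null_sets (tr (x n))" unfolding g(2)
      using ac[OF g(1)] unfolding absolutely_continuous_def by (rule subsetD[rotated])
    then show ?thesis by (simp add: measure_eq_0_null_sets)
  qed
  have "measure (tr l) (space M - A) \<le> 0"
  proof (rule field_le_epsilon)
    fix e :: real assume "e > 0"
    from c[OF this] obtain n where "tv_le l (x n) e" ..
    then have "\<bar>measure (tr l) (space M - A) - measure (tr (x n)) (space M - A)\<bar> \<le> e"
      unfolding tv_le_def using sets.compl_sets[OF A(1)] by (rule bspec)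
    then show "measure (tr l) (space M - A) \<le> 0 + e" using nul by simp
  qed
  moreover have "measure (tr l) (space M - A) = 1 - measure (tr l) A" using T.prob_compl[of A] A(1) by simp
  moreover have "measure (tr l) A = 0" using A(2) by (simp add: measure_def)
  ultimately show False by simp
qed

text \<open>The image \<open>\<Gamma>\<close> of the involutions is complete for the metric of \<open>X\<close> plus total variation: a limit
  in \<open>X\<close> along which total variation also converges is not singular, hence lies in the range of \<open>f\<close>.
  Being countable, \<open>\<Gamma>\<close> has an isolated point by Baire and is discrete.\<close>

lemma no_distinct_involutions:
  fixes t :: "nat \<Rightarrow> 'g"
  assumes comm: "\<And>x y. x \<in> carrier G \<Longrightarrow> y \<in> carrier G \<Longrightarrow> x \<otimes>\<^bsub>G\<^esub> y = y \<otimes>\<^bsub>G\<^esub> x"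
    and cnt: "countable {v \<in> carrier G. v \<otimes>\<^bsub>G\<^esub> v = \<one>\<^bsub>G\<^esub>}"
    and t: "\<And>i. t i \<in> carrier G" "\<And>i. t i \<otimes>\<^bsub>G\<^esub> t i = \<one>\<^bsub>G\<^esub>" "inj t"
    and small: "\<And>J \<epsilon>. \<epsilon> > 0 \<Longrightarrow> \<exists>j\<ge>J. tv_le (f (t j)) \<one>\<^bsub>X\<^esub> \<epsilon>"
  shows False
proof -
  define \<Gamma> where "\<Gamma> = f ` {v \<in> carrier G. v \<otimes>\<^bsub>G\<^esub> v = \<one>\<^bsub>G\<^esub>}"
  have \<Gamma>X: "\<Gamma> \<subseteq> carrier X" unfolding \<Gamma>_def by (rule image_subsetI) (simp add: f_carrier)
  have \<Gamma>I: "f v \<in> \<Gamma>" if "v \<in> carrier G" "v \<otimes>\<^bsub>G\<^esub> v = \<one>\<^bsub>G\<^esub>" for v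
    unfolding \<Gamma>_def using that by (intro imageI CollectI conjI)
  have \<Gamma>E: "\<exists>v. v \<in> carrier G \<and> v \<otimes>\<^bsub>G\<^esub> v = \<one>\<^bsub>G\<^esub> \<and> a = f v" if "a \<in> \<Gamma>" for a
    using that unfolding \<Gamma>_def by (elim imageE CollectE) (simp only: ex_simps, metis)
  have \<Gamma>_mult: "a \<otimes>\<^bsub>X\<^esub> b \<in> \<Gamma>" if ab: "a \<in> \<Gamma>" "b \<in> \<Gamma>" for a b
  proof -
    obtain v w where vw: "v \<in> carrier G" "v \<otimes>\<^bsub>G\<^esub> v = \<one>\<^bsub>G\<^esub>" "a = f v" "w \<in> carrier G" "w \<otimes>\<^bsub>G\<^esub> w = \<one>\<^bsub>G\<^esub>" "b = f w"
      using \<Gamma>E[OF ab(1)] \<Gamma>E[OF ab(2)] by metis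
    have vw': "v \<otimes>\<^bsub>G\<^esub> w \<in> carrier G" using vw(1,4) by (rule G.m_closed)
    have "(v \<otimes>\<^bsub>G\<^esub> w) \<otimes>\<^bsub>G\<^esub> (v \<otimes>\<^bsub>G\<^esub> w) = (v \<otimes>\<^bsub>G\<^esub> w) \<otimes>\<^bsub>G\<^esub> (w \<otimes>\<^bsub>G\<^esub> v)"
      by (simp only: comm[OF vw(4,1)])
    also have "\<dots> = v \<otimes>\<^bsub>G\<^esub> ((w \<otimes>\<^bsub>G\<^esub> w) \<otimes>\<^bsub>G\<^esub> v)"
      by (simp only: G.m_assoc G.m_closed vw(1,4))
    also have "\<dots> = \<one>\<^bsub>G\<^esub>" by (simp only: vw(5) G.l_one vw(1,2))
    finally show ?thesis unfolding vw(3,6) f_mult[OF vw(1,4), symmetric] by (rule \<Gamma>I[OF vw'])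
  qed
  have \<Gamma>_inv: "inv\<^bsub>X\<^esub> a = a" if a: "a \<in> \<Gamma>" for a
  proof -
    obtain v where v: "v \<in> carrier G" "v \<otimes>\<^bsub>G\<^esub> v = \<one>\<^bsub>G\<^esub>" "a = f v" using \<Gamma>E[OF a] by metis
    have "a \<otimes>\<^bsub>X\<^esub> a = \<one>\<^bsub>X\<^esub>" by (simp only: v(3) f_mult[OF v(1,1), symmetric] v(2) f_one)
    then show ?thesis using f_carrier[OF v(1)] v(3) by (intro X.inv_equality) auto
  qed
  have \<Gamma>c: "countable \<Gamma>" unfolding \<Gamma>_def using cnt by (rule countable_image)
  obtain Q d where m: "Metric_space Q d" "Metric_space.mcomplete Q d" and T: "gtop X = Metric_space.mtopology Q d"
    using polish_X unfolding polish_group_def completely_metrizable_space_def by blast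
  interpret D: Metric_space Q d by (rule m(1))
  have Q: "Q = carrier X" using ts_X T by simp
  \<comment> \<open>The absolute value keeps the function nonnegative off the carrier, where
    \<open>Metric_space\<close> requires it too.\<close>
  define \<rho> where "\<rho> x y = d x y + \<bar>tv_dist x y\<bar>" for x y
  have tv_dist_sym: "tv_dist x y = tv_dist y x" for x y unfolding tv_dist_def by (simp add: abs_minus_commute)
  have tv_tri: "tv_dist x z \<le> tv_dist x y + tv_dist y z" if "x \<in> carrier X" "y \<in> carrier X" "z \<in> carrier X" for x y z
    using that tv_le_trans[of x y "tv_dist x y" z "tv_dist y z"] by (simp add: tv_le_iff_tv_dist)
  have \<rho>ms: "Metric_space \<Gamma> \<rho>"
  proof
    fix x y z
    show "0 \<le> \<rho> x y" by (simp add: \<rho>_def)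
    show "\<rho> x y = \<rho> y x" by (simp add: \<rho>_def tv_dist_sym[of x] D.commute)
    show "\<rho> x y = 0 \<longleftrightarrow> x = y" if "x \<in> \<Gamma>" "y \<in> \<Gamma>"
    proof
      assume "\<rho> x y = 0"
      then have "d x y = 0" using D.nonneg[of x y] by (simp add: \<rho>_def add_nonneg_eq_0_iff)
      moreover have "x \<in> Q" "y \<in> Q" using that \<Gamma>X Q by auto
      ultimately show "x = y" using D.zero by simp
    next
      assume "x = y"
      have "tv_le x x 0" by (simp add: tv_le_def)
      then have "tv_dist x x = 0" using that \<Gamma>X tv_dist_nonneg[of x x] tv_le_iff_tv_dist[of x x 0] by auto
      moreover have "x \<in> Q" using that \<Gamma>X Q by auto
      ultimately show "\<rho> x y = 0" using \<open>x = y\<close> D.zero[of x x] by (simp add: \<rho>_def)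
    qed
    show "\<rho> x z \<le> \<rho> x y + \<rho> y z" if "x \<in> \<Gamma>" "y \<in> \<Gamma>" "z \<in> \<Gamma>"
    proof -
      have c: "x \<in> carrier X" "y \<in> carrier X" "z \<in> carrier X" using that \<Gamma>X by auto
      have "d x z \<le> d x y + d y z" by (rule D.triangle) (use c Q in auto)
      then show ?thesis using tv_tri[OF c] tv_dist_nonneg c by (simp add: \<rho>_def)
    qed
  qed
  interpret R: Metric_space \<Gamma> \<rho> by (rule \<rho>ms)
  \<comment> \<open>Used twice: for Cauchy sequences of \<open>\<rho>\<close>, giving completeness,
    and for the convergent sequence of involutions found at the end. Squaring to the identity passes
    to the limit because \<open>X\<close> is Hausdorff.\<close>
  have conv: "\<exists>l\<in>\<Gamma>. limitin (gtop X) \<sigma> l sequentially \<and> (\<forall>\<epsilon>>0. \<exists>N. \<forall>n\<ge>N. tv_le l (\<sigma> n) \<epsilon>)"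
    if \<sigma>: "range \<sigma> \<subseteq> \<Gamma>" and lim: "limitin (gtop X) \<sigma> l sequentially"
      and tc: "\<forall>\<epsilon>>0. \<exists>N. \<forall>n\<ge>N. \<forall>m\<ge>N. tv_le (\<sigma> n) (\<sigma> m) \<epsilon>" for \<sigma> :: "nat \<Rightarrow> 'x" and l
  proof -
    have \<sigma>X: "\<sigma> n \<in> carrier X" for n using \<sigma> \<Gamma>X by blast
    have lX: "l \<in> carrier X" using lim ts_X by (simp add: limitin_def)
    have tl: "\<exists>N. \<forall>n\<ge>N. tv_le l (\<sigma> n) \<epsilon>" if e: "\<epsilon> > 0" for \<epsilon>
    proof -
      obtain N where N: "\<And>n m. n \<ge> N \<Longrightarrow> m \<ge> N \<Longrightarrow> tv_le (\<sigma> n) (\<sigma> m) \<epsilon>" using tc e by blast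
      have "tv_le l (\<sigma> n) \<epsilon>" if "n \<ge> N" for n
      proof (rule tv_le_limit[where x = "\<lambda>i. \<sigma> (i + N)"])
        show "limitin (gtop X) (\<lambda>i. \<sigma> (i + N)) l sequentially"
          using lim by (rule limitin_sequentially_offset)
      qed (use N \<sigma>X that in auto)
      then show ?thesis by blast
    qed
    have "l \<in> f ` carrier G"
    proof (rule tv_limit_in_range[OF lim])
      show "\<sigma> n \<in> f ` carrier G" for n using \<Gamma>E[of "\<sigma> n"] \<sigma> by (metis imageI rangeI subsetD)
      show "\<exists>n. tv_le l (\<sigma> n) \<epsilon>" if "\<epsilon> > 0" for \<epsilon> using tl[OF that] by blast
    qed
    then obtain v where v: "v \<in> carrier G" "l = f v" by (metis imageE)
    have "continuous_map (gtop X) (prod_topology (gtop X) (gtop X)) (\<lambda>x. (x, x))"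
      by (simp add: continuous_map_pairwise o_def)
    then have "continuous_map (gtop X) (gtop X) ((\<lambda>(x, y). x \<otimes>\<^bsub>X\<^esub> y) \<circ> (\<lambda>x. (x, x)))"
      using tg_X unfolding topological_group_def by (blast intro: continuous_map_compose)
    from continuous_map_limit[OF this lim]
    have l1: "limitin (gtop X) (\<lambda>n. \<sigma> n \<otimes>\<^bsub>X\<^esub> \<sigma> n) (l \<otimes>\<^bsub>X\<^esub> l) sequentially" by (simp add: o_def)
    have "\<sigma> n \<otimes>\<^bsub>X\<^esub> \<sigma> n = \<one>\<^bsub>X\<^esub>" for n
      using \<sigma> \<Gamma>_inv[of "\<sigma> n"] X.r_inv[OF \<sigma>X[of n]] by (metis rangeI subsetD)
    then have "limitin (gtop X) (\<lambda>n::nat. \<one>\<^bsub>X\<^esub>) (l \<otimes>\<^bsub>X\<^esub> l) sequentially" using l1 by simp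
    moreover have "limitin (gtop X) (\<lambda>n::nat. \<one>\<^bsub>X\<^esub>) \<one>\<^bsub>X\<^esub> sequentially" by (simp add: limitin_const ts_X)
    ultimately have "l \<otimes>\<^bsub>X\<^esub> l = \<one>\<^bsub>X\<^esub>"
      using limitin_Hausdorff_unique[OF _ _ trivial_limit_sequentially metrizable_imp_Hausdorff_space[OF metrizable_X]] by blast
    then have "f (v \<otimes>\<^bsub>G\<^esub> v) = f \<one>\<^bsub>G\<^esub>" using v by (simp add: f_mult f_one)
    then have "v \<otimes>\<^bsub>G\<^esub> v = \<one>\<^bsub>G\<^esub>" using f_inj v by (auto dest: inj_onD)
    then have "l \<in> \<Gamma>" unfolding v(2) by (rule \<Gamma>I[OF v(1)])
    then show ?thesis using lim tl by (intro bexI[of _ l] conjI allI impI)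
  qed
  have "R.mcomplete"
    unfolding R.mcomplete_def
  proof (intro allI impI)
    fix \<sigma> assume C: "R.MCauchy \<sigma>"
    then have \<sigma>: "range \<sigma> \<subseteq> \<Gamma>" by (simp add: R.MCauchy_def)
    have \<sigma>X: "\<sigma> n \<in> carrier X" for n using \<sigma> \<Gamma>X by blast
    have c: "\<exists>N. \<forall>n\<ge>N. \<forall>m\<ge>N. \<rho> (\<sigma> n) (\<sigma> m) < \<epsilon>" if "\<epsilon> > 0" for \<epsilon>
      using C that unfolding R.MCauchy_def by metis
    have "D.MCauchy \<sigma>"
      unfolding D.MCauchy_def
    proof (intro conjI allI impI)
      show "range \<sigma> \<subseteq> Q" using \<sigma> \<Gamma>X Q by blast
      fix \<epsilon> :: real assume "\<epsilon> > 0"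
      from c[OF this] obtain N where N: "\<forall>n\<ge>N. \<forall>m\<ge>N. \<rho> (\<sigma> n) (\<sigma> m) < \<epsilon>" ..
      have "d (\<sigma> n) (\<sigma> m) < \<epsilon>" if "N \<le> n" "N \<le> m" for n m
        using N that unfolding \<rho>_def by (smt (verit))
      then show "\<exists>N. \<forall>n n'. N \<le> n \<longrightarrow> N \<le> n' \<longrightarrow> d (\<sigma> n) (\<sigma> n') < \<epsilon>" by blast
    qed
    then obtain l where l: "limitin (gtop X) \<sigma> l sequentially" using m(2) T unfolding D.mcomplete_def by auto
    have tc: "\<forall>\<epsilon>>0. \<exists>N. \<forall>n\<ge>N. \<forall>m\<ge>N. tv_le (\<sigma> n) (\<sigma> m) \<epsilon>"
    proof (intro allI impI)
      fix \<epsilon> :: real assume "\<epsilon> > 0"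
      from c[OF this] obtain N where N: "\<forall>n\<ge>N. \<forall>m\<ge>N. \<rho> (\<sigma> n) (\<sigma> m) < \<epsilon>" ..
      have "tv_le (\<sigma> n) (\<sigma> m) \<epsilon>" if "N \<le> n" "N \<le> m" for n m
      proof -
        have "\<rho> (\<sigma> n) (\<sigma> m) < \<epsilon>" using N that by blast
        then have "tv_dist (\<sigma> n) (\<sigma> m) \<le> \<epsilon>" unfolding \<rho>_def using D.nonneg[of "\<sigma> n" "\<sigma> m"] by linarith
        then show ?thesis using tv_le_iff_tv_dist[OF \<sigma>X \<sigma>X] by simp
      qed
      then show "\<exists>N. \<forall>n\<ge>N. \<forall>m\<ge>N. tv_le (\<sigma> n) (\<sigma> m) \<epsilon>" by blast
    qed
    obtain k where k: "k \<in> \<Gamma>" "limitin (gtop X) \<sigma> k sequentially" "\<forall>\<epsilon>>0. \<exists>N. \<forall>n\<ge>N. tv_le k (\<sigma> n) \<epsilon>"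
      using conv[OF \<sigma> l tc] by blast
    have "limitin R.mtopology \<sigma> k sequentially"
      unfolding R.limitin_metric
    proof (intro conjI allI impI)
      show "k \<in> \<Gamma>" by (rule k(1))
      fix \<epsilon> :: real assume e: "\<epsilon> > 0"
      have "\<forall>\<^sub>F n in sequentially. \<sigma> n \<in> Q \<and> d (\<sigma> n) k < \<epsilon>/2"
        using k(2) half_gt_zero[OF e] unfolding T D.limitin_metric by blast
      moreover have "\<forall>\<^sub>F n in sequentially. tv_le k (\<sigma> n) (\<epsilon>/2)"
        using k(3) half_gt_zero[OF e] unfolding eventually_sequentially by blast
      ultimately show "\<forall>\<^sub>F n in sequentially. \<sigma> n \<in> \<Gamma> \<and> \<rho> (\<sigma> n) k < \<epsilon>"
      proof eventually_elim
        case (elim n)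
        have kX: "k \<in> carrier X" using k(1) \<Gamma>X by blast
        have "tv_dist (\<sigma> n) k \<le> \<epsilon>/2" using elim(2) tv_le_iff_tv_dist[OF kX \<sigma>X] tv_dist_sym[of k] by simp
        then show ?case using elim \<sigma> tv_dist_nonneg[OF \<sigma>X[of n] kX] unfolding \<rho>_def by auto
      qed
    qed
    then show "\<exists>x. limitin R.mtopology \<sigma> x sequentially" by blast
  qed
  have one\<Gamma>: "\<one>\<^bsub>X\<^esub> \<in> \<Gamma>" using \<Gamma>I[OF G.one_closed] f_one by simp
  have "\<exists>p\<in>\<Gamma>. R.mtopology interior_of {p} \<noteq> {}"
  proof (rule ccontr)
    assume "\<not> ?thesis"
    then have "R.mtopology interior_of \<Union>((\<lambda>p. {p}) ` \<Gamma>) = {}"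
      using \<Gamma>c by (intro R.metric_Baire_category_alt \<open>R.mcomplete\<close>)
        (auto intro!: closedin_Hausdorff_singleton[OF R.Hausdorff_space_mtopology])
    moreover have "\<Union>((\<lambda>p. {p}) ` \<Gamma>) = topspace R.mtopology" by simp
    ultimately have "topspace R.mtopology = {}" by (metis interior_of_topspace)
    then show False using one\<Gamma> by simp
  qed
  then obtain p where p: "p \<in> \<Gamma>" "R.mtopology interior_of {p} \<noteq> {}" by blast
  then have "p \<in> R.mtopology interior_of {p}" using interior_of_subset[of R.mtopology "{p}"] by blast
  then obtain r where r: "r > 0" "R.mball p r \<subseteq> {p}"
    using openin_interior_of[of R.mtopology "{p}"] interior_of_subset[of R.mtopology "{p}"]
    unfolding R.openin_mtopology by blast
  \<comment> \<open>The shares \<open>r/2\<close> for the metric and \<open>r/4\<close> for total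
    variation add up to less than \<open>r\<close>.\<close>
  have iso: "y = p" if "y \<in> \<Gamma>" "d p y < r/2" "tv_le p y (r/4)" for y
  proof -
    have X: "p \<in> carrier X" "y \<in> carrier X" using that p \<Gamma>X by auto
    have "tv_dist p y \<le> r/4" "tv_dist p y \<ge> 0" using that(3) X tv_le_iff_tv_dist tv_dist_nonneg by auto
    then have "\<rho> p y < r" using that(2) r(1) unfolding \<rho>_def by linarith
    then show ?thesis using r(2) that(1) p(1) by (auto simp: R.in_mball)
  qed
  obtain K where K: "compactin (gtop X) K" "K \<in> sets M" "measure M K > 3/4" using compact_large by blast
  \<comment> \<open>\<open>L\<close> is compact and, by \<open>translates_meet\<close>, contains
    every element that moves \<open>M\<close> by at most \<open>1/4\<close>. This is how local
    compactness of \<open>X\<close> provides a convergent subsequence.\<close>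
  define L where "L = (\<lambda>(x, y). x \<otimes>\<^bsub>X\<^esub> inv\<^bsub>X\<^esub> y) ` (K \<times> K)"
  have "continuous_map (prod_topology (gtop X) (gtop X)) (prod_topology (gtop X) (gtop X)) (\<lambda>z. (fst z, inv\<^bsub>X\<^esub> (snd z)))"
    using tg_X unfolding continuous_map_pairwise topological_group_def
    by (auto simp: o_def continuous_map_fst intro: continuous_map_compose[OF continuous_map_snd, unfolded o_def])
  then have "continuous_map (prod_topology (gtop X) (gtop X)) (gtop X)
      ((\<lambda>(x, y). x \<otimes>\<^bsub>X\<^esub> y) \<circ> (\<lambda>z. (fst z, inv\<^bsub>X\<^esub> (snd z))))"
    using tg_X unfolding topological_group_def by (blast intro: continuous_map_compose)
  moreover have "(\<lambda>(x, y). x \<otimes>\<^bsub>X\<^esub> y) \<circ> (\<lambda>z. (fst z, inv\<^bsub>X\<^esub> (snd z))) = (\<lambda>(x, y). x \<otimes>\<^bsub>X\<^esub> inv\<^bsub>X\<^esub> y)"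
    by (auto simp: fun_eq_iff)
  ultimately have "continuous_map (prod_topology (gtop X) (gtop X)) (gtop X) (\<lambda>(x, y). x \<otimes>\<^bsub>X\<^esub> inv\<^bsub>X\<^esub> y)" by simp
  then have Lc: "compactin (gtop X) L"
    unfolding L_def by (rule image_compactin[rotated]) (simp add: compactin_Times K(1))
  have inL: "g \<in> L" if g: "g \<in> carrier X" "tv_le g \<one>\<^bsub>X\<^esub> (1/4)" for g
  proof -
    obtain x where x: "x \<in> K" "g \<otimes>\<^bsub>X\<^esub> x \<in> K" using translates_meet[OF g(1) K(2,3) g(2)] by blast
    have "x \<in> carrier X" using x(1) K(1) ts_X compactin_subset_topspace by blast
    then have "g = (g \<otimes>\<^bsub>X\<^esub> x) \<otimes>\<^bsub>X\<^esub> inv\<^bsub>X\<^esub> x" using g(1) by (simp add: X.m_assoc)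
    then show ?thesis unfolding L_def using x by (intro image_eqI[of _ _ "(g \<otimes>\<^bsub>X\<^esub> x, x)"]) auto
  qed
  \<comment> \<open>The offset \<open>4\<close> puts every member of the sequence into
    \<open>L\<close>, not only the late ones.\<close>
  have "\<exists>j. \<forall>n. tv_le (f (t (j n))) \<one>\<^bsub>X\<^esub> (1 / real (n + 4)) \<and> j n < j (Suc n)"
  proof (rule dependent_nat_choice)
    show "\<exists>x. tv_le (f (t x)) \<one>\<^bsub>X\<^esub> (1 / real (0 + 4))" using small[of "1 / real (0 + 4)" 0] by auto
    fix x n
    show "\<exists>y. tv_le (f (t y)) \<one>\<^bsub>X\<^esub> (1 / real (Suc n + 4)) \<and> x < y"
      using small[of "1 / real (Suc n + 4)" "Suc x"] by (auto simp: Suc_le_eq)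
  qed
  then obtain j where j: "\<And>n. tv_le (f (t (j n))) \<one>\<^bsub>X\<^esub> (1 / real (n + 4))" "strict_mono j"
    by (auto simp: strict_mono_Suc_iff)
  define y where "y n = f (t (j n))" for n
  have y\<Gamma>: "y n \<in> \<Gamma>" for n unfolding y_def using t(1,2) by (rule \<Gamma>I)
  then have yX: "y n \<in> carrier X" for n using \<Gamma>X by blast
  have "tv_le (y n) \<one>\<^bsub>X\<^esub> (1/4)" for n unfolding y_def by (rule tv_le_mono[OF j(1)]) simp
  then have "range y \<subseteq> L" using inL yX by blast
  then obtain l s where ls: "l \<in> L" "strict_mono s" "limitin (gtop X) (y \<circ> s) l sequentially"
    using Lc unfolding T D.compactin_sequentially by blast
  have small_y: "\<exists>N. \<forall>n\<ge>N. tv_le (y (s n)) \<one>\<^bsub>X\<^esub> \<epsilon>" if e: "\<epsilon> > 0" for \<epsilon>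
  proof -
    obtain N :: nat where N: "1 / \<epsilon> < real N" using reals_Archimedean2 by blast
    have "tv_le (y (s n)) \<one>\<^bsub>X\<^esub> \<epsilon>" if "n \<ge> N" for n
    proof -
      have "real N \<le> real (s n + 4)" using seq_suble[OF ls(2), of n] that by simp
      then have "1 / \<epsilon> < real (s n + 4)" using N by linarith
      then have "1 / real (s n + 4) \<le> \<epsilon>" using e by (simp add: field_simps)
      then show ?thesis unfolding y_def by (rule tv_le_mono[OF j(1)])
    qed
    then show ?thesis by blast
  qed
  have "\<exists>l\<in>\<Gamma>. limitin (gtop X) (y \<circ> s) l sequentially \<and> (\<forall>\<epsilon>>0. \<exists>N. \<forall>n\<ge>N. tv_le l ((y \<circ> s) n) \<epsilon>)"
  proof (rule conv[OF _ ls(3)])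
    show "range (y \<circ> s) \<subseteq> \<Gamma>" using y\<Gamma> by auto
    show "\<forall>\<epsilon>>0. \<exists>N. \<forall>n\<ge>N. \<forall>m\<ge>N. tv_le ((y \<circ> s) n) ((y \<circ> s) m) \<epsilon>"
    proof (intro allI impI)
      fix \<epsilon> :: real assume "\<epsilon> > 0"
      then obtain N where N: "\<forall>n\<ge>N. tv_le (y (s n)) \<one>\<^bsub>X\<^esub> (\<epsilon>/2)" using small_y half_gt_zero by blast
      have "tv_le (y (s n)) (y (s m)) \<epsilon>" if "n \<ge> N" "m \<ge> N" for n m
        using tv_le_trans[of "y (s n)" _ "\<epsilon>/2" "y (s m)" "\<epsilon>/2"] N that tv_le_sym by fastforce
      then show "\<exists>N. \<forall>n\<ge>N. \<forall>m\<ge>N. tv_le ((y \<circ> s) n) ((y \<circ> s) m) \<epsilon>" by auto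
    qed
  qed
  then obtain k where k: "k \<in> \<Gamma>" "limitin (gtop X) (y \<circ> s) k sequentially"
    "\<And>\<epsilon>. \<epsilon> > 0 \<Longrightarrow> \<exists>N. \<forall>n\<ge>N. tv_le k (y (s n)) \<epsilon>" by auto
  \<comment> \<open>Discreteness spreads from \<open>p\<close> to the limit \<open>k\<close>: since
    \<open>k\<close> is an involution, multiplication by \<open>q\<close> carries \<open>k\<close>
    to \<open>p\<close>, so the translated sequence is eventually \<open>p\<close> and the sequence
    itself eventually \<open>k\<close>.\<close>
  define q where "q = p \<otimes>\<^bsub>X\<^esub> k"
  have kX: "k \<in> carrier X" "p \<in> carrier X" using k(1) p(1) \<Gamma>X by auto
  have q: "q \<in> \<Gamma>" "q \<in> carrier X" "q \<otimes>\<^bsub>X\<^esub> k = p"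
  proof -
    show "q \<in> \<Gamma>" unfolding q_def using \<Gamma>_mult p(1) k(1) by blast
    then show "q \<in> carrier X" using \<Gamma>X by blast
    have "k \<otimes>\<^bsub>X\<^esub> k = \<one>\<^bsub>X\<^esub>" using X.r_inv[OF kX(1)] \<Gamma>_inv[OF k(1)] by simp
    then show "q \<otimes>\<^bsub>X\<^esub> k = p" unfolding q_def using kX by (simp add: X.m_assoc)
  qed
  have "limitin (gtop X) ((\<lambda>x. q \<otimes>\<^bsub>X\<^esub> x) \<circ> (y \<circ> s)) (q \<otimes>\<^bsub>X\<^esub> k) sequentially"
    by (rule continuous_map_limit[OF translate_continuous[OF tg_X q(2)] k(2)])
  then have "\<forall>\<epsilon>>0. \<forall>\<^sub>F n in sequentially. q \<otimes>\<^bsub>X\<^esub> y (s n) \<in> Q \<and> d (q \<otimes>\<^bsub>X\<^esub> y (s n)) p < \<epsilon>"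
    unfolding T D.limitin_metric q(3) o_def by (elim conjE)
  from this[rule_format, OF half_gt_zero[OF r(1)]]
  have "\<forall>\<^sub>F n in sequentially. d (q \<otimes>\<^bsub>X\<^esub> y (s n)) p < r/2" by (rule eventually_mono) (elim conjE)
  then obtain N1 where N1: "\<And>n. n \<ge> N1 \<Longrightarrow> d (q \<otimes>\<^bsub>X\<^esub> y (s n)) p < r/2" unfolding eventually_sequentially by blast
  have "r/4 > 0" using r(1) by simp
  then obtain N2 where N2: "\<And>n. n \<ge> N2 \<Longrightarrow> tv_le k (y (s n)) (r/4)" using k(3) by blast
  have eq: "y (s n) = k" if n: "n \<ge> max N1 N2" for n
  proof -
    have "q \<otimes>\<^bsub>X\<^esub> y (s n) = p"
    proof (rule iso)
      show "q \<otimes>\<^bsub>X\<^esub> y (s n) \<in> \<Gamma>" using \<Gamma>_mult q(1) y\<Gamma> by blast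
      show "d p (q \<otimes>\<^bsub>X\<^esub> y (s n)) < r/2" using N1[of n] n D.commute by simp
      show "tv_le p (q \<otimes>\<^bsub>X\<^esub> y (s n)) (r/4)"
        using tv_le_left[OF N2[of n] q(2) kX(1) yX] n q(3) by simp
    qed
    also have "p = q \<otimes>\<^bsub>X\<^esub> k" by (rule q(3)[symmetric])
    finally show ?thesis using q(2) kX(1) yX by simp
  qed
  have "y (s (max N1 N2)) = y (s (Suc (max N1 N2)))"
    using eq[OF order_refl] eq[OF le_SucI[OF order_refl]] by (simp only:)
  then have "t (j (s (max N1 N2))) = t (j (s (Suc (max N1 N2))))"
    unfolding y_def using f_inj t(1) by (auto dest: inj_onD)
  then have "j (s (max N1 N2)) = j (s (Suc (max N1 N2)))" using t(3) by (auto dest: injD)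
  moreover have "j (s (max N1 N2)) < j (s (Suc (max N1 N2)))"
    using j(2) ls(2) by (simp add: strict_mono_def)
  ultimately show False by simp
qed

end

text \<open>The order of quantifiers in \<open>roots\<close> is the point: \<open>p\<close> and
  \<open>F\<close> may depend on the neighbourhood, the powers \<open>t i\<close> may not. Total
  variation is small on a whole neighbourhood, hence on all products \<open>F S\<close>, and
  averaging transfers this to infinitely many \<open>t j\<close>.\<close>

theorem not_QI_group:
  fixes G :: "'g topgroup"
  assumes comm: "\<And>x y. x \<in> carrier G \<Longrightarrow> y \<in> carrier G \<Longrightarrow> x \<otimes>\<^bsub>G\<^esub> y = y \<otimes>\<^bsub>G\<^esub> x"
    and cnt: "countable {v \<in> carrier G. v \<otimes>\<^bsub>G\<^esub> v = \<one>\<^bsub>G\<^esub>}"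
    and t: "\<And>i. t i \<in> carrier G" "\<And>i. t i \<otimes>\<^bsub>G\<^esub> t i = \<one>\<^bsub>G\<^esub>" "inj (t :: nat \<Rightarrow> 'g)"
    and roots: "\<And>W. openin (gtop G) W \<Longrightarrow> \<one>\<^bsub>G\<^esub> \<in> W \<Longrightarrow> \<exists>(p::nat) F.
      (\<forall>S. finite S \<longrightarrow> F S \<in> carrier G \<inter> W) \<and> F {} = \<one>\<^bsub>G\<^esub> \<and>
      (\<forall>i S. finite S \<longrightarrow> i \<notin> S \<longrightarrow> F (insert i S) = F S \<otimes>\<^bsub>G\<^esub> F {i}) \<and> (\<forall>i. F {i} [^]\<^bsub>G\<^esub> p = t i)"
  shows "\<not> QI_group G"
proof
  assume "QI_group G"
  then obtain X :: "(nat \<Rightarrow> complex) topgroup" and M f where "polish_group G" "QI_witness G X M f"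
    unfolding QI_group_def by blast
  then interpret qi_witness G X M f by unfold_locales
  show False
  proof (rule no_distinct_involutions[OF comm cnt t])
    fix J and \<epsilon> :: real assume e: "\<epsilon> > 0"
    \<comment> \<open>Chosen so that \<open>24 * \<delta> = (\<epsilon>/2)\<^sup>2\<close>, the form
      from which \<open>sq_norm_imp_tv\<close> returns \<open>2 * (\<epsilon>/2)\<close>.\<close>
    define \<delta> where "\<delta> = (\<epsilon>/2)\<^sup>2 / 24"
    have d: "\<delta> > 0" using e by (simp add: \<delta>_def)
    obtain W where W: "openin (gtop G) W" "\<one>\<^bsub>G\<^esub> \<in> W" "\<And>g. g \<in> W \<Longrightarrow> tv_le (f g) \<one>\<^bsub>X\<^esub> \<delta>"
      using tv_continuous[OF d] by blast
    obtain p :: nat and F where F: "\<And>S. finite S \<Longrightarrow> F S \<in> carrier G \<inter> W" "F {} = \<one>\<^bsub>G\<^esub>"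
      "\<And>i S. finite S \<Longrightarrow> i \<notin> S \<Longrightarrow> F (insert i S) = F S \<otimes>\<^bsub>G\<^esub> F {i}" "\<And>i. F {i} [^]\<^bsub>G\<^esub> p = t i"
      using roots[OF W(1,2)] by metis
    have "\<exists>j\<ge>J. sq_norm (\<lambda>x. 1 - sqrt (rho (f (F {j} [^]\<^bsub>G\<^esub> p)) x)) \<le> ennreal (24 * \<delta>)"
      by (rule uniformly_small_powers[OF _ F(2,3) _ d]) (use F(1) W(3) in auto)
    then obtain j where j: "j \<ge> J" "sq_norm (\<lambda>x. 1 - sqrt (rho (f (t j)) x)) \<le> ennreal ((\<epsilon>/2)\<^sup>2)"
      unfolding F(4) \<delta>_def by auto
    have "tv_le (f (t j)) \<one>\<^bsub>X\<^esub> (2 * (\<epsilon>/2))"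
      by (rule sq_norm_imp_tv[OF t(1) j(2)]) (use e in simp)
    then show "\<exists>j\<ge>J. tv_le (f (t j)) \<one>\<^bsub>X\<^esub> \<epsilon>" using j(1) by auto
  qed
qed

section \<open>Square-summable sequences\<close>

lemma l2_dist_eq:
  assumes "summable (\<lambda>n. (norm (x n - y n))\<^sup>2)"
  shows "l2_dist x y = sqrt (\<Sum>n. (norm (x n - y n))\<^sup>2)"
  unfolding l2_dist_def
  by (rule arg_cong[of _ _ sqrt], rule infsumI, rule sums_nonneg_imp_has_sum)
    (use assms in \<open>auto simp: summable_sums\<close>)

lemma T2H_summable:
  assumes "x \<in> T2H_set" "y \<in> T2H_set"
  shows "summable (\<lambda>n. (norm (x n - y n))\<^sup>2)"
proof -
  have "summable (\<lambda>n. (norm ((x n - 1) + (1 - y n)))\<^sup>2)"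
    by (intro square_summable_add) (use assms in \<open>auto simp: T2H_set_def norm_minus_commute\<close>)
  then show ?thesis by simp
qed

lemma ell2_summable:
  assumes "x \<in> ell2_set" "y \<in> ell2_set"
  shows "summable (\<lambda>n. (norm (x n - y n))\<^sup>2)"
proof -
  have "summable (\<lambda>n. (norm (x n + - y n))\<^sup>2)"
    by (intro square_summable_add) (use assms in \<open>auto simp: ell2_set_def\<close>)
  then show ?thesis by simp
qed

interpretation T: Metric_space T2H_set l2_dist by (rule Metric_space_T2H)
interpretation E: Metric_space ell2_set l2_dist by (rule Metric_space_ell2)

lemma l2_dist_le:
  fixes x y :: "nat \<Rightarrow> 'a::real_normed_vector" and u v :: "nat \<Rightarrow> 'b::real_normed_vector"
  assumes s: "summable (\<lambda>n. (norm (u n - v n))\<^sup>2)" and c: "c \<ge> 0"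
    and le: "\<And>n. norm (x n - y n) \<le> c * norm (u n - v n)"
  shows "l2_dist x y \<le> c * l2_dist u v"
proof -
  have le2: "(norm (x n - y n))\<^sup>2 \<le> c\<^sup>2 * (norm (u n - v n))\<^sup>2" for n
    using power_mono[OF le[of n], of 2] by (simp add: power_mult_distrib)
  have s': "summable (\<lambda>n. (norm (x n - y n))\<^sup>2)"
    by (rule summable_comparison_test'[OF summable_mult[OF s, of "c\<^sup>2"]]) (use le2 in auto)
  have "(\<Sum>n. (norm (x n - y n))\<^sup>2) \<le> (\<Sum>n. c\<^sup>2 * (norm (u n - v n))\<^sup>2)"
    by (rule suminf_le[OF le2 s' summable_mult[OF s]])
  also have "\<dots> = c\<^sup>2 * (\<Sum>n. (norm (u n - v n))\<^sup>2)" by (rule suminf_mult[OF s])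
  finally have "sqrt (\<Sum>n. (norm (x n - y n))\<^sup>2) \<le> sqrt (c\<^sup>2 * (\<Sum>n. (norm (u n - v n))\<^sup>2))"
    by (rule real_sqrt_le_mono)
  then show ?thesis using c by (simp add: l2_dist_eq[OF s] l2_dist_eq[OF s'] real_sqrt_mult)
qed

lemma l2_dist_coord:
  assumes s: "summable (\<lambda>n. (norm (x n - y n))\<^sup>2)"
  shows "norm (x n - y n) \<le> l2_dist x y"
proof -
  have "(\<Sum>i\<in>{n}. (norm (x i - y i))\<^sup>2) \<le> (\<Sum>n. (norm (x n - y n))\<^sup>2)"
    by (rule sum_le_suminf[OF s]) auto
  then have "(norm (x n - y n))\<^sup>2 \<le> (\<Sum>n. (norm (x n - y n))\<^sup>2)" by simp
  then show ?thesis unfolding l2_dist_eq[OF s] by (rule real_le_rsqrt)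
qed

lemma T2H_mult_closed:
  assumes "z \<in> T2H_set" "w \<in> T2H_set" shows "(\<lambda>n. z n * w n) \<in> T2H_set"
proof -
  have n: "cmod (z n) = 1" "cmod (w n) = 1" for n using assms by (auto simp: T2H_set_def)
  have inv: "cmod (cnj (z n)) = 1" for n using n by simp
  have "summable (\<lambda>n. (norm ((1 - z n) + z n * (1 - w n)))\<^sup>2)"
    by (intro square_summable_add) (use assms n in \<open>auto simp: T2H_set_def norm_mult\<close>)
  then show ?thesis using n by (auto simp: T2H_set_def norm_mult algebra_simps)
qed

lemma T2H_cnj_closed: "z \<in> T2H_set \<Longrightarrow> (\<lambda>n. cnj (z n)) \<in> T2H_set"
proof -
  assume z: "z \<in> T2H_set"
  have "cmod (1 - cnj (z n)) = cmod (1 - z n)" for n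
    by (metis complex_cnj_diff complex_cnj_one complex_mod_cnj)
  then show ?thesis using z by (simp add: T2H_set_def)
qed

lemma T2H_one: "(\<lambda>n. 1) \<in> T2H_set" by (simp add: T2H_set_def)

lemma T2H_simps: "carrier T2H = T2H_set" "monoid.mult T2H = (\<lambda>z w n. z n * w n)" "one T2H = (\<lambda>n. 1)"
    "gtop T2H = T.mtopology"
  by (simp_all add: T2H_def)

lemma ell2_simps: "carrier ell2 = ell2_set" "monoid.mult ell2 = (\<lambda>x y n. x n + y n)" "one ell2 = (\<lambda>n. 0)"
    "gtop ell2 = E.mtopology"
  by (simp_all add: ell2_def)

lemma comm_group_T2H: "comm_group T2H"
proof (rule comm_groupI)
  fix x assume x: "x \<in> carrier T2H"
  have "cnj (x n) * x n = 1" for n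
    using x complex_norm_square[of "x n"] by (simp add: T2H_simps T2H_set_def mult.commute)
  then have "(\<lambda>n. cnj (x n)) \<otimes>\<^bsub>T2H\<^esub> x = \<one>\<^bsub>T2H\<^esub>" by (simp add: T2H_simps)
  then show "\<exists>y\<in>carrier T2H. y \<otimes>\<^bsub>T2H\<^esub> x = \<one>\<^bsub>T2H\<^esub>" using T2H_cnj_closed x by (auto simp: T2H_simps)
qed (auto simp: T2H_simps T2H_mult_closed T2H_one ac_simps)

lemma ell2_add_closed:
  assumes "x \<in> ell2_set" "y \<in> ell2_set" shows "(\<lambda>n. x n + y n) \<in> ell2_set"
  using square_summable_add[of x y] assms by (simp add: ell2_set_def)

lemma ell2_scale_closed: "x \<in> ell2_set \<Longrightarrow> (\<lambda>n. c * x n) \<in> ell2_set"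
  by (simp add: ell2_set_def power_mult_distrib summable_mult)

lemma comm_group_ell2: "comm_group ell2"
proof (rule comm_groupI)
  fix x assume x: "x \<in> carrier ell2"
  then have "(\<lambda>n. - x n) \<in> carrier ell2" by (simp add: ell2_simps ell2_set_def)
  moreover have "(\<lambda>n. - x n) \<otimes>\<^bsub>ell2\<^esub> x = \<one>\<^bsub>ell2\<^esub>" by (simp add: ell2_simps)
  ultimately show "\<exists>y\<in>carrier ell2. y \<otimes>\<^bsub>ell2\<^esub> x = \<one>\<^bsub>ell2\<^esub>" by blast
qed (auto simp: ell2_simps ell2_add_closed ac_simps, auto simp: ell2_set_def)

text \<open>For an invariant metric on an abelian group, multiplication is 1-Lipschitz in each variable
  and inversion is an isometry.\<close>

lemma topological_group_invariant_metric:
  fixes G :: "'a topgroup"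
  assumes G: "comm_group G" and ms: "Metric_space (carrier G) d" and T: "gtop G = Metric_space.mtopology (carrier G) d"
    and inv: "\<And>x y z. x \<in> carrier G \<Longrightarrow> y \<in> carrier G \<Longrightarrow> z \<in> carrier G \<Longrightarrow> d (z \<otimes>\<^bsub>G\<^esub> x) (z \<otimes>\<^bsub>G\<^esub> y) = d x y"
  shows "topological_group G"
proof -
  interpret G: comm_group G by (rule G)
  interpret D: Metric_space "carrier G" d by (rule ms)
  have m: "d (x \<otimes>\<^bsub>G\<^esub> y) (x' \<otimes>\<^bsub>G\<^esub> y') \<le> d x x' + d y y'"
    if c: "x \<in> carrier G" "y \<in> carrier G" "x' \<in> carrier G" "y' \<in> carrier G" for x y x' y'
  proof -
    have "d (x \<otimes>\<^bsub>G\<^esub> y) (x' \<otimes>\<^bsub>G\<^esub> y') \<le> d (x \<otimes>\<^bsub>G\<^esub> y) (x' \<otimes>\<^bsub>G\<^esub> y) + d (x' \<otimes>\<^bsub>G\<^esub> y) (x' \<otimes>\<^bsub>G\<^esub> y')"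
      by (rule D.triangle) (use c in auto)
    also have "d (x \<otimes>\<^bsub>G\<^esub> y) (x' \<otimes>\<^bsub>G\<^esub> y) = d (y \<otimes>\<^bsub>G\<^esub> x) (y \<otimes>\<^bsub>G\<^esub> x')" using c G.m_comm by simp
    finally show ?thesis using inv c by simp
  qed
  have i: "d (inv\<^bsub>G\<^esub> x) (inv\<^bsub>G\<^esub> y) = d x y" if c: "x \<in> carrier G" "y \<in> carrier G" for x y
  proof -
    have "d (inv\<^bsub>G\<^esub> x) (inv\<^bsub>G\<^esub> y) = d ((x \<otimes>\<^bsub>G\<^esub> y) \<otimes>\<^bsub>G\<^esub> inv\<^bsub>G\<^esub> x) ((x \<otimes>\<^bsub>G\<^esub> y) \<otimes>\<^bsub>G\<^esub> inv\<^bsub>G\<^esub> y)"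
      by (rule inv[symmetric]) (use c in auto)
    also have "(x \<otimes>\<^bsub>G\<^esub> y) \<otimes>\<^bsub>G\<^esub> inv\<^bsub>G\<^esub> x = y" using c by (simp add: G.m_comm[of x y] G.m_assoc)
    also have "(x \<otimes>\<^bsub>G\<^esub> y) \<otimes>\<^bsub>G\<^esub> inv\<^bsub>G\<^esub> y = x" using c by (simp add: G.m_assoc)
    finally show ?thesis by (simp add: D.commute)
  qed
  have ci: "continuous_map (gtop G) (gtop G) (\<lambda>x. inv\<^bsub>G\<^esub> x)"
    unfolding T Metric_space.metric_continuous_map[OF ms ms]
    using i by (auto intro!: exI)
  have cm: "continuous_map (prod_topology (gtop G) (gtop G)) (gtop G) (\<lambda>(x, y). x \<otimes>\<^bsub>G\<^esub> y)"
    unfolding continuous_map_def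
  proof (intro conjI allI impI)
    show "(\<lambda>(x, y). x \<otimes>\<^bsub>G\<^esub> y) \<in> topspace (prod_topology (gtop G) (gtop G)) \<rightarrow> topspace (gtop G)"
      by (auto simp: T)
    fix U assume U: "openin (gtop G) U"
    show "openin (prod_topology (gtop G) (gtop G)) {x \<in> topspace (prod_topology (gtop G) (gtop G)). (\<lambda>(x, y). x \<otimes>\<^bsub>G\<^esub> y) x \<in> U}"
      unfolding openin_prod_topology_alt
    proof (intro allI impI)
      fix x y assume "(x, y) \<in> {x \<in> topspace (prod_topology (gtop G) (gtop G)). (\<lambda>(x, y). x \<otimes>\<^bsub>G\<^esub> y) x \<in> U}"
      then have xy: "x \<in> carrier G" "y \<in> carrier G" "x \<otimes>\<^bsub>G\<^esub> y \<in> U" by (auto simp: T)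
      obtain r where r: "r > 0" "D.mball (x \<otimes>\<^bsub>G\<^esub> y) r \<subseteq> U"
        using U xy(3) unfolding T D.openin_mtopology by blast
      show "\<exists>V W. openin (gtop G) V \<and> openin (gtop G) W \<and> x \<in> V \<and> y \<in> W \<and>
          V \<times> W \<subseteq> {x \<in> topspace (prod_topology (gtop G) (gtop G)). (\<lambda>(x, y). x \<otimes>\<^bsub>G\<^esub> y) x \<in> U}"
      proof (intro exI conjI)
        show "openin (gtop G) (D.mball x (r/2))" "openin (gtop G) (D.mball y (r/2))" by (simp_all add: T)
        show "x \<in> D.mball x (r/2)" "y \<in> D.mball y (r/2)" using xy r by auto
        show "D.mball x (r/2) \<times> D.mball y (r/2)
            \<subseteq> {x \<in> topspace (prod_topology (gtop G) (gtop G)). (\<lambda>(x, y). x \<otimes>\<^bsub>G\<^esub> y) x \<in> U}"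
        proof (clarsimp simp: T, intro subsetD[OF r(2)])
          fix a b assume ab: "a \<in> carrier G" "b \<in> carrier G" "d x a * 2 < r" "d y b * 2 < r"
          have "d (x \<otimes>\<^bsub>G\<^esub> y) (a \<otimes>\<^bsub>G\<^esub> b) < r" using m[of x y a b] xy ab by simp
          then show "a \<otimes>\<^bsub>G\<^esub> b \<in> D.mball (x \<otimes>\<^bsub>G\<^esub> y) r" using xy ab by simp
        qed
      qed
    qed
  qed
  show ?thesis unfolding topological_group_def
    using ci cm G.is_group by (simp add: T)
qed

lemma topological_group_T2H: "topological_group T2H"
proof (rule topological_group_invariant_metric[OF comm_group_T2H, where d = l2_dist])
  show "Metric_space (carrier T2H) l2_dist" by (simp add: T2H_simps Metric_space_T2H)
  fix x y z assume "x \<in> carrier T2H" "y \<in> carrier T2H" "z \<in> carrier T2H"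
  then have "cmod (z n * x n - z n * y n) = cmod (x n - y n)" for n
    by (simp add: T2H_simps T2H_set_def norm_mult flip: right_diff_distrib)
  then show "l2_dist (z \<otimes>\<^bsub>T2H\<^esub> x) (z \<otimes>\<^bsub>T2H\<^esub> y) = l2_dist x y"
    by (simp add: T2H_simps l2_dist_def)
qed (simp add: T2H_simps)

section \<open>Angles and chords of the circle\<close>

definition wrap :: "(nat \<Rightarrow> real) \<Rightarrow> nat \<Rightarrow> complex" where
  "wrap x n = cis (2 * pi * x n)"

lemma cmod_cis_minus_1: "cmod (cis t - 1) = 2 * \<bar>sin (t / 2)\<bar>"
proof -
  have "cis t - 1 = cis (t/2) * (cis (t/2) - cis (- (t/2)))"
    by (simp only: right_diff_distrib cis_mult) simp
  also have "cis (t/2) - cis (- (t/2)) = 2 * \<i> * of_real (sin (t/2))" by (simp add: complex_eq_iff)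
  finally show ?thesis by (simp add: norm_mult)
qed

lemma cmod_cis_diff: "cmod (cis a - cis b) = 2 * \<bar>sin ((a - b) / 2)\<bar>"
proof -
  have "cis a - cis b = cis b * (cis (a - b) - 1)" by (simp add: right_diff_distrib cis_mult)
  then show ?thesis by (simp add: norm_mult cmod_cis_minus_1)
qed

lemma cmod_cis_diff_le: "cmod (cis a - cis b) \<le> \<bar>a - b\<bar>"
  unfolding cmod_cis_diff using abs_sin_x_le_abs_x[of "(a - b) / 2"] by simp

text \<open>The chord is \<open>2 * \<bar>sin (pi * t)\<bar>\<close>, so a weak form of Jordan's
  inequality is enough: up to \<open>1/6\<close> by the mean value theorem with cosine at least
  \<open>1/2\<close>, beyond it by monotonicity of the sine from its value \<open>1/2\<close> at
  \<open>pi/6\<close>.\<close>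

lemma cmod_cis_diff_ge:
  assumes "\<bar>t\<bar> \<le> 1/2" shows "\<bar>t\<bar> \<le> cmod (1 - cis (2 * pi * t))"
proof -
  have jordan: "s \<le> sin (pi * s)" if s: "0 \<le> s" "s \<le> 1/2" for s :: real
  proof (cases "s = 0")
    case False
    show ?thesis
    proof (cases "s \<le> 1/6")
      case True
      have "pi * s > 0" using False s by simp
      then obtain c where c: "0 < c" "c < pi * s" "sin (pi * s) - sin 0 = (pi * s - 0) * cos c"
        using MVT2[of 0 "pi * s" sin cos] by (auto intro: derivative_eq_intros)
      have "pi * s \<le> pi * (1/6)" by (rule mult_left_mono) (use True in auto)
      then have "c \<le> pi / 3" using c(2) pi_gt_zero by linarith
      then have "cos (pi/3) \<le> cos c" using c by (intro cos_monotone_0_pi_le) auto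
      then have "1/2 \<le> cos c" by (simp add: cos_60)
      then have "(pi * s) * (1/2) \<le> (pi * s) * cos c" using s by (intro mult_left_mono) auto
      then have "pi * s / 2 \<le> sin (pi * s)" using c(3) by simp
      moreover have "2 * s \<le> pi * s" by (rule mult_right_mono) (use pi_ge_two s in auto)
      ultimately show ?thesis by simp
    next
      case False
      have "pi * (1/6) \<le> pi * s" "pi * s \<le> pi * (1/2)" by (rule mult_left_mono, use False s in auto)+
      then have "sin (pi/6) \<le> sin (pi * s)" by (intro sin_monotone_2pi_le) auto
      then show ?thesis using s by (simp add: sin_30)
    qed
  qed simp
  have "cmod (1 - cis (2 * pi * t)) = 2 * \<bar>sin (pi * t)\<bar>"
    using cmod_cis_minus_1[of "2 * pi * t"] by (simp add: norm_minus_commute)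
  moreover have "\<bar>t\<bar> \<le> \<bar>sin (pi * t)\<bar>"
    using jordan[of t] jordan[of "- t"] assms by (cases "t \<ge> 0") auto
  ultimately show ?thesis by simp
qed

section \<open>The covering of \<open>T2H\<close> by \<open>ell2\<close>\<close>

lemma cmod_wrap[simp]: "cmod (wrap x n) = 1" by (simp add: wrap_def)

lemma wrap_add: "wrap (\<lambda>n. x n + y n) = (\<lambda>n. wrap x n * wrap y n)"
  by (simp add: wrap_def fun_eq_iff cis_mult distrib_left)

lemma wrap_zero: "wrap (\<lambda>n. 0) = (\<lambda>n. 1)" by (simp add: wrap_def fun_eq_iff)

lemma cmod_wrap_diff_le: "cmod (wrap x n - wrap y n) \<le> 2 * pi * \<bar>x n - y n\<bar>"
  unfolding wrap_def using cmod_cis_diff_le[of "2 * pi * x n" "2 * pi * y n"]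
  by (simp add: abs_mult flip: right_diff_distrib)

lemma zero_ell2: "(\<lambda>n. 0) \<in> ell2_set" by (simp add: ell2_set_def)

lemma l2_dist_wrap:
  assumes "x \<in> ell2_set" "y \<in> ell2_set"
  shows "l2_dist (wrap x) (wrap y) \<le> (2 * pi) * l2_dist x y"
  by (rule l2_dist_le[OF ell2_summable[OF assms]]) (use cmod_wrap_diff_le in auto)

lemma wrap_in_T2H: assumes x: "x \<in> ell2_set" shows "wrap x \<in> T2H_set"
proof -
  have "summable (\<lambda>n. (cmod (1 - wrap x n))\<^sup>2)"
  proof (rule summable_comparison_test')
    show "summable (\<lambda>n. (2 * pi)\<^sup>2 * (x n)\<^sup>2)" using x by (simp add: ell2_set_def summable_mult)
    fix n
    have "cmod (1 - wrap x n) \<le> 2 * pi * \<bar>x n\<bar>"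
      using cmod_wrap_diff_le[of "\<lambda>n. 0" n x] by (simp add: wrap_zero)
    from power_mono[OF this, of 2] show "norm ((cmod (1 - wrap x n))\<^sup>2) \<le> (2 * pi)\<^sup>2 * (x n)\<^sup>2"
      by (simp add: power_mult_distrib)
  qed
  then show ?thesis by (simp add: T2H_set_def)
qed

lemma circle_angle: assumes "cmod z = 1" obtains t where "z = cis (2 * pi * t)" "\<bar>t\<bar> \<le> 1/2"
proof
  have "z \<noteq> 0" using assms by auto
  then have A: "cis (Arg z) = z" "- pi < Arg z" "Arg z \<le> pi" using assms Arg_bounded by (auto simp: cis_Arg sgn_div_norm)
  show "z = cis (2 * pi * (Arg z / (2 * pi)))" using A by simp
  have "\<bar>Arg z\<bar> \<le> pi" using A by linarith
  then show "\<bar>Arg z / (2 * pi)\<bar> \<le> 1/2" by (simp add: abs_divide field_simps)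
qed

text \<open>Principal angles do not exceed the chords, so square summability passes from the chords
  to the angles. This section of \<open>wrap\<close> serves for surjectivity, openness and paths
  alike.\<close>

lemma unwrap:
  assumes z: "z \<in> T2H_set"
  obtains t where "t \<in> ell2_set" "wrap t = z" "\<And>n. \<bar>t n\<bar> \<le> cmod (1 - z n)"
proof -
  have "\<exists>t. z n = cis (2 * pi * t) \<and> \<bar>t\<bar> \<le> 1/2" for n
  proof -
    have "cmod (z n) = 1" using z by (simp add: T2H_set_def)
    from circle_angle[OF this] show ?thesis by metis
  qed
  then obtain t where t: "\<And>n. z n = cis (2 * pi * t n)" "\<And>n. \<bar>t n\<bar> \<le> 1/2" by metis
  have le: "\<bar>t n\<bar> \<le> cmod (1 - z n)" for n unfolding t(1) by (rule cmod_cis_diff_ge[OF t(2)])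
  have "summable (\<lambda>n. (t n)\<^sup>2)"
  proof (rule summable_comparison_test')
    show "summable (\<lambda>n. (cmod (1 - z n))\<^sup>2)" using z by (simp add: T2H_set_def)
    fix n show "norm ((t n)\<^sup>2) \<le> (cmod (1 - z n))\<^sup>2" using power_mono[OF le, of n 2] by simp
  qed
  then show thesis using t le by (intro that[of t]) (auto simp: ell2_set_def wrap_def fun_eq_iff)
qed

lemma wrap_surj: "wrap ` ell2_set = T2H_set"
  using wrap_in_T2H unwrap by (metis image_eqI image_subsetI subsetI subset_antisym)

lemma Z0_ell2: "Z0 \<subseteq> ell2_set"
proof
  fix x assume "x \<in> Z0"
  then have "finite {n. x n \<noteq> 0}" by (simp add: Z0_def)
  then have "summable (\<lambda>n. (x n)\<^sup>2)" by (rule summable_finite) auto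
  then show "x \<in> ell2_set" by (simp add: ell2_set_def)
qed

text \<open>A square-summable sequence tends to zero, and integers tending to zero vanish from some
  index on.\<close>

lemma wrap_kernel: "{x \<in> ell2_set. wrap x = (\<lambda>n. 1)} = Z0"
proof (intro equalityI subsetI)
  fix x assume "x \<in> Z0"
  then show "x \<in> {x \<in> ell2_set. wrap x = (\<lambda>n. 1)}"
    using Z0_ell2 by (auto simp: Z0_def wrap_def fun_eq_iff)
next
  fix x assume "x \<in> {x \<in> ell2_set. wrap x = (\<lambda>n. 1)}"
  then have x: "x \<in> ell2_set" "\<And>n. cis (2 * pi * x n) = 1" by (auto simp: wrap_def fun_eq_iff)
  have int: "x n \<in> \<int>" for n
  proof -
    have "cos (2 * pi * x n) = 1" using x(2)[of n] by (simp add: complex_eq_iff)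
    then obtain k :: int where "2 * pi * x n = real_of_int k * 2 * pi" unfolding cos_one_2pi_int ..
    then show ?thesis by simp
  qed
  have "(\<lambda>n. (x n)\<^sup>2) \<longlonglongrightarrow> 0" using x(1) by (intro summable_LIMSEQ_zero) (simp add: ell2_set_def)
  then have "\<forall>\<^sub>F n in sequentially. (x n)\<^sup>2 < 1" by (rule order_tendstoD) simp
  then obtain N where N: "\<And>n. n \<ge> N \<Longrightarrow> (x n)\<^sup>2 < 1" unfolding eventually_sequentially by blast
  have "x n = 0" if "n \<ge> N" for n
  proof -
    have "\<bar>x n\<bar> < 1" using N[OF that] by (simp add: abs_square_less_1)
    then show ?thesis using int[of n] by (metis Ints_nonzero_abs_less1)
  qed
  then have "{n. x n \<noteq> 0} \<subseteq> {..<N}" by (auto simp: not_less[symmetric])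
  then show "x \<in> Z0" using int finite_subset by (auto simp: Z0_def)
qed

lemma wrap_group_hom: "group_hom ell2 T2H wrap"
proof -
  interpret E: comm_group ell2 by (rule comm_group_ell2)
  interpret T: comm_group T2H by (rule comm_group_T2H)
  show ?thesis
    by unfold_locales (auto simp: hom_def ell2_simps T2H_simps wrap_in_T2H wrap_add)
qed

lemma kernel_wrap: "kernel ell2 T2H wrap = Z0"
  unfolding kernel_def using wrap_kernel by (simp add: ell2_simps T2H_simps)

text \<open>Two integer sequences at distance below one differ by less than one in every coordinate,
  hence coincide.\<close>

lemma discrete_Z0: "discrete_subgroup Z0 ell2"
  unfolding discrete_subgroup_def
proof
  interpret group_hom ell2 T2H wrap by (rule wrap_group_hom)
  show "subgroup Z0 ell2" using subgroup_kernel kernel_wrap by simp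
  have "openin (subtopology E.mtopology Z0) {x}" if x: "x \<in> Z0" for x
  proof -
    have "y = x" if "y \<in> Z0" "l2_dist x y < 1" for y
    proof
      fix n
      have "norm (x n - y n) \<le> l2_dist x y" using x that Z0_ell2 by (intro l2_dist_coord ell2_summable) auto
      then have "\<bar>x n - y n\<bar> < 1" using that by simp
      moreover have "x n - y n \<in> \<int>" using x that by (simp add: Z0_def)
      ultimately show "y n = x n" using Ints_nonzero_abs_less1 by fastforce
    qed
    then have "{x} = E.mball x 1 \<inter> Z0" using x Z0_ell2 by auto
    then show ?thesis unfolding openin_subtopology using E.openin_mball by blast
  qed
  then show "subtopology (gtop ell2) Z0 = discrete_topology Z0"
    unfolding ell2_simps(4) by (subst eq_commute) (simp add: discrete_topology_unique Z0_ell2 Int_absorb1)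
qed

lemma T2H_dist_mult:
  assumes "z \<in> T2H_set" shows "l2_dist (\<lambda>n. z n * x n) (\<lambda>n. z n * y n) = l2_dist x y"
proof -
  have "cmod (z n * x n - z n * y n) = cmod (x n - y n)" for n
    using assms by (simp add: T2H_set_def norm_mult flip: right_diff_distrib)
  then show ?thesis by (simp add: l2_dist_def)
qed

lemma l2_dist_one_ge:
  assumes w: "w \<in> T2H_set" and t: "\<And>n. \<bar>t n\<bar> \<le> cmod (1 - w n)"
  shows "l2_dist (\<lambda>n. 0) t \<le> l2_dist (\<lambda>n. 1) w"
  using l2_dist_le[OF T2H_summable[OF T2H_one w], of 1 "\<lambda>n. 0" t] t by simp

lemma wrap_continuous: "continuous_map E.mtopology T.mtopology wrap"
  unfolding T.continuous_map_to_metric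
proof (intro ballI allI impI)
  fix x and \<epsilon> :: real assume x: "x \<in> topspace E.mtopology" and e: "\<epsilon> > 0"
  show "\<exists>U. openin E.mtopology U \<and> x \<in> U \<and> (\<forall>y\<in>U. wrap y \<in> T.mball (wrap x) \<epsilon>)"
  proof (intro exI conjI ballI)
    show "openin E.mtopology (E.mball x (\<epsilon> / (2 * pi)))" by simp
    show "x \<in> E.mball x (\<epsilon> / (2 * pi))" using x e by simp
    fix y assume "y \<in> E.mball x (\<epsilon> / (2 * pi))"
    then have y: "y \<in> ell2_set" "x \<in> ell2_set" "l2_dist x y < \<epsilon> / (2 * pi)" by auto
    have "l2_dist (wrap x) (wrap y) \<le> 2 * pi * l2_dist x y" by (rule l2_dist_wrap) (use y in auto)
    also have "\<dots> < 2 * pi * (\<epsilon> / (2 * pi))" by (rule mult_strict_left_mono[OF y(3)]) simp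
    finally show "wrap y \<in> T.mball (wrap x) \<epsilon>" using y wrap_in_T2H by simp
  qed
qed

text \<open>A point \<open>w\<close> near \<open>z\<close> is \<open>z\<close> times a point
  \<open>v\<close> equally near the identity, and lifting \<open>v\<close> by \<open>unwrap\<close>
  does not increase the distance to the origin. So the image of a ball contains the ball of the same
  radius around the image of its centre.\<close>

lemma wrap_open: "open_map E.mtopology T.mtopology wrap"
  unfolding open_map_def
proof (intro allI impI)
  fix U assume U: "openin E.mtopology U"
  then have US: "U \<subseteq> ell2_set" using openin_subset by fastforce
  show "openin T.mtopology (wrap ` U)"
    unfolding T.openin_mtopology
  proof (intro conjI allI impI)
    show "wrap ` U \<subseteq> T2H_set" using US wrap_in_T2H by auto
    fix z assume "z \<in> wrap ` U"
    then obtain x where x: "x \<in> U" "z = wrap x" by blast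
    obtain r where r: "r > 0" "E.mball x r \<subseteq> U" using U x unfolding E.openin_mtopology by blast
    have "T.mball z r \<subseteq> wrap ` U"
    proof
      fix w assume "w \<in> T.mball z r"
      then have w: "w \<in> T2H_set" "z \<in> T2H_set" "l2_dist z w < r" by auto
      define v where "v n = cnj (z n) * w n" for n
      have v: "v \<in> T2H_set" unfolding v_def by (rule T2H_mult_closed[OF T2H_cnj_closed[OF w(2)] w(1)])
      have zz: "cnj (z n) * z n = 1" for n
        using w(2) complex_norm_square[of "z n"] by (simp add: T2H_set_def mult.commute)
      have "l2_dist (\<lambda>n. 1) v = l2_dist z w"
        using T2H_dist_mult[OF T2H_cnj_closed[OF w(2)], of z w] by (simp add: v_def[abs_def] zz)
      obtain t where t: "t \<in> ell2_set" "wrap t = v" "\<And>n. \<bar>t n\<bar> \<le> cmod (1 - v n)" using unwrap[OF v] by metis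
      have xt: "(\<lambda>n. x n + t n) \<in> ell2_set" using x US t by (intro ell2_add_closed) auto
      have "l2_dist x (\<lambda>n. x n + t n) = l2_dist (\<lambda>n. 0) t" by (simp add: l2_dist_def)
      also have "\<dots> \<le> l2_dist (\<lambda>n. 1) v" by (rule l2_dist_one_ge[OF v t(3)])
      also have "\<dots> < r" using w(3) \<open>l2_dist (\<lambda>n. 1) v = l2_dist z w\<close> by simp
      finally have "(\<lambda>n. x n + t n) \<in> E.mball x r" using xt x US by (simp add: subset_iff)
      then have "(\<lambda>n. x n + t n) \<in> U" using r(2) by blast
      moreover have "wrap (\<lambda>n. x n + t n) = w"
      proof -
        have "z n * v n = w n" for n using zz[of n] by (simp add: v_def mult.assoc[symmetric] mult.commute[of "z n"])
        then show ?thesis by (simp add: wrap_add t(2) x(2)[symmetric])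
      qed
      ultimately show "w \<in> wrap ` U" by blast
    qed
    then show "\<exists>r>0. T.mball z r \<subseteq> wrap ` U" using r(1) by blast
  qed
qed

lemma wrap_quotient_map: "quotient_map E.mtopology T.mtopology wrap"
  by (rule continuous_open_imp_quotient_map[OF wrap_continuous wrap_open]) (simp add: wrap_surj)

text \<open>Both \<open>wrap\<close> and the coset projection are quotient maps from
  \<open>ell2\<close> with the same fibres, so the induced bijection is a homeomorphism.\<close>

lemma T2H_iso_quotient: "topologically_isomorphic T2H (quotient_group ell2 Z0)"
proof -
  interpret group_hom ell2 T2H wrap by (rule wrap_group_hom)
  let ?Q = "quotient_group ell2 Z0" and ?\<phi> = "\<lambda>X. the_elem (wrap ` X)" and ?p = "\<lambda>x. Z0 #>\<^bsub>ell2\<^esub> x"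
  have cQ: "carrier ?Q = carrier (ell2 Mod Z0)" "monoid.mult ?Q = monoid.mult (ell2 Mod Z0)"
    by (simp_all add: quotient_group_def)
  have iso: "?\<phi> \<in> iso (ell2 Mod Z0) T2H"
    using FactGroup_iso_set kernel_wrap wrap_surj by (simp add: ell2_simps T2H_simps)
  have "topspace (gtop ell2) = carrier ell2" by (simp add: ell2_simps)
  note qm = quotient_map_quotient_group[OF this, of Z0]
  have ph: "?\<phi> (?p x) = wrap x" if "x \<in> ell2_set" for x
  proof -
    have "wrap ` (?p x) = {wrap x}"
    proof -
      have "wrap y = wrap x" if y: "y \<in> ?p x" for y
      proof -
        obtain h where "h \<in> Z0" "y = (\<lambda>n. h n + x n)" using y unfolding r_coset_def ell2_simps by blast
        moreover from this have "wrap h = (\<lambda>n. 1)" using wrap_kernel by blast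
        ultimately show ?thesis by (simp add: wrap_add)
      qed
      moreover have "x \<in> ?p x"
      proof -
        have "(\<lambda>n. 0) \<in> Z0" by (simp add: Z0_def)
        then show ?thesis unfolding r_coset_def by (force simp: ell2_simps)
      qed
      ultimately show ?thesis by blast
    qed
    then show ?thesis by simp
  qed
  have "continuous_map (gtop ell2) (gtop T2H) (?\<phi> \<circ> ?p)"
    by (rule continuous_map_eq[OF wrap_continuous[folded ell2_simps T2H_simps]]) (simp add: ell2_simps ph)
  then have c: "continuous_map (gtop ?Q) (gtop T2H) ?\<phi>" by (rule continuous_compose_quotient_map[OF qm])
  have "quotient_map (gtop ell2) (gtop T2H) (?\<phi> \<circ> ?p)"
    by (rule quotient_map_eq[OF wrap_quotient_map[folded ell2_simps T2H_simps]]) (simp add: ell2_simps ph)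
  then have "quotient_map (gtop ?Q) (gtop T2H) ?\<phi>"
    by (rule quotient_map_from_composition[OF quotient_imp_continuous_map[OF qm] c])
  moreover have tsQ: "topspace (gtop ?Q) = carrier ?Q"
    using quotient_imp_surjective_map[OF qm] by (auto simp: ell2_simps cQ(1) carrier_FactGroup)
  moreover have "inj_on ?\<phi> (carrier ?Q)" using iso by (simp add: iso_def bij_betw_def cQ)
  ultimately have hm: "homeomorphic_map (gtop ?Q) (gtop T2H) ?\<phi>" by (simp add: homeomorphic_map_def)
  \<comment> \<open>The induced map goes from the quotient to \<open>T2H\<close>, while the claim is
    stated in the other direction.\<close>
  define \<psi> where "\<psi> = inv_into (carrier ?Q) ?\<phi>"
  have Z0n: "Z0 \<lhd> ell2" using normal_kernel kernel_wrap by simp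
  have "group (ell2 Mod Z0)" by (rule normal.factorgroup_is_group[OF Z0n])
  then have "\<psi> \<in> iso T2H (ell2 Mod Z0)"
    unfolding \<psi>_def cQ using iso by (rule group.iso_set_sym)
  then have "\<psi> \<in> iso T2H ?Q" by (simp add: iso_def hom_def cQ)
  moreover have "homeomorphic_map (gtop T2H) (gtop ?Q) \<psi>"
  proof -
    obtain g where g: "homeomorphic_maps (gtop ?Q) (gtop T2H) ?\<phi> g" using hm unfolding homeomorphic_map_maps by blast
    have "homeomorphic_map (gtop T2H) (gtop ?Q) g" using g homeomorphic_maps_map by blast
    moreover have "g z = \<psi> z" if z: "z \<in> topspace (gtop T2H)" for z
    proof -
      have "g z \<in> carrier ?Q" "?\<phi> (g z) = z"
        using g z tsQ unfolding homeomorphic_maps_def continuous_map_def by auto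
      then show ?thesis unfolding \<psi>_def using \<open>inj_on ?\<phi> (carrier ?Q)\<close> by (metis inv_into_f_f)
    qed
    ultimately show ?thesis by (rule homeomorphic_map_eq)
  qed
  ultimately show ?thesis unfolding topologically_isomorphic_def top_group_iso_def by blast
qed

lemma path_connected_T2H: "path_connected_space T.mtopology"
  unfolding path_connected_space_def
proof (intro ballI)
  fix x y assume "x \<in> topspace T.mtopology" "y \<in> topspace T.mtopology"
  then have xy: "x \<in> T2H_set" "y \<in> T2H_set" by auto
  obtain a where a: "a \<in> ell2_set" "wrap a = x" using unwrap[OF xy(1)] by metis
  obtain b where b: "b \<in> ell2_set" "wrap b = y" using unwrap[OF xy(2)] by metis
  define g where "g t n = a n + t * (b n - a n)" for t n
  \<comment> \<open>A Lipschitz constant of the path; adding \<open>1\<close> keeps it positive when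
    \<open>a\<close> and \<open>b\<close> coincide.\<close>
  define D where "D = 2 * pi * l2_dist a b + 1"
  have D: "D > 0" unfolding D_def using E.nonneg[of a b] by (simp add: add_nonneg_pos)
  have g: "g t \<in> ell2_set" for t
    using ell2_add_closed[OF a(1) ell2_scale_closed[OF ell2_add_closed[OF b(1) ell2_scale_closed[OF a(1), of "-1"]], of t]]
    by (simp add: g_def[abs_def])
  have d: "l2_dist (wrap (g s)) (wrap (g t)) \<le> D * \<bar>s - t\<bar>" for s t
  proof -
    have "l2_dist (g s) (g t) \<le> \<bar>s - t\<bar> * l2_dist a b"
    proof (rule l2_dist_le[OF ell2_summable[OF a(1) b(1)]])
      fix n
      have "g s n - g t n = (s - t) * (b n - a n)" by (simp add: g_def algebra_simps)
      then show "norm (g s n - g t n) \<le> \<bar>s - t\<bar> * norm (a n - b n)" by (simp add: abs_mult abs_minus_commute)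
    qed simp
    then have "2 * pi * l2_dist (g s) (g t) \<le> 2 * pi * (\<bar>s - t\<bar> * l2_dist a b)" by (intro mult_left_mono) auto
    moreover have "D * \<bar>s - t\<bar> = 2 * pi * (\<bar>s - t\<bar> * l2_dist a b) + \<bar>s - t\<bar>" by (simp add: D_def algebra_simps)
    ultimately show ?thesis using l2_dist_wrap[OF g g, of s t] by linarith
  qed
  have "continuous_map (top_of_set {0..1}) T.mtopology (\<lambda>t. wrap (g t))"
    unfolding T.continuous_map_to_metric
  proof (intro ballI allI impI)
    fix t :: real and \<epsilon> :: real assume t: "t \<in> topspace (top_of_set {0..1})" and e: "\<epsilon> > 0"
    show "\<exists>U. openin (top_of_set {0..1}) U \<and> t \<in> U \<and> (\<forall>y\<in>U. wrap (g y) \<in> T.mball (wrap (g t)) \<epsilon>)"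
    proof (intro exI conjI ballI)
      show "openin (top_of_set {0..1}) ({0..1} \<inter> ball t (\<epsilon> / D))" by (rule openin_open_Int) simp
      show "t \<in> {0..1} \<inter> ball t (\<epsilon> / D)" using t e D by simp
      fix y assume "y \<in> {0..1} \<inter> ball t (\<epsilon> / D)"
      then have "\<bar>t - y\<bar> < \<epsilon> / D" by (simp add: dist_real_def)
      then have "D * \<bar>t - y\<bar> < \<epsilon>" using D by (simp add: field_simps)
      then have "l2_dist (wrap (g t)) (wrap (g y)) < \<epsilon>" using d[of t y] by simp
      then show "wrap (g y) \<in> T.mball (wrap (g t)) \<epsilon>" using wrap_in_T2H[OF g] by simp
    qed
  qed
  moreover have "wrap (g 0) = x" "wrap (g 1) = y" using a b by (simp_all add: g_def[abs_def])
  ultimately show "\<exists>g. pathin T.mtopology g \<and> g 0 = x \<and> g 1 = y" unfolding pathin_def by blast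
qed

text \<open>The limit is taken coordinatewise. Bounds on finite partial sums survive it and give
  both square summability of the difference and convergence for \<open>l2_dist\<close>.\<close>

lemma mcomplete_T2H: "T.mcomplete"
  unfolding T.mcomplete_def
proof (intro allI impI)
  fix \<sigma> assume C: "T.MCauchy \<sigma>"
  then have \<sigma>: "\<sigma> n \<in> T2H_set" for n by (auto simp: T.MCauchy_def)
  have c: "\<exists>N. \<forall>n\<ge>N. \<forall>m\<ge>N. l2_dist (\<sigma> n) (\<sigma> m) < \<epsilon>" if "\<epsilon> > 0" for \<epsilon>
    using C that unfolding T.MCauchy_def by metis
  have "Cauchy (\<lambda>n. \<sigma> n k)" for k
    unfolding Cauchy_def
  proof (intro allI impI)
    fix e :: real assume "e > 0"
    from c[OF this] obtain N where N: "\<forall>n\<ge>N. \<forall>m\<ge>N. l2_dist (\<sigma> n) (\<sigma> m) < e" ..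
    have "dist (\<sigma> m k) (\<sigma> n k) < e" if "m \<ge> N" "n \<ge> N" for m n
      using l2_dist_coord[OF T2H_summable[OF \<sigma>[of m] \<sigma>[of n]], of k] N that unfolding dist_norm by (meson le_less_trans)
    then show "\<exists>M. \<forall>m\<ge>M. \<forall>n\<ge>M. dist (\<sigma> m k) (\<sigma> n k) < e" by blast
  qed
  then have "\<exists>z. (\<lambda>n. \<sigma> n k) \<longlonglongrightarrow> z" for k by (simp add: Cauchy_convergent_iff convergent_def)
  then obtain z where z: "\<And>k. (\<lambda>n. \<sigma> n k) \<longlonglongrightarrow> z k" by metis
  have n1: "cmod (z k) = 1" for k
  proof -
    have "(\<lambda>n. cmod (\<sigma> n k)) \<longlonglongrightarrow> cmod (z k)" by (rule tendsto_norm[OF z])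
    moreover have "(\<lambda>n. cmod (\<sigma> n k)) = (\<lambda>n. 1)" using \<sigma> by (auto simp: T2H_set_def)
    ultimately show ?thesis by (simp add: LIMSEQ_const_iff)
  qed
  have close: "summable (\<lambda>k. (norm (\<sigma> n k - z k))\<^sup>2) \<and> l2_dist (\<sigma> n) z \<le> e"
    if e: "e > 0" and n: "\<And>m. m \<ge> N \<Longrightarrow> l2_dist (\<sigma> n) (\<sigma> m) \<le> e" for e n N
  proof -
    have b: "(\<Sum>k<K. (norm (\<sigma> n k - z k))\<^sup>2) \<le> e\<^sup>2" for K
    proof (rule LIMSEQ_le_const2)
      show "(\<lambda>m. \<Sum>k<K. (norm (\<sigma> n k - \<sigma> m k))\<^sup>2) \<longlonglongrightarrow> (\<Sum>k<K. (norm (\<sigma> n k - z k))\<^sup>2)"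
        by (intro tendsto_intros z)
      have "(\<Sum>k<K. (norm (\<sigma> n k - \<sigma> m k))\<^sup>2) \<le> e\<^sup>2" if "m \<ge> N" for m
      proof -
        have s: "summable (\<lambda>k. (norm (\<sigma> n k - \<sigma> m k))\<^sup>2)" by (rule T2H_summable[OF \<sigma> \<sigma>])
        have "sqrt (\<Sum>k. (norm (\<sigma> n k - \<sigma> m k))\<^sup>2) \<le> e" using n[OF that] l2_dist_eq[OF s] by simp
        then have "(\<Sum>k. (norm (\<sigma> n k - \<sigma> m k))\<^sup>2) \<le> e\<^sup>2" by (rule sqrt_le_D)
        moreover have "(\<Sum>k<K. (norm (\<sigma> n k - \<sigma> m k))\<^sup>2) \<le> (\<Sum>k. (norm (\<sigma> n k - \<sigma> m k))\<^sup>2)"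
          by (rule sum_le_suminf[OF s]) auto
        ultimately show ?thesis by simp
      qed
      then show "\<exists>N. \<forall>m\<ge>N. (\<Sum>k<K. (norm (\<sigma> n k - \<sigma> m k))\<^sup>2) \<le> e\<^sup>2" by blast
    qed
    have s: "summable (\<lambda>k. (norm (\<sigma> n k - z k))\<^sup>2)" by (rule summableI_nonneg_bounded[OF _ b]) simp
    have "(\<Sum>k. (norm (\<sigma> n k - z k))\<^sup>2) \<le> e\<^sup>2" by (rule suminf_le_const[OF s b])
    then have "l2_dist (\<sigma> n) z \<le> e" unfolding l2_dist_eq[OF s] using e by (intro real_le_lsqrt) auto
    then show ?thesis using s by blast
  qed
  from c[OF zero_less_one] obtain N1 where N1: "\<forall>n\<ge>N1. \<forall>m\<ge>N1. l2_dist (\<sigma> n) (\<sigma> m) < 1" ..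
  then have s1: "summable (\<lambda>k. (norm (\<sigma> N1 k - z k))\<^sup>2)" using close[of 1 N1 N1] by (auto intro: less_imp_le)
  have "summable (\<lambda>k. (norm ((1 - \<sigma> N1 k) + (\<sigma> N1 k - z k)))\<^sup>2)"
    by (rule square_summable_add[OF _ s1]) (use \<sigma> in \<open>auto simp: T2H_set_def\<close>)
  then have zT: "z \<in> T2H_set" using n1 by (simp add: T2H_set_def)
  have "limitin T.mtopology \<sigma> z sequentially"
    unfolding T.limitin_metric eventually_sequentially
  proof (intro conjI allI impI)
    fix e :: real assume e: "e > 0"
    from c[OF half_gt_zero[OF e]] obtain N where N: "\<forall>n\<ge>N. \<forall>m\<ge>N. l2_dist (\<sigma> n) (\<sigma> m) < e/2" ..
    have "l2_dist (\<sigma> n) z < e" if n: "n \<ge> N" for n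
    proof -
      have "l2_dist (\<sigma> n) (\<sigma> m) \<le> e/2" if "m \<ge> N" for m using N n that by (meson less_imp_le)
      from close[OF half_gt_zero[OF e] this] have "l2_dist (\<sigma> n) z \<le> e/2" by simp
      then show ?thesis using e by simp
    qed
    then show "\<exists>N. \<forall>n\<ge>N. \<sigma> n \<in> T2H_set \<and> l2_dist (\<sigma> n) z < e" using \<sigma> by blast
  qed (rule zT)
  then show "\<exists>x. limitin T.mtopology \<sigma> x sequentially" by blast
qed

section \<open>Rotations of a density on the circle\<close>

text \<open>Normalised Haar measure of the circle, but as a Borel measure on all of
  \<open>complex\<close>: the infinite product then lives on the Borel sets of
  \<open>nat \<Rightarrow> complex\<close> and is restricted to the torus only at the end.\<close>

definition circle_measure :: "complex measure" where
  "circle_measure = distr (uniform_measure lborel {0..<1}) borel (\<lambda>t. cis (2 * pi * t))"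

lemma cis_2pi_measurable[measurable]: "(\<lambda>t. cis (2 * pi * t)) \<in> borel_measurable borel"
  by (intro borel_measurable_continuous_onI continuous_intros)

lemma prob_circle_measure: "prob_space circle_measure"
proof -
  interpret prob_space "uniform_measure lborel {0..<1::real}" by (rule prob_space_uniform_measure) auto
  show ?thesis unfolding circle_measure_def by (rule prob_space_distr) simp
qed

interpretation circle_measure: prob_space circle_measure by (rule prob_circle_measure)

lemma sets_circle_measure[simp, measurable_cong]: "sets circle_measure = sets borel" and space_circle_measure[simp]: "space circle_measure = UNIV"
  by (simp_all add: circle_measure_def)

lemma nn_integral_circle_measure:
  assumes [measurable]: "F \<in> borel_measurable borel"
  shows "(\<integral>\<^sup>+z. F z \<partial>circle_measure) = (\<integral>\<^sup>+t. F (cis (2 * pi * t)) * indicator {0..<1} t \<partial>lborel)"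
proof -
  have "(\<integral>\<^sup>+z. F z \<partial>circle_measure) = (\<integral>\<^sup>+t. F (cis (2 * pi * t)) \<partial>uniform_measure lborel {0..<1})"
    unfolding circle_measure_def by (rule nn_integral_distr) simp_all
  also have "\<dots> = (\<integral>\<^sup>+t. F (cis (2 * pi * t)) * indicator {0..<1} t \<partial>lborel) / emeasure lborel {0..<1::real}"
    by (rule nn_integral_uniform_measure) auto
  finally show ?thesis by (simp add: divide_ennreal_def)
qed

lemma AE_circle_measure: "AE z in circle_measure. cmod z = 1"
  unfolding circle_measure_def by (subst AE_distr_iff) auto

text \<open>The shifted window \<open>[a, a + 1)\<close> is cut at \<open>1\<close>, and its right
  part is moved back by one period.\<close>

lemma nn_integral_periodic_shift:
  fixes h :: "real \<Rightarrow> ennreal"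
  assumes [measurable]: "h \<in> borel_measurable borel" and per: "\<And>u. h (1 + u) = h u" and a: "0 \<le> a" "a < 1"
  shows "(\<integral>\<^sup>+t. h (a + t) * indicator {0..<1} t \<partial>lborel) = (\<integral>\<^sup>+t. h t * indicator {0..<1} t \<partial>lborel)"
proof -
  have "(\<integral>\<^sup>+t. h (a + t) * indicator {0..<1} t \<partial>lborel) = (\<integral>\<^sup>+t. h (a + 1 * t) * indicator {a..<a+1} (a + 1 * t) \<partial>lborel)"
    by (rule nn_integral_cong) (auto simp: indicator_def)
  also have "\<dots> = (\<integral>\<^sup>+u. h u * indicator {a..<a+1} u \<partial>lborel)"
    by (subst nn_integral_real_affine[of "\<lambda>u. h u * indicator {a..<a+1} u" 1 a]) auto
  also have "\<dots> = (\<integral>\<^sup>+u. h u * indicator {a..<1} u + h u * indicator {1..<a+1} u \<partial>lborel)"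
    by (rule nn_integral_cong) (use a in \<open>auto simp: indicator_def\<close>)
  also have "\<dots> = (\<integral>\<^sup>+u. h u * indicator {a..<1} u \<partial>lborel) + (\<integral>\<^sup>+u. h u * indicator {1..<a+1} u \<partial>lborel)"
    by (rule nn_integral_add) auto
  also have "(\<integral>\<^sup>+u. h u * indicator {1..<a+1} u \<partial>lborel) = (\<integral>\<^sup>+u. h (1 + 1 * u) * indicator {1..<a+1} (1 + 1 * u) \<partial>lborel)"
    by (subst nn_integral_real_affine[of "\<lambda>u. h u * indicator {1..<a+1} u" 1 1]) auto
  also have "\<dots> = (\<integral>\<^sup>+u. h u * indicator {0..<a} u \<partial>lborel)"
    by (rule nn_integral_cong) (auto simp: indicator_def per)
  also have "(\<integral>\<^sup>+u. h u * indicator {a..<1} u \<partial>lborel) + (\<integral>\<^sup>+u. h u * indicator {0..<a} u \<partial>lborel)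
      = (\<integral>\<^sup>+u. h u * indicator {a..<1} u + h u * indicator {0..<a} u \<partial>lborel)"
    by (rule nn_integral_add[symmetric]) auto
  also have "\<dots> = (\<integral>\<^sup>+t. h t * indicator {0..<1} t \<partial>lborel)"
    by (rule nn_integral_cong) (use a in \<open>auto simp: indicator_def\<close>)
  finally show ?thesis .
qed

lemma nn_integral_circle_measure_rotate:
  assumes c: "cmod c = 1" and [measurable]: "F \<in> borel_measurable borel"
  shows "(\<integral>\<^sup>+z. F (c * z) \<partial>circle_measure) = (\<integral>\<^sup>+z. F z \<partial>circle_measure)"
proof -
  have "c \<noteq> 0" using c by auto
  then have A: "cis (Arg c) = c" using c by (simp add: cis_Arg sgn_div_norm)
  define b where "b = Arg c / (2 * pi)"
  define a where "a = frac b"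
  have a: "0 \<le> a" "a < 1" by (simp_all add: a_def frac_lt_1)
  have "cis (2 * pi * b) = cis (2 * pi * of_int \<lfloor>b\<rfloor>) * cis (2 * pi * a)"
    by (simp add: cis_mult a_def frac_def algebra_simps)
  then have ca: "c = cis (2 * pi * a)" using A by (simp add: b_def)
  have "(\<integral>\<^sup>+z. F (c * z) \<partial>circle_measure) = (\<integral>\<^sup>+t. F (cis (2 * pi * (a + t))) * indicator {0..<1} t \<partial>lborel)"
    by (subst nn_integral_circle_measure) (auto simp: ca cis_mult distrib_left)
  also have "\<dots> = (\<integral>\<^sup>+t. F (cis (2 * pi * t)) * indicator {0..<1} t \<partial>lborel)"
  proof (rule nn_integral_periodic_shift[where h = "\<lambda>t. F (cis (2 * pi * t))", OF _ _ a])
    fix u :: real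
    have "cis (2 * pi * (1 + u)) = cis (2 * pi * 1) * cis (2 * pi * u)" unfolding cis_mult by (simp add: distrib_left)
    then show "F (cis (2 * pi * (1 + u))) = F (cis (2 * pi * u))" by simp
  qed simp
  also have "\<dots> = (\<integral>\<^sup>+z. F z \<partial>circle_measure)" by (simp add: nn_integral_circle_measure)
  finally show ?thesis .
qed

lemma distr_circle_measure_rotate: assumes c: "cmod c = 1" shows "distr circle_measure borel (\<lambda>z. c * z) = circle_measure"
proof (rule measure_eqI)
  fix A assume "A \<in> sets (distr circle_measure borel ((*) c))"
  then have A[measurable]: "A \<in> sets borel" by simp
  have "emeasure (distr circle_measure borel (\<lambda>z. c * z)) A = (\<integral>\<^sup>+z. indicator A z \<partial>distr circle_measure borel (\<lambda>z. c * z))" by simp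
  also have "\<dots> = (\<integral>\<^sup>+z. indicator A (c * z) \<partial>circle_measure)" by (rule nn_integral_distr) auto
  also have "\<dots> = (\<integral>\<^sup>+z. indicator A z \<partial>circle_measure)" by (rule nn_integral_circle_measure_rotate[OF c]) simp
  finally show "emeasure (distr circle_measure borel ((*) c)) A = emeasure circle_measure A" by simp
qed simp

lemma integral_circle_measure_rotate:
  fixes F :: "complex \<Rightarrow> real"
  assumes c: "cmod c = 1" and [measurable]: "F \<in> borel_measurable borel"
  shows "(\<integral>z. F (c * z) \<partial>circle_measure) = (\<integral>z. F z \<partial>circle_measure)"
proof -
  have "(\<integral>z. F z \<partial>circle_measure) = (\<integral>z. F z \<partial>distr circle_measure borel (\<lambda>z. c * z))" by (simp add: distr_circle_measure_rotate[OF c])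
  also have "\<dots> = (\<integral>z. F (c * z) \<partial>circle_measure)" by (rule integral_distr) auto
  finally show ?thesis ..
qed

lemma integrable_circle_measure:
  fixes F :: "complex \<Rightarrow> real"
  assumes [measurable]: "F \<in> borel_measurable borel" and b: "\<And>z. cmod z = 1 \<Longrightarrow> \<bar>F z\<bar> \<le> B"
  shows "integrable circle_measure F"
proof (rule circle_measure.integrable_const_bound)
  show "AE z in circle_measure. norm (F z) \<le> B" using AE_circle_measure by eventually_elim (use b in auto)
qed simp

lemma abs_Re_Im_circle: "cmod z = 1 \<Longrightarrow> \<bar>Re z\<bar> \<le> 1" "cmod z = 1 \<Longrightarrow> \<bar>Im z\<bar> \<le> 1"
  using abs_Re_le_cmod[of z] abs_Im_le_cmod[of z] by auto

lemma integrable_circle_measure_moments: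
  "integrable circle_measure Re" "integrable circle_measure Im" "integrable circle_measure (\<lambda>z. (Re z)\<^sup>2)" "integrable circle_measure (\<lambda>z. (Im z)\<^sup>2)" "integrable circle_measure (\<lambda>z. Re z * Im z)"
proof -
  have sq: "x\<^sup>2 \<le> 1" if "\<bar>x\<bar> \<le> 1" for x :: real using that by (simp add: abs_square_le_1)
  show "integrable circle_measure Re" "integrable circle_measure Im" by (rule integrable_circle_measure[where B = 1], use abs_Re_Im_circle in auto)+
  show "integrable circle_measure (\<lambda>z. (Re z)\<^sup>2)" "integrable circle_measure (\<lambda>z. (Im z)\<^sup>2)"
    by (rule integrable_circle_measure[where B = 1], use abs_Re_Im_circle sq in auto)+
  show "integrable circle_measure (\<lambda>z. Re z * Im z)"
    by (rule integrable_circle_measure[where B = 1]) (auto simp: abs_mult intro!: mult_le_one abs_Re_Im_circle)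
qed

text \<open>Rotation invariance suffices: rotation by \<open>-1\<close> kills the first moments,
  rotation by \<open>\<i>\<close> kills the mixed moment and exchanges the squares of
  \<open>Re\<close> and \<open>Im\<close>, whose sum is \<open>1\<close>.\<close>

lemma circle_measure_moments: "(\<integral>z. Re z \<partial>circle_measure) = 0" "(\<integral>z. Im z \<partial>circle_measure) = 0" "(\<integral>z. (Re z)\<^sup>2 \<partial>circle_measure) = 1/2" "(\<integral>z. Re z * Im z \<partial>circle_measure) = 0"
proof -
  have "(\<integral>z. Re ((-1) * z) \<partial>circle_measure) = (\<integral>z. Re z \<partial>circle_measure)" by (rule integral_circle_measure_rotate) auto
  then show "(\<integral>z. Re z \<partial>circle_measure) = 0" by simp
  have "(\<integral>z. Im ((-1) * z) \<partial>circle_measure) = (\<integral>z. Im z \<partial>circle_measure)" by (rule integral_circle_measure_rotate) auto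
  then show "(\<integral>z. Im z \<partial>circle_measure) = 0" by simp
  have "(\<integral>z. Re (\<i> * z) * Im (\<i> * z) \<partial>circle_measure) = (\<integral>z. Re z * Im z \<partial>circle_measure)"
    by (rule integral_circle_measure_rotate) auto
  then show "(\<integral>z. Re z * Im z \<partial>circle_measure) = 0" by (simp add: mult.commute)
  have "(\<integral>z. (Re (\<i> * z))\<^sup>2 \<partial>circle_measure) = (\<integral>z. (Re z)\<^sup>2 \<partial>circle_measure)" by (rule integral_circle_measure_rotate) auto
  then have e: "(\<integral>z. (Im z)\<^sup>2 \<partial>circle_measure) = (\<integral>z. (Re z)\<^sup>2 \<partial>circle_measure)" by simp
  have "(\<integral>z. (Re z)\<^sup>2 + (Im z)\<^sup>2 \<partial>circle_measure) = (\<integral>z. 1 \<partial>circle_measure)"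
    by (rule integral_cong_AE) (use AE_circle_measure in \<open>auto elim!: eventually_mono simp: cmod_power2[symmetric]\<close>)
  then have "(\<integral>z. (Re z)\<^sup>2 \<partial>circle_measure) + (\<integral>z. (Im z)\<^sup>2 \<partial>circle_measure) = 1"
    using integrable_circle_measure_moments circle_measure.prob_space by simp
  then show "(\<integral>z. (Re z)\<^sup>2 \<partial>circle_measure) = 1/2" using e by simp
qed

text \<open>The normalised square of \<open>2 + Re z\<close>; with this choice the Hellinger affinity of the measure
  \<open>coord_density\<close> and its rotation by \<open>c\<close> is exactly \<open>1 - cmod (1 - c) ^ 2 / 18\<close>.\<close>

definition coord_density :: "complex \<Rightarrow> real" where "coord_density z = 2/9 * (2 + Re z)\<^sup>2"

lemma coord_density_measurable[measurable]: "coord_density \<in> borel_measurable borel" unfolding coord_density_def by measurable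

lemma coord_density_nonneg[simp]: "coord_density z \<ge> 0" by (simp add: coord_density_def)

lemma coord_density_ge: "cmod z = 1 \<Longrightarrow> coord_density z \<ge> 2/9"
proof -
  assume "cmod z = 1"
  then have "1 \<le> 2 + Re z" using abs_Re_Im_circle[of z] by linarith
  then have "1\<^sup>2 \<le> (2 + Re z)\<^sup>2" by (rule power_mono) simp
  then show ?thesis by (simp add: coord_density_def)
qed

lemma cmod_cnj_mult: "cmod c = 1 \<Longrightarrow> cnj c * (c * z) = z" "cmod c = 1 \<Longrightarrow> c * (cnj c * z) = z"
  using complex_norm_square[of c] by (simp_all add: mult.assoc[symmetric] mult.commute)

text \<open>The integrand is the product of the square roots of the density and its rotation. These
  are affine in the coordinates, so only moments up to order two enter, and
  \<open>(cmod (1 - c))\<^sup>2 = 2 - 2 * Re c\<close>.\<close>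

lemma affinity_integral:
  assumes c: "cmod c = 1"
  shows "(\<integral>z. 2/9 * (2 + Re z) * (2 + Re (cnj c * z)) \<partial>circle_measure) = 1 - (cmod (1 - c))\<^sup>2 / 18"
proof -
  have "(\<integral>z. 2/9 * (2 + Re z) * (2 + Re (cnj c * z)) \<partial>circle_measure)
      = (\<integral>z. 8/9 + (4/9 + 4/9 * Re c) * Re z + (4/9 * Im c) * Im z + (2/9 * Re c) * (Re z)\<^sup>2 + (2/9 * Im c) * (Re z * Im z) \<partial>circle_measure)"
    by (rule Bochner_Integration.integral_cong) (auto simp: power2_eq_square algebra_simps)
  also have "\<dots> = (\<integral>z. 8/9 + (4/9 + 4/9 * Re c) * Re z + (4/9 * Im c) * Im z + (2/9 * Re c) * (Re z)\<^sup>2 \<partial>circle_measure)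
      + (2/9 * Im c) * (\<integral>z. Re z * Im z \<partial>circle_measure)"
    by (subst Bochner_Integration.integral_add) (use integrable_circle_measure_moments in auto)
  also have "(\<integral>z. 8/9 + (4/9 + 4/9 * Re c) * Re z + (4/9 * Im c) * Im z + (2/9 * Re c) * (Re z)\<^sup>2 \<partial>circle_measure)
      = (\<integral>z. 8/9 + (4/9 + 4/9 * Re c) * Re z + (4/9 * Im c) * Im z \<partial>circle_measure) + (2/9 * Re c) * (\<integral>z. (Re z)\<^sup>2 \<partial>circle_measure)"
    by (subst Bochner_Integration.integral_add) (use integrable_circle_measure_moments in auto)
  also have "(\<integral>z. 8/9 + (4/9 + 4/9 * Re c) * Re z + (4/9 * Im c) * Im z \<partial>circle_measure)
      = (\<integral>z. 8/9 + (4/9 + 4/9 * Re c) * Re z \<partial>circle_measure) + (4/9 * Im c) * (\<integral>z. Im z \<partial>circle_measure)"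
    by (subst Bochner_Integration.integral_add) (use integrable_circle_measure_moments in auto)
  also have "(\<integral>z. 8/9 + (4/9 + 4/9 * Re c) * Re z \<partial>circle_measure) = 8/9 + (4/9 + 4/9 * Re c) * (\<integral>z. Re z \<partial>circle_measure)"
    by (subst Bochner_Integration.integral_add) (use integrable_circle_measure_moments circle_measure.prob_space in auto)
  finally have "(\<integral>z. 2/9 * (2 + Re z) * (2 + Re (cnj c * z)) \<partial>circle_measure) = 8/9 + (2/9 * Re c) * (1/2)"
    by (simp only: circle_measure_moments)
  moreover have "(cmod (1 - c))\<^sup>2 = 2 - 2 * Re c"
  proof -
    have "(Re c)\<^sup>2 + (Im c)\<^sup>2 = 1" using c cmod_power2[of c] by simp
    moreover have "(cmod (1 - c))\<^sup>2 = (1 - Re c)\<^sup>2 + (Im c)\<^sup>2" by (simp add: cmod_power2)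
    ultimately show ?thesis by (simp add: power2_diff)
  qed
  ultimately show ?thesis by (simp add: field_simps)
qed

lemma nn_integral_coord_density: "(\<integral>\<^sup>+z. ennreal (coord_density z) \<partial>circle_measure) = 1"
proof -
  have i: "integrable circle_measure coord_density"
  proof (rule integrable_circle_measure[where B = 2])
    fix z assume z: "cmod z = 1"
    then have "(2 + Re z)\<^sup>2 \<le> 3\<^sup>2" using abs_Re_Im_circle[of z] by (intro power_mono) auto
    then show "\<bar>coord_density z\<bar> \<le> 2" by (simp add: coord_density_def)
  qed simp
  have eq: "coord_density = (\<lambda>z. 2/9 * (2 + Re z) * (2 + Re (cnj 1 * z)))"
    by (auto simp: fun_eq_iff coord_density_def power2_eq_square)
  have "(\<integral>z. coord_density z \<partial>circle_measure) = 1 - (cmod (1 - 1))\<^sup>2 / 18" unfolding eq by (rule affinity_integral) simp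
  then have "(\<integral>z. coord_density z \<partial>circle_measure) = 1" by simp
  then show ?thesis using i by (subst nn_integral_eq_integral) auto
qed

definition coord_measure :: "complex measure" where "coord_measure = density circle_measure (\<lambda>z. ennreal (coord_density z))"

lemma sets_coord_measure[simp, measurable_cong]: "sets coord_measure = sets borel" and space_coord_measure[simp]: "space coord_measure = UNIV"
  by (simp_all add: coord_measure_def)

lemma prob_coord_measure: "prob_space coord_measure"
  by (rule prob_spaceI) (simp add: coord_measure_def emeasure_density nn_integral_coord_density)

lemma nn_integral_coord_measure:
  "F \<in> borel_measurable borel \<Longrightarrow> (\<integral>\<^sup>+z. F z \<partial>coord_measure) = (\<integral>\<^sup>+z. ennreal (coord_density z) * F z \<partial>circle_measure)"
  unfolding coord_measure_def by (rule nn_integral_density) auto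

text \<open>For \<open>c\<close> on the circle this is the density, with respect to
  \<open>coord_measure\<close>, of the image of \<open>coord_measure\<close> under multiplication by
  \<open>c\<close>; there \<open>cnj c\<close> is the inverse of \<open>c\<close>.\<close>

definition ratio :: "complex \<Rightarrow> complex \<Rightarrow> real" where "ratio c z = coord_density (cnj c * z) / coord_density z"

lemma ratio_measurable[measurable]: "ratio c \<in> borel_measurable borel" unfolding ratio_def by measurable

lemma ratio_nonneg[simp]: "ratio c z \<ge> 0" by (simp add: ratio_def)

lemma nn_integral_ratio:
  assumes c: "cmod c = 1" and [measurable]: "F \<in> borel_measurable borel"
  shows "(\<integral>\<^sup>+z. ennreal (ratio c z) * F z \<partial>coord_measure) = (\<integral>\<^sup>+z. F (c * z) \<partial>coord_measure)"
proof -
  have "(\<integral>\<^sup>+z. ennreal (ratio c z) * F z \<partial>coord_measure) = (\<integral>\<^sup>+z. ennreal (coord_density z) * (ennreal (ratio c z) * F z) \<partial>circle_measure)"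
    by (rule nn_integral_coord_measure) measurable
  also have "\<dots> = (\<integral>\<^sup>+z. ennreal (coord_density (cnj c * z)) * F z \<partial>circle_measure)"
  proof (rule nn_integral_cong_AE)
    show "AE z in circle_measure. ennreal (coord_density z) * (ennreal (ratio c z) * F z) = ennreal (coord_density (cnj c * z)) * F z"
      using AE_circle_measure
    proof eventually_elim
      case (elim z)
      have "coord_density z > 0" using coord_density_ge[OF elim] by linarith
      then have "coord_density z * ratio c z = coord_density (cnj c * z)" by (simp add: ratio_def)
      then show ?case by (simp add: mult.assoc[symmetric] ennreal_mult[symmetric])
    qed
  qed
  also have "\<dots> = (\<integral>\<^sup>+z. ennreal (coord_density (cnj c * (c * z))) * F (c * z) \<partial>circle_measure)"
    by (rule nn_integral_circle_measure_rotate[OF c, symmetric]) measurable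
  also have "\<dots> = (\<integral>\<^sup>+z. F (c * z) \<partial>coord_measure)"
    by (subst nn_integral_coord_measure) (auto simp: cmod_cnj_mult[OF c])
  finally show ?thesis .
qed

lemma nn_integral_sqrt_ratio:
  assumes c: "cmod c = 1"
  shows "(\<integral>\<^sup>+z. ennreal (sqrt (ratio c z)) \<partial>coord_measure) = ennreal (1 - (cmod (1 - c))\<^sup>2 / 18)"
proof -
  have gen: "2/9 * a\<^sup>2 * (b / a) = 2/9 * a * b" if "a > 0" for a b :: real
    using that by (simp add: power2_eq_square)
  have "(\<integral>\<^sup>+z. ennreal (sqrt (ratio c z)) \<partial>coord_measure) = (\<integral>\<^sup>+z. ennreal (coord_density z) * ennreal (sqrt (ratio c z)) \<partial>circle_measure)"
    by (rule nn_integral_coord_measure) measurable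
  also have "\<dots> = (\<integral>\<^sup>+z. ennreal (2/9 * (2 + Re z) * (2 + Re (cnj c * z))) \<partial>circle_measure)"
  proof (rule nn_integral_cong_AE)
    show "AE z in circle_measure. ennreal (coord_density z) * ennreal (sqrt (ratio c z)) = ennreal (2/9 * (2 + Re z) * (2 + Re (cnj c * z)))"
      using AE_circle_measure
    proof eventually_elim
      case (elim z)
      have p: "2 + Re z > 0" using abs_Re_Im_circle(1)[OF elim] by linarith
      have "cmod (cnj c * z) = 1" using c elim by (simp add: norm_mult)
      then have q: "2 + Re (cnj c * z) > 0" using abs_Re_Im_circle(1)[of "cnj c * z"] by linarith
      have "ratio c z = ((2 + Re (cnj c * z)) / (2 + Re z))\<^sup>2"
        unfolding ratio_def coord_density_def power_divide by simp
      then have "sqrt (ratio c z) = (2 + Re (cnj c * z)) / (2 + Re z)" using p q by (simp add: real_sqrt_abs)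
      then have "coord_density z * sqrt (ratio c z) = 2/9 * (2 + Re z) * (2 + Re (cnj c * z))"
        unfolding coord_density_def using gen[OF p] by simp
      moreover have "ennreal (coord_density z) * ennreal (sqrt (ratio c z)) = ennreal (coord_density z * sqrt (ratio c z))"
        by (rule ennreal_mult[symmetric]) auto
      ultimately show ?case by (simp only:)
    qed
  qed
  also have "\<dots> = ennreal (\<integral>z. 2/9 * (2 + Re z) * (2 + Re (cnj c * z)) \<partial>circle_measure)"
  proof (rule nn_integral_eq_integral)
    have b: "0 \<le> 2 + Re z \<and> 2 + Re z \<le> 3 \<and> 0 \<le> 2 + Re (cnj c * z) \<and> 2 + Re (cnj c * z) \<le> 3" if "cmod z = 1" for z
    proof -
      have "cmod (cnj c * z) = 1" using c that by (simp add: norm_mult)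
      from abs_Re_Im_circle(1)[OF this] abs_Re_Im_circle(1)[OF that] show ?thesis by linarith
    qed
    show "AE z in circle_measure. 0 \<le> 2/9 * (2 + Re z) * (2 + Re (cnj c * z))"
      using AE_circle_measure by eventually_elim (intro mult_nonneg_nonneg, use b in auto)
    show "integrable circle_measure (\<lambda>z. 2/9 * (2 + Re z) * (2 + Re (cnj c * z)))"
    proof (rule integrable_circle_measure[where B = 2])
      fix z assume z: "cmod z = 1"
      have "(2 + Re z) * (2 + Re (cnj c * z)) \<le> 3 * 3" by (intro mult_mono) (use b[OF z] in auto)
      moreover have "0 \<le> (2 + Re z) * (2 + Re (cnj c * z))" by (intro mult_nonneg_nonneg) (use b[OF z] in auto)
      ultimately show "\<bar>2/9 * (2 + Re z) * (2 + Re (cnj c * z))\<bar> \<le> 2" unfolding mult.assoc abs_mult by simp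
    qed measurable
  qed
  finally show ?thesis unfolding affinity_integral[OF c] .
qed

lemma coord_density_diff_sq:
  assumes c: "cmod c = 1" and z: "cmod z = 1"
  shows "(coord_density (cnj c * z) - coord_density z)\<^sup>2 \<le> 16/9 * (cmod (1 - c))\<^sup>2"
proof -
  let ?u = "Re (cnj c * z)" and ?v = "Re z"
  have cz: "cmod (cnj c * z) = 1" using c z by (simp add: norm_mult)
  have "\<bar>?u - ?v\<bar> \<le> cmod (cnj c * z - z)" using abs_Re_le_cmod[of "cnj c * z - z"] by simp
  also have "\<dots> = cmod ((cnj c - 1) * z)" by (simp add: algebra_simps)
  also have "\<dots> = cmod (cnj (c - 1))" using z by (simp add: norm_mult)
  also have "\<dots> = cmod (1 - c)" by (simp only: complex_mod_cnj norm_minus_commute)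
  finally have 1: "\<bar>?u - ?v\<bar> \<le> cmod (1 - c)" .
  have 2: "\<bar>4 + ?u + ?v\<bar> \<le> 6" using abs_Re_Im_circle(1)[OF cz] abs_Re_Im_circle(1)[OF z] by linarith
  have "coord_density (cnj c * z) - coord_density z = 2/9 * ((?u - ?v) * (4 + ?u + ?v))"
    by (simp add: coord_density_def power2_eq_square algebra_simps)
  moreover have "\<bar>2/9 * (x * y)\<bar> = 2/9 * (\<bar>x\<bar> * \<bar>y\<bar>)" for x y :: real by (simp add: abs_mult)
  ultimately have "\<bar>coord_density (cnj c * z) - coord_density z\<bar> = 2/9 * (\<bar>?u - ?v\<bar> * \<bar>4 + ?u + ?v\<bar>)" by (simp only:)
  also have "\<dots> \<le> 2/9 * (cmod (1 - c) * 6)" by (intro mult_left_mono mult_mono 1 2) auto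
  finally have "\<bar>coord_density (cnj c * z) - coord_density z\<bar> \<le> 4/3 * cmod (1 - c)" by simp
  from power_mono[OF this, of 2] show ?thesis by (simp add: power_mult_distrib power2_eq_square)
qed

text \<open>A chi-square estimate. With \<open>x\<close> and \<open>y\<close> the densities before
  and after rotation, \<open>x * (y / x)\<^sup>2 + x = 2 * y + (y - x)\<^sup>2 / x\<close>; adding
  the total mass \<open>1\<close> avoids subtraction in \<open>ennreal\<close>. The factor
  \<open>8\<close> is \<open>16/9\<close> from \<open>coord_density_diff_sq\<close> divided by the
  lower bound \<open>2/9\<close> of the density.\<close>

lemma nn_integral_ratio_sq:
  assumes c: "cmod c = 1"
  shows "(\<integral>\<^sup>+z. ennreal ((ratio c z)\<^sup>2) \<partial>coord_measure) \<le> ennreal (1 + 8 * (cmod (1 - c))\<^sup>2)"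
proof -
  let ?d = "8 * (cmod (1 - c))\<^sup>2" and ?I = "\<integral>\<^sup>+z. ennreal ((ratio c z)\<^sup>2) \<partial>coord_measure"
  have gen: "x * (y / x)\<^sup>2 + x = 2 * y + (y - x)\<^sup>2 / x" if "x > 0" for x y :: real
    using that by (simp add: power2_eq_square field_simps)
  have rot: "(\<integral>\<^sup>+z. ennreal (coord_density (cnj c * z)) \<partial>circle_measure) = 1"
    using nn_integral_circle_measure_rotate[of "cnj c" "\<lambda>z. ennreal (coord_density z)"] c nn_integral_coord_density by simp
  have "?I + 1 = (\<integral>\<^sup>+z. ennreal (coord_density z) * ennreal ((ratio c z)\<^sup>2) \<partial>circle_measure) + (\<integral>\<^sup>+z. ennreal (coord_density z) \<partial>circle_measure)"
    by (simp add: nn_integral_coord_measure nn_integral_coord_density)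
  also have "\<dots> = (\<integral>\<^sup>+z. ennreal (coord_density z) * ennreal ((ratio c z)\<^sup>2) + ennreal (coord_density z) \<partial>circle_measure)"
    by (rule nn_integral_add[symmetric]) measurable
  also have "\<dots> \<le> (\<integral>\<^sup>+z. 2 * ennreal (coord_density (cnj c * z)) + ennreal ?d \<partial>circle_measure)"
  proof (rule nn_integral_mono_AE)
    show "AE z in circle_measure. ennreal (coord_density z) * ennreal ((ratio c z)\<^sup>2) + ennreal (coord_density z) \<le> 2 * ennreal (coord_density (cnj c * z)) + ennreal ?d"
      using AE_circle_measure
    proof eventually_elim
      case (elim z)
      let ?p = "coord_density z" and ?q = "coord_density (cnj c * z)"
      have p: "?p \<ge> 2/9" by (rule coord_density_ge[OF elim])
      have "(?q - ?p)\<^sup>2 \<le> 16/9 * (cmod (1 - c))\<^sup>2" by (rule coord_density_diff_sq[OF c elim])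
      also have "\<dots> = (2/9) * ?d" by simp
      also have "\<dots> \<le> ?p * ?d" by (rule mult_right_mono[OF p]) simp
      finally have le: "(?q - ?p)\<^sup>2 / ?p \<le> ?d" using p by (simp add: pos_divide_le_eq mult.commute)
      have "?p * (ratio c z)\<^sup>2 + ?p = 2 * ?q + (?q - ?p)\<^sup>2 / ?p"
        unfolding ratio_def by (rule gen) (use p in linarith)
      then have "?p * (ratio c z)\<^sup>2 + ?p \<le> 2 * ?q + ?d" using le by simp
      then have "ennreal (?p * (ratio c z)\<^sup>2 + ?p) \<le> ennreal (2 * ?q + ?d)" by (rule ennreal_leI)
      then show ?case by (simp add: ennreal_plus ennreal_mult)
    qed
  qed
  also have "\<dots> = 2 * (\<integral>\<^sup>+z. ennreal (coord_density (cnj c * z)) \<partial>circle_measure) + ennreal ?d"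
    by (subst nn_integral_add) (auto simp: nn_integral_cmult circle_measure.emeasure_space_1[simplified])
  also have "\<dots> = 2 + ennreal ?d" by (simp add: rot)
  also have "\<dots> = 1 + (1 + ennreal ?d)" by (simp only: one_add_one[symmetric] add.assoc)
  finally have "1 + ?I \<le> 1 + (1 + ennreal ?d)" by (subst add.commute)
  then have "?I \<le> 1 + ennreal ?d" by (subst (asm) ennreal_add_left_cancel_le) simp
  also have "\<dots> = ennreal (1 + ?d)" by (subst ennreal_plus) auto
  finally show ?thesis .
qed

section \<open>Rotations of the product measure\<close>

definition torus_product :: "(nat \<Rightarrow> complex) measure" where "torus_product = PiM UNIV (\<lambda>_. coord_measure)"

interpretation mu: product_prob_space "\<lambda>_::nat. coord_measure" UNIV
proof -
  interpret prob_space coord_measure by (rule prob_coord_measure)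
  show "product_prob_space (\<lambda>_::nat. coord_measure)" by unfold_locales
qed

interpretation torus_product: prob_space torus_product unfolding torus_product_def by (rule prob_space_PiM[OF prob_coord_measure])

lemma sets_torus_product[simp, measurable_cong]: "sets torus_product = sets borel"
proof -
  have "sets torus_product = sets (PiM UNIV (\<lambda>_::nat. borel :: complex measure))"
    unfolding torus_product_def by (rule sets_PiM_cong) auto
  then show ?thesis by (simp add: sets_PiM_equal_borel)
qed

lemma space_torus_product[simp]: "space torus_product = UNIV" using sets_eq_imp_space_eq[OF sets_torus_product] by simp

lemma coord_measurable[measurable]: "(\<lambda>x :: nat \<Rightarrow> complex. x n) \<in> borel_measurable borel"
  by (rule borel_measurable_continuous_onI, rule continuous_on_product_coordinates)

lemma nn_integral_prod_torus_product:
  fixes \<phi> :: "nat \<Rightarrow> complex \<Rightarrow> ennreal"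
  assumes K: "finite K" and [measurable]: "\<And>k. \<phi> k \<in> borel_measurable borel"
  shows "(\<integral>\<^sup>+x. (\<Prod>k\<in>K. \<phi> k (x k)) \<partial>torus_product) = (\<Prod>k\<in>K. \<integral>\<^sup>+z. \<phi> k z \<partial>coord_measure)"
proof -
  have [measurable]: "\<phi> k \<in> borel_measurable coord_measure" for k
    using assms(2)[of k] by (simp cong: measurable_cong_sets)
  have "(\<Prod>k\<in>K. \<integral>\<^sup>+z. \<phi> k z \<partial>coord_measure) = (\<integral>\<^sup>+y. (\<Prod>k\<in>K. \<phi> k (y k)) \<partial>PiM K (\<lambda>_. coord_measure))"
    by (rule mu.product_nn_integral_prod[symmetric]) (use K in auto)
  also have "\<dots> = (\<integral>\<^sup>+y. (\<Prod>k\<in>K. \<phi> k (y k)) \<partial>distr torus_product (PiM K (\<lambda>_. coord_measure)) (\<lambda>x. restrict x K))"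
    unfolding torus_product_def by (subst mu.distr_PiM_restrict_finite) (use K in auto)
  also have "\<dots> = (\<integral>\<^sup>+x. (\<Prod>k\<in>K. \<phi> k (restrict x K k)) \<partial>torus_product)"
    unfolding torus_product_def by (rule nn_integral_distr) (use K in auto)
  also have "\<dots> = (\<integral>\<^sup>+x. (\<Prod>k\<in>K. \<phi> k (x k)) \<partial>torus_product)"
    by (intro nn_integral_cong prod.cong) auto
  finally show ?thesis ..
qed

definition rot :: "(nat \<Rightarrow> complex) \<Rightarrow> (nat \<Rightarrow> complex) \<Rightarrow> nat \<Rightarrow> complex" where
  "rot g x = (\<lambda>n. g n * x n)"

lemma rot_measurable[measurable]: "rot g \<in> borel_measurable borel"
  unfolding rot_def
  by (intro borel_measurable_continuous_onI continuous_on_coordinatewise_then_product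
      continuous_on_mult continuous_on_const continuous_on_product_coordinates)

text \<open>Rotating finitely many coordinates has an explicit density, a finite product of ratios,
  and the full rotation agrees with it on sets determined by these coordinates.\<close>

definition trunc :: "(nat \<Rightarrow> complex) \<Rightarrow> nat \<Rightarrow> nat \<Rightarrow> complex" where
  "trunc g N = (\<lambda>n. if n < N then g n else 1)"

definition likelihood :: "(nat \<Rightarrow> complex) \<Rightarrow> nat \<Rightarrow> (nat \<Rightarrow> complex) \<Rightarrow> real" where
  "likelihood g N x = (\<Prod>n<N. ratio (g n) (x n))"

lemma likelihood_measurable[measurable]: "likelihood g N \<in> borel_measurable borel"
  unfolding likelihood_def by measurable

lemma likelihood_nonneg[simp]: "likelihood g N x \<ge> 0" unfolding likelihood_def by (rule prod_nonneg) simp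

definition torus :: "(nat \<Rightarrow> complex) set" where "torus = {z. \<forall>n. cmod (z n) = 1}"

lemma distr_trunc:
  assumes g: "g \<in> torus"
  shows "distr torus_product torus_product (rot (trunc g N)) = density torus_product (\<lambda>x. ennreal (likelihood g N x))"
proof (rule measure_eqI_PiM_infinite[where M = "\<lambda>_. coord_measure" and I = UNIV])
  show "sets (distr torus_product torus_product (rot (trunc g N))) = sets (PiM UNIV (\<lambda>_. coord_measure))"
    "sets (density torus_product (\<lambda>x. ennreal (likelihood g N x))) = sets (PiM UNIV (\<lambda>_. coord_measure))"
    by (simp_all add: torus_product_def)
  show "finite_measure (distr torus_product torus_product (rot (trunc g N)))" by (rule torus_product.finite_measure_distr) simp
  fix A and J :: "nat set" assume J: "finite J" and A: "\<And>i. i \<in> J \<Longrightarrow> A i \<in> sets coord_measure"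
  define F where "F k z = (if k \<in> J then indicator (A k) z else (1::ennreal))" for k z
  have F[measurable]: "F k \<in> borel_measurable borel" for k unfolding F_def using A[of k] by (cases "k \<in> J") simp_all
  \<comment> \<open>A common index set for the box and the likelihood; coordinates missing from
    either get the factor \<open>1\<close>.\<close>
  define K where "K = J \<union> {..<N}"
  have K: "finite K" using J by (simp add: K_def)
  let ?B = "prod_emb UNIV (\<lambda>_. coord_measure) J (Pi\<^sub>E J A)"
  have B: "?B = {x. \<forall>k\<in>J. x k \<in> A k}" by (auto simp: prod_emb_def PiE_iff)
  have Bs: "?B \<in> sets torus_product" unfolding torus_product_def by (rule sets_PiM_I) (use J A in auto)
  have ind: "indicator ?B x = (\<Prod>k\<in>K. F k (x k))" for x
  proof -
    have "(\<Prod>k\<in>K. F k (x k)) = (\<Prod>k\<in>J. F k (x k))"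
      by (rule prod.mono_neutral_right[OF K]) (auto simp: K_def F_def)
    also have "\<dots> = (\<Prod>k\<in>J. indicator (A k) (x k))" by (rule prod.cong) (auto simp: F_def)
    also have "\<dots> = indicator ?B x"
    proof (cases "x \<in> ?B")
      case False
      then obtain k where "k \<in> J" "x k \<notin> A k" unfolding B by blast
      then have "(\<Prod>k\<in>J. indicator (A k) (x k) :: ennreal) = 0" using J by (auto simp: indicator_def)
      then show ?thesis using False by simp
    qed (auto simp: B)
    finally show ?thesis ..
  qed
  have likelihood_eq: "ennreal (likelihood g N x) = (\<Prod>k\<in>K. if k < N then ennreal (ratio (g k) (x k)) else 1)" for x
  proof -
    have "ennreal (likelihood g N x) = (\<Prod>k<N. ennreal (ratio (g k) (x k)))" unfolding likelihood_def by (rule prod_ennreal[symmetric]) simp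
    also have "\<dots> = (\<Prod>k<N. if k < N then ennreal (ratio (g k) (x k)) else 1)" by (rule prod.cong) auto
    also have "\<dots> = (\<Prod>k\<in>K. if k < N then ennreal (ratio (g k) (x k)) else 1)"
      by (rule prod.mono_neutral_left[OF K]) (auto simp: K_def)
    finally show ?thesis .
  qed
  have "emeasure (distr torus_product torus_product (rot (trunc g N))) ?B = (\<integral>\<^sup>+x. indicator ?B x \<partial>distr torus_product torus_product (rot (trunc g N)))"
    using Bs by simp
  also have "\<dots> = (\<integral>\<^sup>+x. indicator ?B (rot (trunc g N) x) \<partial>torus_product)"
    by (rule nn_integral_distr) (use Bs in auto)
  also have "\<dots> = (\<integral>\<^sup>+x. (\<Prod>k\<in>K. F k (trunc g N k * x k)) \<partial>torus_product)" by (simp add: ind rot_def)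
  also have "\<dots> = (\<Prod>k\<in>K. \<integral>\<^sup>+z. F k (trunc g N k * z) \<partial>coord_measure)"
    by (rule nn_integral_prod_torus_product[OF K, where \<phi> = "\<lambda>k z. F k (trunc g N k * z)"]) measurable
  also have "\<dots> = (\<Prod>k\<in>K. \<integral>\<^sup>+z. (if k < N then ennreal (ratio (g k) z) else 1) * F k z \<partial>coord_measure)"
  proof (rule prod.cong[OF refl])
    fix k
    have "cmod (g k) = 1" using g by (simp add: torus_def)
    from nn_integral_ratio[OF this F]
    show "(\<integral>\<^sup>+z. F k (trunc g N k * z) \<partial>coord_measure) = (\<integral>\<^sup>+z. (if k < N then ennreal (ratio (g k) z) else 1) * F k z \<partial>coord_measure)"
      by (simp add: trunc_def)
  qed
  also have "\<dots> = (\<integral>\<^sup>+x. (\<Prod>k\<in>K. (if k < N then ennreal (ratio (g k) (x k)) else 1) * F k (x k)) \<partial>torus_product)"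
    by (rule nn_integral_prod_torus_product[OF K, symmetric, where \<phi> = "\<lambda>k z. (if k < N then ennreal (ratio (g k) z) else 1) * F k z"]) measurable
  also have "\<dots> = (\<integral>\<^sup>+x. ennreal (likelihood g N x) * indicator ?B x \<partial>torus_product)"
    by (simp add: prod.distrib likelihood_eq ind)
  also have "\<dots> = emeasure (density torus_product (\<lambda>x. ennreal (likelihood g N x))) ?B"
    by (rule emeasure_density[symmetric]) (use Bs in auto)
  finally show "emeasure (distr torus_product torus_product (rot (trunc g N))) ?B = emeasure (density torus_product (\<lambda>x. ennreal (likelihood g N x))) ?B" .
qed

section \<open>The two alternatives for rotations of all coordinates\<close>

definition depends_on :: "nat \<Rightarrow> (nat \<Rightarrow> complex) set \<Rightarrow> bool" where
  "depends_on N E \<longleftrightarrow> (\<forall>x y. (\<forall>n<N. x n = y n) \<longrightarrow> x \<in> E \<longrightarrow> y \<in> E)"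

lemma emeasure_rot_cylinder:
  assumes g: "g \<in> torus" and E: "E \<in> sets borel" "depends_on N E"
  shows "emeasure (distr torus_product torus_product (rot g)) E = (\<integral>\<^sup>+x. ennreal (likelihood g N x) * indicator E x \<partial>torus_product)"
proof -
  have "rot g -` E = rot (trunc g N) -` E"
  proof -
    have "rot g x \<in> E \<longleftrightarrow> rot (trunc g N) x \<in> E" for x
    proof -
      have "\<forall>n<N. rot g x n = rot (trunc g N) x n" by (simp add: rot_def trunc_def)
      then show ?thesis using E(2) unfolding depends_on_def by metis
    qed
    then show ?thesis by blast
  qed
  then have "emeasure (distr torus_product torus_product (rot g)) E = emeasure (distr torus_product torus_product (rot (trunc g N))) E"
    using E(1) by (simp add: emeasure_distr)
  also have "\<dots> = (\<integral>\<^sup>+x. ennreal (likelihood g N x) * indicator E x \<partial>torus_product)"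
    unfolding distr_trunc[OF g] by (rule emeasure_density) (use E in auto)
  finally show ?thesis .
qed

text \<open>Independence turns the integral into a product, and \<open>1 + s \<le> exp s\<close>
  bounds the product uniformly in \<open>N\<close>: second moments stay bounded along the
  truncations.\<close>

lemma likelihood_sq_bound:
  assumes g: "g \<in> torus" and s: "summable (\<lambda>n. (cmod (1 - g n))\<^sup>2)"
  shows "(\<integral>\<^sup>+x. ennreal ((likelihood g N x)\<^sup>2) \<partial>torus_product) \<le> ennreal (exp (8 * (\<Sum>n. (cmod (1 - g n))\<^sup>2)))"
proof -
  have gc: "cmod (g n) = 1" for n using g by (simp add: torus_def)
  have "(\<integral>\<^sup>+x. ennreal ((likelihood g N x)\<^sup>2) \<partial>torus_product) = (\<integral>\<^sup>+x. (\<Prod>n<N. ennreal ((ratio (g n) (x n))\<^sup>2)) \<partial>torus_product)"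
    by (rule nn_integral_cong) (simp add: likelihood_def prod_power_distrib[symmetric] prod_ennreal)
  also have "\<dots> = (\<Prod>n<N. \<integral>\<^sup>+z. ennreal ((ratio (g n) z)\<^sup>2) \<partial>coord_measure)"
    by (rule nn_integral_prod_torus_product[where \<phi> = "\<lambda>n z. ennreal ((ratio (g n) z)\<^sup>2)"]) auto
  also have "\<dots> \<le> (\<Prod>n<N. ennreal (exp (8 * (cmod (1 - g n))\<^sup>2)))"
  proof (rule prod_mono_ennreal)
    fix n
    have "(\<integral>\<^sup>+z. ennreal ((ratio (g n) z)\<^sup>2) \<partial>coord_measure) \<le> ennreal (1 + 8 * (cmod (1 - g n))\<^sup>2)"
      by (rule nn_integral_ratio_sq[OF gc])
    also have "\<dots> \<le> ennreal (exp (8 * (cmod (1 - g n))\<^sup>2))"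
      by (rule ennreal_leI) (rule exp_ge_add_one_self)
    finally show "(\<integral>\<^sup>+z. ennreal ((ratio (g n) z)\<^sup>2) \<partial>coord_measure) \<le> ennreal (exp (8 * (cmod (1 - g n))\<^sup>2))" .
  qed
  also have "\<dots> = ennreal (exp (8 * (\<Sum>n<N. (cmod (1 - g n))\<^sup>2)))"
    by (simp add: prod_ennreal exp_sum sum_distrib_left)
  also have "\<dots> \<le> ennreal (exp (8 * (\<Sum>n. (cmod (1 - g n))\<^sup>2)))"
    using sum_le_suminf[OF s, of "{..<N}"] by (intro ennreal_leI) simp
  finally show ?thesis .
qed

text \<open>\<open>V N\<close> is the largest open subset of \<open>U\<close> determined by the
  first \<open>N\<close> coordinates. Basic open sets of the product topology restrict finitely many
  coordinates, so these sets exhaust \<open>U\<close>.\<close>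

lemma open_cylinder_exhaustion:
  fixes U :: "(nat \<Rightarrow> complex) set"
  assumes U: "open U"
  shows "\<exists>V. incseq V \<and> (\<Union>N. V N) = U \<and> (\<forall>N. open (V N) \<and> depends_on N (V N))"
proof (intro exI conjI allI)
  define V where "V N = \<Union>{W. open W \<and> depends_on N W \<and> W \<subseteq> U}" for N
  show "incseq V"
  proof (rule incseq_SucI)
    fix N
    have "depends_on (Suc N) W" if "depends_on N W" for W
      using that unfolding depends_on_def by (meson less_SucI)
    then show "V N \<subseteq> V (Suc N)" unfolding V_def by blast
  qed
  show "open (V N)" for N unfolding V_def by blast
  show "depends_on N (V N)" for N unfolding V_def depends_on_def by blast
  show "(\<Union>N. V N) = U"
  proof
    show "(\<Union>N. V N) \<subseteq> U" unfolding V_def by blast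
    show "U \<subseteq> (\<Union>N. V N)"
    proof
      fix x assume x: "x \<in> U"
      have "openin (product_topology (\<lambda>_. euclidean) UNIV) U" using U by (simp add: euclidean_product_topology)
      from product_topology_open_contains_basis[OF this x]
      obtain X where X: "x \<in> PiE UNIV X" "\<And>i. open (X i)" "finite {i. X i \<noteq> UNIV}" "PiE UNIV X \<subseteq> U" by auto
      obtain N where "\<forall>i\<in>{i. X i \<noteq> UNIV}. i < N" using X(3) unfolding finite_nat_set_iff_bounded ..
      then have N: "i < N" if "X i \<noteq> UNIV" for i using that by simp
      have "open (PiE UNIV X)" using X(2,3) by (intro open_PiE) auto
      moreover have "depends_on N (PiE UNIV X)"
        unfolding depends_on_def
      proof (intro allI impI)
        fix x y assume xy: "\<forall>n<N. x n = y n" "x \<in> PiE UNIV X"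
        have "y i \<in> X i" for i
        proof (cases "X i = UNIV")
          case False
          have "x i \<in> X i" using xy(2) by (rule PiE_mem) simp
          moreover have "x i = y i" using xy(1) N[OF False] by blast
          ultimately show ?thesis by simp
        qed simp
        then show "y \<in> PiE UNIV X" by (simp add: PiE_iff)
      qed
      ultimately have "PiE UNIV X \<subseteq> V N" unfolding V_def using X(4) by blast
      then show "x \<in> (\<Union>N. V N)" using X(1) by blast
    qed
  qed
qed

text \<open>Uniform integrability in elementary form: by \<open>s \<le> t + s\<^sup>2 / t\<close>
  the rotated measure of an open set is at most \<open>t\<close> times its measure plus
  \<open>C / t\<close>, where \<open>C\<close> bounds the second moments. This holds first for sets
  depending on finitely many coordinates, then for all open sets by exhaustion, and outer regularity
  covers a null set by open sets of small measure.\<close>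

lemma rot_absolutely_continuous:
  assumes g: "g \<in> torus" and s: "summable (\<lambda>n. (cmod (1 - g n))\<^sup>2)"
  shows "absolutely_continuous torus_product (distr torus_product torus_product (rot g))"
  unfolding absolutely_continuous_def
proof
  fix E assume E: "E \<in> null_sets torus_product"
  then have Eb: "E \<in> sets borel" and E0: "emeasure torus_product E = 0" by auto
  interpret Q: prob_space "distr torus_product torus_product (rot g)" by (rule torus_product.prob_space_distr) simp
  define C where "C = exp (8 * (\<Sum>n. (cmod (1 - g n))\<^sup>2))"
  have C: "C > 0" by (simp add: C_def)
  have cyl: "emeasure (distr torus_product torus_product (rot g)) W \<le> ennreal t * emeasure torus_product W + ennreal (C / t)"
    if W: "open W" "depends_on N W" and t: "t > 0" for W N t
  proof -
    have Wb: "W \<in> sets borel" using W by simp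
    have "emeasure (distr torus_product torus_product (rot g)) W = (\<integral>\<^sup>+x. ennreal (likelihood g N x) * indicator W x \<partial>torus_product)"
      by (rule emeasure_rot_cylinder[OF g Wb W(2)])
    also have "\<dots> \<le> (\<integral>\<^sup>+x. ennreal t * indicator W x + ennreal (1 / t) * ennreal ((likelihood g N x)\<^sup>2) \<partial>torus_product)"
    proof (rule nn_integral_mono)
      fix x
      have "likelihood g N x \<le> t + 1 / t * (likelihood g N x)\<^sup>2"
      proof (cases "likelihood g N x \<le> t")
        case True
        then show ?thesis using t by (simp add: add_increasing2)
      next
        case False
        then have "t * likelihood g N x \<le> (likelihood g N x)\<^sup>2" unfolding power2_eq_square by (intro mult_right_mono) auto
        then have "likelihood g N x \<le> 1 / t * (likelihood g N x)\<^sup>2" using t by (simp add: field_simps)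
        then show ?thesis using t by simp
      qed
      then have "ennreal (likelihood g N x) \<le> ennreal (t + 1 / t * (likelihood g N x)\<^sup>2)" by (rule ennreal_leI)
      also have "\<dots> = ennreal t + ennreal (1 / t) * ennreal ((likelihood g N x)\<^sup>2)"
        using t by (subst ennreal_plus) (auto simp: ennreal_mult[symmetric])
      finally show "ennreal (likelihood g N x) * indicator W x \<le> ennreal t * indicator W x + ennreal (1 / t) * ennreal ((likelihood g N x)\<^sup>2)"
        by (auto simp: indicator_def)
    qed
    also have "\<dots> = ennreal t * emeasure torus_product W + ennreal (1 / t) * (\<integral>\<^sup>+x. ennreal ((likelihood g N x)\<^sup>2) \<partial>torus_product)"
      using Wb by (subst nn_integral_add) (auto simp: nn_integral_cmult)
    also have "\<dots> \<le> ennreal t * emeasure torus_product W + ennreal (1 / t) * ennreal C"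
      unfolding C_def by (intro add_left_mono mult_left_mono likelihood_sq_bound[OF g s]) auto
    also have "ennreal (1 / t) * ennreal C = ennreal (C / t)"
      using t C by (subst ennreal_mult[symmetric]) auto
    finally show ?thesis .
  qed
  have op: "emeasure (distr torus_product torus_product (rot g)) U \<le> ennreal t * emeasure torus_product U + ennreal (C / t)" if U: "open U" and t: "t > 0" for U t
  proof -
    obtain V where V: "incseq V" "(\<Union>N. V N) = U" "\<And>N. open (V N)" "\<And>N. depends_on N (V N)"
      using open_cylinder_exhaustion[OF U] by blast
    have "range V \<subseteq> sets (distr torus_product torus_product (rot g))" using V(3) by auto
    from SUP_emeasure_incseq[OF this V(1)]
    have "emeasure (distr torus_product torus_product (rot g)) U = (SUP N. emeasure (distr torus_product torus_product (rot g)) (V N))" by (simp add: V(2))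
    also have "\<dots> \<le> ennreal t * emeasure torus_product U + ennreal (C / t)"
    proof (rule SUP_least)
      fix N
      have "emeasure (distr torus_product torus_product (rot g)) (V N) \<le> ennreal t * emeasure torus_product (V N) + ennreal (C / t)"
        by (rule cyl[OF V(3,4) t])
      also have "\<dots> \<le> ennreal t * emeasure torus_product U + ennreal (C / t)"
        using U V(2) by (intro add_right_mono mult_left_mono emeasure_mono) auto
      finally show "emeasure (distr torus_product torus_product (rot g)) (V N) \<le> ennreal t * emeasure torus_product U + ennreal (C / t)" .
    qed
    finally show ?thesis .
  qed
  have small: "measure (distr torus_product torus_product (rot g)) E \<le> e" if e: "e > 0" for e :: real
  proof -
    \<comment> \<open>This makes \<open>C / t\<close> equal to \<open>e / 2\<close>; an open set of
      measure at most \<open>e / (2 * t)\<close> pays for the other half.\<close>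
    define t where "t = 2 * C / e"
    have t: "t > 0" using C e by (simp add: t_def)
    have "e / (2 * t) > 0" using e t by simp
    have "E \<in> sets torus_product" "metrizable_space (euclidean :: (nat \<Rightarrow> complex) topology)"
      using Eb by (simp_all add: metrizable_space_euclidean)
    moreover have "sets torus_product = sigma_sets (topspace euclidean) {U. openin euclidean U}" by (simp add: borel_def)
    ultimately obtain U where U: "open U" "E \<subseteq> U" "measure torus_product U \<le> measure torus_product E + e / (2 * t)"
      using borel_outer_regular[of euclidean torus_product E "e / (2 * t)"] \<open>e / (2 * t) > 0\<close> torus_product.finite_measure_axioms by auto
    have "measure torus_product E = 0" using E0 by (simp add: measure_def)
    then have PU: "measure torus_product U \<le> e / (2 * t)" using U(3) by simp
    have "ennreal (measure (distr torus_product torus_product (rot g)) E) = emeasure (distr torus_product torus_product (rot g)) E" by (simp add: Q.emeasure_eq_measure)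
    also have "\<dots> \<le> emeasure (distr torus_product torus_product (rot g)) U" using U by (intro emeasure_mono) auto
    also have "\<dots> \<le> ennreal t * emeasure torus_product U + ennreal (C / t)" by (rule op[OF U(1) t])
    also have "\<dots> = ennreal (t * measure torus_product U + C / t)"
      using t C by (simp add: torus_product.emeasure_eq_measure ennreal_mult ennreal_plus)
    finally have "measure (distr torus_product torus_product (rot g)) E \<le> t * measure torus_product U + C / t"
      using t C by (subst (asm) ennreal_le_iff) auto
    also have "t * measure torus_product U \<le> t * (e / (2 * t))" using PU t by (intro mult_left_mono) auto
    also have "t * (e / (2 * t)) + C / t = e" using t C e by (simp add: t_def field_simps)
    finally show ?thesis by simp
  qed
  have "measure (distr torus_product torus_product (rot g)) E \<le> 0" by (rule field_le_epsilon) (use small in simp)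
  then have "measure (distr torus_product torus_product (rot g)) E = 0" by (intro antisym measure_nonneg)
  then have "emeasure (distr torus_product torus_product (rot g)) E = 0" by (simp add: Q.emeasure_eq_measure)
  then show "E \<in> null_sets (distr torus_product torus_product (rot g))" using Eb by (auto intro!: null_setsI)
qed

lemma sqrt_prod: "sqrt (\<Prod>i\<in>A. f i) = (\<Prod>i\<in>A. sqrt (f i))"
  by (induction A rule: infinite_finite_induct) (auto simp: real_sqrt_mult)

text \<open>The affinity of the truncations is at most \<open>exp\<close> of minus the partial sums
  of a divergent series. Where the likelihood is below \<open>1\<close> it is at most its square
  root, and elsewhere \<open>1\<close> is; hence \<open>A k\<close> has small rotated measure and
  its complement small original measure. Borel-Cantelli along truncations with affinity at most
  \<open>(1/2)^k\<close> lets \<open>limsup A\<close> separate the two measures.\<close>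

lemma rot_singular:
  assumes g: "g \<in> torus" and s: "\<not> summable (\<lambda>n. (cmod (1 - g n))\<^sup>2)"
  shows "\<exists>A\<in>sets borel. emeasure (distr torus_product torus_product (rot g)) A = 0 \<and> emeasure torus_product (UNIV - A) = 0"
proof -
  let ?Q = "distr torus_product torus_product (rot g)"
  interpret Q: prob_space ?Q by (rule torus_product.prob_space_distr) simp
  have gc: "cmod (g n) = 1" for n using g by (simp add: torus_def)
  define d where "d n = (cmod (1 - g n))\<^sup>2 / 18" for n
  have d: "0 \<le> d n" for n by (simp add: d_def)
  have d1: "d n \<le> 1" for n
  proof -
    have "cmod (1 - g n) \<le> 2" using norm_triangle_ineq4[of 1 "g n"] gc by simp
    then have "(cmod (1 - g n))\<^sup>2 \<le> 2\<^sup>2" by (rule power_mono) simp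
    then show ?thesis by (simp add: d_def)
  qed
  have aff: "(\<integral>\<^sup>+x. ennreal (sqrt (likelihood g N x)) \<partial>torus_product) \<le> ennreal (exp (- (\<Sum>n<N. d n)))" for N
  proof -
    have "(\<integral>\<^sup>+x. ennreal (sqrt (likelihood g N x)) \<partial>torus_product) = (\<integral>\<^sup>+x. (\<Prod>n<N. ennreal (sqrt (ratio (g n) (x n)))) \<partial>torus_product)"
      by (rule nn_integral_cong) (simp add: likelihood_def sqrt_prod prod_ennreal)
    also have "\<dots> = (\<Prod>n<N. \<integral>\<^sup>+z. ennreal (sqrt (ratio (g n) z)) \<partial>coord_measure)"
      by (rule nn_integral_prod_torus_product[where \<phi> = "\<lambda>n z. ennreal (sqrt (ratio (g n) z))"]) auto
    also have "\<dots> \<le> (\<Prod>n<N. ennreal (exp (- d n)))"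
    proof (rule prod_mono_ennreal)
      fix n
      show "(\<integral>\<^sup>+z. ennreal (sqrt (ratio (g n) z)) \<partial>coord_measure) \<le> ennreal (exp (- d n))"
        unfolding nn_integral_sqrt_ratio[OF gc] d_def[symmetric]
        using exp_ge_add_one_self[of "- d n"] by (intro ennreal_leI) simp
    qed
    also have "\<dots> = ennreal (exp (- (\<Sum>n<N. d n)))" by (simp add: prod_ennreal exp_sum flip: sum_negf)
    finally show ?thesis .
  qed
  have nsum: "\<not> summable d"
  proof
    assume "summable d"
    from summable_mult[OF this, of 18] show False using s by (simp add: d_def)
  qed
  have big: "\<exists>N. (\<Sum>n<N. d n) > B" for B
  proof (rule ccontr)
    assume "\<not> ?thesis"
    then have "summable d" by (intro summableI_nonneg_bounded[where x = B]) (auto simp: d not_less)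
    then show False using nsum by simp
  qed
  have "\<exists>N. exp (- (\<Sum>n<N. d n)) \<le> (1/2)^k" for k :: nat
  proof -
    obtain N where N: "(\<Sum>n<N. d n) > - ln ((1/2)^k)" using big by blast
    then have "exp (- (\<Sum>n<N. d n)) \<le> exp (ln ((1/2)^k))" by (subst exp_le_cancel_iff) linarith
    also have "exp (ln ((1/2)^k)) = (1/2::real)^k" by (rule exp_ln) simp
    finally show ?thesis ..
  qed
  then obtain n where n: "\<And>k. exp (- (\<Sum>i<n k. d i)) \<le> (1/2)^k" by metis
  define A where "A k = {x. likelihood g (n k) x < 1}" for k
  have A[measurable]: "A k \<in> sets borel" for k unfolding A_def by measurable
  have QA: "emeasure ?Q (A k) \<le> ennreal ((1/2)^k)" for k
  proof -
    have eq: "likelihood g (n k) x = likelihood g (n k) y" if "\<forall>i<n k. x i = y i" for x y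
      unfolding likelihood_def by (rule prod.cong) (use that in auto)
    have "depends_on (n k) (A k)"
      unfolding depends_on_def
    proof (intro allI impI)
      fix x y assume xy: "\<forall>i<n k. x i = y i" "x \<in> A k"
      show "y \<in> A k" using xy(2) eq[OF xy(1)] by (simp add: A_def)
    qed
    then have "emeasure ?Q (A k) = (\<integral>\<^sup>+x. ennreal (likelihood g (n k) x) * indicator (A k) x \<partial>torus_product)"
      by (rule emeasure_rot_cylinder[OF g A])
    also have "\<dots> \<le> (\<integral>\<^sup>+x. ennreal (sqrt (likelihood g (n k) x)) \<partial>torus_product)"
    proof (rule nn_integral_mono)
      fix x
      have "likelihood g (n k) x \<le> sqrt (likelihood g (n k) x)" if "likelihood g (n k) x < 1"
      proof (rule real_le_rsqrt)
        show "(likelihood g (n k) x)\<^sup>2 \<le> likelihood g (n k) x"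
          unfolding power2_eq_square using that by (intro mult_left_le) auto
      qed
      then show "ennreal (likelihood g (n k) x) * indicator (A k) x \<le> ennreal (sqrt (likelihood g (n k) x))"
        by (auto simp: A_def indicator_def intro: ennreal_leI)
    qed
    also have "\<dots> \<le> ennreal ((1/2)^k)" using aff[of "n k"] n[of k] ennreal_leI order_trans by blast
    finally show ?thesis .
  qed
  have PA: "emeasure torus_product (UNIV - A k) \<le> ennreal ((1/2)^k)" for k
  proof -
    have "emeasure torus_product (UNIV - A k) = (\<integral>\<^sup>+x. indicator (UNIV - A k) x \<partial>torus_product)" by simp
    also have "\<dots> \<le> (\<integral>\<^sup>+x. ennreal (sqrt (likelihood g (n k) x)) \<partial>torus_product)"
      by (rule nn_integral_mono) (auto simp: A_def indicator_def)
    also have "\<dots> \<le> ennreal ((1/2)^k)" using aff[of "n k"] n[of k] ennreal_leI order_trans by blast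
    finally show ?thesis .
  qed
  have sh: "summable (\<lambda>k. (1/2::real)^k)" by (rule summable_geometric) simp
  have "limsup A \<in> null_sets ?Q"
  proof (rule borel_cantelli_limsup1)
    show "summable (\<lambda>k. measure ?Q (A k))"
    proof (rule summable_comparison_test'[OF sh])
      fix k show "norm (measure ?Q (A k)) \<le> (1/2)^k"
        using QA[of k] by (simp add: Q.emeasure_eq_measure)
    qed
  qed (auto simp: Q.emeasure_eq_measure)
  then have Q0: "emeasure ?Q (limsup A) = 0" by auto
  have "emeasure torus_product (UNIV - limsup A) = 0"
  proof -
    have "UNIV - limsup A \<subseteq> (\<Union>m. \<Inter>k\<in>{m..}. UNIV - A k)" by (auto simp: limsup_INF_SUP)
    moreover have "(\<Inter>k\<in>{m..}. UNIV - A k) \<in> null_sets torus_product" for m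
    proof -
      have mb: "(\<Inter>k\<in>{m..}. UNIV - A k) \<in> sets borel" by measurable
      have "measure torus_product (\<Inter>k\<in>{m..}. UNIV - A k) \<le> (1/2)^k" if "k \<ge> m" for k
      proof -
        have "emeasure torus_product (\<Inter>k\<in>{m..}. UNIV - A k) \<le> emeasure torus_product (UNIV - A k)"
          by (rule emeasure_mono) (use that in auto)
        also have "\<dots> \<le> ennreal ((1/2)^k)" by (rule PA)
        finally show ?thesis by (simp add: torus_product.emeasure_eq_measure)
      qed
      moreover have "(\<lambda>k. (1/2::real)^k) \<longlonglongrightarrow> 0" by (rule LIMSEQ_realpow_zero) auto
      ultimately have "measure torus_product (\<Inter>k\<in>{m..}. UNIV - A k) \<le> 0" by (intro LIMSEQ_le_const[of "\<lambda>k. (1/2::real)^k"]) auto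
      then have "measure torus_product (\<Inter>k\<in>{m..}. UNIV - A k) = 0" by (intro antisym measure_nonneg)
      then have "emeasure torus_product (\<Inter>k\<in>{m..}. UNIV - A k) = 0" unfolding torus_product.emeasure_eq_measure by simp
      then show ?thesis using mb by (intro null_setsI) auto
    qed
    then have "(\<Union>m. \<Inter>k\<in>{m..}. UNIV - A k) \<in> null_sets torus_product" by (intro null_sets_UN) auto
    ultimately have "UNIV - limsup A \<in> null_sets torus_product" by (rule null_sets_subset[rotated 2]) measurable
    then show ?thesis by auto
  qed
  moreover have "limsup A \<in> sets borel" by measurable
  ultimately show ?thesis using Q0 by blast
qed

section \<open>\<open>T2H\<close> as a group of quasi-invariance\<close>

lemma coord_continuous: "continuous_map T.mtopology euclidean (\<lambda>x. x n)"
proof -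
  have "continuous_map T.mtopology Met_TC.mtopology (\<lambda>x :: nat \<Rightarrow> complex. x n)"
    unfolding Met_TC.continuous_map_to_metric
  proof (intro ballI allI impI)
    fix x and \<epsilon> :: real assume x: "x \<in> topspace T.mtopology" and e: "\<epsilon> > 0"
    show "\<exists>U. openin T.mtopology U \<and> x \<in> U \<and> (\<forall>y\<in>U. y n \<in> Met_TC.mball (x n) \<epsilon>)"
    proof (intro exI conjI ballI)
      show "openin T.mtopology (T.mball x \<epsilon>)" by simp
      show "x \<in> T.mball x \<epsilon>" using x e by simp
      fix y assume "y \<in> T.mball x \<epsilon>"
      then have y: "x \<in> T2H_set" "y \<in> T2H_set" "l2_dist x y < \<epsilon>" by auto
      have "dist (x n) (y n) \<le> l2_dist x y" unfolding dist_norm by (rule l2_dist_coord[OF T2H_summable[OF y(1,2)]])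
      then show "y n \<in> Met_TC.mball (x n) \<epsilon>" using y(3) by simp
    qed
  qed
  then show ?thesis by simp
qed

section \<open>The compact torus as ambient group\<close>

definition torus_group :: "(nat \<Rightarrow> complex) topgroup" where
  "torus_group = \<lparr>carrier = torus, monoid.mult = (\<lambda>z w n. z n * w n), one = (\<lambda>n. 1), gtop = top_of_set torus\<rparr>"

lemma torus_simps: "carrier torus_group = torus" "monoid.mult torus_group = (\<lambda>z w n. z n * w n)"
    "one torus_group = (\<lambda>n. 1)" "gtop torus_group = top_of_set torus"
  by (simp_all add: torus_group_def)

lemma torus_cnj: "z \<in> torus \<Longrightarrow> (\<lambda>n. cnj (z n)) \<in> torus" "z \<in> torus \<Longrightarrow> cnj (z n) * z n = 1"
  using complex_norm_square[of "z n"] by (auto simp: torus_def mult.commute)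

lemma comm_group_torus: "comm_group torus_group"
proof (rule comm_groupI)
  fix x assume x: "x \<in> carrier torus_group"
  then have "(\<lambda>n. cnj (x n)) \<otimes>\<^bsub>torus_group\<^esub> x = \<one>\<^bsub>torus_group\<^esub>" by (simp add: torus_simps torus_cnj)
  then show "\<exists>y\<in>carrier torus_group. y \<otimes>\<^bsub>torus_group\<^esub> x = \<one>\<^bsub>torus_group\<^esub>"
    using torus_cnj(1) x by (auto simp: torus_simps)
qed (auto simp: torus_simps torus_def norm_mult ac_simps)

lemma compact_torus: "compact torus"
proof -
  have "compactin (product_topology (\<lambda>_::nat. euclidean :: complex topology) UNIV) (PiE UNIV (\<lambda>_. sphere 0 1))"
    by (simp add: compactin_PiE)
  moreover have "PiE UNIV (\<lambda>_. sphere 0 1) = torus" by (auto simp: torus_def PiE_iff)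
  ultimately show ?thesis by (simp add: euclidean_product_topology)
qed

lemma topological_group_torus: "topological_group torus_group"
proof -
  interpret comm_group torus_group by (rule comm_group_torus)
  have inv: "inv\<^bsub>torus_group\<^esub> z = (\<lambda>n. cnj (z n))" if "z \<in> torus" for z
    using that torus_cnj by (intro inv_equality) (auto simp: torus_simps)
  have coord: "continuous_on S (\<lambda>z. g z n)" if "continuous_on S g" for S :: "'a::topological_space set" and g :: "'a \<Rightarrow> nat \<Rightarrow> complex" and n
    using continuous_on_compose2[OF continuous_on_product_coordinates that, of n] by simp
  have m: "continuous_map (top_of_set (torus \<times> torus)) (top_of_set torus) (\<lambda>(x, y). \<lambda>n. x n * y n)"
  proof -
    have "continuous_on (torus \<times> torus) (\<lambda>z. \<lambda>n. fst z n * snd z n)"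
      by (intro continuous_on_coordinatewise_then_product continuous_on_mult
          coord[OF continuous_on_fst[OF continuous_on_id]] coord[OF continuous_on_snd[OF continuous_on_id]])
    then have "continuous_map (top_of_set (torus \<times> torus)) euclidean (\<lambda>z. \<lambda>n. fst z n * snd z n)" by simp
    then show ?thesis unfolding case_prod_unfold
      by (rule continuous_map_into_subtopology) (auto simp: torus_def norm_mult)
  qed
  have i: "continuous_map (top_of_set torus) (top_of_set torus) (\<lambda>z. inv\<^bsub>torus_group\<^esub> z)"
  proof (rule continuous_map_eq)
    have "continuous_on torus (\<lambda>z n. cnj (z n))"
      by (intro continuous_on_coordinatewise_then_product continuous_on_cnj coord[OF continuous_on_id])
    then have "continuous_map (top_of_set torus) euclidean (\<lambda>z n. cnj (z n))" by simp
    then show "continuous_map (top_of_set torus) (top_of_set torus) (\<lambda>z n. cnj (z n))"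
      by (rule continuous_map_into_subtopology) (auto simp: torus_def)
  qed (simp add: inv)
  show ?thesis
    unfolding topological_group_def using m i is_group by (simp add: torus_simps)
qed

lemma polish_torus: "polish_group torus_group"
  unfolding polish_group_def
proof (intro conjI topological_group_torus)
  have "closed torus" using compact_torus by (rule compact_imp_closed)
  then show "completely_metrizable_space (gtop torus_group)"
    unfolding torus_simps by (intro completely_metrizable_space_closedin completely_metrizable_space_euclidean) simp
  obtain D where D: "countable D" "D \<subseteq> torus" "torus \<subseteq> closure D" using separable by metis
  have "top_of_set torus closure_of D = torus \<inter> closure D"
    using D(2) by (subst closure_of_subtopology) (auto simp: Int_absorb1)
  then show "separable_space (gtop torus_group)"
    unfolding separable_space_def torus_simps using D by (intro exI[of _ D]) auto
qed

lemma torus_borel[measurable]: "torus \<in> sets borel"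
  using compact_imp_closed[OF compact_torus] by simp

lemma emeasure_torus: "emeasure torus_product torus = 1"
proof -
  have "coord_density \<in> borel_measurable circle_measure" using coord_density_measurable by (simp only: measurable_cong_sets[OF sets_circle_measure refl])
  then have "(\<lambda>z. ennreal (coord_density z)) \<in> borel_measurable circle_measure" by (rule measurable_compose) (rule measurable_ennreal)
  then have "AE z in coord_measure. cmod z = 1"
    unfolding coord_measure_def by (subst AE_density) (use AE_circle_measure in \<open>auto elim: eventually_mono\<close>)
  then have "AE x in torus_product. cmod (x n) = 1" for n
    unfolding torus_product_def by (intro AE_PiM_component prob_coord_measure) auto
  then have "AE x in torus_product. x \<in> torus" unfolding torus_def by (simp add: AE_all_countable)
  then show ?thesis by (intro torus_product.emeasure_eq_1_AE) auto
qed

definition torus_measure :: "(nat \<Rightarrow> complex) measure" where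
  "torus_measure = restrict_space torus_product torus"

lemma space_torus_measure: "space torus_measure = torus"
  by (simp add: torus_measure_def space_restrict_space)

lemma sets_torus_measure: "A \<in> sets torus_measure \<longleftrightarrow> A \<subseteq> torus \<and> A \<in> sets borel"
  unfolding torus_measure_def by (subst sets_restrict_space_iff) auto

lemma emeasure_torus_measure: "A \<subseteq> torus \<Longrightarrow> emeasure torus_measure A = emeasure torus_product A"
  unfolding torus_measure_def by (rule emeasure_restrict_space) auto

lemma borel_prob_torus: "borel_prob torus_group torus_measure"
  unfolding borel_prob_def
proof (intro conjI)
  show "prob_space torus_measure"
    by (rule prob_spaceI) (simp add: space_torus_measure emeasure_torus_measure emeasure_torus)
  show "space torus_measure = topspace (gtop torus_group)" by (simp add: space_torus_measure torus_simps)
  have "sets torus_measure = (\<inter>) torus ` sets borel"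
    unfolding torus_measure_def sets_restrict_space by simp
  also have "sets borel = sigma_sets UNIV {U :: (nat \<Rightarrow> complex) set. open U}" by (simp add: borel_def)
  also have "(\<inter>) torus ` sigma_sets UNIV {U. open U} = sigma_sets torus ((\<inter>) torus ` {U. open U})"
    by (rule sigma_sets_Int) (use torus_borel in \<open>auto simp: borel_def\<close>)
  also have "(\<inter>) torus ` {U. open U} = {U. openin (gtop torus_group) U}"
    by (auto simp: torus_simps openin_open)
  finally show "sets torus_measure = sigma_sets (topspace (gtop torus_group)) {U. openin (gtop torus_group) U}"
    by (simp add: torus_simps)
qed

lemma emeasure_translate_torus:
  assumes g: "g \<in> torus" and E: "E \<in> sets torus_measure"
  shows "emeasure (translate torus_group torus_measure g) E = emeasure (distr torus_product torus_product (rot g)) E"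
proof -
  have Eb: "E \<subseteq> torus" "E \<in> sets borel" using E by (auto simp: sets_torus_measure)
  have "emeasure (translate torus_group torus_measure g) E
      = emeasure torus_measure ((\<lambda>x. g \<otimes>\<^bsub>torus_group\<^esub> x) -` E \<inter> space torus_measure)"
    unfolding translate_def
    by (rule emeasure_distr[OF translate_measurable[OF topological_group_torus borel_prob_torus] E])
      (use g in \<open>simp add: torus_simps\<close>)
  also have "(\<lambda>x. g \<otimes>\<^bsub>torus_group\<^esub> x) -` E \<inter> space torus_measure = rot g -` E"
  proof -
    have "x \<in> torus" if "rot g x \<in> E" for x
    proof -
      have "cmod (g n * x n) = 1" for n using that Eb(1) by (auto simp: torus_def rot_def)
      then show ?thesis using g by (simp add: torus_def norm_mult)
    qed
    then show ?thesis by (auto simp: torus_simps rot_def space_torus_measure)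
  qed
  also have "emeasure torus_measure (rot g -` E) = emeasure torus_product (rot g -` E)"
  proof (rule emeasure_torus_measure)
    show "rot g -` E \<subseteq> torus"
    proof
      fix x assume "x \<in> rot g -` E"
      then have "cmod (g n * x n) = 1" for n using Eb(1) by (auto simp: torus_def rot_def)
      then show "x \<in> torus" using g by (simp add: torus_def norm_mult)
    qed
  qed
  also have "\<dots> = emeasure (distr torus_product torus_product (rot g)) E" using Eb by (simp add: emeasure_distr)
  finally show ?thesis .
qed

lemma T2H_torus: "T2H_set = {g \<in> torus. summable (\<lambda>n. (cmod (1 - g n))\<^sup>2)}"
  by (auto simp: T2H_set_def torus_def)

text \<open>The second direction is the first one applied to the inverse rotation \<open>h\<close>,
  because \<open>rot g\<close> after \<open>rot h\<close> is the identity.\<close>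

lemma torus_equivalent:
  assumes "g \<in> T2H_set"
  shows "equivalent_measures (translate torus_group torus_measure g) torus_measure"
  unfolding equivalent_measures_def
proof
  let ?t = "translate torus_group torus_measure g"
  have g: "g \<in> torus" "summable (\<lambda>n. (cmod (1 - g n))\<^sup>2)" using assms by (auto simp: T2H_torus)
  define h where "h n = cnj (g n)" for n
  have "h \<in> T2H_set" unfolding h_def using T2H_cnj_closed[OF assms] .
  then have h: "h \<in> torus" "summable (\<lambda>n. (cmod (1 - h n))\<^sup>2)" by (auto simp: T2H_torus)
  have st: "sets ?t = sets torus_measure" by (simp add: translate_def)
  show "absolutely_continuous torus_measure ?t"
    unfolding absolutely_continuous_def
  proof
    fix E assume E: "E \<in> null_sets torus_measure"
    then have Es: "E \<in> sets torus_measure" "E \<subseteq> torus" "E \<in> sets borel" using sets_torus_measure by blast+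
    have "emeasure torus_product E = 0" using E Es emeasure_torus_measure by (metis null_setsD1)
    then have "E \<in> null_sets torus_product" using Es by (intro null_setsI) auto
    then have "E \<in> null_sets (distr torus_product torus_product (rot g))"
      using rot_absolutely_continuous[OF g] unfolding absolutely_continuous_def by blast
    then have "emeasure ?t E = 0" unfolding emeasure_translate_torus[OF g(1) Es(1)] by (rule null_setsD1)
    then show "E \<in> null_sets ?t" using Es(1) st by (intro null_setsI) auto
  qed
  show "absolutely_continuous ?t torus_measure"
    unfolding absolutely_continuous_def
  proof
    fix E assume E: "E \<in> null_sets ?t"
    then have Es: "E \<in> sets torus_measure" using st by blast
    then have Eb: "E \<subseteq> torus" "E \<in> sets borel" using sets_torus_measure by blast+
    have "emeasure (distr torus_product torus_product (rot g)) E = 0"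
      using null_setsD1[OF E] unfolding emeasure_translate_torus[OF g(1) Es] .
    then have z: "emeasure torus_product (rot g -` E) = 0" using Eb by (simp add: emeasure_distr)
    have mb: "rot g -` E \<in> sets borel" using measurable_sets_borel[OF rot_measurable Eb(2)] by simp
    have "rot g -` E \<in> null_sets torus_product" using z mb by (intro null_setsI) auto
    then have "rot g -` E \<in> null_sets (distr torus_product torus_product (rot h))"
      using rot_absolutely_continuous[OF h] unfolding absolutely_continuous_def by blast
    then have "emeasure torus_product (rot h -` (rot g -` E)) = 0" using mb by (simp add: null_sets_def emeasure_distr)
    also have "rot h -` (rot g -` E) = E"
    proof -
      have "g n * h n = 1" for n
        using torus_cnj(2)[OF g(1), of n] by (simp add: h_def mult.commute)
      then have "rot g (rot h x) = x" for x by (simp add: rot_def mult.assoc[symmetric])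
      then show ?thesis by auto
    qed
    finally have "emeasure torus_measure E = 0" using Eb emeasure_torus_measure by simp
    then show "E \<in> null_sets torus_measure" using Es by (intro null_setsI) auto
  qed
qed

lemma torus_singular:
  assumes "g \<in> torus - T2H_set"
  shows "mutually_singular (translate torus_group torus_measure g) torus_measure"
proof -
  let ?t = "translate torus_group torus_measure g"
  have g: "g \<in> torus" "\<not> summable (\<lambda>n. (cmod (1 - g n))\<^sup>2)" using assms by (auto simp: T2H_torus)
  obtain A where A: "A \<in> sets borel" "emeasure (distr torus_product torus_product (rot g)) A = 0" "emeasure torus_product (UNIV - A) = 0"
    using rot_singular[OF g] by blast
  have s: "A \<inter> torus \<in> sets torus_measure" using A(1) by (simp add: sets_torus_measure)
  have "emeasure ?t (A \<inter> torus) \<le> emeasure (distr torus_product torus_product (rot g)) A"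
    unfolding emeasure_translate_torus[OF g(1) s] by (rule emeasure_mono) (use A in auto)
  then have 1: "emeasure ?t (A \<inter> torus) = 0" using A(2) by simp
  have "emeasure torus_measure (torus - A) = emeasure torus_product (torus - A)" by (rule emeasure_torus_measure) auto
  also have "\<dots> \<le> emeasure torus_product (UNIV - A)" by (rule emeasure_mono) (use A in auto)
  finally have "emeasure torus_measure (torus - A) = 0" using A(3) by simp
  moreover have "space ?t - (A \<inter> torus) = torus - A" by (auto simp: translate_def space_torus_measure)
  ultimately show ?thesis unfolding mutually_singular_def using 1 s
    by (intro bexI[of _ "A \<inter> torus"]) (auto simp: translate_def)
qed

lemma prob_torus_measure: "prob_space torus_measure"
  using borel_prob_torus by (simp add: borel_prob_def)

lemma singular_not_equivalent:
  assumes sing: "mutually_singular N M" and M: "prob_space M" and s: "sets N = sets M"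
  shows "\<not> equivalent_measures N M"
proof
  assume e: "equivalent_measures N M"
  interpret prob_space M by (rule M)
  from sing[unfolded mutually_singular_def]
  obtain A where A: "A \<in> sets N" "emeasure N A = 0" "emeasure M (space N - A) = 0" by (elim bexE conjE)
  have "A \<in> null_sets N" using A(1,2) by (intro null_setsI)
  then have "A \<in> null_sets M" using e unfolding equivalent_measures_def absolutely_continuous_def by blast
  moreover have "space N - A \<in> null_sets M" using A(1,3) s sets_eq_imp_space_eq[OF s] by (intro null_setsI) auto
  ultimately have "A \<union> (space N - A) \<in> null_sets M" by (rule null_sets.Un)
  moreover have "A \<union> (space N - A) = space M" using sets.sets_into_space[OF A(1)] sets_eq_imp_space_eq[OF s] by auto
  ultimately show False using emeasure_space_1 by (simp add: null_sets_def)
qed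

text \<open>Rotations outside \<open>T2H_set\<close> give singular and therefore inequivalent
  measures, so one dichotomy yields both the exact set \<open>quasi_invariance\<close> and the
  singularity clause.\<close>

lemma QI_witness_T2H: "QI_witness T2H torus_group torus_measure (\<lambda>x. x)"
  unfolding QI_witness_def
proof (intro conjI)
  show "polish_group torus_group" by (rule polish_torus)
  show "locally_compact_space (gtop torus_group)"
    using compact_torus by (simp add: torus_simps compact_imp_locally_compact_space compact_space_subtopology)
  show "borel_prob torus_group torus_measure" by (rule borel_prob_torus)
  show "(\<lambda>x. x) \<in> hom T2H torus_group" by (auto simp: hom_def T2H_simps torus_simps T2H_torus)
  show "inj_on (\<lambda>x. x) (carrier T2H)" by simp
  have "continuous_map T.mtopology euclidean (\<lambda>x :: nat \<Rightarrow> complex. x)"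
    unfolding euclidean_product_topology[symmetric] continuous_map_componentwise_UNIV using coord_continuous by blast
  then show "continuous_map (gtop T2H) (gtop torus_group) (\<lambda>x. x)"
    unfolding T2H_simps torus_simps
  proof (rule continuous_map_into_subtopology)
    have "T2H_set \<subseteq> torus" by (auto simp: T2H_set_def torus_def)
    then show "(\<lambda>x. x) \<in> topspace T.mtopology \<rightarrow> torus" by (auto simp only: T.topspace_mtopology)
  qed
  have "\<not> equivalent_measures (translate torus_group torus_measure g) torus_measure" if "g \<in> torus - T2H_set" for g
    using torus_singular[OF that] prob_torus_measure by (rule singular_not_equivalent) (simp add: translate_def)
  then show QI: "quasi_invariance torus_group torus_measure = (\<lambda>x. x) ` carrier T2H"
    unfolding quasi_invariance_def using torus_equivalent by (auto simp: torus_simps T2H_simps T2H_torus)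
  show "\<forall>g\<in>carrier torus_group - quasi_invariance torus_group torus_measure.
      mutually_singular (translate torus_group torus_measure g) torus_measure"
    unfolding QI using torus_singular by (simp add: torus_simps T2H_simps)
qed

section \<open>A topological generator\<close>

text \<open>Independence over the integers of the first \<open>n\<close> values of \<open>a\<close>
  together with the constant \<open>1\<close>; the coefficient of the constant carries the index
  \<open>n\<close>.\<close>

definition int_independent :: "(nat \<Rightarrow> real) \<Rightarrow> nat \<Rightarrow> bool" where
  "int_independent a n \<longleftrightarrow>
     (\<forall>u :: nat \<Rightarrow> int. (\<Sum>i<n. of_int (u i) * a i) + of_int (u n) = 0 \<longrightarrow> (\<forall>i\<le>n. u i = 0))"

lemma int_independent_cong: "(\<And>i. i < n \<Longrightarrow> a i = b i) \<Longrightarrow> int_independent a n = int_independent b n"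
proof -
  assume eq: "\<And>i. i < n \<Longrightarrow> a i = b i"
  have "(\<Sum>i<n. of_int (u i) * a i) = (\<Sum>i<n. of_int (u i) * b i)" for u :: "nat \<Rightarrow> int"
    by (rule sum.cong) (use eq in auto)
  then show ?thesis unfolding int_independent_def by simp
qed

text \<open>An integer relation with nonzero coefficient at the new number determines that number,
  so only countably many values have to be avoided in the interval.\<close>

lemma int_independent_extend:
  assumes ind: "int_independent a n" and \<delta>: "\<delta> > 0"
  shows "\<exists>r. 0 < r \<and> r < \<delta> \<and> int_independent (a(n := r)) (Suc n)"
proof -
  define q where "q = (\<lambda>(l :: int list, c :: int, e :: int). ((\<Sum>i<n. of_int (l ! i) * a i) + of_int c) / of_int e)"
  have "countable (range q)" by simp
  moreover have "uncountable {0<..<\<delta>}" using \<delta> by (simp add: uncountable_open_interval)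
  ultimately have "uncountable ({0<..<\<delta>} - range q)" by (rule uncountable_minus_countable[rotated])
  then have "{0<..<\<delta>} - range q \<noteq> {}" by (metis countable_empty)
  then obtain r where "r \<in> {0<..<\<delta>} - range q" by blast
  then have r: "0 < r" "r < \<delta>" "r \<notin> range q" by simp_all
  have "int_independent (a(n := r)) (Suc n)"
    unfolding int_independent_def
  proof (intro allI impI)
    fix u :: "nat \<Rightarrow> int" and i
    assume "(\<Sum>i<Suc n. of_int (u i) * (a(n := r)) i) + of_int (u (Suc n)) = 0" and i: "i \<le> Suc n"
    then have eq: "(\<Sum>i<n. of_int (u i) * a i) + of_int (u n) * r + of_int (u (Suc n)) = 0" by simp
    have un: "u n = 0"
    proof (rule ccontr)
      assume nz: "u n \<noteq> 0"
      have "(\<Sum>i<n. of_int (map u [0..<n] ! i) * a i) = (\<Sum>i<n. of_int (u i) * a i)" by (rule sum.cong) auto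
      then have "q (map u [0..<n], u (Suc n), - u n) = ((\<Sum>i<n. of_int (u i) * a i) + of_int (u (Suc n))) / of_int (- u n)"
        by (simp add: q_def)
      also have "\<dots> = r"
      proof -
        have "(\<Sum>i<n. of_int (u i) * a i) + of_int (u (Suc n)) = of_int (- u n) * r" using eq by simp
        then show ?thesis using nz by simp
      qed
      finally show False using r(3) by (metis rangeI)
    qed
    define v where "v j = (if j < n then u j else u (Suc n))" for j
    have "(\<Sum>j<n. of_int (v j) * a j) = (\<Sum>j<n. of_int (u j) * a j)" by (rule sum.cong) (auto simp: v_def)
    then have "(\<Sum>j<n. of_int (v j) * a j) + of_int (v n) = 0" using eq un by (simp add: v_def)
    then have v0: "\<And>j. j \<le> n \<Longrightarrow> v j = 0" using ind unfolding int_independent_def by blast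
    show "u i = 0"
    proof -
      consider "i < n" | "i = n" | "i = Suc n" using i by linarith
      then show ?thesis
      proof cases
        case 1 then show ?thesis using v0[of i] by (simp add: v_def)
      next
        case 2 then show ?thesis using un by simp
      next
        case 3 then show ?thesis using v0[of n] by (simp add: v_def)
      qed
    qed
  qed
  then show ?thesis using r by blast
qed

lemma kronecker_int_independent:
  assumes ind: "int_independent a n" and e: "\<epsilon> > 0"
  shows "\<exists>k :: int. \<forall>i<n. \<exists>h :: int. \<bar>of_int k * a i - of_int h - t i\<bar> < \<epsilon>"
proof -
  \<comment> \<open>Kronecker's theorem in the form used here wants the constant \<open>1\<close> as
    last member of an independent family.\<close>
  define \<theta> where "\<theta> i = (if i < n then a i else 1)" for i
  have key: "\<forall>i\<le>n. u i = 0" if "(\<Sum>i\<le>n. of_int (u i) * \<theta> i) = 0" for u :: "nat \<Rightarrow> int"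
  proof -
    have "(\<Sum>i<n. of_int (u i) * \<theta> i) = (\<Sum>i<n. of_int (u i) * a i)" by (rule sum.cong) (auto simp: \<theta>_def)
    moreover have "(\<Sum>i\<le>n. of_int (u i) * \<theta> i) = (\<Sum>i<n. of_int (u i) * \<theta> i) + of_int (u n)"
      by (simp add: lessThan_Suc_atMost[symmetric] \<theta>_def)
    ultimately show ?thesis using that ind unfolding int_independent_def by metis
  qed
  have inj: "inj_on \<theta> {..n}"
  proof (rule inj_onI, rule ccontr)
    fix i j assume ij: "i \<in> {..n}" "j \<in> {..n}" "\<theta> i = \<theta> j" "i \<noteq> j"
    define u :: "nat \<Rightarrow> int" where "u l = (if l = i then 1 else if l = j then - 1 else 0)" for l
    have "(\<Sum>l\<le>n. of_int (u l) * \<theta> l) = (\<Sum>l\<in>{i, j}. of_int (u l) * \<theta> l)"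
      by (rule sum.mono_neutral_right) (use ij in \<open>auto simp: u_def\<close>)
    also have "\<dots> = 0" using ij by (simp add: u_def)
    finally have "u i = 0" using key ij(1) by auto
    then show False by (simp add: u_def)
  qed
  interpret Modules.module "(\<lambda>r. (*) (real_of_int r))"
    by (simp add: Modules.module.intro distrib_left mult.commute)
  have "independent (\<theta> ` {..n})"
  proof
    assume "dependent (\<theta> ` {..n})"
    then obtain u v where uv: "v \<in> \<theta> ` {..n}" "u v \<noteq> 0" "(\<Sum>v\<in>\<theta> ` {..n}. of_int (u v) * v) = 0"
      by (auto simp: dependent_finite)
    then have "(\<Sum>i\<le>n. of_int (u (\<theta> i)) * \<theta> i) = 0" using sum.reindex[OF inj, of "\<lambda>v. of_int (u v) * v"] by simp
    from key[OF this] show False using uv(1,2) by auto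
  qed
  then obtain k m where "\<And>i. i < n \<Longrightarrow> \<bar>of_int k * \<theta> i - of_int (m i) - t i\<bar> < \<epsilon>"
    using Kronecker_thm_2[of \<theta> n \<epsilon> t] inj e by (auto simp: \<theta>_def)
  then show ?thesis by (intro exI[of _ k]) (auto simp: \<theta>_def)
qed

text \<open>Kronecker approximation with a multiplier bounded uniformly in the target. It depends
  only on the first \<open>N\<close> angles, so the remaining angles can be chosen when
  \<open>m\<close> is already known.\<close>

definition net_bound :: "(nat \<Rightarrow> real) \<Rightarrow> nat \<Rightarrow> nat \<Rightarrow> bool" where
  "net_bound a N m \<longleftrightarrow> (\<forall>t :: nat \<Rightarrow> real. \<exists>k :: int. \<bar>k\<bar> \<le> int m \<and>
     (\<forall>i<N. \<exists>h :: int. \<bar>of_int k * a i - of_int h - t i\<bar> < 1 / real (Suc N)))"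

text \<open>A grid of mesh \<open>1 / real q\<close> on the finite-dimensional torus leaves finitely
  many targets and hence finitely many multipliers. Rounding to the grid and approximating the grid
  point cost at most \<open>1 / real q\<close> each, together
  \<open>1 / real (Suc N)\<close>.\<close>

lemma net_bound_exists:
  assumes "int_independent a N" shows "\<exists>m. net_bound a N m"
proof -
  define q where "q = 2 * Suc N"
  define S where "S = PiE {..<N} (\<lambda>_. {..<q})"
  have fS: "finite S" unfolding S_def by (rule finite_PiE) auto
  have "\<forall>s. \<exists>k :: int. \<forall>i<N. \<exists>h :: int. \<bar>of_int k * a i - of_int h - real (s i) / real q\<bar> < 1 / real q"
    for s :: "nat \<Rightarrow> nat"
    using kronecker_int_independent[OF assms, of "1 / real q"] by (auto simp: q_def)
  then obtain k :: "(nat \<Rightarrow> nat) \<Rightarrow> int" where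
    k: "\<And>s i. i < N \<Longrightarrow> \<exists>h :: int. \<bar>of_int (k s) * a i - of_int h - real (s i) / real q\<bar> < 1 / real q"
    by metis
  define m where "m = (\<Sum>s\<in>S. nat \<bar>k s\<bar>)"
  have "net_bound a N m"
    unfolding net_bound_def
  proof
    fix t :: "nat \<Rightarrow> real"
    define s where "s = (\<lambda>i\<in>{..<N}. nat \<lfloor>frac (t i) * real q\<rfloor>)"
    have q0: "real q > 0" by (simp add: q_def)
    have sb: "real (nat \<lfloor>frac (t i) * real q\<rfloor>) \<le> frac (t i) * real q \<and> frac (t i) * real q < real (nat \<lfloor>frac (t i) * real q\<rfloor>) + 1" for i
      using q0 frac_ge_0[of "t i"] by (simp add: zero_le_mult_iff)
    have "nat \<lfloor>frac (t i) * real q\<rfloor> < q" for i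
    proof -
      have "frac (t i) * real q < 1 * real q" by (rule mult_strict_right_mono[OF frac_lt_1 q0])
      then have "real (nat \<lfloor>frac (t i) * real q\<rfloor>) < real q" using sb[of i] by linarith
      then show ?thesis by (simp only: of_nat_less_iff)
    qed
    then have sS: "s \<in> S" unfolding S_def s_def by auto
    have "nat \<bar>k s\<bar> \<le> m" unfolding m_def by (rule member_le_sum) (use sS fS in auto)
    moreover have "\<exists>h :: int. \<bar>of_int (k s) * a i - of_int h - t i\<bar> < 1 / real (Suc N)" if i: "i < N" for i
    proof -
      obtain h :: int where h: "\<bar>of_int (k s) * a i - of_int h - real (s i) / real q\<bar> < 1 / real q" using k[OF i] by blast
      have "\<bar>frac (t i) - real (s i) / real q\<bar> \<le> 1 / real q"
      proof -
        have "real (s i) / real q \<le> frac (t i)" "frac (t i) \<le> (real (s i) + 1) / real q"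
          using sb[of i] q0 i by (simp_all add: s_def pos_divide_le_eq pos_le_divide_eq)
        then show ?thesis by (simp add: add_divide_distrib)
      qed
      moreover have "t i = of_int \<lfloor>t i\<rfloor> + frac (t i)" by (simp add: frac_def)
      ultimately have "\<bar>of_int (k s) * a i - of_int (h - \<lfloor>t i\<rfloor>) - t i\<bar> < 1 / real q + 1 / real q"
        using h by simp
      also have "1 / real q + 1 / real q = 1 / real (Suc N)" by (simp add: q_def field_simps)
      finally show ?thesis by blast
    qed
    ultimately show "\<exists>k. \<bar>k\<bar> \<le> int m \<and> (\<forall>i<N. \<exists>h :: int. \<bar>of_int k * a i - of_int h - t i\<bar> < 1 / real (Suc N))"
      by (intro exI[of _ "k s"]) auto
  qed
  then show ?thesis ..
qed

text \<open>The angles decrease so fast that the multiples needed to approximate a point in the first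
  \<open>N\<close> coordinates hardly move the later coordinates.\<close>

lemma generator_angles:
  "\<exists>a :: nat \<Rightarrow> real. (\<forall>n. 0 < a n \<and> a n \<le> (1/2)^n) \<and>
     (\<forall>N. \<exists>m. net_bound a N m \<and> (\<forall>n\<ge>N. real m * a n \<le> (1/2)^n))"
proof -
  \<comment> \<open>The least bound is a function of the first \<open>N\<close> entries of
    \<open>f\<close>. The conditions at stage \<open>n\<close> involve \<open>M f N\<close> for
    \<open>N \<le> n\<close> only and are thus admissible in a recursion on initial
    segments.\<close>
  define M where "M f N = (LEAST m. net_bound f N m)" for f N
  \<comment> \<open>The \<open>1\<close> added to \<open>M f N\<close> ensures
    \<open>r \<le> (1/2)^n\<close> even when the multiplier bound is zero.\<close>
  define P where "P f n r \<longleftrightarrow> 0 < r \<and> int_independent (f(n := r)) (Suc n) \<and> (\<forall>N\<le>n. (real (M f N) + 1) * r \<le> (1/2)^n)"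
    for f n and r :: real
  have "\<exists>a. \<forall>n. P a n (a n)"
  proof (rule dependent_wellorder_choice)
    fix r and f g :: "nat \<Rightarrow> real" and n assume fg: "\<And>y. y < n \<Longrightarrow> f y = g y"
    have "int_independent (f(n := r)) (Suc n) = int_independent (g(n := r)) (Suc n)"
      by (rule int_independent_cong) (use fg in auto)
    moreover have "M f N = M g N" if "N \<le> n" for N
    proof -
      have "net_bound f N = net_bound g N" unfolding net_bound_def fun_eq_iff using fg that by auto
      then show ?thesis by (simp add: M_def)
    qed
    ultimately show "P f n r = P g n r" unfolding P_def by auto
  next
    fix n and f :: "nat \<Rightarrow> real" assume IH: "\<And>y. y < n \<Longrightarrow> P f y (f y)"
    have ind: "int_independent f n"
    proof (cases n)
      case 0
      then show ?thesis by (simp add: int_independent_def)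
    next
      case (Suc k)
      then show ?thesis using IH[of k] by (simp add: P_def)
    qed
    define D where "D = (\<Sum>N\<le>n. real (M f N) + 1)"
    have D: "real (M f N) + 1 \<le> D" if "N \<le> n" for N
      unfolding D_def by (rule member_le_sum) (use that in auto)
    then have D0: "D > 0" by (rule less_le_trans[rotated, of _ _ 0]) auto
    obtain r where r: "0 < r" "r < (1/2)^n / D" "int_independent (f(n := r)) (Suc n)"
      using int_independent_extend[OF ind, of "(1/2)^n / D"] D0 by auto
    have "(real (M f N) + 1) * r \<le> (1/2)^n" if "N \<le> n" for N
    proof -
      have "(real (M f N) + 1) * r \<le> D * r" using D[OF that] r(1) by (intro mult_right_mono) auto
      also have "\<dots> \<le> (1/2)^n" using r(2) D0 by (simp add: pos_less_divide_eq mult.commute)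
      finally show ?thesis .
    qed
    then show "\<exists>r. P f n r" unfolding P_def using r by blast
  qed
  then obtain a where a: "\<And>n. P a n (a n)" by blast
  have pos: "0 < a n" for n using a[of n] by (simp add: P_def)
  have le: "(real (M a N) + 1) * a n \<le> (1/2)^n" if "N \<le> n" for n N using a[of n] that by (simp add: P_def)
  have ind: "int_independent a N" for N
  proof (cases N)
    case 0
    then show ?thesis by (simp add: int_independent_def)
  next
    case (Suc k)
    then show ?thesis using a[of k] by (simp add: P_def)
  qed
  have nb: "net_bound a N (M a N)" for N
    unfolding M_def using net_bound_exists[OF ind] by (rule LeastI_ex)
  have "a n \<le> (1/2)^n" for n
  proof -
    have "1 * a n \<le> (real (M a n) + 1) * a n" using pos[of n] by (intro mult_right_mono) auto
    then show ?thesis using le[of n n] by simp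
  qed
  moreover have "real (M a N) * a n \<le> (1/2)^n" if "N \<le> n" for n N
    using le[OF that] pos[of n] by (simp add: distrib_right)
  ultimately show ?thesis using pos nb by blast
qed

lemma wrap_multiple_generate:
  assumes a: "a \<in> ell2_set"
  shows "wrap (\<lambda>n. of_int k * a n) \<in> generate T2H {wrap a}"
proof -
  interpret group_hom ell2 T2H wrap by (rule wrap_group_hom)
  have ma: "(\<lambda>n. - a n) \<in> ell2_set" using ell2_scale_closed[OF a, of "-1"] by simp
  have "wrap a \<otimes>\<^bsub>T2H\<^esub> wrap (\<lambda>n. - a n) = \<one>\<^bsub>T2H\<^esub>"
    by (simp add: T2H_simps wrap_add[symmetric] wrap_zero)
  then have "inv\<^bsub>T2H\<^esub> (wrap a) = wrap (\<lambda>n. - a n)"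
    using wrap_in_T2H[OF a] wrap_in_T2H[OF ma] comm_group_T2H
    by (intro H.inv_equality) (auto simp: T2H_simps mult.commute)
  then have mg: "wrap (\<lambda>n. - a n) \<in> generate T2H {wrap a}"
    using generate.inv[of "wrap a" "{wrap a}" T2H] by simp
  have one: "wrap (\<lambda>n. 0) \<in> generate T2H {wrap a}"
    unfolding wrap_zero using generate.one[of T2H "{wrap a}"] by (simp add: T2H_simps)
  have pos: "wrap (\<lambda>n. real m * b n) \<in> generate T2H {wrap a}" if b: "wrap b \<in> generate T2H {wrap a}" for m b
  proof (induction m)
    case 0
    show ?case using one by simp
  next
    case (Suc m)
    have "wrap (\<lambda>n. real (Suc m) * b n) = wrap (\<lambda>n. real m * b n) \<otimes>\<^bsub>T2H\<^esub> wrap b"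
      by (simp add: T2H_simps wrap_add[symmetric] distrib_right add.commute)
    then show ?case using generate.eng[OF Suc b] by simp
  qed
  show ?thesis
  proof (cases "k \<ge> 0")
    case True
    then have "(\<lambda>n. of_int k * a n) = (\<lambda>n. real (nat k) * a n)" by simp
    then show ?thesis using pos[of a "nat k"] generate.incl[of "wrap a" "{wrap a}" T2H] by simp
  next
    case False
    then have "(\<lambda>n. of_int k * a n) = (\<lambda>n. real (nat (- k)) * - a n)" by simp
    then show ?thesis using pos[OF mg, of "nat (- k)"] by simp
  qed
qed

text \<open>In the first \<open>N\<close> coordinates a multiple of \<open>a\<close> approximates
  the angles \<open>t\<close> of the target modulo integers; beyond \<open>N\<close> both that
  multiple and \<open>t\<close> itself are small in square sum, whichever admissible multiplier was
  taken.\<close>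

lemma monothetic_T2H: "monothetic T2H"
proof -
  obtain a :: "nat \<Rightarrow> real" where a: "\<And>n. 0 < a n" "\<And>n. a n \<le> (1/2)^n"
    "\<And>N. \<exists>m. net_bound a N m \<and> (\<forall>n\<ge>N. real m * a n \<le> (1/2)^n)"
    using generator_angles by metis
  have sq: "((1/2)^n)\<^sup>2 = (1/4::real)^n" for n :: nat
    by (simp add: power_divide power_mult[symmetric] power2_eq_square power_mult_distrib[symmetric])
  have geo: "summable (\<lambda>n. (1/4::real)^n)" by (rule summable_geometric) simp
  have a2: "a \<in> ell2_set"
    unfolding ell2_set_def
  proof (rule CollectI, rule summable_comparison_test'[OF geo])
    fix n
    have "(a n)\<^sup>2 \<le> ((1/2)^n)\<^sup>2" using a(1)[of n] a(2)[of n] by (intro power_mono) auto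
    then show "norm ((a n)\<^sup>2) \<le> (1/4)^n" by (simp add: sq)
  qed
  interpret T: comm_group T2H by (rule comm_group_T2H)
  have zc: "wrap a \<in> carrier T2H" using wrap_in_T2H[OF a2] by (simp add: T2H_simps)
  have gen: "generate T2H {wrap a} \<subseteq> T2H_set" using T.generate_incl[of "{wrap a}"] zc by (simp add: T2H_simps)
  have "\<exists>y\<in>generate T2H {wrap a}. l2_dist w y < \<epsilon>" if w: "w \<in> T2H_set" and e: "\<epsilon> > 0" for w \<epsilon>
  proof -
    obtain t where t: "t \<in> ell2_set" "wrap t = w" using unwrap[OF w] by metis
    define c where "c n = 2 * (1/4)^n + 2 * (t n)\<^sup>2" for n
    have sc: "summable c" unfolding c_def using geo t(1) by (intro summable_add summable_mult) (auto simp: ell2_set_def)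
    have c0: "c n \<ge> 0" for n by (simp add: c_def)
    \<comment> \<open>The squared errors of head and tail sum to at most \<open>2 * \<eta>\<close>,
      whose square root is \<open>\<epsilon> / (4 * pi)\<close>; the Lipschitz constant
      \<open>2 * pi\<close> of \<open>wrap\<close> turns this into
      \<open>\<epsilon> / 2\<close>.\<close>
    define \<eta> where "\<eta> = (\<epsilon> / (4 * pi))\<^sup>2 / 2"
    have \<eta>: "\<eta> > 0" using e by (simp add: \<eta>_def)
    have "(\<lambda>N. 1 / real (Suc N)) \<longlonglongrightarrow> 0" using LIMSEQ_inverse_real_of_nat by (simp add: inverse_eq_divide)
    then have "\<forall>\<^sub>F N in sequentially. 1 / real (Suc N) < \<eta>" by (rule order_tendstoD(2)) (rule \<eta>)
    moreover have "\<forall>\<^sub>F N in sequentially. (\<Sum>n. c (n + N)) < \<eta>"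
      by (rule order_tendstoD(2)[OF suminf_exist_split2[OF sc] \<eta>])
    ultimately have "\<forall>\<^sub>F N in sequentially. 1 / real (Suc N) < \<eta> \<and> (\<Sum>n. c (n + N)) < \<eta>" by (rule eventually_conj)
    then obtain N where N: "1 / real (Suc N) < \<eta>" "(\<Sum>n. c (n + N)) < \<eta>" unfolding eventually_sequentially by blast
    obtain m where m: "net_bound a N m" "\<And>n. n \<ge> N \<Longrightarrow> real m * a n \<le> (1/2)^n" using a(3)[of N] by blast
    obtain k :: int where k: "\<bar>k\<bar> \<le> int m" "\<And>i. i < N \<Longrightarrow> \<exists>h :: int. \<bar>of_int k * a i - of_int h - t i\<bar> < 1 / real (Suc N)"
      using m(1) unfolding net_bound_def by metis
    from k(2) obtain h :: "nat \<Rightarrow> int" where h: "\<And>i. i < N \<Longrightarrow> \<bar>of_int k * a i - of_int (h i) - t i\<bar> < 1 / real (Suc N)"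
      by metis
    \<comment> \<open>Subtracting integers in finitely many coordinates stays in the same coset of
      \<open>Z0\<close>, so \<open>wrap\<close> does not change.\<close>
    define y where "y n = of_int k * a n - (if n < N then of_int (h n) else 0)" for n
    have wy: "wrap y = wrap (\<lambda>n. of_int k * a n)"
    proof -
      have "(\<lambda>n. - (if n < N then of_int (h n) else (0::real))) \<in> Z0" unfolding Z0_def by (auto intro: finite_subset[of _ "{..<N}"])
      then have "wrap (\<lambda>n. - (if n < N then of_int (h n) else (0::real))) = (\<lambda>n. 1)" using wrap_kernel by blast
      then have "wrap (\<lambda>n. of_int k * a n + - (if n < N then of_int (h n) else 0)) = wrap (\<lambda>n. of_int k * a n)"
        by (simp only: wrap_add mult_1_right)
      then show ?thesis by (simp add: y_def[abs_def])
    qed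
    have yt: "(norm (y n - t n))\<^sup>2 \<le> (if n < N then (1 / real (Suc N))\<^sup>2 else c n)" for n
    proof (cases "n < N")
      case True
      then have "norm (y n - t n) \<le> 1 / real (Suc N)" using h[OF True] by (simp add: y_def)
      then show ?thesis using True power_mono[of "norm (y n - t n)" _ 2] by simp
    next
      case False
      then have n: "n \<ge> N" by simp
      have "\<bar>of_int k * a n\<bar> = of_int \<bar>k\<bar> * a n" using a(1)[of n] by (simp add: abs_mult)
      also have "\<dots> \<le> real m * a n"
      proof (rule mult_right_mono)
        show "real_of_int \<bar>k\<bar> \<le> real m" using k(1) by (metis of_int_le_iff of_int_of_nat_eq)
      qed (use a(1)[of n] in simp)
      also have "\<dots> \<le> (1/2)^n" by (rule m(2)[OF n])
      finally have "\<bar>of_int k * a n\<bar> \<le> (1/2)^n" .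
      then have 1: "(of_int k * a n)\<^sup>2 \<le> (1/4)^n"
        using power_mono[of "\<bar>of_int k * a n\<bar>" "(1/2)^n" 2] by (simp add: sq)
      have "(y n - t n)\<^sup>2 \<le> 2 * (of_int k * a n)\<^sup>2 + 2 * (t n)\<^sup>2"
        using False sum_squares_bound[of "of_int k * a n" "- t n"] by (simp add: y_def power2_diff)
      then show ?thesis using 1 False by (simp add: c_def)
    qed
    have sr: "summable (\<lambda>n. if n < N then (1 / real (Suc N))\<^sup>2 else c n)"
      by (subst summable_iff_shift[of _ N, symmetric]) (simp add: sc summable_iff_shift[of c])
    have sy: "summable (\<lambda>n. (norm (y n - t n))\<^sup>2)"
      by (rule summable_comparison_test'[OF sr]) (use yt in simp)
    have "(\<Sum>n. (norm (y n - t n))\<^sup>2) \<le> (\<Sum>n. if n < N then (1 / real (Suc N))\<^sup>2 else c n)"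
      by (rule suminf_le[OF yt sy sr])
    also have "\<dots> = (\<Sum>n. c (n + N)) + (\<Sum>n<N. (1 / real (Suc N))\<^sup>2)"
      by (subst suminf_split_initial_segment[OF sr, of N]) simp
    \<comment> \<open>There are \<open>N\<close> coordinates with squared error
      \<open>(1 / real (Suc N))\<^sup>2\<close> each: this is why the precision in
      \<open>net_bound\<close> improves with \<open>N\<close>.\<close>
    also have "(\<Sum>n<N. (1 / real (Suc N))\<^sup>2) \<le> 1 / real (Suc N)"
    proof -
      have "real N / real (Suc N) * (1 / real (Suc N)) \<le> 1 * (1 / real (Suc N))" by (rule mult_right_mono) auto
      then show ?thesis by (simp add: power2_eq_square)
    qed
    finally have "(\<Sum>n. (norm (y n - t n))\<^sup>2) \<le> 2 * \<eta>" using N by linarith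
    then have "sqrt (\<Sum>n. (norm (y n - t n))\<^sup>2) \<le> sqrt (2 * \<eta>)" by (rule real_sqrt_le_mono)
    also have "sqrt (2 * \<eta>) = \<epsilon> / (4 * pi)" using e by (simp add: \<eta>_def real_sqrt_divide real_sqrt_mult)
    finally have dy: "l2_dist y t \<le> \<epsilon> / (4 * pi)" by (simp add: l2_dist_eq[OF sy])
    have ty: "y \<in> ell2_set"
    proof -
      have "summable (\<lambda>n. (norm ((y n - t n) + t n))\<^sup>2)"
        by (rule square_summable_add[OF sy]) (use t(1) in \<open>simp add: ell2_set_def\<close>)
      then show ?thesis by (simp add: ell2_set_def)
    qed
    have "l2_dist (wrap y) w \<le> 2 * pi * l2_dist y t" using l2_dist_wrap[OF ty t(1)] t(2) by simp
    also have "\<dots> \<le> 2 * pi * (\<epsilon> / (4 * pi))" by (rule mult_left_mono[OF dy]) simp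
    also have "\<dots> < \<epsilon>" using e by simp
    finally have "l2_dist w (wrap y) < \<epsilon>" using T.commute by metis
    then show ?thesis unfolding wy using wrap_multiple_generate[OF a2] by blast
  qed
  then have "T.mtopology closure_of (generate T2H {wrap a}) = T2H_set"
    unfolding T.metric_closure_of using gen by (auto simp: subset_iff)
  then show ?thesis unfolding monothetic_def using zc by (auto simp: T2H_simps)
qed

text \<open>Separability comes from monotheticity, the dense cyclic subgroup being
  countable.\<close>

lemma polish_T2H: "polish_group T2H"
  unfolding polish_group_def
proof (intro conjI topological_group_T2H)
  show "completely_metrizable_space (gtop T2H)"
    unfolding T2H_simps by (rule T.completely_metrizable_space_mtopology[OF mcomplete_T2H])
  obtain g where g: "g \<in> carrier T2H" "gtop T2H closure_of (generate T2H {g}) = carrier T2H"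
    using monothetic_T2H unfolding monothetic_def by blast
  interpret comm_group T2H by (rule comm_group_T2H)
  have "generate T2H {g} = range (\<lambda>k::int. g [^]\<^bsub>T2H\<^esub> k)" using generate_pow[OF g(1)] by auto
  then have "countable (generate T2H {g})" by simp
  moreover have "generate T2H {g} \<subseteq> carrier T2H" using generate_incl[of "{g}"] g(1) by simp
  ultimately show "separable_space (gtop T2H)"
    unfolding separable_space_def using g(2) by (intro exI[of _ "generate T2H {g}"]) (auto simp: T2H_simps)
qed

section \<open>Characters\<close>

lemma continuous_additive_linear:
  fixes g :: "real \<Rightarrow> complex"
  assumes cont: "continuous_on UNIV g" and add: "\<And>s t. g (s + t) = g s + g t"
  shows "g t = of_real t * g 1"
proof -
  have g0: "g 0 = 0" using add[of 0 0] by simp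
  have nat: "g (real n * x) = of_nat n * g x" for n x
    by (induction n) (auto simp: g0 add distrib_right)
  have int: "g (of_int m * x) = of_int m * g x" for m x
  proof (cases "m \<ge> 0")
    case True
    then show ?thesis using nat[of "nat m" x] by simp
  next
    case False
    have "g (of_int m * x) + g (real (nat (- m)) * x) = g (of_int m * x + real (nat (- m)) * x)" by (simp only: add)
    also have "\<dots> = 0" using False g0 by simp
    finally have "g (of_int m * x) = - (of_nat (nat (- m)) * g x)" by (simp only: nat add_eq_0_iff2)
    then show ?thesis using False by simp
  qed
  have rat: "g q = of_real q * g 1" if q: "q \<in> \<rat>" for q
  proof -
    obtain a b :: int where ab: "q = of_int a / of_int b" "b > 0" using Rats_cases'[OF q] by metis
    have "of_int b * g q = g (of_int b * q)" by (simp only: int)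
    also have "of_int b * q = of_int a * 1" using ab by simp
    also have "g (of_int a * 1) = of_int a * g 1" by (simp only: int)
    finally have "of_int b * g q = of_int a * g 1" .
    then have "g q = of_int a * g 1 / of_int b" using ab(2) by (simp add: eq_divide_eq mult.commute)
    then show ?thesis by (simp add: ab(1))
  qed
  have "closed {t. g t = of_real t * g 1}"
    by (intro closed_Collect_eq cont continuous_intros)
  then have o: "open (- {t. g t = of_real t * g 1})" by (rule open_Compl)
  show ?thesis
  proof (rule ccontr)
    assume "\<not> ?thesis"
    then obtain e where e: "e > 0" "ball t e \<subseteq> - {t. g t = of_real t * g 1}"
      using o unfolding open_contains_ball by blast
    obtain q where q: "q \<in> \<rat>" "t < q" "q < t + e" using Rats_dense_in_real[of t "t + e"] e(1) by auto
    then have "q \<in> ball t e" by (simp add: dist_real_def)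
    then show False using e(2) rat[OF q(1)] by blast
  qed
qed

text \<open>A continuous logarithm \<open>g\<close> is additive up to a defect with values in the
  multiples of \<open>2 * pi * \<i>\<close>. By continuity the defect is constant, so
  \<open>g - g 0\<close> is additive, hence linear, and its slope is imaginary because
  \<open>\<theta>\<close> has modulus one.\<close>

lemma continuous_circle_hom:
  fixes \<theta> :: "real \<Rightarrow> complex"
  assumes cont: "continuous_on UNIV \<theta>" and n1: "\<And>t. cmod (\<theta> t) = 1" and hom: "\<And>s t. \<theta> (s + t) = \<theta> s * \<theta> t"
  shows "\<exists>a. \<forall>t. \<theta> t = cis (a * t)"
proof -
  have nz: "\<theta> t \<noteq> 0" for t using n1[of t] by auto
  have \<theta>0: "\<theta> 0 = 1" using hom[of 0 0] nz[of 0] by simp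
  obtain g where g: "continuous_on UNIV g" "\<And>t. \<theta> t = exp (g t)"
    using continuous_logarithm_on_contractible[OF cont] nz by (metis UNIV_I contractible_UNIV)
  define D where "D s t = g (s + t) - g s - g t" for s t
  have D1: "exp (D s t) = 1" for s t
    using hom[of s t] nz by (simp add: D_def exp_diff flip: g(2))
  have Dc: "D s t = D s 0" for s t
  proof -
    have c: "continuous_on UNIV (D s)" unfolding D_def
      by (intro continuous_intros continuous_on_compose2[OF g(1)] g(1)) auto
    have "D s constant_on UNIV"
    proof (rule continuous_discrete_range_constant[OF connected_UNIV c])
      fix t
      show "\<exists>e>0. \<forall>y. y \<in> UNIV \<and> D s y \<noteq> D s t \<longrightarrow> e \<le> cmod (D s y - D s t)"
      proof (intro exI[of _ 1] conjI allI impI)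
        fix y assume y: "y \<in> UNIV \<and> D s y \<noteq> D s t"
        have "exp (D s y) = exp (D s t)" by (simp add: D1)
        then obtain k :: int where k: "D s y = D s t + of_real (real_of_int (2 * k) * pi) * \<i>" unfolding exp_eq by blast
        then have "k \<noteq> 0" using y by auto
        then have "1 \<le> \<bar>real_of_int k\<bar>" by linarith
        then have "1 * 1 \<le> \<bar>real_of_int k\<bar> * (2 * pi)" using pi_ge_two by (intro mult_mono) auto
        also have "\<dots> = cmod (D s y - D s t)" using k by (simp add: norm_mult)
        finally show "1 \<le> cmod (D s y - D s t)" by simp
      qed simp
    qed
    then show ?thesis unfolding constant_on_def by (metis UNIV_I)
  qed
  define G where "G t = g t - g 0" for t
  have "G (s + t) = G s + G t" for s t
    using Dc[of s t] by (simp add: D_def G_def algebra_simps)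
  moreover have "continuous_on UNIV G" unfolding G_def by (intro continuous_intros g(1))
  ultimately have G: "G t = of_real t * G 1" for t by (rule continuous_additive_linear[rotated])
  have \<theta>G: "\<theta> t = exp (G t)" for t
    using g(2)[of t] g(2)[of 0] \<theta>0 by (simp add: G_def exp_diff)
  have "exp (Re (G 1)) = 1" using n1[of 1] by (simp add: \<theta>G)
  then have "Re (G 1) = 0" by simp
  then have "\<exists>b. G 1 = \<i> * of_real b" by (intro exI[of _ "Im (G 1)"]) (simp add: complex_eq_iff)
  then obtain b where b: "G 1 = \<i> * of_real b" ..
  have "\<theta> t = cis (b * t)" for t
    using \<theta>G[of t] G[of t] by (simp add: b cis_conv_exp mult.commute mult.left_commute)
  then show ?thesis by blast
qed

definition cutoff :: "(nat \<Rightarrow> real) \<Rightarrow> nat \<Rightarrow> nat \<Rightarrow> real" where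
  "cutoff x N n = (if n < N then x n else 0)"

lemma cutoff_ell2: "cutoff x N \<in> ell2_set"
proof -
  have "summable (\<lambda>n. (cutoff x N n)\<^sup>2)" by (rule summable_finite[of "{..<N}"]) (auto simp: cutoff_def)
  then show ?thesis by (simp add: ell2_set_def)
qed

lemma circle_simps: "carrier circle_group = sphere 0 1" "gtop circle_group = top_of_set (sphere 0 1)"
    "monoid.mult circle_group = (*)" "one circle_group = 1"
  by (auto simp: circle_group_def sphere_def dist_norm)

lemma characterD:
  assumes "\<phi> \<in> characters T2H"
  shows "z \<in> T2H_set \<Longrightarrow> cmod (\<phi> z) = 1"
    "z \<in> T2H_set \<Longrightarrow> w \<in> T2H_set \<Longrightarrow> \<phi> (\<lambda>n. z n * w n) = \<phi> z * \<phi> w"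
    "\<phi> (\<lambda>n. 1) = 1" "continuous_map T.mtopology (top_of_set (sphere 0 1)) \<phi>"
    "\<phi> \<in> extensional T2H_set"
proof -
  have h: "\<phi> \<in> hom T2H circle_group" "\<phi> \<in> extensional T2H_set" "continuous_map T.mtopology (top_of_set (sphere 0 1)) \<phi>"
    using assms unfolding characters_def by (auto simp: T2H_simps circle_simps)
  show 1: "z \<in> T2H_set \<Longrightarrow> cmod (\<phi> z) = 1" for z
    using h(1) by (auto simp: hom_def T2H_simps circle_simps Pi_iff)
  show 2: "z \<in> T2H_set \<Longrightarrow> w \<in> T2H_set \<Longrightarrow> \<phi> (\<lambda>n. z n * w n) = \<phi> z * \<phi> w" for z w
    using h(1) by (auto simp: hom_def T2H_simps circle_simps)
  have "\<phi> (\<lambda>n. 1) \<noteq> 0" using 1[OF T2H_one] by auto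
  then show "\<phi> (\<lambda>n. 1) = 1" using 2[OF T2H_one T2H_one] by simp
qed (use assms in \<open>auto simp: characters_def T2H_simps circle_simps\<close>)

text \<open>Tested only on finitely supported angles, where the sum is finite. That almost all
  coefficients vanish is known only from \<open>character_finite_support\<close> on, and
  \<open>character_wrap\<close> then removes the restriction.\<close>

definition coefs :: "((nat \<Rightarrow> complex) \<Rightarrow> complex) \<Rightarrow> (nat \<Rightarrow> int) \<Rightarrow> bool" where
  "coefs \<phi> \<kappa> \<longleftrightarrow> (\<forall>x N. \<phi> (wrap (cutoff x N)) = cis (2 * pi * (\<Sum>n<N. of_int (\<kappa> n) * x n)))"

lemma coefsD: "coefs \<phi> \<kappa> \<Longrightarrow> \<phi> (wrap (cutoff x N)) = cis (2 * pi * (\<Sum>n<N. of_int (\<kappa> n) * x n))"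
  by (simp add: coefs_def)

text \<open>Along one coordinate the character is a continuous homomorphism from the reals to the
  circle that is trivial at \<open>1\<close>, so its frequency is an integer.\<close>

lemma character_coefs:
  assumes \<phi>: "\<phi> \<in> characters T2H" shows "\<exists>\<kappa>. coefs \<phi> \<kappa>"
proof -
  define e where "e n t = (\<lambda>i. if i = n then t else 0 :: real)" for n :: nat and t
  have e2: "e n t \<in> ell2_set" for n t
  proof -
    have "summable (\<lambda>i. (e n t i)\<^sup>2)" by (rule summable_finite[of "{n}"]) (auto simp: e_def)
    then show ?thesis by (simp add: ell2_set_def)
  qed
  have e_dist: "l2_dist (e n s) (e n t) = \<bar>s - t\<bar>" for n s t
  proof -
    have "(\<Sum>i. (norm (e n s i - e n t i))\<^sup>2) = (\<Sum>i\<in>{n}. (norm (e n s i - e n t i))\<^sup>2)"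
      by (rule suminf_finite) (auto simp: e_def)
    then have "(\<Sum>i. (norm (e n s i - e n t i))\<^sup>2) = (s - t)\<^sup>2" by (simp add: e_def)
    then show ?thesis unfolding l2_dist_eq[OF ell2_summable[OF e2 e2]] by simp
  qed
  have "\<exists>k :: int. \<forall>t. \<phi> (wrap (e n t)) = cis (2 * pi * (of_int k * t))" for n
  proof -
    have "continuous_map euclideanreal E.mtopology (e n)"
      unfolding E.continuous_map_to_metric
    proof (intro ballI allI impI)
      fix t \<epsilon> :: real assume "\<epsilon> > 0"
      then show "\<exists>U. openin euclideanreal U \<and> t \<in> U \<and> (\<forall>s\<in>U. e n s \<in> E.mball (e n t) \<epsilon>)"
        by (intro exI[of _ "ball t \<epsilon>"]) (auto simp: e2 e_dist dist_real_def)
    qed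
    from continuous_map_compose[OF continuous_map_compose[OF this wrap_continuous] characterD(4)[OF \<phi>]]
    have "continuous_map euclideanreal (top_of_set (sphere 0 1)) (\<lambda>t. \<phi> (wrap (e n t)))" by (simp add: o_def)
    then have c: "continuous_on UNIV (\<lambda>t. \<phi> (wrap (e n t)))" by (simp add: continuous_map_in_subtopology)
    have n1: "cmod (\<phi> (wrap (e n t))) = 1" for t by (rule characterD(1)[OF \<phi> wrap_in_T2H[OF e2]])
    have h: "\<phi> (wrap (e n (s + t))) = \<phi> (wrap (e n s)) * \<phi> (wrap (e n t))" for s t
    proof -
      have "e n (s + t) = (\<lambda>i. e n s i + e n t i)" by (auto simp: e_def)
      then show ?thesis using characterD(2)[OF \<phi> wrap_in_T2H[OF e2] wrap_in_T2H[OF e2]] by (simp add: wrap_add)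
    qed
    obtain a where a: "\<And>t. \<phi> (wrap (e n t)) = cis (a * t)" using continuous_circle_hom[OF c n1 h] by metis
    have "e n 1 \<in> Z0" unfolding Z0_def e_def by auto
    then have "wrap (e n 1) = (\<lambda>n. 1)" using wrap_kernel by blast
    then have "cis a = 1" using a[of 1] characterD(3)[OF \<phi>] by simp
    then have "cos a = 1" by (simp add: complex_eq_iff)
    then obtain k :: int where "a = real_of_int k * 2 * pi" unfolding cos_one_2pi_int ..
    then show ?thesis using a by (intro exI[of _ k]) (simp add: mult.assoc mult.left_commute)
  qed
  then obtain \<kappa> :: "nat \<Rightarrow> int" where \<kappa>: "\<And>n t. \<phi> (wrap (e n t)) = cis (2 * pi * (of_int (\<kappa> n) * t))" by metis
  have "\<phi> (wrap (cutoff x N)) = cis (2 * pi * (\<Sum>n<N. of_int (\<kappa> n) * x n))" for x N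
  proof (induction N)
    case 0
    have "cutoff x 0 = (\<lambda>n. 0)" by (simp add: cutoff_def fun_eq_iff)
    then show ?case using characterD(3)[OF \<phi>] by (simp add: wrap_zero)
  next
    case (Suc N)
    have "cutoff x (Suc N) = (\<lambda>i. cutoff x N i + e N (x N) i)" by (auto simp: cutoff_def e_def fun_eq_iff)
    then have "\<phi> (wrap (cutoff x (Suc N))) = \<phi> (wrap (cutoff x N)) * \<phi> (wrap (e N (x N)))"
      using characterD(2)[OF \<phi> wrap_in_T2H[OF cutoff_ell2] wrap_in_T2H[OF e2]] by (simp add: wrap_add)
    also have "\<dots> = cis (2 * pi * (\<Sum>n<Suc N. of_int (\<kappa> n) * x n))"
      by (simp add: Suc \<kappa> cis_mult distrib_left)
    finally show ?case .
  qed
  then show ?thesis unfolding coefs_def by blast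
qed

text \<open>The point at angles \<open>\<kappa> / (2 \<parallel>\<kappa>\<parallel>\<^sup>2)\<close>, where the character takes the value \<open>-1\<close>, is within
  \<open>\<pi> / \<parallel>\<kappa>\<parallel>\<close> of the identity.\<close>

definition antipode :: "(nat \<Rightarrow> int) \<Rightarrow> nat \<Rightarrow> nat \<Rightarrow> complex" where
  "antipode \<kappa> N = wrap (cutoff (\<lambda>n. of_int (\<kappa> n) / (2 * (\<Sum>n<N. (of_int (\<kappa> n))\<^sup>2))) N)"

lemma antipode_T2H: "antipode \<kappa> N \<in> T2H_set"
  unfolding antipode_def by (rule wrap_in_T2H[OF cutoff_ell2])

lemma coefs_antipode:
  assumes "coefs \<phi> \<kappa>" and "(\<Sum>n<N. (real_of_int (\<kappa> n))\<^sup>2) > 0"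
  shows "\<phi> (antipode \<kappa> N) = - 1"
proof -
  let ?K = "\<Sum>n<N. (real_of_int (\<kappa> n))\<^sup>2"
  have "(\<Sum>n<N. of_int (\<kappa> n) * (of_int (\<kappa> n) / (2 * ?K))) = ?K / (2 * ?K)"
    by (simp add: power2_eq_square sum_divide_distrib)
  also have "\<dots> = 1/2" using assms(2) by simp
  finally have h: "(\<Sum>n<N. of_int (\<kappa> n) * (of_int (\<kappa> n) / (2 * ?K))) = 1/2" .
  show ?thesis unfolding antipode_def coefsD[OF assms(1)] h by simp
qed

lemma antipode_dist:
  assumes K: "(\<Sum>n<N. (real_of_int (\<kappa> n))\<^sup>2) \<ge> c" and c: "c > 0"
  shows "l2_dist (\<lambda>n. 1) (antipode \<kappa> N) \<le> pi / sqrt c"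
proof -
  let ?K = "\<Sum>n<N. (real_of_int (\<kappa> n))\<^sup>2"
  define x where "x = cutoff (\<lambda>n. of_int (\<kappa> n) / (2 * ?K)) N"
  have x: "x \<in> ell2_set" unfolding x_def by (rule cutoff_ell2)
  have K0: "?K > 0" using K c by linarith
  have "(\<Sum>n. (norm ((\<lambda>n. 0) n - x n))\<^sup>2) = (\<Sum>n<N. (norm ((\<lambda>n. 0) n - x n))\<^sup>2)"
    by (rule suminf_finite) (auto simp: x_def cutoff_def)
  also have "\<dots> = (\<Sum>n<N. (of_int (\<kappa> n))\<^sup>2 / (2 * ?K)\<^sup>2)"
    by (rule sum.cong) (auto simp: x_def cutoff_def power_divide)
  also have "\<dots> = ?K / (2 * ?K)\<^sup>2" by (simp add: sum_divide_distrib)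
  also have "\<dots> = 1 / (4 * ?K)" using K0 by (simp add: power2_eq_square)
  finally have "l2_dist (\<lambda>n. 0) x = sqrt (1 / (4 * ?K))"
    using l2_dist_eq[OF ell2_summable[OF zero_ell2 x]] by simp
  also have "\<dots> \<le> sqrt (1 / (4 * c))" using K c K0 by (intro real_sqrt_le_mono divide_left_mono) auto
  also have "\<dots> = 1 / (2 * sqrt c)" by (simp add: real_sqrt_divide real_sqrt_mult)
  finally have d: "l2_dist (\<lambda>n. 0) x \<le> 1 / (2 * sqrt c)" .
  have "l2_dist (wrap (\<lambda>n. 0)) (wrap x) \<le> 2 * pi * l2_dist (\<lambda>n. 0) x" by (rule l2_dist_wrap[OF zero_ell2 x])
  also have "\<dots> \<le> 2 * pi * (1 / (2 * sqrt c))" by (rule mult_left_mono[OF d]) simp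
  finally show ?thesis unfolding antipode_def x_def[symmetric] wrap_zero by simp
qed

text \<open>Otherwise the antipode of the first \<open>N\<close> coefficients would lie within
  \<open>\<delta>\<close> of the identity, where the character cannot take the value
  \<open>-1\<close>. The constant \<open>4\<close> could be any number above
  \<open>pi\<close>.\<close>

lemma coefs_bound:
  assumes co: "coefs \<phi> \<kappa>" and re: "\<And>z. z \<in> T2H_set \<Longrightarrow> l2_dist (\<lambda>n. 1) z < \<delta> \<Longrightarrow> Re (\<phi> z) \<ge> 0" and d: "\<delta> > 0"
  shows "(\<Sum>n<N. (real_of_int (\<kappa> n))\<^sup>2) \<le> (4 / \<delta>)\<^sup>2"
proof (rule ccontr)
  assume "\<not> ?thesis"
  then have K: "(\<Sum>n<N. (real_of_int (\<kappa> n))\<^sup>2) \<ge> (4 / \<delta>)\<^sup>2" by simp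
  have p: "(4 / \<delta>)\<^sup>2 > 0" using d by simp
  have "l2_dist (\<lambda>n. 1) (antipode \<kappa> N) \<le> pi / sqrt ((4 / \<delta>)\<^sup>2)" by (rule antipode_dist[OF K p])
  also have "\<dots> < \<delta>" using d pi_less_4 by simp
  finally have "Re (\<phi> (antipode \<kappa> N)) \<ge> 0" by (rule re[OF antipode_T2H])
  moreover have "\<phi> (antipode \<kappa> N) = - 1" by (rule coefs_antipode[OF co]) (use K p in linarith)
  ultimately show False by simp
qed

lemma sum_abs_coefs_le: "(\<Sum>n<N. \<bar>real_of_int (\<kappa> n)\<bar>) \<le> (\<Sum>n<N. (real_of_int (\<kappa> n))\<^sup>2)"
proof (rule sum_mono)
  fix n
  have "\<bar>\<kappa> n\<bar> \<le> (\<kappa> n)\<^sup>2"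
  proof (cases "\<kappa> n = 0")
    case False
    then have "\<bar>\<kappa> n\<bar> * 1 \<le> \<bar>\<kappa> n\<bar> * \<bar>\<kappa> n\<bar>" by (intro mult_left_mono) auto
    then show ?thesis by (simp add: power2_eq_square)
  qed simp
  then show "\<bar>real_of_int (\<kappa> n)\<bar> \<le> (real_of_int (\<kappa> n))\<^sup>2"
    by (metis of_int_abs of_int_le_iff of_int_power)
qed

lemma coefs_pairing_le:
  fixes x :: "nat \<Rightarrow> real"
  assumes "(\<Sum>n<N. (real_of_int (\<kappa> n))\<^sup>2) \<le> C" and x: "\<And>n. \<bar>x n\<bar> \<le> r"
  shows "\<bar>\<Sum>n<N. of_int (\<kappa> n) * x n\<bar> \<le> r * C"
proof -
  have r: "r \<ge> 0" using x[of 0] by linarith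
  have "\<bar>\<Sum>n<N. of_int (\<kappa> n) * x n\<bar> \<le> (\<Sum>n<N. \<bar>real_of_int (\<kappa> n)\<bar> * r)"
    by (rule order_trans[OF sum_abs]) (auto simp: abs_mult intro!: sum_mono mult_left_mono x)
  also have "\<dots> = r * (\<Sum>n<N. \<bar>real_of_int (\<kappa> n)\<bar>)" by (simp add: sum_distrib_left mult.commute)
  also have "\<dots> \<le> r * C" using sum_abs_coefs_le[of \<kappa> N] assms(1) r by (intro mult_left_mono) auto
  finally show ?thesis .
qed

text \<open>Provides the test points for both negative results on \<open>T2H\<close>: small sup
  norm, but outside the unit ball.\<close>

lemma l2_dist_constant_large:
  assumes r: "0 < r" "r \<le> 1/2"
  shows "\<exists>N. l2_dist (\<lambda>n. 1) (wrap (cutoff (\<lambda>n. r) N)) \<ge> 1"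
proof -
  obtain N :: nat where N: "1 / r\<^sup>2 < real N" using reals_Archimedean2 by blast
  let ?w = "wrap (cutoff (\<lambda>n. r) N)"
  have w: "?w \<in> T2H_set" by (rule wrap_in_T2H[OF cutoff_ell2])
  have "1 \<le> real N * r\<^sup>2" using N r by (simp add: field_simps)
  also have "\<dots> = (\<Sum>n<N. r\<^sup>2)" by simp
  also have "\<dots> \<le> (\<Sum>n<N. (norm (1 - ?w n))\<^sup>2)"
  proof (rule sum_mono)
    fix n assume "n \<in> {..<N}"
    then have "?w n = cis (2 * pi * r)" by (simp add: wrap_def cutoff_def)
    then have "\<bar>r\<bar> \<le> norm (1 - ?w n)" using cmod_cis_diff_ge[of r] r by simp
    then show "r\<^sup>2 \<le> (norm (1 - ?w n))\<^sup>2" using r by (intro power_mono) auto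
  qed
  also have "\<dots> \<le> (\<Sum>n. (norm (1 - ?w n))\<^sup>2)"
    by (rule sum_le_suminf) (use T2H_summable[OF T2H_one w] in auto)
  finally have "1 \<le> sqrt (\<Sum>n. (norm (1 - ?w n))\<^sup>2)" by simp
  then have "1 \<le> l2_dist (\<lambda>n. 1) ?w" unfolding l2_dist_eq[OF T2H_summable[OF T2H_one w]] .
  then show ?thesis ..
qed

text \<open>A quasi-convex set containing a ball contains every point at which the characters
  nonnegative on that ball stay nonnegative. Among these points is a small constant angle
  \<open>r\<close> repeated so often that it leaves the unit ball.\<close>

lemma not_locally_quasi_convex_T2H: "\<not> locally_quasi_convex T2H"
proof
  assume lqc: "locally_quasi_convex T2H"
  have "openin (gtop T2H) (T.mball (\<lambda>n. 1) 1)" "\<one>\<^bsub>T2H\<^esub> \<in> T.mball (\<lambda>n. 1) 1"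
    using T2H_one by (simp_all add: T2H_simps)
  then obtain A V where AV: "quasi_convex T2H A" "openin T.mtopology V" "(\<lambda>n. 1) \<in> V" "V \<subseteq> A" "A \<subseteq> T.mball (\<lambda>n. 1) 1"
    using lqc unfolding locally_quasi_convex_def T2H_simps by metis
  obtain \<delta> where \<delta>: "\<delta> > 0" "T.mball (\<lambda>n. 1) \<delta> \<subseteq> V" using AV(2,3) unfolding T.openin_mtopology by blast
  \<comment> \<open>The coefficients will have square sum, hence absolute sum, at most
    \<open>(4 / \<delta>)\<^sup>2\<close>, so the total angle is at most a quarter turn; the
    \<open>+ 1\<close> keeps \<open>r\<close> itself at most \<open>1/4\<close>.\<close>
  define r where "r = 1 / (4 * ((4 / \<delta>)\<^sup>2 + 1))"
  have r: "0 < r" "r \<le> 1/4" "r * (4 / \<delta>)\<^sup>2 \<le> 1/4"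
  proof -
    have p: "(4 / \<delta>)\<^sup>2 \<ge> 0" by simp
    then show "0 < r" by (simp add: r_def add_nonneg_pos)
    have e: "1 / (4 * (c + 1)) \<le> 1/4" "1 / (4 * (c + 1)) * c \<le> 1/4" if "c \<ge> 0" for c :: real
      using that by (simp_all add: divide_simps)
    show "r \<le> 1/4" "r * (4 / \<delta>)\<^sup>2 \<le> 1/4" using e[OF p] unfolding r_def by blast+
  qed
  obtain N where N: "l2_dist (\<lambda>n. 1) (wrap (cutoff (\<lambda>n. r) N)) \<ge> 1"
    using l2_dist_constant_large[of r] r(1,2) by auto
  let ?g = "wrap (cutoff (\<lambda>n. r) N)"
  have g: "?g \<in> T2H_set" by (rule wrap_in_T2H[OF cutoff_ell2])
  have "?g \<in> A"
  proof (rule ccontr)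
    assume "?g \<notin> A"
    then obtain \<phi> where \<phi>: "\<phi> \<in> polar T2H A" "Re (\<phi> ?g) < 0"
      using AV(1) g unfolding quasi_convex_def T2H_simps by blast
    have \<phi>c: "\<phi> \<in> characters T2H" "\<And>z. z \<in> A \<Longrightarrow> Re (\<phi> z) \<ge> 0" using \<phi>(1) by (auto simp: polar_def dual_def)
    obtain \<kappa> where \<kappa>: "coefs \<phi> \<kappa>" using character_coefs[OF \<phi>c(1)] by blast
    have "(\<Sum>n<N. (real_of_int (\<kappa> n))\<^sup>2) \<le> (4 / \<delta>)\<^sup>2"
    proof (rule coefs_bound[OF \<kappa> _ \<delta>(1)])
      fix z assume "z \<in> T2H_set" "l2_dist (\<lambda>n. 1) z < \<delta>"
      then have "z \<in> A" using \<delta>(2) AV(4) T2H_one by auto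
      then show "Re (\<phi> z) \<ge> 0" by (rule \<phi>c(2))
    qed
    then have "\<bar>\<Sum>n<N. of_int (\<kappa> n) * r\<bar> \<le> r * (4 / \<delta>)\<^sup>2" by (rule coefs_pairing_le) (use r(1) in simp)
    then have b: "\<bar>\<Sum>n<N. of_int (\<kappa> n) * r\<bar> \<le> 1/4" using r(3) by linarith
    have "Re (\<phi> ?g) = cos (2 * pi * (\<Sum>n<N. of_int (\<kappa> n) * r))" unfolding coefsD[OF \<kappa>] by simp
    also have "\<dots> \<ge> 0"
    proof (rule cos_ge_zero)
      have "\<bar>2 * pi * (\<Sum>n<N. of_int (\<kappa> n) * r)\<bar> = 2 * pi * \<bar>\<Sum>n<N. of_int (\<kappa> n) * r\<bar>" by (simp add: abs_mult)
      also have "\<dots> \<le> 2 * pi * (1/4)" by (rule mult_left_mono[OF b]) simp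
      finally show "- (pi/2) \<le> 2 * pi * (\<Sum>n<N. of_int (\<kappa> n) * r)" "2 * pi * (\<Sum>n<N. of_int (\<kappa> n) * r) \<le> pi/2"
        by linarith+
    qed
    finally show False using \<phi>(2) by simp
  qed
  then have "l2_dist (\<lambda>n. 1) ?g < 1" using AV(5) by auto
  then show False using N by simp
qed

section \<open>The dual group\<close>

text \<open>Handles neighbourhoods in the compact-open topologies, which are given by a subbasis
  only. \<open>Q\<close> says that a set belongs to some filter, whence the closure conditions
  \<open>inter\<close> and \<open>mono\<close>.\<close>

lemma generated_nbhd_induct:
  assumes "openin (topology_generated_by \<S>) W" "x \<in> W"
    and inter: "\<And>A B. Q A \<Longrightarrow> Q B \<Longrightarrow> Q (A \<inter> B)" and mono: "\<And>A B. Q A \<Longrightarrow> A \<subseteq> B \<Longrightarrow> Q B"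
    and basic: "\<And>B. B \<in> \<S> \<Longrightarrow> x \<in> B \<Longrightarrow> Q B"
  shows "Q W"
proof -
  have "generate_topology_on \<S> W" using assms(1) by (simp add: openin_topology_generated_by_iff)
  then have "x \<in> W \<longrightarrow> Q W"
  proof induction
    case (UN K)
    then show ?case using mono by (metis Union_iff Union_upper)
  qed (use inter basic in auto)
  then show ?thesis using assms(2) by blast
qed

lemma carrier_dual: "carrier (dual G) = characters G"
  by (simp add: dual_def)

lemma mult_dual: "\<phi> \<otimes>\<^bsub>dual G\<^esub> \<psi> = (\<lambda>g\<in>carrier G. \<phi> g * \<psi> g)"
  by (simp add: dual_def)

lemma one_dual: "\<one>\<^bsub>dual G\<^esub> = (\<lambda>g\<in>carrier G. 1)"
  by (simp add: dual_def)

lemma charactersI: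
  assumes "\<And>x. x \<in> carrier G \<Longrightarrow> cmod (\<phi> x) = 1"
    and "\<And>x y. x \<in> carrier G \<Longrightarrow> y \<in> carrier G \<Longrightarrow> \<phi> (x \<otimes>\<^bsub>G\<^esub> y) = \<phi> x * \<phi> y"
    and "\<phi> \<in> extensional (carrier G)" "continuous_map (gtop G) euclidean \<phi>" "topspace (gtop G) = carrier G"
  shows "\<phi> \<in> characters G"
  using assms unfolding characters_def
  by (auto simp: hom_def circle_simps continuous_map_in_subtopology)

lemma charactersD:
  assumes "\<phi> \<in> characters G"
  shows "x \<in> carrier G \<Longrightarrow> cmod (\<phi> x) = 1"
    and "x \<in> carrier G \<Longrightarrow> y \<in> carrier G \<Longrightarrow> \<phi> (x \<otimes>\<^bsub>G\<^esub> y) = \<phi> x * \<phi> y"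
    and "\<phi> \<in> extensional (carrier G)" "continuous_map (gtop G) euclidean \<phi>"
  using assms unfolding characters_def
  by (auto simp: hom_def circle_simps continuous_map_in_subtopology Pi_iff)

lemma comm_group_dual:
  assumes G: "group G" and ts: "topspace (gtop G) = carrier G"
  shows "comm_group (dual G)"
proof (rule comm_groupI)
  interpret group G by fact
  show "\<one>\<^bsub>dual G\<^esub> \<in> carrier (dual G)" unfolding carrier_dual one_dual
  proof (rule charactersI)
    have "continuous_map (gtop G) euclidean (\<lambda>x. 1 :: complex)" by simp
    then show "continuous_map (gtop G) euclidean (\<lambda>g\<in>carrier G. 1 :: complex)"
      by (rule continuous_map_eq) (simp add: ts)
  qed (use ts in auto)
  fix \<phi> assume "\<phi> \<in> carrier (dual G)"
  then have \<phi>: "\<phi> \<in> characters G" by (simp add: carrier_dual)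
  note D = charactersD[OF \<phi>]
  show "\<one>\<^bsub>dual G\<^esub> \<otimes>\<^bsub>dual G\<^esub> \<phi> = \<phi>"
    unfolding mult_dual one_dual by (rule extensionalityI[OF _ D(3)]) auto
  let ?c = "\<lambda>g\<in>carrier G. cnj (\<phi> g)"
  have "?c \<in> characters G"
  proof (rule charactersI)
    have "continuous_map (gtop G) euclidean (\<lambda>g. cnj (\<phi> g))"
      using continuous_map_compose[OF D(4), of euclidean cnj] by (simp add: o_def continuous_intros)
    then show "continuous_map (gtop G) euclidean ?c" by (rule continuous_map_eq) (simp add: ts)
  qed (use D ts in auto)
  moreover have "?c \<otimes>\<^bsub>dual G\<^esub> \<phi> = \<one>\<^bsub>dual G\<^esub>"
    unfolding mult_dual one_dual
  proof (rule restrict_ext)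
    fix g assume g: "g \<in> carrier G"
    then show "?c g * \<phi> g = 1" using D(1)[OF g] by (simp add: mult.commute complex_norm_square[symmetric])
  qed
  ultimately show "\<exists>y\<in>carrier (dual G). y \<otimes>\<^bsub>dual G\<^esub> \<phi> = \<one>\<^bsub>dual G\<^esub>" by (auto simp: carrier_dual)
  fix \<psi> assume "\<psi> \<in> carrier (dual G)"
  then have \<psi>: "\<psi> \<in> characters G" by (simp add: carrier_dual)
  show "\<phi> \<otimes>\<^bsub>dual G\<^esub> \<psi> = \<psi> \<otimes>\<^bsub>dual G\<^esub> \<phi>" unfolding mult_dual by (simp add: mult.commute)
  show "\<phi> \<otimes>\<^bsub>dual G\<^esub> \<psi> \<in> carrier (dual G)" unfolding mult_dual carrier_dual
  proof (rule charactersI)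
    have "continuous_map (gtop G) euclidean (\<lambda>g. \<phi> g * \<psi> g)"
    proof (rule continuous_map_compose[of _ "prod_topology euclidean euclidean" "\<lambda>g. (\<phi> g, \<psi> g)" _ "\<lambda>(a, b). a * b", unfolded o_def prod.case])
      show "continuous_map (gtop G) (prod_topology euclidean euclidean) (\<lambda>g. (\<phi> g, \<psi> g))"
        using D(4) charactersD(4)[OF \<psi>] unfolding continuous_map_pairwise o_def by simp
      show "continuous_map (prod_topology euclidean euclidean) euclidean (\<lambda>(a, b). a * b :: complex)"
        by (simp add: case_prod_beta euclidean_product_topology continuous_intros)
    qed
    then show "continuous_map (gtop G) euclidean (\<lambda>g\<in>carrier G. \<phi> g * \<psi> g)" by (rule continuous_map_eq) (simp add: ts)
  qed (use D charactersD[OF \<psi>] ts in \<open>auto simp: norm_mult\<close>)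
  fix \<rho> assume "\<rho> \<in> carrier (dual G)"
  show "\<phi> \<otimes>\<^bsub>dual G\<^esub> \<psi> \<otimes>\<^bsub>dual G\<^esub> \<rho> = \<phi> \<otimes>\<^bsub>dual G\<^esub> (\<psi> \<otimes>\<^bsub>dual G\<^esub> \<rho>)"
    unfolding mult_dual by (rule restrict_ext) (simp add: mult.assoc)
qed

lemma comm_group_dual_T2H: "comm_group (dual T2H)"
  using topological_group_T2H unfolding topological_group_def by (intro comm_group_dual) auto

lemma comm_group_bidual_T2H: "comm_group (bidual T2H)"
  by (rule comm_group_dual) (simp_all add: comm_group_dual_T2H comm_group.axioms topspace_dual)

lemma cutoff_tendsto:
  assumes x: "x \<in> ell2_set"
  shows "limitin E.mtopology (cutoff x) x sequentially"
proof -
  have s: "summable (\<lambda>n. (x n)\<^sup>2)" using x by (simp add: ell2_set_def)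
  have "l2_dist (cutoff x m) x = sqrt ((\<Sum>n. (x n)\<^sup>2) - (\<Sum>n<m. (x n)\<^sup>2))" for m
  proof -
    have "(\<lambda>n. (x n)\<^sup>2 - (if n \<in> {..<m} then (x n)\<^sup>2 else 0)) sums ((\<Sum>n. (x n)\<^sup>2) - (\<Sum>n<m. (x n)\<^sup>2))"
      by (intro sums_diff summable_sums s sums_If_finite_set) simp
    also have "(\<lambda>n. (x n)\<^sup>2 - (if n \<in> {..<m} then (x n)\<^sup>2 else 0)) = (\<lambda>n. (norm (cutoff x m n - x n))\<^sup>2)"
      by (auto simp: cutoff_def)
    finally have "(\<Sum>n. (norm (cutoff x m n - x n))\<^sup>2) = (\<Sum>n. (x n)\<^sup>2) - (\<Sum>n<m. (x n)\<^sup>2)" by (rule sums_unique[symmetric])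
    then show ?thesis unfolding l2_dist_eq[OF ell2_summable[OF cutoff_ell2 x]] by simp
  qed
  moreover have "(\<lambda>m. sqrt ((\<Sum>n. (x n)\<^sup>2) - (\<Sum>n<m. (x n)\<^sup>2))) \<longlonglongrightarrow> sqrt ((\<Sum>n. (x n)\<^sup>2) - (\<Sum>n. (x n)\<^sup>2))"
    by (intro tendsto_intros summable_LIMSEQ s)
  ultimately show ?thesis unfolding E.limitin_metric_dist_null using x cutoff_ell2 by simp
qed

lemma character_positive_nbhd:
  assumes \<phi>: "\<phi> \<in> characters T2H"
  obtains \<delta> where "\<delta> > 0" "\<And>z. z \<in> T2H_set \<Longrightarrow> l2_dist (\<lambda>n. 1) z < \<delta> \<Longrightarrow> Re (\<phi> z) > 0"
proof -
  have c: "continuous_map T.mtopology euclidean \<phi>" using charactersD(4)[OF \<phi>] by (simp add: T2H_simps)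
  have "open {z. Re z > 0}" by (rule open_halfspace_Re_gt)
  then have "openin T.mtopology {z \<in> topspace T.mtopology. \<phi> z \<in> {z. Re z > 0}}"
    by (intro openin_continuous_map_preimage[OF c]) simp
  moreover have "(\<lambda>n. 1) \<in> {z \<in> topspace T.mtopology. \<phi> z \<in> {z. Re z > 0}}"
    using characterD(3)[OF \<phi>] T2H_one by simp
  ultimately obtain \<delta> where "\<delta> > 0" "T.mball (\<lambda>n. 1) \<delta> \<subseteq> {z \<in> topspace T.mtopology. \<phi> z \<in> {z. Re z > 0}}"
    unfolding T.openin_mtopology by blast
  then show ?thesis using T2H_one by (intro that[of \<delta>]) auto
qed

text \<open>Near the identity the character has positive real part, which bounds the square sum of
  its coefficients; integers with a convergent square sum vanish eventually.\<close>

lemma character_finite_support: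
  assumes \<phi>: "\<phi> \<in> characters T2H" and \<kappa>: "coefs \<phi> \<kappa>"
  shows "\<exists>N. \<forall>n\<ge>N. \<kappa> n = 0"
proof -
  obtain \<delta> where \<delta>: "\<delta> > 0" "\<And>z. z \<in> T2H_set \<Longrightarrow> l2_dist (\<lambda>n. 1) z < \<delta> \<Longrightarrow> Re (\<phi> z) > 0"
    using character_positive_nbhd[OF \<phi>] by blast
  have "summable (\<lambda>n. (real_of_int (\<kappa> n))\<^sup>2)"
    by (rule summableI_nonneg_bounded[of _ "(4 / \<delta>)\<^sup>2"]) (use coefs_bound[OF \<kappa> _ \<delta>(1)] \<delta>(2) less_imp_le in auto)
  then have "(\<lambda>n. (real_of_int (\<kappa> n))\<^sup>2) \<longlonglongrightarrow> 0" by (rule summable_LIMSEQ_zero)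
  then have "eventually (\<lambda>n. (real_of_int (\<kappa> n))\<^sup>2 < 1) sequentially" by (rule order_tendstoD) simp
  then obtain N where N: "\<And>n. n \<ge> N \<Longrightarrow> (real_of_int (\<kappa> n))\<^sup>2 < 1" unfolding eventually_sequentially by blast
  have "\<kappa> n = 0" if "n \<ge> N" for n
  proof -
    have "\<bar>real_of_int (\<kappa> n)\<bar> < 1" using N[OF that] by (simp add: abs_square_less_1)
    then show ?thesis by linarith
  qed
  then show ?thesis by blast
qed

lemma character_wrap:
  assumes \<phi>: "\<phi> \<in> characters T2H" and \<kappa>: "coefs \<phi> \<kappa>" and N: "\<And>n. n \<ge> N \<Longrightarrow> \<kappa> n = 0" and x: "x \<in> ell2_set"
  shows "\<phi> (wrap x) = cis (2 * pi * (\<Sum>n<N. of_int (\<kappa> n) * x n))"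
proof (rule LIMSEQ_unique)
  have c: "continuous_map T.mtopology euclidean \<phi>" using charactersD(4)[OF \<phi>] by (simp add: T2H_simps)
  have "limitin euclidean ((\<phi> \<circ> wrap) \<circ> cutoff x) ((\<phi> \<circ> wrap) x) sequentially"
    by (rule continuous_map_limit[OF continuous_map_compose[OF wrap_continuous c] cutoff_tendsto[OF x]])
  then show "(\<lambda>m. \<phi> (wrap (cutoff x m))) \<longlonglongrightarrow> \<phi> (wrap x)" by (simp add: o_def)
  have "eventually (\<lambda>m. \<phi> (wrap (cutoff x m)) = cis (2 * pi * (\<Sum>n<N. of_int (\<kappa> n) * x n))) sequentially"
    using eventually_ge_at_top[of N]
  proof eventually_elim
    case (elim m)
    have "(\<Sum>n<m. of_int (\<kappa> n) * x n) = (\<Sum>n<N. of_int (\<kappa> n) * x n)"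
      using elim N by (intro sum.mono_neutral_right) auto
    then show ?case by (simp add: coefsD[OF \<kappa>])
  qed
  then show "(\<lambda>m. \<phi> (wrap (cutoff x m))) \<longlonglongrightarrow> cis (2 * pi * (\<Sum>n<N. of_int (\<kappa> n) * x n))" by (rule tendsto_eventually)
qed

section \<open>Coordinate characters generate the dual\<close>

definition coord_char :: "nat \<Rightarrow> (nat \<Rightarrow> complex) \<Rightarrow> complex" where
  "coord_char j = (\<lambda>z\<in>T2H_set. z j)"

lemma coord_char_character: "coord_char j \<in> characters T2H"
proof (rule charactersI)
  show "continuous_map (gtop T2H) euclidean (coord_char j)"
    unfolding T2H_simps by (rule continuous_map_eq[OF coord_continuous[of j]]) (simp add: coord_char_def)
qed (auto simp: T2H_simps coord_char_def T2H_mult_closed, auto simp: T2H_set_def)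

lemma coefs_coord_char: "coefs (coord_char j) (\<lambda>n. if n = j then 1 else 0)"
proof -
  have "(\<Sum>n<N. real_of_int (if n = j then 1 else 0) * x n) = cutoff x N j" for x :: "nat \<Rightarrow> real" and N
    by (simp add: cutoff_def if_distrib[of "\<lambda>a. real_of_int a * _"] sum.delta cong: if_cong)
  then show ?thesis
    unfolding coefs_def coord_char_def using wrap_in_T2H[OF cutoff_ell2] by (simp add: wrap_def)
qed

lemma coefs_mult:
  assumes "coefs \<phi> \<kappa>" "coefs \<psi> \<mu>"
  shows "coefs (\<phi> \<otimes>\<^bsub>dual T2H\<^esub> \<psi>) (\<lambda>n. \<kappa> n + \<mu> n)"
  using assms wrap_in_T2H[OF cutoff_ell2]
  by (simp add: coefs_def mult_dual T2H_simps cis_mult distrib_right distrib_left sum.distrib)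

text \<open>Characters are products of powers of coordinate characters, by induction on the sum of
  the absolute values of the coefficients. The rule \<open>down\<close> stands in for inverses, so
  that identities between homomorphisms are carried along by cancelling a nonzero factor.\<close>

lemma T2H_characters_induct[consumes 1, case_names one up down]:
  assumes "\<phi> \<in> characters T2H" and one: "Q \<one>\<^bsub>dual T2H\<^esub>"
    and up: "\<And>\<phi> j. \<phi> \<in> characters T2H \<Longrightarrow> Q \<phi> \<Longrightarrow> Q (\<phi> \<otimes>\<^bsub>dual T2H\<^esub> coord_char j)"
    and down: "\<And>\<phi> j. \<phi> \<in> characters T2H \<Longrightarrow> Q (\<phi> \<otimes>\<^bsub>dual T2H\<^esub> coord_char j) \<Longrightarrow> Q \<phi>"
  shows "Q \<phi>"
proof -
  interpret D: comm_group "dual T2H" by (rule comm_group_dual_T2H)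
  have ec: "coord_char j \<in> carrier (dual T2H)" for j by (simp add: carrier_dual coord_char_character)
  have main: "Q \<phi>" if "\<phi> \<in> characters T2H" "coefs \<phi> \<kappa>" "\<And>n. n \<ge> N \<Longrightarrow> \<kappa> n = 0" "(\<Sum>n<N. nat \<bar>\<kappa> n\<bar>) = m" for \<phi> \<kappa> N m
    using that
  proof (induction m arbitrary: \<phi> \<kappa> rule: less_induct)
    case (less m)
    note \<phi> = less.prems(1) and \<kappa> = less.prems(2) and N = less.prems(3)
    have \<phi>D: "\<phi> \<in> carrier (dual T2H)" using \<phi> by (simp add: carrier_dual)
    have smaller: "(\<Sum>n<N. nat \<bar>\<kappa> n + s * (if n = j then 1 else 0)\<bar>) < m"
      if j: "j < N" and s: "nat \<bar>\<kappa> j + s\<bar> < nat \<bar>\<kappa> j\<bar>" for j and s :: int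
      unfolding less.prems(4)[symmetric]
      by (rule sum_strict_mono_ex1) (use j s in auto)
    show ?case
    proof (cases "\<forall>j<N. \<kappa> j = 0")
      case True
      have "\<phi> = \<one>\<^bsub>dual T2H\<^esub>"
      proof (rule extensionalityI[OF characterD(5)[OF \<phi>]])
        show "\<one>\<^bsub>dual T2H\<^esub> \<in> extensional T2H_set" by (simp add: one_dual T2H_simps)
        fix z assume z: "z \<in> T2H_set"
        then obtain x where x: "x \<in> ell2_set" "z = wrap x" using wrap_surj by blast
        have "\<phi> (wrap x) = cis (2 * pi * (\<Sum>n<N. of_int (\<kappa> n) * x n))" by (rule character_wrap[OF \<phi> \<kappa> N x(1)])
        then have "\<phi> z = 1" using True x(2) by simp
        then show "\<phi> z = \<one>\<^bsub>dual T2H\<^esub> z" using z by (simp add: one_dual T2H_simps)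
      qed
      then show ?thesis using one by simp
    next
      case False
      then obtain j where j: "j < N" "\<kappa> j \<noteq> 0" by blast
      show ?thesis
      proof (cases "\<kappa> j < 0")
        case True
        have "Q (\<phi> \<otimes>\<^bsub>dual T2H\<^esub> coord_char j)"
        proof (rule less.IH[OF smaller[OF j(1), of 1] _ _ _ refl])
          show "nat \<bar>\<kappa> j + 1\<bar> < nat \<bar>\<kappa> j\<bar>" using True by simp
          show "\<phi> \<otimes>\<^bsub>dual T2H\<^esub> coord_char j \<in> characters T2H"
            using D.m_closed[OF \<phi>D ec] by (simp add: carrier_dual)
          show "coefs (\<phi> \<otimes>\<^bsub>dual T2H\<^esub> coord_char j) (\<lambda>n. \<kappa> n + 1 * (if n = j then 1 else 0))"
            using coefs_mult[OF \<kappa> coefs_coord_char] by simp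
        qed (use N j(1) in auto)
        then show ?thesis by (rule down[OF \<phi>])
      next
        case False
        \<comment> \<open>A positive coefficient is lowered with the inverse of the coordinate
          character, and \<open>up\<close> restores the original character; a negative coefficient
          was raised directly, with \<open>down\<close> leading back.\<close>
        define e where "e = inv\<^bsub>dual T2H\<^esub> coord_char j"
        have e: "e \<in> carrier (dual T2H)" "e \<otimes>\<^bsub>dual T2H\<^esub> coord_char j = \<one>\<^bsub>dual T2H\<^esub>" unfolding e_def using ec by auto
        then obtain \<epsilon> where \<epsilon>: "coefs e \<epsilon>" using character_coefs by (auto simp: carrier_dual)
        let ?\<phi>' = "\<phi> \<otimes>\<^bsub>dual T2H\<^esub> e"
        have \<phi>': "?\<phi>' \<in> characters T2H" using D.m_closed[OF \<phi>D e(1)] by (simp add: carrier_dual)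
        have "coefs e (\<lambda>n. - (if n = j then 1 else 0))"
          unfolding coefs_def
        proof (intro allI)
          fix x N
          let ?z = "wrap (cutoff x N)" and ?s = "\<Sum>n<N. real_of_int (if n = j then 1 else 0) * x n"
          have z: "?z \<in> T2H_set" by (rule wrap_in_T2H[OF cutoff_ell2])
          have "e ?z * coord_char j ?z = 1"
            using fun_cong[OF e(2), of ?z] z by (simp add: mult_dual one_dual T2H_simps)
          then have "e ?z * cis (2 * pi * ?s) = 1" by (simp only: coefsD[OF coefs_coord_char])
          then have "e ?z * cis (2 * pi * ?s) * cis (- (2 * pi * ?s)) = cis (- (2 * pi * ?s))" by simp
          then have "e ?z = cis (- (2 * pi * ?s))" by (simp add: mult.assoc cis_mult)
          then show "e ?z = cis (2 * pi * (\<Sum>n<N. real_of_int (- (if n = j then 1 else 0)) * x n))"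
            by (simp add: sum_negf)
        qed
        from coefs_mult[OF \<kappa> this]
        have co: "coefs ?\<phi>' (\<lambda>n. \<kappa> n + (- 1) * (if n = j then 1 else 0))" by simp
        have "Q ?\<phi>'"
          by (rule less.IH[OF smaller[OF j(1), of "- 1"] \<phi>' co _ refl]) (use N j False in auto)
        then have "Q (?\<phi>' \<otimes>\<^bsub>dual T2H\<^esub> coord_char j)" by (rule up[OF \<phi>'])
        then show ?thesis using e \<phi>D ec by (simp add: D.m_assoc)
      qed
    qed
  qed
  obtain \<kappa> where \<kappa>: "coefs \<phi> \<kappa>" using character_coefs[OF assms(1)] by blast
  obtain N where "\<forall>n\<ge>N. \<kappa> n = 0" using character_finite_support[OF assms(1) \<kappa>] by blast
  then show ?thesis using main[OF assms(1) \<kappa>] by blast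
qed

lemma bidual_determined:
  assumes \<psi>: "\<psi> \<in> characters (dual T2H)" "\<psi>' \<in> characters (dual T2H)"
    and eq: "\<And>j. \<psi> (coord_char j) = \<psi>' (coord_char j)"
  shows "\<psi> = \<psi>'"
proof (rule extensionalityI[OF charactersD(3)[OF \<psi>(1)] charactersD(3)[OF \<psi>(2)]])
  interpret D: comm_group "dual T2H" by (rule comm_group_dual_T2H)
  note D1 = charactersD[OF \<psi>(1)] and D2 = charactersD[OF \<psi>(2)]
  have ec: "coord_char j \<in> carrier (dual T2H)" for j by (simp add: carrier_dual coord_char_character)
  have nz: "\<psi>' (coord_char j) \<noteq> 0" for j using D2(1)[OF ec[of j]] by auto
  fix \<phi> assume "\<phi> \<in> carrier (dual T2H)"
  then have "\<phi> \<in> characters T2H" by (simp add: carrier_dual)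
  then show "\<psi> \<phi> = \<psi>' \<phi>"
  proof (induction rule: T2H_characters_induct)
    case one
    have h: "\<psi> \<one>\<^bsub>dual T2H\<^esub> = 1" if "\<psi> \<in> characters (dual T2H)" for \<psi>
      using charactersD(1)[OF that D.one_closed] charactersD(2)[OF that D.one_closed D.one_closed] by auto
    show ?case unfolding h[OF \<psi>(1)] h[OF \<psi>(2)] by (rule refl)
  next
    case (up \<phi> j)
    then show ?case using D1(2)[OF _ ec] D2(2)[OF _ ec] eq by (simp add: carrier_dual)
  next
    case (down \<phi> j)
    then show ?case using D1(2)[OF _ ec] D2(2)[OF _ ec] eq nz by (simp add: carrier_dual)
  qed
qed

text \<open>Square summability makes \<open>z j\<close> tend to \<open>1\<close> for each
  \<open>z\<close>, and on a compact set a finite \<open>\<epsilon>/2\<close>-net makes this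
  uniform. So the coordinate characters converge to the trivial character in the dual.\<close>

lemma coord_char_eventually:
  assumes W: "openin (gtop (dual T2H)) W" "\<one>\<^bsub>dual T2H\<^esub> \<in> W"
  shows "eventually (\<lambda>j. coord_char j \<in> W) sequentially"
proof -
  have "openin (compact_open_topology T2H) W" using W(1) by (simp add: dual_def)
  then show ?thesis unfolding compact_open_topology_def
  proof (rule generated_nbhd_induct[OF _ W(2)])
    fix B assume "B \<in> {{\<phi> \<in> characters T2H. \<phi> ` K \<subseteq> U} | K U. compactin (gtop T2H) K \<and> openin (gtop circle_group) U}"
      and one: "\<one>\<^bsub>dual T2H\<^esub> \<in> B"
    then obtain K U where B: "B = {\<phi> \<in> characters T2H. \<phi> ` K \<subseteq> U}" and K: "compactin T.mtopology K"
      and U: "openin (top_of_set (sphere 0 1)) U" by (auto simp: T2H_simps circle_simps)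
    have KT: "K \<subseteq> T2H_set" using compactin_subset_topspace[OF K] by simp
    show "eventually (\<lambda>j. coord_char j \<in> B) sequentially"
    proof (cases "K = {}")
      case False
      then obtain k where "k \<in> K" by blast
      then have "k \<in> T2H_set" "\<one>\<^bsub>dual T2H\<^esub> k \<in> U" using one KT unfolding B by blast+
      then have "1 \<in> U" by (simp add: one_dual T2H_simps)
      then obtain \<epsilon> where \<epsilon>: "\<epsilon> > 0" "ball 1 \<epsilon> \<inter> sphere 0 1 \<subseteq> U" using U unfolding openin_contains_ball by blast
      then have "\<epsilon>/2 > 0" by simp
      then obtain F where F: "finite F" "F \<subseteq> K" "K \<subseteq> (\<Union>z\<in>F. T.mball z (\<epsilon>/2))"
        using T.compactin_imp_mtotally_bounded[OF K] unfolding T.mtotally_bounded_def by meson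
      have "\<forall>z\<in>F. \<forall>\<^sub>F j in sequentially. cmod (z j - 1) < \<epsilon>/2"
      proof
        fix z assume "z \<in> F"
        then have "z \<in> T2H_set" using F(2) KT by blast
        then have "(\<lambda>j. (cmod (1 - z j))\<^sup>2) \<longlonglongrightarrow> 0" by (intro summable_LIMSEQ_zero) (simp add: T2H_set_def)
        then have "\<forall>\<^sub>F j in sequentially. (cmod (1 - z j))\<^sup>2 < (\<epsilon>/2)\<^sup>2" by (rule order_tendstoD) (use \<epsilon> in simp)
        then show "\<forall>\<^sub>F j in sequentially. cmod (z j - 1) < \<epsilon>/2"
        proof eventually_elim
          case (elim j)
          then have "cmod (1 - z j) < \<epsilon>/2" by (rule power2_less_imp_less) (use \<epsilon>(1) in simp)
          then show ?case by (simp add: norm_minus_commute)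
        qed
      qed
      then have "\<forall>\<^sub>F j in sequentially. \<forall>z\<in>F. cmod (z j - 1) < \<epsilon>/2" by (rule eventually_ball_finite[OF F(1)])
      then show ?thesis
      proof eventually_elim
        case (elim j)
        have "coord_char j w \<in> U" if w: "w \<in> K" for w
        proof -
          obtain z where z: "z \<in> F" "w \<in> T.mball z (\<epsilon>/2)" using F(3) w by blast
          then have zw: "z \<in> T2H_set" "w \<in> T2H_set" "l2_dist z w < \<epsilon>/2" by auto
          have "cmod (z j - w j) \<le> l2_dist z w" by (rule l2_dist_coord[OF T2H_summable[OF zw(1,2)]])
          moreover have "cmod (1 - w j) \<le> cmod (1 - z j) + cmod (z j - w j)" using norm_triangle_ineq[of "1 - z j" "z j - w j"] by simp
          moreover have "cmod (1 - z j) < \<epsilon>/2" using elim z(1) norm_minus_commute[of 1 "z j"] by simp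
          ultimately have "cmod (1 - w j) < \<epsilon>" using zw(3) by linarith
          then have "w j \<in> ball 1 \<epsilon>" by (simp add: dist_norm)
          moreover have "w j \<in> sphere 0 1" using zw(2) by (simp add: T2H_set_def)
          ultimately show ?thesis using \<epsilon>(2) zw(2) by (auto simp: coord_char_def)
        qed
        then show ?case unfolding B using coord_char_character by blast
      qed
    qed (simp add: B coord_char_character)
  qed (auto elim: eventually_elim2 eventually_mono)
qed

text \<open>On coordinate characters an involution takes the values \<open>1\<close> and
  \<open>-1\<close>. Continuity at the trivial character leaves finitely many values
  \<open>-1\<close>, and the finite set of their indices determines the involution.\<close>

lemma bidual_involutions_countable:
  "countable {\<psi> \<in> carrier (bidual T2H). \<psi> \<otimes>\<^bsub>bidual T2H\<^esub> \<psi> = \<one>\<^bsub>bidual T2H\<^esub>}" (is "countable ?V")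
proof -
  define s where "s \<psi> = {j. \<psi> (coord_char j) \<noteq> 1}" for \<psi> :: "((nat \<Rightarrow> complex) \<Rightarrow> complex) \<Rightarrow> complex"
  have ec: "coord_char j \<in> carrier (dual T2H)" for j by (simp add: carrier_dual coord_char_character)
  have pm: "\<psi> (coord_char j) = 1 \<or> \<psi> (coord_char j) = - 1" if "\<psi> \<in> ?V" for \<psi> j
  proof -
    have "(\<psi> \<otimes>\<^bsub>bidual T2H\<^esub> \<psi>) (coord_char j) = \<one>\<^bsub>bidual T2H\<^esub> (coord_char j)" using that by simp
    then have "\<psi> (coord_char j) * \<psi> (coord_char j) = 1"
      unfolding mult_dual one_dual restrict_apply'[OF ec] .
    then show ?thesis by (simp add: square_eq_1_iff)
  qed
  have ch: "\<psi> \<in> characters (dual T2H)" if "\<psi> \<in> ?V" for \<psi> using that by (simp add: carrier_dual)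
  have "inj_on s ?V"
  proof (rule inj_onI, rule bidual_determined)
    fix \<psi> \<psi>' j assume a: "\<psi> \<in> ?V" "\<psi>' \<in> ?V" "s \<psi> = s \<psi>'"
    then have "\<psi> (coord_char j) \<noteq> 1 \<longleftrightarrow> \<psi>' (coord_char j) \<noteq> 1" unfolding s_def by blast
    then show "\<psi> (coord_char j) = \<psi>' (coord_char j)" using pm[OF a(1), of j] pm[OF a(2), of j] by metis
  qed (use ch in auto)
  moreover have "finite (s \<psi>)" if V: "\<psi> \<in> ?V" for \<psi>
  proof -
    interpret D: comm_group "dual T2H" by (rule comm_group_dual_T2H)
    note D = charactersD[OF ch[OF V]]
    let ?W = "{\<phi> \<in> topspace (gtop (dual T2H)). \<psi> \<phi> \<in> {z. Re z > 0}}"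
    have "openin (gtop (dual T2H)) ?W"
      by (rule openin_continuous_map_preimage[OF D(4)]) (simp add: open_halfspace_Re_gt)
    moreover have "\<psi> \<one>\<^bsub>dual T2H\<^esub> = 1"
      using D(1)[OF D.one_closed] D(2)[OF D.one_closed D.one_closed] by auto
    then have "\<one>\<^bsub>dual T2H\<^esub> \<in> ?W" by (simp add: topspace_dual)
    ultimately have "eventually (\<lambda>j. coord_char j \<in> ?W) sequentially" by (rule coord_char_eventually)
    then have "eventually (\<lambda>j. \<psi> (coord_char j) = 1) sequentially"
    proof eventually_elim
      case (elim j)
      then have "Re (\<psi> (coord_char j)) > 0" by simp
      then show ?case using pm[OF V, of j] by auto
    qed
    then obtain N where "\<And>j. j \<ge> N \<Longrightarrow> \<psi> (coord_char j) = 1" unfolding eventually_sequentially by blast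
    then have "s \<psi> \<subseteq> {..<N}" unfolding s_def using not_less by blast
    then show ?thesis by (rule finite_subset) simp
  qed
  then have "s ` ?V \<subseteq> {S. finite S}" by blast
  then have "countable (s ` ?V)" by (rule countable_subset) (rule countable_Collect_finite)
  ultimately show ?thesis by (rule countable_image_inj_on[rotated])
qed

section \<open>The bidual group\<close>

text \<open>Compact subsets of the dual are equicontinuous at the identity because
  \<open>T2H\<close> is metrizable, while unbounded coefficients would give characters in
  \<open>K\<close> equal to \<open>-1\<close> at antipodes tending to the identity.\<close>

lemma compact_dual_coefs_bounded:
  assumes K: "compactin (gtop (dual T2H)) K"
  shows "\<exists>C. \<forall>\<phi>\<in>K. \<forall>\<kappa> N. coefs \<phi> \<kappa> \<longrightarrow> (\<Sum>n<N. (real_of_int (\<kappa> n))\<^sup>2) \<le> C"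
proof (rule ccontr)
  assume "\<not> ?thesis"
  then have unb: "\<exists>\<phi>\<in>K. \<exists>\<kappa> N. coefs \<phi> \<kappa> \<and> (\<Sum>n<N. (real_of_int (\<kappa> n))\<^sup>2) > C" for C by (meson not_le)
  have "\<exists>\<phi> z. \<phi> \<in> K \<and> z \<in> T2H_set \<and> \<phi> z = - 1 \<and> l2_dist (\<lambda>n. 1) z \<le> pi / (real i + 1)" for i
  proof -
    obtain \<phi> \<kappa> N where o: "\<phi> \<in> K" "coefs \<phi> \<kappa>" "(\<Sum>n<N. (real_of_int (\<kappa> n))\<^sup>2) > (real i + 1)\<^sup>2"
      using unb[of "(real i + 1)\<^sup>2"] by blast
    have "0 < (real i + 1)\<^sup>2" by simp
    then have "l2_dist (\<lambda>n. 1) (antipode \<kappa> N) \<le> pi / sqrt ((real i + 1)\<^sup>2)" "(\<Sum>n<N. (real_of_int (\<kappa> n))\<^sup>2) > 0"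
      using antipode_dist[OF less_imp_le[OF o(3)]] o(3) by linarith+
    then show ?thesis using o antipode_T2H coefs_antipode[OF o(2)] by (intro exI[of _ \<phi>] exI[of _ "antipode \<kappa> N"]) simp
  qed
  then obtain \<phi> z where \<phi>: "\<And>i. \<phi> i \<in> K" and z: "\<And>i. z i \<in> T2H_set" and pz: "\<And>i. \<phi> i (z i) = - 1"
    and dz: "\<And>i. l2_dist (\<lambda>n. 1) (z i) \<le> pi / (real i + 1)" by metis
  have d0: "(\<lambda>i. pi / (real i + 1)) \<longlonglongrightarrow> 0" 
    using tendsto_mult_left[OF LIMSEQ_inverse_real_of_nat, of pi] by (simp add: divide_inverse add.commute)
  have lim: "limitin T.mtopology z (\<lambda>n. 1) sequentially"
    unfolding T.limitin_metric_dist_null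
  proof (intro conjI)
    have "(\<lambda>i. l2_dist (\<lambda>n. 1) (z i)) \<longlonglongrightarrow> 0"
      by (rule tendsto_sandwich[OF _ _ tendsto_const d0]) (use dz T.nonneg in auto)
    then show "(\<lambda>i. l2_dist (z i) (\<lambda>n. 1)) \<longlonglongrightarrow> 0" by (simp only: T.commute)
  qed (use T2H_one z in auto)
  \<comment> \<open>A convergent sequence together with its limit is compact, so each
    \<open>W m\<close> is open. The tails shrink, so the sets \<open>W m\<close> grow, and by
    continuity every single character lies in one of them; a finite subcover then contradicts the
    values \<open>-1\<close>.\<close>
  define L where "L m = insert (\<lambda>n. 1) (z ` {m..})" for m
  define W where "W m = {\<phi> \<in> characters T2H. \<phi> ` L m \<subseteq> {u \<in> sphere 0 1. Re u > 0}}" for m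
  have LT: "compactin (gtop T2H) (L m)" for m
    unfolding L_def T2H_simps by (rule compactin_sequence_with_limit[OF lim]) (use z in auto)
  have "openin (gtop circle_group) {u \<in> sphere 0 1. Re u > 0}"
  proof -
    have "{u \<in> sphere 0 1. Re u > 0} = sphere 0 1 \<inter> {u. Re u > 0}" by blast
    then show ?thesis unfolding circle_simps using openin_open_Int[OF open_halfspace_Re_gt] by metis
  qed
  then have Wo: "openin (gtop (dual T2H)) (W m)" for m
    unfolding dual_def compact_open_topology_def W_def using LT[of m]
    by (auto intro!: topology_generated_by_Basis)
  have KD: "K \<subseteq> characters T2H" using compactin_subset_topspace[OF K] by (simp add: topspace_dual carrier_dual)
  have "K \<subseteq> \<Union>(range W)"
  proof
    fix \<rho> assume "\<rho> \<in> K"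
    then have c: "\<rho> \<in> characters T2H" using KD by blast
    obtain \<delta> where \<delta>: "\<delta> > 0" "\<And>z. z \<in> T2H_set \<Longrightarrow> l2_dist (\<lambda>n. 1) z < \<delta> \<Longrightarrow> Re (\<rho> z) > 0"
      using character_positive_nbhd[OF c] by blast
    have "eventually (\<lambda>i. pi / (real i + 1) < \<delta>) sequentially" by (rule order_tendstoD(2)[OF d0 \<delta>(1)])
    then obtain m where m: "\<And>i. i \<ge> m \<Longrightarrow> pi / (real i + 1) < \<delta>" unfolding eventually_sequentially by blast
    have "Re (\<rho> (z i)) > 0" if "i \<ge> m" for i
      by (rule \<delta>(2)[OF z]) (use dz[of i] m[OF that] in linarith)
    then have "\<rho> \<in> W m"
      unfolding W_def L_def using c characterD(3)[OF c] characterD(1)[OF c z] by auto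
    then show "\<rho> \<in> \<Union>(range W)" by blast
  qed
  then obtain \<F> where F: "finite \<F>" "\<F> \<subseteq> range W" "K \<subseteq> \<Union>\<F>" using compactinD[OF K, of "range W"] Wo by blast
  obtain I where I: "finite I" "\<F> = W ` I" using finite_subset_image[OF F(1,2)] by blast
  obtain M where M: "\<And>i. i \<in> I \<Longrightarrow> i \<le> M" using I(1) unfolding finite_nat_set_iff_bounded_le by blast
  obtain i where i: "i \<in> I" "\<phi> M \<in> W i" using F(3) \<phi>[of M] I(2) by blast
  then have "Re (\<phi> M (z M)) > 0" using M[OF i(1)] unfolding W_def L_def by auto
  then show False by (simp add: pz)
qed

section \<open>The canonical map into the bidual\<close>

abbreviation eval_at :: "(nat \<Rightarrow> complex) \<Rightarrow> ((nat \<Rightarrow> complex) \<Rightarrow> complex) \<Rightarrow> complex" where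
  "eval_at \<equiv> canonical_hom T2H"

lemma canonical_in_bidual: assumes z: "z \<in> T2H_set" shows "eval_at z \<in> carrier (bidual T2H)"
  unfolding carrier_dual
proof (rule charactersI)
  have c: "continuous_map (gtop (dual T2H)) (top_of_set (sphere 0 1)) (\<lambda>\<phi>. \<phi> z)"
    unfolding continuous_map_def
  proof (intro conjI allI impI)
    show "(\<lambda>\<phi>. \<phi> z) \<in> topspace (gtop (dual T2H)) \<rightarrow> topspace (top_of_set (sphere 0 1))"
      using z characterD(1) by (auto simp: topspace_dual carrier_dual)
    fix U assume U: "openin (top_of_set (sphere 0 1)) (U :: complex set)"
    have "compactin (gtop T2H) {z}" using z by (simp add: T2H_simps)
    moreover have "{\<phi> \<in> topspace (gtop (dual T2H)). \<phi> z \<in> U} = {\<phi> \<in> characters T2H. \<phi> ` {z} \<subseteq> U}"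
      by (simp add: topspace_dual carrier_dual)
    ultimately have "{\<phi> \<in> topspace (gtop (dual T2H)). \<phi> z \<in> U} \<in> {{\<phi> \<in> characters T2H. \<phi> ` K \<subseteq> U} | K U.
      compactin (gtop T2H) K \<and> openin (gtop circle_group) U}" using U unfolding circle_simps by blast
    then show "openin (gtop (dual T2H)) {\<phi> \<in> topspace (gtop (dual T2H)). \<phi> z \<in> U}"
      by (simp add: dual_def compact_open_topology_def topology_generated_by_Basis)
  qed
  then have "continuous_map (gtop (dual T2H)) euclidean (\<lambda>\<phi>. \<phi> z)" by (simp add: continuous_map_in_subtopology)
  then show "continuous_map (gtop (dual T2H)) euclidean (eval_at z)"
    by (rule continuous_map_eq) (simp add: canonical_hom_def topspace_dual)
  interpret D: comm_group "dual T2H" by (rule comm_group_dual_T2H)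
  fix \<phi> \<psi> assume a: "\<phi> \<in> carrier (dual T2H)" "\<psi> \<in> carrier (dual T2H)"
  have "eval_at z (\<phi> \<otimes>\<^bsub>dual T2H\<^esub> \<psi>) = (\<phi> \<otimes>\<^bsub>dual T2H\<^esub> \<psi>) z"
    unfolding canonical_hom_def by (rule restrict_apply'[OF D.m_closed[OF a]])
  then show "eval_at z (\<phi> \<otimes>\<^bsub>dual T2H\<^esub> \<psi>) = eval_at z \<phi> * eval_at z \<psi>"
    using z a by (simp add: canonical_hom_def mult_dual T2H_simps)
qed (use z in \<open>auto simp: canonical_hom_def topspace_dual carrier_dual characterD(1)\<close>)

lemma canonical_mult:
  assumes "z \<in> T2H_set" "w \<in> T2H_set"
  shows "eval_at (\<lambda>n. z n * w n) = eval_at z \<otimes>\<^bsub>bidual T2H\<^esub> eval_at w"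
  unfolding canonical_hom_def mult_dual
  by (rule restrict_ext) (use assms characterD(2) in \<open>simp add: carrier_dual\<close>)

lemma canonical_one: "eval_at (\<lambda>n. 1) = \<one>\<^bsub>bidual T2H\<^esub>"
  unfolding canonical_hom_def one_dual
  by (rule restrict_ext) (use characterD(3) in \<open>simp add: carrier_dual\<close>)

text \<open>On a compact set of characters the coefficient vectors are bounded in \<open>\<ell>\<^sup>2\<close>, hence, being
  integral, in \<open>\<ell>\<^sup>1\<close>; so the bidual topology on bounded sequences is controlled by the sup norm.\<close>

lemma bidual_nbhd_sup_norm:
  assumes W: "openin (gtop (bidual T2H)) W" "\<one>\<^bsub>bidual T2H\<^esub> \<in> W"
  shows "\<exists>r>0. \<forall>x N. (\<forall>n. \<bar>x n\<bar> \<le> r) \<longrightarrow> eval_at (wrap (cutoff x N)) \<in> W"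
proof -
  have "openin (compact_open_topology (dual T2H)) W" using W(1) by (simp add: dual_def)
  then show ?thesis unfolding compact_open_topology_def
  proof (rule generated_nbhd_induct[OF _ W(2)])
    fix B assume "B \<in> {{\<phi> \<in> characters (dual T2H). \<phi> ` K \<subseteq> U} | K U. compactin (gtop (dual T2H)) K \<and> openin (gtop circle_group) U}"
      and one: "\<one>\<^bsub>bidual T2H\<^esub> \<in> B"
    then obtain K U where B: "B = {\<psi> \<in> characters (dual T2H). \<psi> ` K \<subseteq> U}" and K: "compactin (gtop (dual T2H)) K"
      and U: "openin (top_of_set (sphere 0 1)) U" by (auto simp: circle_simps)
    have KD: "K \<subseteq> carrier (dual T2H)" using compactin_subset_topspace[OF K] by (simp add: topspace_dual)
    have ac: "eval_at (wrap (cutoff x N)) \<in> characters (dual T2H)" for x N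
      using canonical_in_bidual[OF wrap_in_T2H[OF cutoff_ell2]] by (simp add: carrier_dual)
    show "\<exists>r>0. \<forall>x N. (\<forall>n. \<bar>x n\<bar> \<le> r) \<longrightarrow> eval_at (wrap (cutoff x N)) \<in> B"
    proof (cases "K = {}")
      case True
      then show ?thesis using ac by (intro exI[of _ 1]) (simp add: B)
    next
      case False
      then obtain k where "k \<in> K" by blast
      then have "k \<in> carrier (dual T2H)" "\<one>\<^bsub>bidual T2H\<^esub> k \<in> U" using one KD unfolding B by blast+
      then have "1 \<in> U" by (simp add: one_dual)
      then obtain \<epsilon> where \<epsilon>: "\<epsilon> > 0" "ball 1 \<epsilon> \<inter> sphere 0 1 \<subseteq> U" using U unfolding openin_contains_ball by blast
      obtain C0 where C0: "\<And>\<phi> \<kappa> N. \<phi> \<in> K \<Longrightarrow> coefs \<phi> \<kappa> \<Longrightarrow> (\<Sum>n<N. (real_of_int (\<kappa> n))\<^sup>2) \<le> C0"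
        using compact_dual_coefs_bounded[OF K] by blast
      define C where "C = \<bar>C0\<bar>"
      have C: "(\<Sum>n<N. (real_of_int (\<kappa> n))\<^sup>2) \<le> C" if "\<phi> \<in> K" "coefs \<phi> \<kappa>" for \<phi> \<kappa> N
        using C0[OF that, of N] unfolding C_def by linarith
      have C_nn: "C \<ge> 0" by (simp add: C_def)
      \<comment> \<open>Angles of size at most \<open>r\<close> against coefficients of absolute sum
        at most \<open>C\<close> move the value by less than \<open>\<epsilon>\<close>; the
        \<open>+ 1\<close> allows \<open>C = 0\<close>.\<close>
      define r where "r = \<epsilon> / (2 * pi * (C + 1))"
      have r: "r > 0" "2 * pi * (r * C) < \<epsilon>"
      proof -
        have p: "2 * pi * (C + 1) > 0" using C_nn by simp
        then show "r > 0" unfolding r_def using \<epsilon>(1) by simp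
        have "2 * pi * (r * C) < r * (2 * pi * (C + 1))" using \<open>r > 0\<close> by (simp add: algebra_simps)
        also have "\<dots> = \<epsilon>" using p C_nn unfolding r_def by (simp add: add_nonneg_eq_0_iff)
        finally show "2 * pi * (r * C) < \<epsilon>" .
      qed
      show ?thesis
      proof (intro exI[of _ r] conjI allI impI r(1))
        fix x :: "nat \<Rightarrow> real" and N assume x: "\<forall>n. \<bar>x n\<bar> \<le> r"
        have "eval_at (wrap (cutoff x N)) \<phi> \<in> U" if \<phi>: "\<phi> \<in> K" for \<phi>
        proof -
          have \<phi>c: "\<phi> \<in> characters T2H" using KD \<phi> by (auto simp: carrier_dual)
          obtain \<kappa> where \<kappa>: "coefs \<phi> \<kappa>" using character_coefs[OF \<phi>c] by blast
          let ?s = "\<Sum>n<N. of_int (\<kappa> n) * x n"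
          have v: "eval_at (wrap (cutoff x N)) \<phi> = cis (2 * pi * ?s)"
            using \<phi>c by (simp add: canonical_hom_def carrier_dual coefsD[OF \<kappa>])
          have "\<bar>?s\<bar> \<le> r * C" by (rule coefs_pairing_le[OF C[OF \<phi> \<kappa>]]) (use x in simp)
          then have "2 * pi * \<bar>?s\<bar> < \<epsilon>"
            using r(2) mult_left_mono[of "\<bar>?s\<bar>" "r * C" "2 * pi"] pi_gt_zero by linarith
          moreover have "cmod (1 - cis (2 * pi * ?s)) \<le> 2 * pi * \<bar>?s\<bar>"
            using cmod_cis_diff_le[of 0 "2 * pi * ?s"] by (simp add: abs_mult)
          ultimately have "cis (2 * pi * ?s) \<in> ball 1 \<epsilon>" by (simp add: dist_norm)
          then show ?thesis unfolding v using \<epsilon>(2) by auto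
        qed
        then show "eval_at (wrap (cutoff x N)) \<in> B" using ac unfolding B by blast
      qed
    qed
  next
    fix A B assume A: "\<exists>r>0. \<forall>x N. (\<forall>n. \<bar>x n\<bar> \<le> r) \<longrightarrow> eval_at (wrap (cutoff x N)) \<in> A"
      and B: "\<exists>r>0. \<forall>x N. (\<forall>n. \<bar>x n\<bar> \<le> r) \<longrightarrow> eval_at (wrap (cutoff x N)) \<in> B"
    obtain a where a: "a > 0" "\<And>x N. \<forall>n. \<bar>x n\<bar> \<le> a \<Longrightarrow> eval_at (wrap (cutoff x N)) \<in> A" using A by blast
    obtain b where b: "b > 0" "\<And>x N. \<forall>n. \<bar>x n\<bar> \<le> b \<Longrightarrow> eval_at (wrap (cutoff x N)) \<in> B" using B by blast
    show "\<exists>r>0. \<forall>x N. (\<forall>n. \<bar>x n\<bar> \<le> r) \<longrightarrow> eval_at (wrap (cutoff x N)) \<in> A \<inter> B"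
      using a b by (intro exI[of _ "min a b"]) auto
  next
    fix A B assume "\<exists>r>0. \<forall>x N. (\<forall>n. \<bar>x n\<bar> \<le> r) \<longrightarrow> eval_at (wrap (cutoff x N)) \<in> A" "A \<subseteq> B"
    then show "\<exists>r>0. \<forall>x N. (\<forall>n. \<bar>x n\<bar> \<le> r) \<longrightarrow> eval_at (wrap (cutoff x N)) \<in> B" by (meson subsetD)
  qed
qed

text \<open>If the canonical map were open, the image of the unit ball would contain the images of
  all finitely supported points of small sup norm; by injectivity these points would then lie in the
  ball, which some of them do not.\<close>

lemma not_reflexive_T2H: "\<not> reflexive T2H"
proof
  assume "reflexive T2H"
  then have hm: "homeomorphic_map T.mtopology (gtop (bidual T2H)) eval_at"
    by (simp add: reflexive_def top_group_iso_def T2H_simps)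
  let ?b = "T.mball (\<lambda>n. 1) 1"
  have "openin (gtop (bidual T2H)) (eval_at ` ?b)"
    using homeomorphic_imp_open_map[OF hm] by (simp add: open_map_def)
  moreover have "\<one>\<^bsub>bidual T2H\<^esub> \<in> eval_at ` ?b" using canonical_one T2H_one by (intro image_eqI[of _ _ "\<lambda>n. 1"]) auto
  ultimately obtain r where r: "r > 0" "\<And>x N. \<forall>n. \<bar>x n\<bar> \<le> r \<Longrightarrow> eval_at (wrap (cutoff x N)) \<in> eval_at ` ?b"
    using bidual_nbhd_sup_norm by blast
  define s where "s = min r (1/2)"
  have s: "0 < s" "s \<le> 1/2" "s \<le> r" using r(1) by (auto simp: s_def)
  obtain N where N: "l2_dist (\<lambda>n. 1) (wrap (cutoff (\<lambda>n. s) N)) \<ge> 1"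
    using l2_dist_constant_large[OF s(1,2)] by blast
  let ?w = "wrap (cutoff (\<lambda>n. s) N)"
  have "eval_at ?w \<in> eval_at ` ?b" by (rule r(2)) (use s in auto)
  then obtain w where w: "w \<in> ?b" "eval_at ?w = eval_at w" by blast
  have "inj_on eval_at T2H_set" using homeomorphic_imp_injective_map[OF hm] by simp
  moreover have "?w \<in> T2H_set" "w \<in> T2H_set" using wrap_in_T2H[OF cutoff_ell2] w(1) by auto
  ultimately have "?w = w" using w(2) by (meson inj_onD)
  then show False using w(1) N by auto
qed

text \<open>Multiplying roots in different coordinates does not increase the sup norm, so every
  product \<open>E a S\<close> stays in the given neighbourhood once \<open>a\<close> is at most
  \<open>r\<close>.\<close>

lemma not_QI_bidual_T2H: "\<not> QI_group (bidual T2H)"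
proof -
  interpret B: comm_group "bidual T2H" by (rule comm_group_bidual_T2H)
  define x where "x a S n = (if n \<in> S then a else 0)" for a :: real and S and n :: nat
  define E where "E a S = eval_at (wrap (x a S))" for a S
  have x_cut: "\<exists>N. cutoff (x a S) N = x a S" if S: "finite S" for a S
  proof -
    obtain N where "\<And>n. n \<in> S \<Longrightarrow> n < N" using S unfolding finite_nat_set_iff_bounded by blast
    then show ?thesis by (intro exI[of _ N]) (auto simp: cutoff_def x_def fun_eq_iff)
  qed
  have x2: "x a S \<in> ell2_set" if S: "finite S" for a S
    using x_cut[OF S, of a] cutoff_ell2 by metis
  have Ec: "E a S \<in> carrier (bidual T2H)" if S: "finite S" for a S
    unfolding E_def by (rule canonical_in_bidual[OF wrap_in_T2H[OF x2[OF S]]])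
  have E_mult: "E a S \<otimes>\<^bsub>bidual T2H\<^esub> E b R = eval_at (wrap (\<lambda>n. x a S n + x b R n))" if S: "finite S" "finite R" for a b S R
    unfolding E_def wrap_add by (rule canonical_mult[symmetric]) (intro wrap_in_T2H x2 S)+
  have E_pow: "E a {i} [^]\<^bsub>bidual T2H\<^esub> p = E (real p * a) {i}" for a i and p :: nat
  proof (induction p)
    case 0
    have "x 0 {i} = (\<lambda>n. 0)" by (simp add: x_def fun_eq_iff)
    then show ?case by (simp add: E_def wrap_zero canonical_one)
  next
    case (Suc p)
    have "E (real p * a) {i} \<otimes>\<^bsub>bidual T2H\<^esub> E a {i} = eval_at (wrap (\<lambda>n. x (real p * a) {i} n + x a {i} n))" by (rule E_mult) auto
    also have "(\<lambda>n. x (real p * a) {i} n + x a {i} n) = x (real (Suc p) * a) {i}" by (auto simp: x_def algebra_simps)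
    finally show ?case unfolding B.nat_pow_Suc Suc by (simp only: E_def)
  qed
  show ?thesis
  proof (rule not_QI_group[where t = "\<lambda>i. E (1/2) {i}"])
    show "countable {v \<in> carrier (bidual T2H). v \<otimes>\<^bsub>bidual T2H\<^esub> v = \<one>\<^bsub>bidual T2H\<^esub>}" by (rule bidual_involutions_countable)
    show "E (1/2) {i} \<in> carrier (bidual T2H)" for i by (rule Ec) simp
    show "E (1/2) {i} \<otimes>\<^bsub>bidual T2H\<^esub> E (1/2) {i} = \<one>\<^bsub>bidual T2H\<^esub>" for i
    proof -
      have "(\<lambda>n. x (1/2) {i} n + x (1/2) {i} n) \<in> Z0" unfolding Z0_def x_def by auto
      then have "wrap (\<lambda>n. x (1/2) {i} n + x (1/2) {i} n) = (\<lambda>n. 1)" using wrap_kernel by blast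
      then show ?thesis using E_mult[of "{i}" "{i}" "1/2" "1/2"] canonical_one by simp
    qed
    show "inj (\<lambda>i. E (1/2) {i})"
    proof (rule injI, rule ccontr)
      fix i j assume ij: "E (1/2) {i} = E (1/2) {j}" "i \<noteq> j"
      have v: "E (1/2) {k} (coord_char i) = wrap (x (1/2) {k}) i" for k
      proof -
        have "E (1/2) {k} (coord_char i) = coord_char i (wrap (x (1/2) {k}))"
          unfolding E_def canonical_hom_def carrier_dual by (rule restrict_apply'[OF coord_char_character])
        also have "\<dots> = wrap (x (1/2) {k}) i"
          unfolding coord_char_def by (rule restrict_apply'[OF wrap_in_T2H[OF x2]]) simp
        finally show ?thesis .
      qed
      \<comment> \<open>The coordinate character \<open>i\<close> is sent to \<open>-1\<close> by
        the involution in coordinate \<open>i\<close> and to \<open>1\<close> by the one in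
        coordinate \<open>j\<close>.\<close>
      show False using v[of i] v[of j] ij by (simp add: wrap_def x_def)
    qed
    fix W assume "openin (gtop (bidual T2H)) W" "\<one>\<^bsub>bidual T2H\<^esub> \<in> W"
    then obtain r where r: "r > 0" "\<And>x N. \<forall>n. \<bar>x n\<bar> \<le> r \<Longrightarrow> eval_at (wrap (cutoff x N)) \<in> W"
      using bidual_nbhd_sup_norm by blast
    \<comment> \<open>A half turn is the \<open>p\<close>-th power of the rotation with angle
      parameter \<open>1 / (2 * real p)\<close>, which drops below \<open>r\<close> for large
      \<open>p\<close>.\<close>
    obtain p :: nat where p: "1 / (2 * r) < real p" using reals_Archimedean2 by blast
    have p0: "0 < 1 / (2 * r)" using r(1) by simp
    then have pp: "real p > 0" using p by linarith
    define a where "a = 1 / (2 * real p)"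
    have a: "0 < a" "a \<le> r" "real p * a = 1/2" using p pp r(1) by (simp_all add: a_def field_simps)
    show "\<exists>(p::nat) F. (\<forall>S. finite S \<longrightarrow> F S \<in> carrier (bidual T2H) \<inter> W) \<and> F {} = \<one>\<^bsub>bidual T2H\<^esub> \<and>
      (\<forall>i S. finite S \<longrightarrow> i \<notin> S \<longrightarrow> F (insert i S) = F S \<otimes>\<^bsub>bidual T2H\<^esub> F {i}) \<and>
      (\<forall>i. F {i} [^]\<^bsub>bidual T2H\<^esub> p = E (1/2) {i})"
    proof (intro exI[of _ p] exI[of _ "E a"] conjI allI impI)
      fix S :: "nat set" assume S: "finite S"
      obtain N where "cutoff (x a S) N = x a S" using x_cut[OF S] by blast
      then have "E a S \<in> W" using r(2)[of "x a S" N] a unfolding E_def by (simp add: x_def)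
      then show "E a S \<in> carrier (bidual T2H) \<inter> W" using Ec[OF S] by blast
    next
      have "x a {} = (\<lambda>n. 0)" by (simp add: x_def fun_eq_iff)
      then show "E a {} = \<one>\<^bsub>bidual T2H\<^esub>" by (simp add: E_def wrap_zero canonical_one)
    next
      fix i and S :: "nat set" assume S: "finite S" "i \<notin> S"
      have "(\<lambda>n. x a S n + x a {i} n) = x a (insert i S)" using S(2) by (auto simp: x_def fun_eq_iff)
      then show "E a (insert i S) = E a S \<otimes>\<^bsub>bidual T2H\<^esub> E a {i}"
        using E_mult[OF S(1), of "{i}" a a] by (simp add: E_def)
    next
      fix i
      show "E a {i} [^]\<^bsub>bidual T2H\<^esub> p = E (1/2) {i}" unfolding E_pow a(3) by (rule refl)
    qed
  qed (rule B.m_comm)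
qed

theorem mainTheorem2:
  shows "discrete_subgroup Z0 ell2 \<and>
    topologically_isomorphic T2H (quotient_group ell2 Z0) \<and>
    polish_group T2H \<and>
    monothetic T2H \<and>
    path_connected_space (gtop T2H) \<and>
    QI_group T2H \<and>
    \<not> locally_quasi_convex T2H \<and>
    \<not> reflexive T2H \<and>
    \<not> QI_group (bidual T2H)"
proof (intro conjI)
  show "path_connected_space (gtop T2H)" using path_connected_T2H by (simp add: T2H_simps)
  show "QI_group T2H" by (rule QI_groupI[OF polish_T2H QI_witness_T2H])
qed (rule discrete_Z0 T2H_iso_quotient polish_T2H monothetic_T2H not_locally_quasi_convex_T2H
    not_reflexive_T2H not_QI_bidual_T2H)+

end
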